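(* Let $d\ge 2$, $k,t\ge 1$ be integers. Then, as $S_d\wr S_k$-modules, $$\mathbb{C}^{([d]\times[k])^t}\;\cong\;\bigoplus_{(P,\bm Q)}\ \bigoplus_{\underline\Lambda\vdash k}\ \Bigg(\bigoplus_{\substack{\bm j\in[\ell]^r:\\ |\bm j^{-1}(a)|=|\Lambda^a|\text{ for all }a\ge 2}}\ \bigoplus_{\bm\tau\in\bm T^k_{\underline\Lambda,\underline\gamma}}\ \bigoplus_{\bm\sigma\in\bm T^d_{\bm j,\bm q}}W_{\bm\sigma,\bm\tau}\Bigg),$$ where $(P,\bm Q)$ ranges over the orbits of $S_d\wr S_k$ on $([d]\times[k])^t$ (with $r=|P|$, $q_i=|Q_i|$, $\bm q=(q_1,\dots,q_r)$), $\underline\Lambda=(\Lambda^1,\dots,\Lambda^\ell)$ ranges over the $\ell$-multipartitions of $k$, and $\underline\gamma$ is determined by $\bm j$ as defined in the context. Moreover, this is a decomposition into irreducible modules: every summand $W_{\bm\sigma,\bm\tau}$ is an irreducible $S_d\wr S_k$-module.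
   Context: Notation: $[n]=\{1,\dots,n\}$; $S_N$ is the group of permutations of a finite set $N$ and $S_n=S_{[n]}$. All modules are finite-dimensional over $\mathbb{C}$. Tableaux. Let $N$ be a finite set of positive integers, $n=|N|$. For a composition $\mu=(\mu_1,\dots,\mu_h)$ of $n$ (nonnegative integers with sum $n$), a tabloid of shape $\mu$ and content $N$ is a tuple $(R_1,\dots,R_h)$ of pairwise disjoint sets (rows) with union $N$ and $|R_a|=\mu_a$. The permutation module $M^\mu$ has the tabloids as basis, with $S_N$ permuting entries. For a partition $\lambda\vdash n$, let $t$ be a bijection from the cells of the Ferrers diagram of $\lambda$ to $N$; $\{t\}$ is the tabloid formed by its rows, $C_t\le S_N$ its column stabilizer, and $e_t=\sum_{c\in C_t}\mathrm{sign}(c)\,c\{t\}$. The Specht module $S^\lambda\subseteq M^\lambda$ is the span of the $e_t$. $T_{\lambda,\mu}$ is the set of semistandard fillings $\tau$ of $\lambda$ with content $\mu$ (the number $i$ occurs $\mu_i$ times; rows weakly increasing, columns strictly increasing). For $\tau\in T_{\lambda,\mu}$ put $\tau\cdot\{t\}=\sum_{\tau'\sim\tau}\{\tau'*t\}\in M^\mu$, where $\tau'$ ranges over the distinct fillings obtained from $\tau$ by permuting entries within rows and the $a$-th row of $\{\tau'*t\}$ is $\{t(c):c\text{ a cell with }\tau'(c)=a\}$. Extend linearly to $M^\lambda\to M^\mu$; $\tau\cdot S^\lambda\subseteq M^\mu$ is the image of $S^\lambda$. For $N=\emptyset$ all these modules are $\mathbb{C}$ and the set of semistandard tableaux is a singleton.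 Wreath product. $S_d\wr S_k$ consists of $(\bm\alpha,\beta)$, $\bm\alpha=(\alpha_1,\dots,\alpha_k)\in S_d^k$, $\beta\in S_k$, with $(\bm\alpha,\beta)(\bm\eta,\zeta)=((\alpha_i\eta_{\beta^{-1}(i)})_{i},\beta\zeta)$. It acts on $[d]\times[k]$ by $(\bm\alpha,\beta)\cdot(i,j)=(\alpha_{\beta(j)}(i),\beta(j))$, diagonally on $([d]\times[k])^t$, and hence on $\mathbb{C}^{([d]\times[k])^t}$. For $H\le S_k$, $S_d\wr H=\{(\bm\alpha,\beta):\beta\in H\}$. The orbits on $([d]\times [k])^t$ correspond to pairs $(P,\bm Q)$, where $P=\{P_1,\dots,P_r\}$ is a set partition of $[t]$ into $r\le k$ parts (with a fixed order of the parts) and $\bm Q=(Q_1,\dots,Q_r)$ with $Q_i$ a set partition of $P_i$ into at most $d$ parts. Multipartitions. $\nu_1,\dots,\nu_\ell$ is the list of all partitions of $d$, sorted lexicographically with $\nu_1=(d)$. An $\ell$-multipartition of $k$ is a tuple $\underline\Lambda=(\Lambda^1,\dots,\Lambda^\ell)$ of (possibly empty) partitions with $\sum_a|\Lambda^a|=k$. Put $\mu^{(d)}_q=(d-q,1^q)$. For $\bm j=(j(1),\dots,j(r))\in[\ell]^r$ let $\tilde{\bm j}=(j(1),\dots,j(r),1,\dots,1)\in[\ell]^k$, let $S_{\bm j}=\prod_{a\in[\ell]}S_{\tilde{\bm j}^{-1}(a)}\le S_k$, and define $\gamma^1=(k-r,1^{|\bm j^{-1}(1)|})$, $\gamma^a=(1^{|\bm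 j^{-1}(a)|})$ for $a\ge2$, $\underline\gamma=(\gamma^1,\dots,\gamma^\ell)$. Put $\bm T^d_{\bm j,\bm q}=\prod_{i\in[r]}T_{\nu_{j(i)},\mu^{(d)}_{q_i}}$ and $\bm T^k_{\underline\Lambda,\underline\gamma}=\prod_{a\in[\ell]}T_{\Lambda^a,\gamma^a}$. The modules. For each $a$, $M^{\gamma^a}$ consists of tabloids with content $\tilde{\bm j}^{-1}(a)$; the rows for $a\ge2$, and the last $|\bm j^{-1}(1)|$ rows for $a=1$, are indexed by the elements of $\bm j^{-1}(a)$. For tabloids $w_a\in M^{\gamma^a}$, let $w(i)$ ($i\in[r]$) be the entry of the row indexed by $i$ among $w_1,\dots,w_\ell$. For $\bm\sigma\in\bm T^d_{\bm j,\bm q}$, the space $(\sigma_1\cdot S^{\nu_{j(1)}}\otimes\cdots\otimes\sigma_r\cdot S^{\nu_{j(r)}})\otimes(M^{\gamma^1}\otimes\cdots\otimes M^{\gamma^\ell})$ is an $S_d\wr S_{\bm j}$-module via $$(\bm\alpha,\beta)(v_1,\dots,v_r;w_1,\dots,w_\ell)=(\alpha_{\beta(w(1))}v_1,\dots,\alpha_{\beta(w(r))}v_r;\beta w_1,\dots,\beta w_\ell),$$ where $(v_1,\dots,v_r;w_1,\dots,w_\ell)$ denotes $v_1\otimes\cdots\otimes v_r\otimes w_1\otimes\cdots\otimes w_\ell$ with all $w_a$ tabloids. Let $W'_{\bm\sigma}$ be the module induced from it from $S_d\wr S_{\bm j}$ to $S_d\wr S_k$. For $\bm\tau\in\bm T^k_{\underline\Lambda,\underline\gamma}$,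 the $S_d\wr S_k$-submodule $W_{\bm\sigma,\bm\tau}$ of $W'_{\bm\sigma}$ is defined as $$W_{\bm\sigma,\bm\tau}:=\Big[(\sigma_1\cdot S^{\nu_{j(1)}}\otimes\cdots\otimes\sigma_r\cdot S^{\nu_{j(r)}})\otimes(\tau_1\cdot S^{\Lambda^1}\otimes\cdots\otimes\tau_\ell\cdot S^{\Lambda^\ell})\Big]\Big\uparrow_{S_d\wr S_{\bm j}}^{S_d\wr S_k},$$ where $\uparrow$ denotes induction and $\tau_a\cdot S^{\Lambda^a}\subseteq M^{\gamma^a}$.
   Formalization: In W_{σ,τ} the bracket is taken as the span of Σ_w x_w(σ_1·u_{w(1)},…,σ_r·u_{w(r)};w), with u_i instead of u_{w(i)} if j(i)=1, since the plain tensor product is not stable under the action (e.g. d=3, k=r=2, both ν_{j(i)}=(2,1), Λ^a=(2)). *)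

theory Defs
  imports
    Complex_Main
    "HOL-Algebra.Sym_Groups"
    "HOL-Combinatorics.Permutations"
    "HOL-Library.Disjoint_Sets"
    "HOL-Library.FuncSet"
    "HOL-Library.Function_Algebras"
    "HOL-Library.List_Lexorder"
begin

section \<open>Modules of a group over the complex numbers\<close>

text \<open>
  A module is a set \<open>vecs\<close> of vectors inside an ambient complex vector space (a type of class
  \<open>ab_group_add\<close> with scalar multiplication \<open>scal\<close>), together with the action of the group elements.
\<close>

record ('g, 'v) rep =
  vecs :: "'v set"
  scal :: "complex \<Rightarrow> 'v \<Rightarrow> 'v"
  act :: "'g \<Rightarrow> 'v \<Rightarrow> 'v"

definition linear_between :: "('g, 'v::ab_group_add) rep \<Rightarrow> ('g, 'w::ab_group_add) rep \<Rightarrow> ('v \<Rightarrow> 'w) \<Rightarrow> bool" where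
  "linear_between M N f \<longleftrightarrow>
     (\<forall>x\<in>vecs M. f x \<in> vecs N) \<and>
     (\<forall>x\<in>vecs M. \<forall>y\<in>vecs M. f (x + y) = f x + f y) \<and>
     (\<forall>c. \<forall>x\<in>vecs M. f (scal M c x) = scal N c (f x))"

locale representation = group G + vs: vector_space "scal M"
  for G :: "('g, 'm) monoid_scheme" (structure) and M :: "('g, 'v::ab_group_add) rep" +
  assumes subspace_vecs: "vs.subspace (vecs M)"
    and act_linear: "g \<in> carrier G \<Longrightarrow> linear_between M M (act M g)"
    and act_one: "x \<in> vecs M \<Longrightarrow> act M \<one> x = x"
    and act_mult: "g \<in> carrier G \<Longrightarrow> h \<in> carrier G \<Longrightarrow> x \<in> vecs M \<Longrightarrow>
      act M (g \<otimes> h) x = act M g (act M h x)"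

definition submodule :: "('g, 'm) monoid_scheme \<Rightarrow> ('g, 'v::ab_group_add) rep \<Rightarrow> 'v set \<Rightarrow> bool" where
  "submodule G M U \<longleftrightarrow>
     U \<subseteq> vecs M \<and> module.subspace (scal M) U \<and> (\<forall>g\<in>carrier G. \<forall>x\<in>U. act M g x \<in> U)"

definition irreducible_rep :: "('g, 'm) monoid_scheme \<Rightarrow> ('g, 'v::ab_group_add) rep \<Rightarrow> bool" where
  "irreducible_rep G M \<longleftrightarrow>
     representation G M \<and> vecs M \<noteq> {0} \<and> (\<forall>U. submodule G M U \<longrightarrow> U = {0} \<or> U = vecs M)"

definition isomorphic_reps ::
    "('g, 'm) monoid_scheme \<Rightarrow> ('g, 'v::ab_group_add) rep \<Rightarrow> ('g, 'w::ab_group_add) rep \<Rightarrow> bool" where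
  "isomorphic_reps G M N \<longleftrightarrow>
     representation G M \<and> representation G N \<and>
     (\<exists>f. linear_between M N f \<and> bij_betw f (vecs M) (vecs N) \<and>
          (\<forall>g\<in>carrier G. \<forall>x\<in>vecs M. f (act M g x) = act N g (f x)))"

text \<open>The external direct sum; only used for finite index sets, so no support condition is needed.\<close>

definition direct_sum :: "'i set \<Rightarrow> ('i \<Rightarrow> ('g, 'v::ab_group_add) rep) \<Rightarrow> ('g, 'i \<Rightarrow> 'v) rep" where
  "direct_sum I M =
     \<lparr> vecs = {F. (\<forall>i\<in>I. F i \<in> vecs (M i)) \<and> (\<forall>i. i \<notin> I \<longrightarrow> F i = 0)},
       scal = (\<lambda>c F i. scal (M i) c (F i)),
       act = (\<lambda>g F i. if i \<in> I then act (M i) g (F i) else 0) \<rparr>"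

text \<open>
  The module induced from a subgroup \<open>H\<close> of a finite group \<open>G\<close>, in the model of functions
  \<open>F : G \<rightarrow> M\<close> with \<open>F (g h) = h\<^sup>-\<^sup>1 F g\<close>. With \<open>T\<close> representatives of the left cosets of \<open>H\<close>,
  \<open>F\<close> corresponds to the sum of \<open>g \<otimes> F g\<close> over \<open>g \<in> T\<close>.
\<close>

definition induced ::
    "('g, 'm) monoid_scheme \<Rightarrow> 'g set \<Rightarrow> ('g, 'v::ab_group_add) rep \<Rightarrow> ('g, 'g \<Rightarrow> 'v) rep" where
  "induced G H M =
     \<lparr> vecs = {F. (\<forall>g\<in>carrier G. F g \<in> vecs M) \<and> (\<forall>g. g \<notin> carrier G \<longrightarrow> F g = 0) \<and>
                 (\<forall>g\<in>carrier G. \<forall>h\<in>H. F (g \<otimes>\<^bsub>G\<^esub> h) = act M (inv\<^bsub>G\<^esub> h) (F g))},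
       scal = (\<lambda>c F g. scal M c (F g)),
       act = (\<lambda>x F g. if g \<in> carrier G then F (inv\<^bsub>G\<^esub> x \<otimes>\<^bsub>G\<^esub> g) else 0) \<rparr>"


section \<open>Free vector spaces and tensor products\<close>

text \<open>
  The vector space with basis \<open>X\<close> consists of the functions vanishing outside \<open>X\<close>. All bases
  are finite. The tensor product of subspaces of free vector spaces is the span of the pure tensors
  in the vector space on the product of the bases.
\<close>

definition cscale :: "complex \<Rightarrow> ('x \<Rightarrow> complex) \<Rightarrow> ('x \<Rightarrow> complex)" where
  "cscale c f = (\<lambda>x. c * f x)"

lemma vector_space_cscale: "vector_space (cscale :: complex \<Rightarrow> ('x \<Rightarrow> complex) \<Rightarrow> _)"
  by unfold_locales (auto simp: cscale_def fun_eq_iff algebra_simps)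

definition cspan :: "('x \<Rightarrow> complex) set \<Rightarrow> ('x \<Rightarrow> complex) set" where
  "cspan = module.span cscale"

definition free :: "'x set \<Rightarrow> ('x \<Rightarrow> complex) set" where
  "free X = {f. \<forall>x. x \<notin> X \<longrightarrow> f x = 0}"

definition basis_vec :: "'x \<Rightarrow> 'x \<Rightarrow> complex" where
  "basis_vec b = (\<lambda>x. if x = b then 1 else 0)"

definition lin_ext :: "('x \<Rightarrow> 'y \<Rightarrow> complex) \<Rightarrow> ('x \<Rightarrow> complex) \<Rightarrow> ('y \<Rightarrow> complex)" where
  "lin_ext \<phi> f = (\<Sum>x | f x \<noteq> 0. cscale (f x) (\<phi> x))"

definition perm_ext :: "('g \<Rightarrow> 'x \<Rightarrow> 'x) \<Rightarrow> 'g \<Rightarrow> ('x \<Rightarrow> complex) \<Rightarrow> ('x \<Rightarrow> complex)" where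
  "perm_ext \<phi> g = lin_ext (\<lambda>x. basis_vec (\<phi> g x))"

definition pure_tensor :: "'i set \<Rightarrow> ('i \<Rightarrow> 'x \<Rightarrow> complex) \<Rightarrow> ('i \<Rightarrow> 'x) \<Rightarrow> complex" where
  "pure_tensor I v = (\<lambda>b. if b \<in> extensional I then (\<Prod>i\<in>I. v i (b i)) else 0)"

definition tensor_space :: "'i set \<Rightarrow> ('i \<Rightarrow> ('x \<Rightarrow> complex) set) \<Rightarrow> (('i \<Rightarrow> 'x) \<Rightarrow> complex) set" where
  "tensor_space I V = cspan {pure_tensor I v | v. \<forall>i\<in>I. v i \<in> V i}"


section \<open>Tabloids, Specht modules and semistandard tableaux\<close>

text \<open>
  Compositions and partitions are lists. Rows, columns and entries are counted from 1, and
  \<open>part \<mu> a\<close> is the \<open>a\<close>-th part.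
\<close>

definition part :: "nat list \<Rightarrow> nat \<Rightarrow> nat" where
  "part \<mu> a = (if a \<in> {1..length \<mu>} then \<mu> ! (a - 1) else 0)"

definition partitions :: "nat \<Rightarrow> nat list set" where
  "partitions n = {lam. sorted_wrt (\<ge>) lam \<and> 0 \<notin> set lam \<and> sum_list lam = n}"

type_synonym tabloid = "nat \<Rightarrow> nat set"
type_synonym cell = "nat \<times> nat"

definition tabloids :: "nat list \<Rightarrow> nat set \<Rightarrow> tabloid set" where
  "tabloids \<mu> N =
     {R. (\<forall>a\<in>{1..length \<mu>}. card (R a) = part \<mu> a) \<and> (\<forall>a. a \<notin> {1..length \<mu>} \<longrightarrow> R a = {}) \<and>
         disjoint_family R \<and> (\<Union>a. R a) = N}"

definition perm_tabloid :: "(nat \<Rightarrow> nat) \<Rightarrow> tabloid \<Rightarrow> tabloid" where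
  "perm_tabloid p R = (\<lambda>a. p ` R a)"

definition cells :: "nat list \<Rightarrow> cell set" where
  "cells lam = {(a, b). a \<in> {1..length lam} \<and> b \<in> {1..part lam a}}"

definition tableaux :: "nat list \<Rightarrow> nat set \<Rightarrow> (cell \<Rightarrow> nat) set" where
  "tableaux lam N = {t. bij_betw t (cells lam) N}"

definition rows_tabloid :: "nat list \<Rightarrow> (cell \<Rightarrow> nat) \<Rightarrow> tabloid" where
  "rows_tabloid lam t = (\<lambda>a. t ` {c \<in> cells lam. fst c = a})"

definition column_stabilizer :: "nat list \<Rightarrow> nat set \<Rightarrow> (cell \<Rightarrow> nat) \<Rightarrow> (nat \<Rightarrow> nat) set" where
  "column_stabilizer lam N t =
     {p. p permutes N \<and>
         (\<forall>b. p ` t ` {c \<in> cells lam. snd c = b} = t ` {c \<in> cells lam. snd c = b})}"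

definition polytabloid :: "nat list \<Rightarrow> nat set \<Rightarrow> (cell \<Rightarrow> nat) \<Rightarrow> tabloid \<Rightarrow> complex" where
  "polytabloid lam N t =
     (\<Sum>p\<in>column_stabilizer lam N t.
        cscale (of_int (sign p)) (basis_vec (perm_tabloid p (rows_tabloid lam t))))"

definition specht :: "nat list \<Rightarrow> nat set \<Rightarrow> (tabloid \<Rightarrow> complex) set" where
  "specht lam N = cspan (polytabloid lam N ` tableaux lam N)"

definition semistandard :: "nat list \<Rightarrow> nat list \<Rightarrow> (cell \<Rightarrow> nat) set" where
  "semistandard lam \<mu> =
     {\<tau> \<in> cells lam \<rightarrow>\<^sub>E {1..length \<mu>}.
        (\<forall>i\<in>{1..length \<mu>}. card {c \<in> cells lam. \<tau> c = i} = part \<mu> i) \<and>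
        (\<forall>a b b'. (a, b) \<in> cells lam \<and> (a, b') \<in> cells lam \<and> b < b' \<longrightarrow> \<tau> (a, b) \<le> \<tau> (a, b')) \<and>
        (\<forall>a a' b. (a, b) \<in> cells lam \<and> (a', b) \<in> cells lam \<and> a < a' \<longrightarrow> \<tau> (a, b) < \<tau> (a', b))}"

definition row_equivalent :: "nat list \<Rightarrow> (cell \<Rightarrow> nat) \<Rightarrow> (cell \<Rightarrow> nat) set" where
  "row_equivalent lam \<tau> =
     {restrict (\<tau> \<circ> \<pi>) (cells lam) | \<pi>. \<pi> permutes cells lam \<and> (\<forall>c\<in>cells lam. fst (\<pi> c) = fst c)}"

definition star_tabloid :: "nat list \<Rightarrow> (cell \<Rightarrow> nat) \<Rightarrow> (cell \<Rightarrow> nat) \<Rightarrow> tabloid" where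
  "star_tabloid lam \<tau> t = (\<lambda>a. {t c | c. c \<in> cells lam \<and> \<tau> c = a})"

text \<open>
  The value on a tabloid is computed from a tableau \<open>t\<close> with these rows; the sum over the
  row equivalence class of \<open>\<tau>\<close> does not depend on the choice of \<open>t\<close>.
\<close>

definition tableau_on_tabloid ::
    "nat list \<Rightarrow> nat set \<Rightarrow> (cell \<Rightarrow> nat) \<Rightarrow> tabloid \<Rightarrow> (tabloid \<Rightarrow> complex)" where
  "tableau_on_tabloid lam N \<tau> R =
     (let t = (SOME t. t \<in> tableaux lam N \<and> rows_tabloid lam t = R)
      in \<Sum>\<tau>'\<in>row_equivalent lam \<tau>. basis_vec (star_tabloid lam \<tau>' t))"

definition tableau_map ::
    "nat list \<Rightarrow> nat set \<Rightarrow> (cell \<Rightarrow> nat) \<Rightarrow> (tabloid \<Rightarrow> complex) \<Rightarrow> (tabloid \<Rightarrow> complex)" where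
  "tableau_map lam N \<tau> = lin_ext (tableau_on_tabloid lam N \<tau>)"

definition specht_image :: "nat list \<Rightarrow> nat set \<Rightarrow> (cell \<Rightarrow> nat) \<Rightarrow> (tabloid \<Rightarrow> complex) set" where
  "specht_image lam N \<tau> = tableau_map lam N \<tau> ` specht lam N"


section \<open>Wreath products and their action on tuples\<close>

type_synonym wr = "(nat \<Rightarrow> nat \<Rightarrow> nat) \<times> (nat \<Rightarrow> nat)"

definition wreath :: "nat \<Rightarrow> nat \<Rightarrow> (nat \<Rightarrow> nat) set \<Rightarrow> wr monoid" where
  "wreath d k H =
     \<lparr> carrier = ({1..k} \<rightarrow>\<^sub>E carrier (sym_group d)) \<times> H,
       mult = (\<lambda>(\<alpha>, \<beta>) (\<eta>, \<zeta>). (\<lambda>i\<in>{1..k}. \<alpha> i \<circ> \<eta> (inv' \<beta> i), \<beta> \<circ> \<zeta>)),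
       one = (\<lambda>i\<in>{1..k}. id, id) \<rparr>"

abbreviation wreath_sym :: "nat \<Rightarrow> nat \<Rightarrow> wr monoid" where
  "wreath_sym d k \<equiv> wreath d k (carrier (sym_group k))"

definition act_point :: "wr \<Rightarrow> nat \<times> nat \<Rightarrow> nat \<times> nat" where
  "act_point = (\<lambda>(\<alpha>, \<beta>) (i, j). (\<alpha> (\<beta> j) i, \<beta> j))"

definition act_tuple :: "nat \<Rightarrow> wr \<Rightarrow> (nat \<Rightarrow> nat \<times> nat) \<Rightarrow> (nat \<Rightarrow> nat \<times> nat)" where
  "act_tuple t g x = (\<lambda>s\<in>{1..t}. act_point g (x s))"

definition tuple_rep :: "nat \<Rightarrow> nat \<Rightarrow> nat \<Rightarrow> (wr, (nat \<Rightarrow> nat \<times> nat) \<Rightarrow> complex) rep" where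
  "tuple_rep d k t =
     \<lparr> vecs = free ({1..t} \<rightarrow>\<^sub>E {1..d} \<times> {1..k}), scal = cscale, act = perm_ext (act_tuple t) \<rparr>"


section \<open>Index sets\<close>

text \<open>
  The pairs \<open>(P, Q)\<close> parametrizing the orbits on tuples; \<open>parts P\<close> enumerates the parts of \<open>P\<close>
  as \<open>P\<^sub>1, \<dots>, P\<^sub>r\<close>.
\<close>

definition orbit_pairs ::
    "(nat set set \<Rightarrow> nat \<Rightarrow> nat set) \<Rightarrow> nat \<Rightarrow> nat \<Rightarrow> nat \<Rightarrow> (nat set set \<times> (nat \<Rightarrow> nat set set)) set" where
  "orbit_pairs parts d k t =
     (SIGMA P : {P. partition_on {1..t} P \<and> card P \<le> k}.
        \<Pi>\<^sub>E i\<in>{1..card P}. {Q. partition_on (parts P i) Q \<and> card Q \<le> d})"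

definition ell :: "nat \<Rightarrow> nat" where
  "ell d = card (partitions d)"

text \<open>Decreasing lexicographic order, so that \<open>nu d 1 = [d]\<close>.\<close>

definition nu :: "nat \<Rightarrow> nat \<Rightarrow> nat list" where
  "nu d a = rev (sorted_list_of_set (partitions d)) ! (a - 1)"

definition multipartitions :: "nat \<Rightarrow> nat \<Rightarrow> (nat \<Rightarrow> nat list) set" where
  "multipartitions l k =
     {\<Lambda> \<in> {1..l} \<rightarrow>\<^sub>E (\<Union>n. partitions n). (\<Sum>a\<in>{1..l}. sum_list (\<Lambda> a)) = k}"

definition mu :: "nat \<Rightarrow> nat \<Rightarrow> nat list" where
  "mu d q = (d - q) # replicate q 1"

text \<open>\<open>jtilde_class k r j a\<close> is the preimage of \<open>a\<close> under the extension of \<open>j\<close> from \<open>[r]\<close> to \<open>[k]\<close> by 1.\<close>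

definition jtilde_class :: "nat \<Rightarrow> nat \<Rightarrow> (nat \<Rightarrow> nat) \<Rightarrow> nat \<Rightarrow> nat set" where
  "jtilde_class k r j a = {p \<in> {1..k}. (if p \<le> r then j p else 1) = a}"

definition S_j :: "nat \<Rightarrow> nat \<Rightarrow> (nat \<Rightarrow> nat) \<Rightarrow> (nat \<Rightarrow> nat) set" where
  "S_j k r j = {\<beta>. \<beta> permutes {1..k} \<and> (\<forall>a. \<beta> ` jtilde_class k r j a = jtilde_class k r j a)}"

definition gamma :: "nat \<Rightarrow> nat \<Rightarrow> (nat \<Rightarrow> nat) \<Rightarrow> nat \<Rightarrow> nat list" where
  "gamma k r j a =
     (if a = 1 then [k - r] else []) @ replicate (card {i \<in> {1..r}. j i = a}) 1"

definition T_d :: "nat \<Rightarrow> nat \<Rightarrow> (nat \<Rightarrow> nat) \<Rightarrow> (nat \<Rightarrow> nat) \<Rightarrow> (nat \<Rightarrow> cell \<Rightarrow> nat) set" where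
  "T_d d r j q = (\<Pi>\<^sub>E i\<in>{1..r}. semistandard (nu d (j i)) (mu d (q i)))"

definition T_k ::
    "nat \<Rightarrow> nat \<Rightarrow> nat \<Rightarrow> (nat \<Rightarrow> nat) \<Rightarrow> (nat \<Rightarrow> nat list) \<Rightarrow> (nat \<Rightarrow> cell \<Rightarrow> nat) set" where
  "T_k d k r j \<Lambda> = (\<Pi>\<^sub>E a\<in>{1..ell d}. semistandard (\<Lambda> a) (gamma k r j a))"


section \<open>The modules \<open>W\<^sub>\<sigma>\<^sub>,\<^sub>\<tau>\<close>\<close>

text \<open>
  The row of the tabloids of shape \<open>gamma k r j (j i)\<close> indexed by \<open>i\<close> (the elements of each
  preimage of \<open>j\<close> are taken in increasing order, after the first row of length \<open>k - r\<close> if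
  \<open>j i = 1\<close>), and the entry of that row.
\<close>

definition row_index :: "(nat \<Rightarrow> nat) \<Rightarrow> nat \<Rightarrow> nat" where
  "row_index j i = (if j i = 1 then 1 else 0) + card {i' \<in> {1..i}. j i' = j i}"

definition entry :: "(nat \<Rightarrow> nat) \<Rightarrow> (nat \<Rightarrow> tabloid) \<Rightarrow> nat \<Rightarrow> nat" where
  "entry j w i = the_elem (w (j i) (row_index j i))"

text \<open>
  Basis elements are pairs of an \<open>r\<close>-tuple of tabloids with content \<open>[d]\<close> and an \<open>\<ell>\<close>-tuple of
  tabloids, the \<open>a\<close>-th one with content \<open>jtilde_class k r j a\<close>.
\<close>

type_synonym base = "(nat \<Rightarrow> tabloid) \<times> (nat \<Rightarrow> tabloid)"

definition act_base :: "nat \<Rightarrow> nat \<Rightarrow> (nat \<Rightarrow> nat) \<Rightarrow> wr \<Rightarrow> base \<Rightarrow> base" where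
  "act_base d r j = (\<lambda>(\<alpha>, \<beta>) (b, w).
     (\<lambda>i\<in>{1..r}. perm_tabloid (\<alpha> (\<beta> (entry j w i))) (b i),
      \<lambda>a\<in>{1..ell d}. perm_tabloid \<beta> (w a)))"

text \<open>
  The action \<open>act_base\<close> lets the permutation of \<open>[d]\<close> at position \<open>entry j w i\<close> of \<open>[k]\<close> act on the
  \<open>i\<close>-th factor: in a term \<open>(v\<^sub>1, \<dots>, v\<^sub>r; w)\<close>, the vector \<open>v\<^sub>i\<close> sits at the position \<open>entry j w i\<close>.
  Hence the tensor product of \<open>\<sigma>\<^sub>1 \<cdot> S, \<dots>, \<sigma>\<^sub>r \<cdot> S\<close> with a submodule of the tensor product of the
  permutation modules has to be formed with vectors attached to positions:
  for \<open>u\<^sub>p\<close> in the Specht module of \<open>nu d (j p)\<close> and \<open>x = \<Sum>\<^sub>w x\<^sub>w w\<close>, the tensor of \<open>u\<close> and \<open>x\<close> is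
    \<open>\<Sum>\<^sub>w x\<^sub>w (\<sigma>\<^sub>1 \<cdot> u\<^bsub>w(1)\<^esub>, \<dots>, \<sigma>\<^sub>r \<cdot> u\<^bsub>w(r)\<^esub>; w)\<close>.
  If \<open>j i = 1\<close>, the factor is the trivial module of \<open>nu d 1 = [d]\<close>, and \<open>u\<^sub>i\<close> is used for every \<open>w\<close>;
  if \<open>j i \<noteq> 1\<close>, then \<open>w(i)\<close> is again in the preimage of \<open>j i\<close> under \<open>j\<close>.
  With \<open>u\<^sub>i\<close> in place of \<open>u\<^bsub>w(i)\<^esub>\<close> throughout, the resulting space is in general not stable under
  the action (for example \<open>d = 3\<close>, \<open>k = r = 2\<close>, \<open>nu d (j 1) = nu d (j 2) = [2, 1]\<close>).
\<close>

definition position :: "(nat \<Rightarrow> nat) \<Rightarrow> (nat \<Rightarrow> tabloid) \<Rightarrow> nat \<Rightarrow> nat" where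
  "position j w i = (if j i = 1 then i else entry j w i)"

definition placed_tensor ::
    "nat \<Rightarrow> nat \<Rightarrow> (nat \<Rightarrow> nat) \<Rightarrow> (nat \<Rightarrow> cell \<Rightarrow> nat) \<Rightarrow>
     (nat \<Rightarrow> tabloid \<Rightarrow> complex) \<Rightarrow> ((nat \<Rightarrow> tabloid) \<Rightarrow> complex) \<Rightarrow> base \<Rightarrow> complex" where
  "placed_tensor d r j \<sigma> u x = (\<lambda>(b, w).
     x w * pure_tensor {1..r}
       (\<lambda>i. tableau_map (nu d (j i)) {1..d} (\<sigma> i) (u (position j w i))) b)"

definition base_rep ::
    "nat \<Rightarrow> nat \<Rightarrow> nat \<Rightarrow> (nat \<Rightarrow> nat) \<Rightarrow> (nat \<Rightarrow> cell \<Rightarrow> nat) \<Rightarrow>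
     (nat \<Rightarrow> nat list) \<Rightarrow> (nat \<Rightarrow> cell \<Rightarrow> nat) \<Rightarrow> (wr, base \<Rightarrow> complex) rep" where
  "base_rep d k r j \<sigma> \<Lambda> \<tau> =
     \<lparr> vecs = cspan {placed_tensor d r j \<sigma> u x | u x.
         (\<forall>p\<in>{1..r}. u p \<in> specht (nu d (j p)) {1..d}) \<and>
         x \<in> tensor_space {1..ell d} (\<lambda>a. specht_image (\<Lambda> a) (jtilde_class k r j a) (\<tau> a))},
       scal = cscale,
       act = perm_ext (act_base d r j) \<rparr>"

definition base_rep' ::
    "nat \<Rightarrow> nat \<Rightarrow> nat \<Rightarrow> (nat \<Rightarrow> nat) \<Rightarrow> (nat \<Rightarrow> cell \<Rightarrow> nat) \<Rightarrow> (wr, base \<Rightarrow> complex) rep" where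
  "base_rep' d k r j \<sigma> =
     \<lparr> vecs = cspan {\<lambda>(b, w). pure_tensor {1..r} v b * y w | v y.
         (\<forall>i\<in>{1..r}. v i \<in> specht_image (nu d (j i)) {1..d} (\<sigma> i)) \<and>
         y \<in> tensor_space {1..ell d} (\<lambda>a. free (tabloids (gamma k r j a) (jtilde_class k r j a)))},
       scal = cscale,
       act = perm_ext (act_base d r j) \<rparr>"

definition W' ::
    "nat \<Rightarrow> nat \<Rightarrow> nat \<Rightarrow> (nat \<Rightarrow> nat) \<Rightarrow> (nat \<Rightarrow> cell \<Rightarrow> nat) \<Rightarrow> (wr, wr \<Rightarrow> base \<Rightarrow> complex) rep" where
  "W' d k r j \<sigma> =
     induced (wreath_sym d k) (carrier (wreath d k (S_j k r j))) (base_rep' d k r j \<sigma>)"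

definition W ::
    "nat \<Rightarrow> nat \<Rightarrow> nat \<Rightarrow> (nat \<Rightarrow> nat) \<Rightarrow> (nat \<Rightarrow> cell \<Rightarrow> nat) \<Rightarrow>
     (nat \<Rightarrow> nat list) \<Rightarrow> (nat \<Rightarrow> cell \<Rightarrow> nat) \<Rightarrow> (wr, wr \<Rightarrow> base \<Rightarrow> complex) rep" where
  "W d k r j \<sigma> \<Lambda> \<tau> =
     induced (wreath_sym d k) (carrier (wreath d k (S_j k r j))) (base_rep d k r j \<sigma> \<Lambda> \<tau>)"

definition j_tuples :: "nat \<Rightarrow> nat \<Rightarrow> (nat \<Rightarrow> nat list) \<Rightarrow> (nat \<Rightarrow> nat) set" where
  "j_tuples d r \<Lambda> =
     {j \<in> {1..r} \<rightarrow>\<^sub>E {1..ell d}. \<forall>a\<in>{2..ell d}. card {i \<in> {1..r}. j i = a} = sum_list (\<Lambda> a)}"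


section \<open>The modules \<open>W\<^sub>\<sigma>\<^sub>,\<^sub>\<tau>\<close> lie in \<open>W'\<^sub>\<sigma>\<close>\<close>

lemma sum_apply: "(\<Sum>i\<in>I. f i) x = (\<Sum>i\<in>I. f i x :: 'b::comm_monoid_add)"
  by (induction I rule: infinite_finite_induct) auto

interpretation cs: vector_space "cscale :: complex \<Rightarrow> ('x \<Rightarrow> complex) \<Rightarrow> _"
  by (rule vector_space_cscale)

lemma subspace_free: "cs.subspace (free X)"
  by (auto simp: cs.subspace_def free_def cscale_def)

lemma cspan_free: "A \<subseteq> free X \<Longrightarrow> cspan A \<subseteq> free X"
  unfolding cspan_def using cs.span_minimal subspace_free by blast

lemma basis_vec_free: "b \<in> X \<Longrightarrow> basis_vec b \<in> free X"
  by (auto simp: basis_vec_def free_def)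

lemma lin_ext_free:
  assumes "f \<in> free X" "\<And>x. x \<in> X \<Longrightarrow> \<phi> x \<in> free Y"
  shows "lin_ext \<phi> f \<in> free Y"
proof -
  have "cscale (f x) (\<phi> x) \<in> free Y" if "f x \<noteq> 0" for x
  proof -
    have "x \<in> X" using that assms(1) unfolding free_def by blast
    then show ?thesis using assms(2) cs.subspace_scale[OF subspace_free] by blast
  qed
  then show ?thesis
    unfolding lin_ext_def by (intro cs.subspace_sum[OF subspace_free]) auto
qed

lemma polytabloid_free:
  assumes "t \<in> tableaux lam N"
  shows "polytabloid lam N t \<in> free (rows_tabloid lam ` tableaux lam N)"
  unfolding polytabloid_def
proof (intro cs.subspace_sum[OF subspace_free] cs.subspace_scale[OF subspace_free] basis_vec_free)
  fix p assume "p \<in> column_stabilizer lam N t"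
  then have "p permutes N" by (simp add: column_stabilizer_def)
  then have "p \<circ> t \<in> tableaux lam N"
    using assms unfolding tableaux_def mem_Collect_eq
    by (rule bij_betw_trans[OF _ permutes_imp_bij, rotated])
  moreover have "perm_tabloid p (rows_tabloid lam t) = rows_tabloid lam (p \<circ> t)"
    by (simp add: perm_tabloid_def rows_tabloid_def image_comp)
  ultimately show "perm_tabloid p (rows_tabloid lam t) \<in> rows_tabloid lam ` tableaux lam N"
    by blast
qed

lemma specht_free: "specht lam N \<subseteq> free (rows_tabloid lam ` tableaux lam N)"
  unfolding specht_def by (intro cspan_free) (use polytabloid_free in auto)

lemma star_tabloid:
  assumes t: "t \<in> tableaux lam N" and \<tau>: "\<tau> \<in> semistandard lam \<mu>" and \<tau>': "\<tau>' \<in> row_equivalent lam \<tau>"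
  shows "star_tabloid lam \<tau>' t \<in> tabloids \<mu> N"
proof -
  from \<tau>' obtain \<pi> where \<pi>: "\<pi> permutes cells lam" "\<tau>' = restrict (\<tau> \<circ> \<pi>) (cells lam)"
    by (auto simp: row_equivalent_def)
  have inj: "inj_on t (cells lam)" and im: "t ` cells lam = N"
    using t by (auto simp: tableaux_def bij_betw_def)
  have eq: "star_tabloid lam \<tau>' t a = t ` {c \<in> cells lam. \<tau> (\<pi> c) = a}" for a
    unfolding star_tabloid_def \<pi>(2) by auto
  have c: "card (star_tabloid lam \<tau>' t a) = card {c \<in> cells lam. \<tau> c = a}" for a
  proof -
    have "\<pi> ` {c \<in> cells lam. \<tau> (\<pi> c) = a} = {c \<in> cells lam. \<tau> c = a}"
    proof (intro equalityI subsetI)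
      fix c assume c: "c \<in> {c \<in> cells lam. \<tau> c = a}"
      obtain c' where c': "c = \<pi> c'" using permutes_surj[OF \<pi>(1)] by (meson surjD)
      with c have "c' \<in> cells lam" using permutes_in_image[OF \<pi>(1)] by simp
      with c c' show "c \<in> \<pi> ` {c \<in> cells lam. \<tau> (\<pi> c) = a}" by blast
    next
      fix c assume "c \<in> \<pi> ` {c \<in> cells lam. \<tau> (\<pi> c) = a}"
      then obtain c' where "c' \<in> cells lam" "\<tau> (\<pi> c') = a" "c = \<pi> c'" by blast
      then show "c \<in> {c \<in> cells lam. \<tau> c = a}" using permutes_in_image[OF \<pi>(1)] by simp
    qed
    moreover have "card (\<pi> ` {c \<in> cells lam. \<tau> (\<pi> c) = a}) = card {c \<in> cells lam. \<tau> (\<pi> c) = a}"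
      by (intro card_image inj_on_subset[OF permutes_inj[OF \<pi>(1)]]) simp
    moreover have "card (t ` {c \<in> cells lam. \<tau> (\<pi> c) = a}) = card {c \<in> cells lam. \<tau> (\<pi> c) = a}"
      by (intro card_image inj_on_subset[OF inj]) auto
    ultimately show ?thesis by (simp only: eq)
  qed
  have rng: "\<tau> (\<pi> c) \<in> {1..length \<mu>}" if "c \<in> cells lam" for c
  proof -
    have "\<tau> \<in> cells lam \<rightarrow>\<^sub>E {1..length \<mu>}" using \<tau> by (simp add: semistandard_def)
    moreover have "\<pi> c \<in> cells lam" using that permutes_in_image[OF \<pi>(1)] by simp
    ultimately show ?thesis by (rule PiE_mem)
  qed
  show ?thesis
    unfolding tabloids_def mem_Collect_eq
  proof (intro conjI ballI allI impI)
    show "card (star_tabloid lam \<tau>' t a) = part \<mu> a" if "a \<in> {1..length \<mu>}" for a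
      using that \<tau> by (simp add: c semistandard_def)
    show "star_tabloid lam \<tau>' t a = {}" if "a \<notin> {1..length \<mu>}" for a
      using that rng by (auto simp: eq)
    show "disjoint_family (star_tabloid lam \<tau>' t)"
      using inj by (auto simp: eq disjoint_family_on_def inj_on_def)
    show "(\<Union>a. star_tabloid lam \<tau>' t a) = N"
      using im by (auto simp: eq)
  qed
qed

lemma specht_image_free:
  assumes "\<tau> \<in> semistandard lam \<mu>"
  shows "specht_image lam N \<tau> \<subseteq> free (tabloids \<mu> N)"
  unfolding specht_image_def tableau_map_def
proof (safe, rule lin_ext_free)
  fix f assume "f \<in> specht lam N"
  then show "f \<in> free (rows_tabloid lam ` tableaux lam N)" using specht_free by blast
next
  fix R assume R: "R \<in> rows_tabloid lam ` tableaux lam N"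
  define t where "t = (SOME t. t \<in> tableaux lam N \<and> rows_tabloid lam t = R)"
  from R have "\<exists>t. t \<in> tableaux lam N \<and> rows_tabloid lam t = R" by blast
  from someI_ex[OF this] have "t \<in> tableaux lam N" unfolding t_def by (rule conjunct1)
  then show "tableau_on_tabloid lam N \<tau> R \<in> free (tabloids \<mu> N)"
    unfolding tableau_on_tabloid_def Let_def t_def[symmetric]
    by (intro cs.subspace_sum[OF subspace_free] basis_vec_free star_tabloid[OF _ assms])
qed

lemma finite_tabloids: "finite N \<Longrightarrow> finite (tabloids \<mu> N)"
  by (rule finite_subset[OF _ finite_set_of_finite_funs[of "{1..length \<mu>}" "Pow N" "{}"]])
     (auto simp: tabloids_def)

lemma tensor_space_free:
  assumes "finite I" "\<And>i. i \<in> I \<Longrightarrow> V i \<subseteq> free (X i)"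
  shows "tensor_space I V \<subseteq> free (Pi\<^sub>E I X)"
  unfolding tensor_space_def
proof (rule cspan_free, safe)
  fix v assume v: "\<forall>i\<in>I. v i \<in> V i"
  show "pure_tensor I v \<in> free (Pi\<^sub>E I X)"
    unfolding free_def mem_Collect_eq
  proof (intro allI impI)
    fix b assume b: "b \<notin> Pi\<^sub>E I X"
    show "pure_tensor I v b = 0"
    proof (cases "b \<in> extensional I")
      case True
      with b obtain i where "i \<in> I" "b i \<notin> X i" by (auto simp: PiE_def)
      then have "v i (b i) = 0" using v assms(2)[of i] by (auto simp: free_def)
      then show ?thesis using \<open>i \<in> I\<close> assms(1) by (auto simp: pure_tensor_def)
    qed (simp add: pure_tensor_def)
  qed
qed

lemma basis_vec_tensor:
  assumes "finite I" "w \<in> Pi\<^sub>E I X"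
  shows "basis_vec w \<in> tensor_space I (\<lambda>i. free (X i))"
proof -
  have "basis_vec w = pure_tensor I (\<lambda>i. basis_vec (w i))"
  proof
    fix b
    show "basis_vec w b = pure_tensor I (\<lambda>i. basis_vec (w i)) b"
    proof (cases "b = w")
      case True
      then show ?thesis using assms by (auto simp: basis_vec_def pure_tensor_def PiE_def)
    next
      case False
      then have "\<exists>i\<in>I. b i \<noteq> w i" if "b \<in> extensional I"
        using False that assms(2) extensionalityI[of b I w] by (auto simp: PiE_iff)
      then show ?thesis using False assms(1)
        by (auto simp: basis_vec_def pure_tensor_def prod_zero_iff)
    qed
  qed
  then show ?thesis
    unfolding tensor_space_def cspan_def
  proof (intro cs.span_base CollectI exI conjI ballI)
    show "basis_vec (w i) \<in> free (X i)" if "i \<in> I" for i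
      using assms(2) that by (intro basis_vec_free) (rule PiE_mem)
  qed
qed

lemma entry_in_class:
  assumes w: "w (j i) \<in> tabloids (gamma k r j (j i)) (jtilde_class k r j (j i))"
    and i: "i \<in> {1..r}" and j: "j i \<noteq> 1"
  shows "entry j w i \<in> {1..r} \<and> j (entry j w i) = j i"
proof -
  let ?n = "card {i' \<in> {1..r}. j i' = j i}"
  let ?a = "row_index j i"
  have "?a \<le> ?n" using i j by (auto simp: row_index_def intro!: card_mono)
  moreover have "?a \<ge> 1"
    using i j by (auto simp: row_index_def Suc_le_eq card_gt_0_iff)
  moreover have g: "gamma k r j (j i) = replicate ?n 1" using j by (simp add: gamma_def)
  ultimately have "card (w (j i) ?a) = 1"
    using w by (auto simp: tabloids_def part_def)
  then obtain p where p: "w (j i) ?a = {p}" by (auto simp: card_1_singleton_iff)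
  moreover have "w (j i) ?a \<subseteq> jtilde_class k r j (j i)"
    using w by (auto simp: tabloids_def)
  ultimately show ?thesis using j
    by (auto simp: entry_def jtilde_class_def split: if_splits)
qed

lemma base_rep_subset:
  assumes j: "j \<in> {1..r} \<rightarrow>\<^sub>E {1..ell d}" and \<tau>: "\<tau> \<in> T_k d k r j \<Lambda>"
  shows "vecs (base_rep d k r j \<sigma> \<Lambda> \<tau>) \<subseteq> vecs (base_rep' d k r j \<sigma>)"
proof -
  let ?X = "\<lambda>a. tabloids (gamma k r j a) (jtilde_class k r j a)"
  let ?B = "{\<lambda>(b, w). pure_tensor {1..r} v b * y w | v y.
         (\<forall>i\<in>{1..r}. v i \<in> specht_image (nu d (j i)) {1..d} (\<sigma> i)) \<and>
         y \<in> tensor_space {1..ell d} (\<lambda>a. free (?X a))}"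
  have "placed_tensor d r j \<sigma> u x \<in> cs.span ?B"
    if u: "\<forall>p\<in>{1..r}. u p \<in> specht (nu d (j p)) {1..d}"
      and x: "x \<in> tensor_space {1..ell d} (\<lambda>a. specht_image (\<Lambda> a) (jtilde_class k r j a) (\<tau> a))"
    for u x
  proof -
    let ?P = "Pi\<^sub>E {1..ell d} ?X"
    let ?v = "\<lambda>w i. tableau_map (nu d (j i)) {1..d} (\<sigma> i) (u (position j w i))"
    have "specht_image (\<Lambda> a) (jtilde_class k r j a) (\<tau> a) \<subseteq> free (?X a)" if "a \<in> {1..ell d}" for a
      using \<tau> that by (intro specht_image_free) (auto simp: T_k_def)
    then have xf: "x \<in> free ?P"
      by (intro subsetD[OF tensor_space_free x]) auto
    have fin: "finite ?P"
      by (intro finite_PiE finite_tabloids) (auto simp: jtilde_class_def)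
    have eq: "placed_tensor d r j \<sigma> u x =
        (\<Sum>w0\<in>?P. cscale (x w0) (\<lambda>(b, w). pure_tensor {1..r} (?v w0) b * basis_vec w0 w))"
    proof (intro ext, clarify)
      fix b w
      have "(\<Sum>w0\<in>?P. x w0 * (pure_tensor {1..r} (?v w0) b * basis_vec w0 w)) =
          (\<Sum>w0\<in>?P. if w0 = w then x w * pure_tensor {1..r} (?v w) b else 0)"
        by (intro sum.cong) (auto simp: basis_vec_def)
      also have "\<dots> = x w * pure_tensor {1..r} (?v w) b"
        using fin xf by (auto simp: free_def)
      finally show "placed_tensor d r j \<sigma> u x (b, w) =
        (\<Sum>w0\<in>?P. cscale (x w0) (\<lambda>(b, w). pure_tensor {1..r} (?v w0) b * basis_vec w0 w)) (b, w)"
        by (simp add: placed_tensor_def sum_apply cscale_def)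
    qed
    show ?thesis unfolding eq
    proof (intro cs.span_sum cs.span_scale cs.span_base)
      fix w assume w: "w \<in> ?P"
      have "?v w i \<in> specht_image (nu d (j i)) {1..d} (\<sigma> i)" if i: "i \<in> {1..r}" for i
      proof -
        have "w (j i) \<in> ?X (j i)" using w j i by (auto simp: PiE_iff)
        then have "position j w i \<in> {1..r} \<and> j (position j w i) = j i"
          using entry_in_class[of w j i k r] i by (auto simp: position_def)
        then show ?thesis using u unfolding specht_image_def by (metis imageI)
      qed
      moreover have "basis_vec w \<in> tensor_space {1..ell d} (\<lambda>a. free (?X a))"
        by (rule basis_vec_tensor[OF _ w]) simp
      ultimately show "(\<lambda>(b, w'). pure_tensor {1..r} (?v w) b * basis_vec w w') \<in> ?B"
        by blast
    qed
  qed
  then have "{placed_tensor d r j \<sigma> u x | u x.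
         (\<forall>p\<in>{1..r}. u p \<in> specht (nu d (j p)) {1..d}) \<and>
         x \<in> tensor_space {1..ell d} (\<lambda>a. specht_image (\<Lambda> a) (jtilde_class k r j a) (\<tau> a))}
      \<subseteq> cs.span ?B"
    by blast
  then show ?thesis
    unfolding base_rep_def base_rep'_def rep.simps cspan_def
    by (rule cs.span_minimal) simp
qed

lemma induced_mono:
  assumes "vecs M \<subseteq> vecs M'" "act M = act M'"
  shows "vecs (induced G H M) \<subseteq> vecs (induced G H M')"
  using assms unfolding induced_def by auto

lemma W_subset_W':
  assumes "j \<in> {1..r} \<rightarrow>\<^sub>E {1..ell d}" and "\<tau> \<in> T_k d k r j \<Lambda>"
  shows "vecs (W d k r j \<sigma> \<Lambda> \<tau>) \<subseteq> vecs (W' d k r j \<sigma>)"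
  unfolding W_def W'_def
proof (rule induced_mono)
  show "vecs (base_rep d k r j \<sigma> \<Lambda> \<tau>) \<subseteq> vecs (base_rep' d k r j \<sigma>)"
    by (rule base_rep_subset[OF assms])
  show "act (base_rep d k r j \<sigma> \<Lambda> \<tau>) = act (base_rep' d k r j \<sigma>)"
    by (simp only: base_rep_def base_rep'_def rep.simps)
qed

end

theory Submission
 imports Defs
begin

text \<open>
A tuple in ([d] x [k])^t is determined by its pattern of coincidences (P, Q), by the injective placement
of the parts of P in [k], and, for each part, by a tabloid of shape mu d q_i recording the values in [d].
So the functions on the tuples of one pattern are functions of a placement and r tabloids.

The permutation module of such tabloids is the direct sum of the images of Specht modules under the
semistandard tableaux (\<open>specht_images_decompose\<close>). Independence holds because the images of one
polytabloid are triangular with respect to a weight of the tableaux, and Young symmetrizers separate the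
partitions; the images fill the module because a count along the Young lattice bounds the number of tabloids.
Applied to the r slots this produces j and \<sigma>. For fixed j, functions of the placement are induced from
the stabilizer S_d wr S_j of the colouring of [k] by j, where a placement becomes a tuple of tabloids of
shapes gamma (\<open>stabilizer_of_base\<close>, \<open>KS_eq_pull\<close>). Applying the same decomposition
to these tabloids produces \<Lambda> and \<tau> (\<open>leaf_decomposes\<close>), and each piece is isomorphic
to W (\<open>pull_iso\<close>).

For irreducibility (\<open>W_irreducible\<close>), take a nonzero submodule of the induced module. Young
symmetrizers at single positions of [k] turn one of its elements into a function supported on the stabilizer,
with the generating polytabloid in every slot (\<open>reduce_positions\<close>); symmetrizers for the colour classes
then reduce the second factor to its generator (\<open>reduce_classes\<close>). This vector generates everything.
\<close>


section \<open>Linear operators and internal direct sums\<close>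

definition clin :: "(('x => complex) => ('y => complex)) => bool" where
 "clin L \<longleftrightarrow> (ALL f g. L (f + g) = L f + L g) & (ALL c f. L (cscale c f) = cscale c (L f))"

lemma clinI: "(!!f g. L (f + g) = L f + L g) ==> (!!c f. L (cscale c f) = cscale c (L f)) ==> clin L" by (simp add: clin_def)

lemma clin_add: "clin L ==> L (f + g) = L f + L g"
 and clin_scale: "clin L ==> L (cscale c f) = cscale c (L f)" by (simp_all add: clin_def)

lemma clin_zero: "clin L ==> L 0 = 0" using clin_scale[of L 0 0] by (simp add: cs.scale_zero_left)

lemma clin_sum:
 assumes "clin L"
 shows "L (SUM i:I. f i) = (SUM i:I. L (f i))" proof (induction I rule: infinite_finite_induct)
 case (infinite I)
 show "L (SUM i:I. f i) = (SUM i:I. L (f i))" using infinite by (simp add: clin_zero[OF assms])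
next
 case empty
 show "L (SUM i:{}. f i) = (SUM i:{}. L (f i))" by (simp add: clin_zero[OF assms])
next
 case (insert x I)
 show "L (SUM i:insert x I. f i) = (SUM i:insert x I. L (f i))" using insert by (simp add: clin_add[OF assms])
qed

lemma clin_lincomb:
 assumes "clin L"
 shows "L (SUM i:I. cscale (c i) (f i)) = (SUM i:I. cscale (c i) (L (f i)))" by (simp add: clin_sum[OF assms] clin_scale[OF assms])

lemma clin_comp: "clin L ==> clin M ==> clin (%f. L (M f))" by (simp add: clin_def)

lemma clin_id: "clin (%f. f)" by (rule clinI) simp_all

lemma clin_diff: "clin L ==> clin M ==> clin (%f. L f - M f)" by (rule clinI) (auto simp: clin_def cs.scale_right_diff_distrib)

lemma clin_combination:
 assumes "!!i. i : I ==> clin (L i)"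
 shows "clin (%f. SUM i:I. cscale (c i) (L i f))" proof (rule clinI)
 show "(SUM i:I. cscale (c i) (L i (f + g))) = (SUM i:I. cscale (c i) (L i f)) + (SUM i:I. cscale (c i) (L i g))" for f g
  unfolding sum.distrib[symmetric] by (rule sum.cong) (simp_all only: clin_add[OF assms] cs.scale_right_distrib)
 show "(SUM i:I. cscale (c i) (L i (cscale a f))) = cscale a (SUM i:I. cscale (c i) (L i f))" for a f unfolding cs.scale_sum_right
  by (rule sum.cong) (simp_all only: clin_scale[OF assms] cs.scale_scale mult.commute)
qed

lemma span_induct_lin:
 assumes "f : cspan S" "!!s. s : S ==> L s : U" "clin L" "cs.subspace U"
 shows "L f : U" using assms(1) unfolding cspan_def proof (induction rule: cs.span_induct_alt)
 case base
 then show ?case by (simp only: clin_zero[OF assms(3)] cs.subspace_0[OF assms(4)])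
next
 case (step c x y)
 then show ?case unfolding clin_add[OF assms(3)] clin_scale[OF assms(3)]
  by (rule cs.subspace_add[OF assms(4) cs.subspace_scale[OF assms(4) assms(2)]])
qed

lemma subspace_cspan: "cs.subspace (cspan S)" unfolding cspan_def by (rule cs.subspace_span)

lemma cspan_base: "x : S ==> x : cspan S" unfolding cspan_def by (rule cs.span_base)

lemma cspan_minimal: "S <= U ==> cs.subspace U ==> cspan S <= U" unfolding cspan_def by (rule cs.span_minimal)

lemma subspace_image:
 assumes "clin L" "cs.subspace T"
 shows "cs.subspace (L ` T)" unfolding cs.subspace_def proof (intro conjI ballI allI)
 show "0 : L ` T" using clin_zero[OF assms(1)] cs.subspace_0[OF assms(2)] by (metis imageI)
 show "x + y : L ` T" if "x : L ` T" "y : L ` T" for x y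
  using that by (auto simp: clin_add[OF assms(1), symmetric] intro!: imageI cs.subspace_add[OF assms(2)])
 show "cscale c x : L ` T" if "x : L ` T" for c x
  using that by (auto simp: clin_scale[OF assms(1), symmetric] intro!: imageI cs.subspace_scale[OF assms(2)])
qed

lemma subspace_singleton_zero: "cs.subspace {0 :: 'x => complex}" by (auto simp: cs.subspace_def)

lemma subspace_line: "cs.subspace {cscale z e | z. True}" proof -
 have "{cscale z e | z. True} = cspan {e}" unfolding cspan_def cs.span_singleton by auto
 then show ?thesis using subspace_cspan by simp
qed

lemma cscale_apply: "cscale c f x = c * f x" by (simp add: cscale_def)

lemma free_zero: "f : free X ==> x ~: X ==> f x = 0" by (simp add: free_def)

lemma free_expansion:
 assumes "f : free X" "finite X"
 shows "f = (SUM x:X. cscale (f x) (basis_vec x))" proof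
 fix y
 have "(SUM x:X. f x * (if y = x then 1 else 0)) = (if y : X then f y else 0)" using assms(2) by (simp add: if_distrib cong: if_cong)
 then show "f y = (SUM x:X. cscale (f x) (basis_vec x)) y" using assms(1) by (auto simp: sum_apply cscale_apply basis_vec_def free_def)
qed

lemma free_eq_cspan:
 assumes "finite X"
 shows "free X = cspan (basis_vec ` X)" proof
 show "free X <= cspan (basis_vec ` X)" proof
  fix f :: "'a => complex" assume f: "f : free X"
  have "(SUM x:X. cscale (f x) (basis_vec x)) : cspan (basis_vec ` X)"
   unfolding cspan_def by (intro cs.span_sum cs.span_scale cs.span_base) auto
  then show "f : cspan (basis_vec ` X)" using free_expansion[OF f assms] by simp
 qed
 show "cspan (basis_vec ` X) <= free X" by (intro cspan_free) (auto intro: basis_vec_free)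
qed

lemma lin_ext_finite:
 assumes "f : free X" "finite X"
 shows "lin_ext \<phi> f = (SUM x:X. cscale (f x) (\<phi> x))" unfolding lin_ext_def
 by (rule sum.mono_neutral_left) (use assms in \<open>auto simp: free_def cs.scale_zero_left\<close>)

lemma perm_ext_apply:
 assumes f: "f : free X" and X: "finite X" and inj: "inj_on (\<phi> g) X"
 shows "x : X ==> perm_ext \<phi> g f (\<phi> g x) = f x"
  and "y ~: \<phi> g ` X ==> perm_ext \<phi> g f y = 0" proof -
 have eq: "perm_ext \<phi> g f y = (SUM x:X. if \<phi> g x = y then f x else 0)" for y unfolding perm_ext_def lin_ext_finite[OF f X]
  by (auto simp: sum_apply cscale_apply basis_vec_def intro!: sum.cong)
 show "perm_ext \<phi> g f (\<phi> g x) = f x" if "x : X" proof -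
  have "(SUM x':X. if \<phi> g x' = \<phi> g x then f x' else 0) = (SUM x':X. if x' = x then f x' else 0)"
   using inj that by (intro sum.cong) (auto dest: inj_onD)
  then show ?thesis using X that by (simp add: eq)
 qed
 show "perm_ext \<phi> g f y = 0" if "y ~: \<phi> g ` X" unfolding eq by (rule sum.neutral) (use that in auto)
qed

definition decomposes :: "'c set => ('c => ('x => complex) set) => ('x => complex) set => bool" where
 "decomposes C V Z \<longleftrightarrow> finite C & (ALL c:C. cs.subspace (V c) & V c <= Z) &
   (ALL f:Z. EX v. (ALL c:C. v c : V c) & f = (SUM c:C. v c)) &
   (ALL v. (ALL c:C. v c : V c) & (SUM c:C. v c) = 0 --> (ALL c:C. v c = 0))"

lemma decomposesI:
 assumes "finite C" "!!c. c : C ==> cs.subspace (V c)" "!!c. c : C ==> V c <= Z"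
  "!!f. f : Z ==> EX v. (ALL c:C. v c : V c) & f = (SUM c:C. v c)"
  "!!v c. (!!c. c : C ==> v c : V c) ==> (SUM c:C. v c) = 0 ==> c : C ==> v c = 0"
 shows "decomposes C V Z" unfolding decomposes_def using assms by blast

lemma
 assumes "decomposes C V Z"
 shows decomposes_finite: "finite C"
  and decomposes_subspace: "c : C ==> cs.subspace (V c)"
  and decomposes_subset: "c : C ==> V c <= Z"
  and decomposes_ex: "f : Z ==> EX v. (ALL c:C. v c : V c) & f = (SUM c:C. v c)"
  and decomposes_indep: "(!!c. c : C ==> v c : V c) ==> (SUM c:C. v c) = 0 ==> c : C ==> v c = 0"
 using assms unfolding decomposes_def by blast+

lemma decomposes_unique:
 assumes D: "decomposes C V Z"
  and u: "!!c. c : C ==> u c : V c" and v: "!!c. c : C ==> v c : V c"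
  and eq: "(SUM c:C. u c) = (SUM c:C. v c)" and c: "c : C"
 shows "u c = v c" proof -
 have "u c - v c = 0" by (rule decomposes_indep[OF D, of "%c. u c - v c"])
   (use u v c eq decomposes_subspace[OF D] in \<open>auto simp: sum_subtractf intro: cs.subspace_diff\<close>)
 then show ?thesis by simp
qed

lemma subspace_sums:
 assumes "!!c. c : C ==> cs.subspace (V c)"
 shows "cs.subspace {SUM c:C. v c | v. ALL c:C. v c : V c}" (is "cs.subspace ?W") unfolding cs.subspace_def proof (intro conjI ballI allI)
 show "0 : ?W" using cs.subspace_0[OF assms] by (intro CollectI exI[of _ "%_. 0"]) simp
 fix x y a assume "x : ?W"
 then obtain u where u: "x = (SUM c:C. u c)" "ALL c:C. u c : V c" by blast
 show "cscale a x : ?W" unfolding u(1) cs.scale_sum_right using u(2) cs.subspace_scale[OF assms] by blast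
 assume "y : ?W"
 then obtain v where v: "y = (SUM c:C. v c)" "ALL c:C. v c : V c" by blast
 show "x + y : ?W" unfolding u(1) v(1) sum.distrib[symmetric] using u(2) v(2) cs.subspace_add[OF assms] by blast
qed

lemma decomposes_reindex:
 assumes h: "bij_betw h A B" "!!a. a : A ==> U a = V (h a)" and D: "decomposes B V Z"
 shows "decomposes A U Z" proof (rule decomposesI)
 have im: "h ` A = B" and inj: "inj_on h A" using h(1) by (auto simp: bij_betw_def)
 show "finite A" using decomposes_finite[OF D] h(1) bij_betw_finite by blast
 show "cs.subspace (U a)" "U a <= Z" if "a : A" for a
  using that h im decomposes_subspace[OF D, of "h a"] decomposes_subset[OF D, of "h a"] by auto
 show "EX v. (ALL c:A. v c : U c) & f = (SUM c:A. v c)" if f: "f : Z" for f proof -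
  obtain v where v: "ALL c:B. v c : V c" "f = (SUM c:B. v c)" using decomposes_ex[OF D f] by blast
  have "f = (SUM c:A. v (h c))" using v(2) sum.reindex_bij_betw[OF h(1), of v] by simp
  then show ?thesis using v(1) h im by (intro exI[of _ "%c. v (h c)"]) auto
 qed
 show "v c = 0" if v: "!!c. c : A ==> v c : U c" "(SUM c:A. v c) = 0" "c : A" for v c proof -
  define g where "g = inv_into A h"
  have g: "g (h a) = a" if "a : A" for a using that inj by (simp add: g_def)
  have "(SUM b:B. v (g b)) = (SUM a:A. v (g (h a)))" using sum.reindex_bij_betw[OF h(1), of "%b. v (g b)"] by simp
  also have "... = 0" using v(2) g by simp
  finally have "v (g (h c)) = 0" using v(1,3) h(2) im g by (intro decomposes_indep[OF D, of "%b. v (g b)" "h c"]) auto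
  then show ?thesis using g v(3) by simp
 qed
qed

section \<open>Tensor products\<close>

definition slice :: "(('i => 'x) => complex) => 'i => ('i => 'x) => 'x => complex" where
 "slice f i b = (%R. f (b(i := R)))"

lemma clin_slice: "clin (%f. slice f i b)" by (rule clinI) (auto simp: slice_def cscale_def)

lemma slice_self: "slice f i b (b i) = f b" by (simp add: slice_def)

lemma pure_tensor_slice:
 assumes "finite I" "i : I"
 shows "slice (pure_tensor I v) i b =
  cscale (if b(i := undefined) : extensional I - {} then (PROD l:I-{i}. v l (b l)) else 0) (v i)" proof
 fix R
 have "(b(i := R) : extensional I) = (b(i := undefined) : extensional I)" using assms(2) by (auto simp: extensional_def)
 moreover have "(PROD l:I. v l ((b(i := R)) l)) = v i R * (PROD l:I-{i}. v l (b l))"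
  using assms by (subst prod.remove[of I i]) (auto intro!: prod.cong)
 ultimately show "slice (pure_tensor I v) i b R =
  cscale (if b(i := undefined) : extensional I - {} then (PROD l:I-{i}. v l (b l)) else 0) (v i) R"
  by (auto simp: slice_def pure_tensor_def cscale_def)
qed

lemma tensor_slice:
 assumes "finite I" "i : I" "cs.subspace (V i)" "f : tensor_space I V"
 shows "slice f i b : V i" using assms(4) unfolding tensor_space_def proof (rule span_induct_lin[OF _ _ clin_slice assms(3)])
 fix s assume "s : {pure_tensor I v | v. ALL i:I. v i : V i}"
 then obtain v where "s = pure_tensor I v" "v i : V i" using assms(2) by blast
 then show "slice s i b : V i" using cs.subspace_scale[OF assms(3)] by (simp only: pure_tensor_slice[OF assms(1,2)])
qed

lemma pure_tensor_in: "(!!i. i : I ==> v i : V i) ==> pure_tensor I v : tensor_space I V"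
 unfolding tensor_space_def by (rule cspan_base) blast

lemma pure_tensor_cong: "(!!i. i : I ==> v i = v' i) ==> pure_tensor I v = pure_tensor I v'"
 by (auto simp: pure_tensor_def intro!: ext prod.cong)

lemma pure_tensor_basis:
 assumes "finite I" "w : extensional I"
 shows "pure_tensor I (%i. basis_vec (w i)) = basis_vec w" proof
 fix b
 show "pure_tensor I (%i. basis_vec (w i)) b = basis_vec w b" proof (cases "b = w")
  case True
  then show ?thesis using assms by (auto simp: basis_vec_def pure_tensor_def)
 next
  case False
  then have "EX i:I. b i ~= w i" if "b : extensional I" using that assms(2) extensionalityI[of b I w] by blast
  then show ?thesis using False assms(1) by (auto simp: basis_vec_def pure_tensor_def)
 qed
qed

lemma pure_tensor_sum:
 assumes "finite I" "!!i. i : I ==> finite (C i)"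
 shows "pure_tensor I (%i. SUM c:C i. v i c) = (SUM c:PiE I C. pure_tensor I (%i. v i (c i)))"
 by (rule ext) (simp add: pure_tensor_def sum_apply prod_sum_PiE[OF assms])

theorem tensor_decomposes:
 assumes I: "finite I" and D: "!!i. i : I ==> decomposes (C i) (V i) (free (X i))"
  and X: "!!i. i : I ==> finite (X i)"
 shows "decomposes (PiE I C) (%c. tensor_space I (%i. V i (c i))) (free (PiE I X))" proof (rule decomposesI)
 have Vs: "cs.subspace (V i (c i))" "V i (c i) <= free (X i)" if "c : PiE I C" "i : I" for c i
  using that decomposes_subspace[OF D] decomposes_subset[OF D] by (auto simp: PiE_iff)
 show fin: "finite (PiE I C)" using I decomposes_finite[OF D] by (intro finite_PiE) auto
 show "cs.subspace (tensor_space I (%i. V i (c i)))" for c unfolding tensor_space_def by (rule subspace_cspan)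
 show "tensor_space I (%i. V i (c i)) <= free (PiE I X)" if "c : PiE I C" for c using that Vs by (intro tensor_space_free I) auto
 show "EX v. (ALL c:PiE I C. v c : tensor_space I (%i. V i (c i))) & f = (SUM c:PiE I C. v c)" if f: "f : free (PiE I X)" for f proof -
  have "EX u. (ALL c:PiE I C. u c : tensor_space I (%i. V i (c i))) & basis_vec b = (SUM c:PiE I C. u c)" if b: "b : PiE I X" for b proof -
   have "ALL i:I. EX v. (ALL e:C i. v e : V i e) & basis_vec (b i) = (SUM e:C i. v e)"
   using b by (intro ballI decomposes_ex[OF D] basis_vec_free) auto
   then obtain v where v: "!!i e. i : I ==> e : C i ==> v i e : V i e"
   "!!i. i : I ==> basis_vec (b i) = (SUM e:C i. v i e)" by metis
   have "basis_vec b = pure_tensor I (%i. basis_vec (b i))" using b I by (intro pure_tensor_basis[symmetric]) (auto simp: PiE_iff)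
   also have "... = pure_tensor I (%i. SUM e:C i. v i e)" by (rule pure_tensor_cong) (rule v(2))
   also have "... = (SUM c:PiE I C. pure_tensor I (%i. v i (c i)))" using decomposes_finite[OF D] by (intro pure_tensor_sum I) auto
   finally show ?thesis using v(1) by (intro exI[of _ "%c. pure_tensor I (%i. v i (c i))"])
   (auto intro!: pure_tensor_in)
  qed
  then obtain u where u: "!!b c. b : PiE I X ==> c : PiE I C ==> u b c : tensor_space I (%i. V i (c i))"
   "!!b. b : PiE I X ==> basis_vec b = (SUM c:PiE I C. u b c)" by metis
  have "f = (SUM b:PiE I X. cscale (f b) (basis_vec b))" by (rule free_expansion[OF f finite_PiE[OF I X]])
  also have "... = (SUM b:PiE I X. SUM c:PiE I C. cscale (f b) (u b c))" by (rule sum.cong) (simp_all add: u(2) cs.scale_sum_right)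
  also have "... = (SUM c:PiE I C. SUM b:PiE I X. cscale (f b) (u b c))" by (rule sum.swap)
  finally show ?thesis using u(1) unfolding tensor_space_def cspan_def by (intro exI[of _ "%c. SUM b:PiE I X. cscale (f b) (u b c)"])
   (auto intro!: cs.span_sum cs.span_scale)
 qed
 show "y c' = 0" if y: "!!c. c : PiE I C ==> y c : tensor_space I (%i. V i (c i))"
  and z: "(SUM c:PiE I C. y c) = 0" and c': "c' : PiE I C" for y c' proof -
  have "(\<Sum>c | c : PiE I C & (ALL i:A. c i = c' i). y c) = 0" if "A <= I" for A using finite_subset[OF that I] that
  proof (induction A rule: finite_induct)
   case empty
   then show ?case using z by simp
  next
   case (insert i A)
   let ?S = "{c : PiE I C. ALL l:A. c l = c' l}"
   have i: "i : I" using insert by auto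
   have IH: "(SUM c:?S. y c) = 0" using insert.IH insert.prems by blast
   have "(\<Sum>c | c : PiE I C & (ALL l:insert i A. c l = c' l). y c) b = 0" for b proof -
   let ?g = "%e. \<Sum>c | c : ?S & c i = e. slice (y c) i b"
   have "?g (c' i) = 0" proof (rule decomposes_indep[OF D[OF i]])
   show "?g e : V i e" if e: "e : C i" for e proof (rule cs.subspace_sum)
   show "cs.subspace (V i e)" using decomposes_subspace[OF D[OF i] e] .
   fix c assume c: "c : {c : ?S. c i = e}"
   then have "slice (y c) i b : V i (c i)" using i by (intro tensor_slice[OF I, of i "%i. V i (c i)"] Vs y) auto
   then show "slice (y c) i b : V i e" using c by simp
   qed
   have "(SUM e:C i. ?g e) = (SUM c:?S. slice (y c) i b)" using fin i by (intro sum.group decomposes_finite[OF D]) auto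
   also have "... = slice (SUM c:?S. y c) i b" by (rule clin_sum[OF clin_slice, symmetric])
   also have "... = 0" unfolding IH by (rule clin_zero[OF clin_slice])
   finally show "(SUM e:C i. ?g e) = 0" .
   show "c' i : C i" using c' i by auto
   qed
   moreover have "{c : ?S. c i = c' i} = {c : PiE I C. ALL l:insert i A. c l = c' l}" by auto
   ultimately have "(\<Sum>c | c : PiE I C & (ALL l:insert i A. c l = c' l). slice (y c) i b) (b i) = 0" by simp
   then show ?thesis by (simp add: sum_apply slice_self)
   qed
   then show ?case by (auto simp: fun_eq_iff)
  qed
  from this[of I] have "(\<Sum>c | c : PiE I C & (ALL i:I. c i = c' i). y c) = 0" by simp
  moreover have "{c : PiE I C. ALL i:I. c i = c' i} = {c'}" using c' by (auto intro: PiE_ext)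
  ultimately show ?thesis by simp
 qed
qed


section \<open>Permutations acting on tabloids\<close>

lemma perm_tabloid_id [simp]: "perm_tabloid id R = R" by (simp add: perm_tabloid_def)

lemma perm_tabloid_comp: "perm_tabloid (p o q) R = perm_tabloid p (perm_tabloid q R)" by (simp add: perm_tabloid_def image_comp)

lemma perm_tabloid_inv [simp]:
 assumes "bij p"
 shows "perm_tabloid (inv' p) (perm_tabloid p R) = R" "perm_tabloid p (perm_tabloid (inv' p) R) = R" proof -
 have "inv' p o p = id" "p o inv' p = id" using assms by (auto simp: bij_def surj_iff)
 then show "perm_tabloid (inv' p) (perm_tabloid p R) = R" "perm_tabloid p (perm_tabloid (inv' p) R) = R"
  by (metis perm_tabloid_comp perm_tabloid_id)+
qed

lemma tabloid_disjoint: "R : tabloids \<mu> N ==> x : R a ==> x : R a' ==> a = a'" unfolding tabloids_def disjoint_family_on_def by blast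

lemma
 assumes "R : tabloids \<mu> N"
 shows tabloid_empty: "a ~: {1..length \<mu>} ==> R a = {}"
  and tabloid_card: "card (R a) = part \<mu> a"
  and tabloid_Union: "(\<Union>a. R a) = N"
  and tabloid_subset: "R a <= N" proof -
 show e: "R a = {}" if "a ~: {1..length \<mu>}" for a using assms that unfolding tabloids_def by blast
 have "card (R a) = part \<mu> a" if "a : {1..length \<mu>}" using assms that unfolding tabloids_def by blast
 then show "card (R a) = part \<mu> a" using e[of a] by (cases "a : {1..length \<mu>}") (simp_all add: part_def)
 show U: "(\<Union>a. R a) = N" using assms unfolding tabloids_def by blast
 then show "R a <= N" by blast
qed

lemma perm_tabloid_image:
 assumes "inj \<beta>" "\<beta> ` N = N'" "R : tabloids \<mu> N"
 shows "perm_tabloid \<beta> R : tabloids \<mu> N'" proof -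
 have "card (\<beta> ` A) = card A" for A by (rule card_image) (rule inj_on_subset[OF assms(1) subset_UNIV])
 moreover have "disjoint_family (%a. \<beta> ` R a)"
  unfolding disjoint_family_on_def using tabloid_disjoint[OF assms(3)] assms(1) by (auto dest: injD)
 moreover have "(\<Union>a. \<beta> ` R a) = N'" using tabloid_Union[OF assms(3)] assms(2) by (simp add: image_UN[symmetric])
 ultimately show ?thesis using assms(3) by (simp add: tabloids_def perm_tabloid_def)
qed

lemma perm_tabloid_tabloids: "p permutes N ==> R : tabloids \<mu> N ==> perm_tabloid p R : tabloids \<mu> N"
 by (rule perm_tabloid_image[OF permutes_inj permutes_image])

lemma perm_tabloid_tabloids_iff:
 assumes "p permutes N"
 shows "perm_tabloid p R : tabloids \<mu> N \<longleftrightarrow> R : tabloids \<mu> N" proof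
 assume "perm_tabloid p R : tabloids \<mu> N"
 from perm_tabloid_tabloids[OF permutes_inv[OF assms] this] show "R : tabloids \<mu> N" by (simp add: permutes_bij[OF assms])
qed (rule perm_tabloid_tabloids[OF assms])

definition tact :: "(nat => nat) => (tabloid => complex) => (tabloid => complex)" where
 "tact p f = (%R. f (perm_tabloid (inv' p) R))"

lemma clin_tact: "clin (tact p)" by (rule clinI) (auto simp: tact_def cscale_def)

lemma tact_id [simp]: "tact id f = f" by (simp add: tact_def inv_id)

lemma tact_comp: "bij p ==> bij q ==> tact (p o q) f = tact p (tact q f)" by (simp add: tact_def o_inv_distrib perm_tabloid_comp)

lemma tact_basis: "bij p ==> tact p (basis_vec R) = basis_vec (perm_tabloid p R)"
 unfolding tact_def basis_vec_def by (metis perm_tabloid_inv)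

lemma tact_free: "p permutes N ==> f : free (tabloids \<mu> N) ==> tact p f : free (tabloids \<mu> N)"
 using perm_tabloid_tabloids_iff[OF permutes_inv, of p N] by (auto simp: free_def tact_def)

section \<open>Ferrers diagrams and tableaux\<close>

lemma finite_cells [simp]: "finite (cells lam)" proof -
 have "cells lam = Sigma {1..length lam} (%a. {1..part lam a})" by (auto simp: cells_def)
 then show ?thesis by simp
qed

lemma card_cells: "card (cells lam) = sum_list lam" proof -
 have "cells lam = Sigma {1..length lam} (%a. {1..part lam a})" by (auto simp: cells_def)
 then have "card (cells lam) = (SUM a:{1..length lam}. part lam a)" by simp
 also have "... = (SUM i:{0..<length lam}. lam ! i)" by (rule sum.reindex_bij_witness[of _ "%i. i + 1" "%a. a - 1"]) (auto simp: part_def)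
 also have "... = sum_list lam" by (simp add: sum_list_sum_nth)
 finally show ?thesis .
qed

lemma part_mono:
 assumes "lam : partitions n" "1 <= a'" "a' <= a"
 shows "part lam a <= part lam a'" proof -
 have s: "sorted_wrt (>=) lam" using assms(1) by (simp add: partitions_def)
 show ?thesis proof (cases "a = a'")
  case False
  then show ?thesis using assms(2,3) sorted_wrt_nth_less[OF s, of "a' - 1" "a - 1"] by (auto simp: part_def)
 qed simp
qed

lemma cells_down:
 assumes "lam : partitions n" "(a, b) : cells lam" "1 <= a'" "a' <= a" "1 <= b'" "b' <= b"
 shows "(a', b') : cells lam" using part_mono[OF assms(1,3,4)] assms(2-) by (auto simp: cells_def)

lemma part_eqD:
 assumes "lam : partitions n" "\<mu> : partitions m" "!!a. part lam a = part \<mu> a"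
 shows "lam = \<mu>" proof -
 have pos: "part l a > 0 \<longleftrightarrow> a : {1..length l}" if "l : partitions n'" for l n' a proof -
  have "l ! (a - 1) ~= 0" if "a : {1..length l}" proof -
   have "l ! (a - 1) : set l" using that by (intro nth_mem) auto
   moreover have "0 ~: set l" using `l : partitions n'` by (simp add: partitions_def)
   ultimately show ?thesis by metis
  qed
  then show ?thesis by (auto simp: part_def)
 qed
 have "{1..length lam} = {1..length \<mu>}" by (rule Set.set_eqI) (metis pos[OF assms(1)] pos[OF assms(2)] assms(3))
 then have len: "length lam = length \<mu>" by (drule_tac arg_cong[where f = card]) simp
 show ?thesis proof (rule nth_equalityI[OF len])
  fix i assume "i < length lam"
  then show "lam ! i = \<mu> ! i" using assms(3)[of "i + 1"] len by (simp add: part_def)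
 qed
qed

lemma initial_segment_nat:
 fixes A :: "nat set"
 assumes "finite A" "0 ~: A" "!!a a'. a : A ==> 1 <= a' ==> a' <= a ==> a' : A"
 shows "A = {1..card A}" proof (cases "A = {}")
 case False
 have "A = {1..Max A}" proof
  show "A <= {1..Max A}" using assms(1,2) by (auto intro!: Suc_leI gr0I)
  show "{1..Max A} <= A" using Max_in[OF assms(1) False] assms(3) by auto
 qed
 then show ?thesis by (metis card_atLeastAtMost diff_Suc_1)
qed auto

lemma bij_betw_permutes:
 assumes f: "bij_betw f A B" and g: "bij_betw g A B"
 obtains p where "p permutes B" "!!a. a : A ==> p (f a) = g a" proof -
 define p where "p x = (if x : B then g (inv_into A f x) else x)" for x
 have "bij_betw (g o inv_into A f) B B" by (rule bij_betw_trans[OF bij_betw_inv_into[OF f] g])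
 moreover have "bij_betw p B B \<longleftrightarrow> bij_betw (g o inv_into A f) B B" by (rule bij_betw_cong) (simp add: p_def)
 ultimately have "p permutes B" by (intro bij_imp_permutes) (simp_all add: p_def)
 moreover have "p (f a) = g a" if "a : A" for a using f that by (auto simp: p_def bij_betw_def)
 ultimately show ?thesis by (rule that)
qed

lemma fibres_tabloid:
 assumes "!!x. x : N ==> f x : {1..length \<mu>}" "!!a. a : {1..length \<mu>} ==> card {x : N. f x = a} = part \<mu> a"
 shows "(%a. {x : N. f x = a}) : tabloids \<mu> N" using assms unfolding tabloids_def disjoint_family_on_def by blast

lemma rows_tabloid_in:
 assumes "t : tableaux lam N"
 shows "rows_tabloid lam t : tabloids lam N" proof -
 have inj: "inj_on t (cells lam)" and im: "t ` cells lam = N" using assms by (auto simp: tableaux_def bij_betw_def)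
 have "card (rows_tabloid lam t a) = part lam a" if "a : {1..length lam}" for a proof -
  have "card (rows_tabloid lam t a) = card {c : cells lam. fst c = a}"
   unfolding rows_tabloid_def by (rule card_image) (rule inj_on_subset[OF inj], auto)
  also have "{c : cells lam. fst c = a} = {a} \<times> {1..part lam a}" using that by (auto simp: cells_def)
  finally show ?thesis by simp
 qed
 moreover have "rows_tabloid lam t a = {}" if "a ~: {1..length lam}" for a using that by (auto simp: rows_tabloid_def cells_def)
 moreover have "disjoint_family (rows_tabloid lam t)" using inj by (auto simp: rows_tabloid_def disjoint_family_on_def inj_on_def)
 moreover have "(\<Union>a. rows_tabloid lam t a) = N" using im by (auto simp: rows_tabloid_def)
 ultimately show ?thesis by (simp add: tabloids_def)
qed

lemma tabloid_eq_rows: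
 assumes R: "R : tabloids lam N" and N: "finite N"
 obtains t where "t : tableaux lam N" "rows_tabloid lam t = R" proof -
 have RN: "R a <= N" for a using R by (auto simp: tabloids_def)
 have "EX h. bij_betw h {1..part lam a} (R a)" if "a : {1..length lam}" for a proof -
  have "card (R a) = part lam a" using R that by (simp add: tabloids_def)
  then show ?thesis using ex_bij_betw_nat_finite_1[OF finite_subset[OF RN N], of a] by simp
 qed
 then obtain h where h: "!!a. a : {1..length lam} ==> bij_betw (h a) {1..part lam a} (R a)" by metis
 define t where "t = (%(a, b). h a b)"
 have hR: "h a ` {1..part lam a} = R a" "inj_on (h a) {1..part lam a}" if "a : {1..length lam}" for a
  using h[OF that] by (auto simp: bij_betw_def)
 have rows: "rows_tabloid lam t = R" proof
  fix a
  show "rows_tabloid lam t a = R a" proof (cases "a : {1..length lam}")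
   case True
   have "rows_tabloid lam t a = h a ` {1..part lam a}" using True by (auto simp: rows_tabloid_def cells_def t_def)
   then show ?thesis using hR(1)[OF True] by simp
  next
   case False
   then show ?thesis using R by (auto simp: rows_tabloid_def cells_def tabloids_def)
  qed
 qed
 have "inj_on t (cells lam)" proof (rule inj_onI)
  fix c c' assume c: "c : cells lam" "c' : cells lam" "t c = t c'"
  obtain a b a' b' where ab: "c = (a, b)" "c' = (a', b')" by (cases c, cases c')
  have m: "h a b : R a" "h a' b' : R a'" using c ab hR(1)[of a] hR(1)[of a'] by (auto simp: cells_def)
  then have "a = a'" using tabloid_disjoint[OF R] c(3) ab by (auto simp: t_def)
  moreover from this have "b = b'" using c ab hR(2)[of a] by (auto simp: t_def cells_def dest: inj_onD)
  ultimately show "c = c'" using ab by simp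
 qed
 moreover have "t ` cells lam = (\<Union>a. rows_tabloid lam t a)" by (auto simp: rows_tabloid_def)
 ultimately have "t : tableaux lam N" using R rows by (simp add: tableaux_def bij_betw_def tabloids_def)
 with rows show ?thesis by (rule that[rotated])
qed

lemma tabloids_eq_rows: "finite N ==> rows_tabloid lam ` tableaux lam N = tabloids lam N" proof (intro equalityI subsetI)
 fix R assume "finite N" "R : tabloids lam N"
 then obtain t where "t : tableaux lam N" "rows_tabloid lam t = R" by (metis tabloid_eq_rows)
 then show "R : rows_tabloid lam ` tableaux lam N" by blast
qed (use rows_tabloid_in in blast)

lemma tableaux_nonempty:
 assumes "lam : partitions (card N)" "finite N"
 shows "tableaux lam N ~= {}" proof -
 have "card (cells lam) = card N" using assms by (simp add: card_cells partitions_def)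
 then show ?thesis using finite_same_card_bij[OF finite_cells assms(2)] by (auto simp: tableaux_def)
qed

definition rowof :: "tabloid => nat => nat" where
 "rowof R x = (THE a. x : R a)"

lemma rowof_eq:
 assumes "R : tabloids \<mu> N" "x : R a"
 shows "rowof R x = a" unfolding rowof_def using assms(2) tabloid_disjoint[OF assms(1)] by (intro the_equality) auto

lemma rowof_iff:
 assumes "R : tabloids \<mu> N" "x : N"
 shows "rowof R x = a \<longleftrightarrow> x : R a" proof -
 obtain a' where "x : R a'" using assms by (auto simp: tabloids_def)
 then show ?thesis using rowof_eq[OF assms(1)] by auto
qed

lemma rowof_pos:
 assumes "R : tabloids \<mu> N" "x : N"
 shows "rowof R x : {1..length \<mu>}" proof (rule ccontr)
 assume "rowof R x ~: {1..length \<mu>}"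
 then have "R (rowof R x) = {}" using assms(1) by (auto simp: tabloids_def)
 then show False using rowof_iff[OF assms, of "rowof R x"] by simp
qed

lemma rowof_rows:
 assumes "t : tableaux lam N" "c : cells lam"
 shows "rowof (rows_tabloid lam t) (t c) = fst c"
 by (rule rowof_eq[OF rows_tabloid_in[OF assms(1)]]) (use assms(2) in \<open>auto simp: rows_tabloid_def\<close>)

definition column :: "nat list => (cell => nat) => nat => nat set" where
 "column lam t b = t ` {c : cells lam. snd c = b}"

lemma column_stabilizer_iff:
 "p : column_stabilizer lam N t \<longleftrightarrow> p permutes N & (ALL b. p ` column lam t b = column lam t b)"
 by (simp add: column_stabilizer_def column_def)

definition row_stabilizer :: "nat list => nat set => (cell => nat) => (nat => nat) set" where
 "row_stabilizer lam N t =
   {p. p permutes N & perm_tabloid p (rows_tabloid lam t) = rows_tabloid lam t}"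

lemma
 shows column_stabilizer_id: "id : column_stabilizer lam N t"
  and column_stabilizer_comp: "p : column_stabilizer lam N t ==> q : column_stabilizer lam N t ==>
   p o q : column_stabilizer lam N t"
  and column_stabilizer_inv: "p : column_stabilizer lam N t ==> inv' p : column_stabilizer lam N t" proof -
 show "inv' p : column_stabilizer lam N t" if p: "p : column_stabilizer lam N t" proof -
  have "inv' p ` column lam t b = column lam t b" for b proof -
   have "inv' p ` (p ` column lam t b) = column lam t b"
   using p permutes_inj[of p N] by (intro image_inv_f_f) (simp add: column_stabilizer_iff)
   then show ?thesis using p unfolding column_stabilizer_iff by metis
  qed
  then show ?thesis using p by (simp add: column_stabilizer_iff permutes_inv)
 qed
 show "p o q : column_stabilizer lam N t" if "p : column_stabilizer lam N t" "q : column_stabilizer lam N t" proof -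
  have "(p o q) ` column lam t b = p ` q ` column lam t b" for b by (rule image_comp[symmetric])
  then show ?thesis using that by (simp add: column_stabilizer_iff permutes_compose del: image_comp)
 qed
qed (simp add: column_stabilizer_iff permutes_id)

lemma
 shows row_stabilizer_id: "id : row_stabilizer lam N t"
  and row_stabilizer_comp: "p : row_stabilizer lam N t ==> q : row_stabilizer lam N t ==>
   p o q : row_stabilizer lam N t"
  and row_stabilizer_inv: "p : row_stabilizer lam N t ==> inv' p : row_stabilizer lam N t" proof -
 show "inv' p : row_stabilizer lam N t" if p: "p : row_stabilizer lam N t"
  using p perm_tabloid_inv(1)[OF permutes_bij[of p N], of "rows_tabloid lam t"] by (simp add: row_stabilizer_def permutes_inv)
qed (auto simp: row_stabilizer_def permutes_id permutes_compose perm_tabloid_comp)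

lemma finite_stabilizers:
 assumes "finite N"
 shows "finite (column_stabilizer lam N t)" "finite (row_stabilizer lam N t)" by (rule finite_subset[OF _ finite_permutations[OF assms]],
   simp add: column_stabilizer_def row_stabilizer_def subset_iff)+

lemma transpose_image:
 assumes "x : B \<longleftrightarrow> y : B"
 shows "transpose x y ` B = B" using assms by (auto simp: transpose_def image_iff)

lemma column_subset: "t : tableaux lam N ==> column lam t b <= N" by (auto simp: column_def tableaux_def bij_betw_def)

lemma column_disjoint:
 assumes "t : tableaux lam N" "x : column lam t b" "x : column lam t b'"
 shows "b = b'" using assms by (auto simp: column_def tableaux_def bij_betw_def dest: inj_onD)

lemma transpose_column_stabilizer:
 assumes "t : tableaux lam N" "x : column lam t b" "y : column lam t b"
 shows "transpose x y : column_stabilizer lam N t" proof -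
 have "transpose x y permutes N" using assms column_subset[OF assms(1), of b] by (intro permutes_swap_id) auto
 moreover have "transpose x y ` column lam t b' = column lam t b'" for b' proof (rule transpose_image)
  have "x : column lam t b' \<longleftrightarrow> b' = b" "y : column lam t b' \<longleftrightarrow> b' = b"
   using assms(2,3) column_disjoint[OF assms(1), of _ b b'] by auto
  then show "x : column lam t b' \<longleftrightarrow> y : column lam t b'" by simp
 qed
 ultimately show ?thesis by (simp add: column_stabilizer_iff)
qed

lemma transpose_tabloid:
 assumes "R : tabloids \<mu> N" "x : N" "y : N" "rowof R x = rowof R y"
 shows "perm_tabloid (transpose x y) R = R" proof -
 have "transpose x y ` R a = R a" for a by (rule transpose_image) (metis assms rowof_iff)
 then show ?thesis by (simp add: perm_tabloid_def)
qed

section \<open>The numerical comparison lemma\<close>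

definition row_sum :: "nat list => nat" where
 "row_sum lam = (SUM c:cells lam. fst c)"

lemma sum_rowof:
 assumes "t : tableaux lam N"
 shows "(SUM x:N. rowof (rows_tabloid lam t) x) = row_sum lam" proof -
 have b: "bij_betw t (cells lam) N" using assms by (simp add: tableaux_def)
 have "(SUM x:N. rowof (rows_tabloid lam t) x) = (SUM c:cells lam. rowof (rows_tabloid lam t) (t c))"
  by (rule sum.reindex_bij_betw[OF b, symmetric])
 also have "... = row_sum lam" unfolding row_sum_def by (rule sum.cong[OF refl]) (rule rowof_rows[OF assms])
 finally show ?thesis .
qed

text \<open>The entries of a column lie in pairwise distinct rows of another tabloid, so after sorting the
a-th of them has row number at least a. Summing over all columns compares the total row numbers; this
number replaces the dominance order.\<close>
lemma sort_values:
 fixes f :: "'a => nat"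
 assumes "finite C" "inj_on f C" "!!x. x : C ==> 1 <= f x"
 shows "EX h. bij_betw h {1..card C} C & (ALL a:{1..card C}. a <= f (h a))" using assms proof (induction "card C" arbitrary: C)
 case 0
 then show ?case by (simp add: bij_betw_def)
next
 case (Suc n)
 then have ne: "C ~= {}" by auto
 have "Max (f ` C) : f ` C" using Suc.prems(1) ne by simp
 then obtain m where m: "m : C" "Max (f ` C) = f m" by blast
 have fm: "f x <= f m" if "x : C" for x unfolding m(2)[symmetric] using Suc.prems(1) that by simp
 have n: "n = card (C - {m})" using Suc.hyps(2) Suc.prems(1) m(1) by simp
 have "EX h. bij_betw h {1..card (C - {m})} (C - {m}) & (ALL a:{1..card (C - {m})}. a <= f (h a))"
  by (rule Suc.hyps(1)[OF n]) (use Suc.prems in \<open>auto intro: inj_on_diff\<close>)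
 then obtain h where h: "bij_betw h {1..n} (C - {m})" "ALL a:{1..n}. a <= f (h a)" unfolding n[symmetric] by blast
 have "card C = card (f ` C)" by (rule card_image[OF Suc.prems(2), symmetric])
 also have "... <= card {1..f m}" by (rule card_mono) (use fm Suc.prems(3) in auto)
 finally have le: "Suc n <= f m" using Suc.hyps(2) by simp
 have "bij_betw (h(Suc n := m)) {1..n} (C - {m})" by (rule bij_betw_cong[THEN iffD2, OF _ h(1)]) simp
 then have "bij_betw (h(Suc n := m)) ({1..n} \<union> {Suc n}) (C - {m} \<union> {m})"
  using notIn_Un_bij_betw[of "Suc n" "{1..n}" "h(Suc n := m)" "C - {m}"] by simp
 moreover have "{1..n} \<union> {Suc n} = {1..card C}" "C - {m} \<union> {m} = C" using m(1) Suc.hyps(2)[symmetric] by auto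
 ultimately have "bij_betw (h(Suc n := m)) {1..card C} C" by simp
 moreover have "ALL a:{1..card C}. a <= f ((h(Suc n := m)) a)" using h(2) le Suc.hyps(2)[symmetric] by auto
 ultimately show ?case by blast
qed

lemma sort_columns:
 assumes lam: "lam : partitions n" and t: "t : tableaux lam N"
  and pos: "!!x. x : N ==> f x >= (1::nat)" and inj: "!!b. inj_on f (column lam t b)"
 obtains p where "p : column_stabilizer lam N t" "!!c. c : cells lam ==> fst c <= f (p (t c))" proof -
 have bij: "bij_betw t (cells lam) N" using t by (simp add: tableaux_def)
 have sub: "column lam t b <= N" for b by (rule column_subset[OF t])
 have finc: "finite (column lam t b)" for b by (simp add: column_def)
 let ?n = "%b. card (column lam t b)"
 have seg: "{a. (a, b) : cells lam} = {1..?n b}" for b proof -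
  have "{a. (a, b) : cells lam} = {1..card {a. (a, b) : cells lam}}" proof (rule initial_segment_nat)
   show "finite {a. (a, b) : cells lam}" by (rule finite_subset[OF _ finite_imageI[OF finite_cells, of fst lam]]) force
   show "a' : {a. (a, b) : cells lam}" if "a : {a. (a, b) : cells lam}" "1 <= a'" "a' <= a" for a a'
   using that cells_down[OF lam, of a b a' b] by (auto simp: cells_def)
  qed (auto simp: cells_def)
  also have "card {a. (a, b) : cells lam} = card {c : cells lam. snd c = b}"
   by (rule bij_betw_same_card[of "%a. (a, b)"]) (auto simp: bij_betw_def inj_on_def)
  also have "... = ?n b" unfolding column_def by (rule card_image[symmetric]) (rule inj_on_subset[OF bij_betw_imp_inj_on[OF bij]], auto)
  finally show ?thesis .
 qed
 have "ALL b. EX h. bij_betw h {1..?n b} (column lam t b) & (ALL a:{1..?n b}. a <= f (h a))"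
  by (intro allI sort_values[OF finc inj]) (use pos sub in blast)
 then obtain h where h: "!!b. bij_betw (h b) {1..?n b} (column lam t b)" "!!a b. a : {1..?n b} ==> a <= f (h b a)" by metis
 define s where "s c = h (snd c) (fst c)" for c :: cell
 have ab: "fst c : {1..?n (snd c)}" if "c : cells lam" for c using that unfolding seg[symmetric] by simp
 have scol: "s c : column lam t (snd c)" if "c : cells lam" for c unfolding s_def by (rule bij_betwE[OF h(1), rule_format, OF ab[OF that]])
 have "inj_on s (cells lam)" proof (rule inj_onI)
  fix c c' assume c: "c : cells lam" "c' : cells lam" "s c = s c'"
  then have e: "snd c = snd c'" using scol[OF c(1)] scol[OF c(2)] column_disjoint[OF t] by metis
  then have "fst c = fst c'" using c(3) ab[OF c(1)] ab[OF c(2)] inj_onD[OF bij_betw_imp_inj_on[OF h(1)]] unfolding s_def by metis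
  then show "c = c'" using e by (rule prod_eqI)
 qed
 moreover have "s ` cells lam <= N" using scol sub by blast
 ultimately have sb: "bij_betw s (cells lam) N" using bij by (metis bij_betw_def card_image card_subset_eq bij_betw_finite finite_cells)
 obtain p where p: "p permutes N" "!!c. c : cells lam ==> p (t c) = s c" by (rule bij_betw_permutes[OF bij sb]) blast
 have "p ` column lam t b <= column lam t b" for b using scol p(2) unfolding column_def by auto
 then have "p ` column lam t b = column lam t b" for b
  by (rule endo_inj_surj[OF finc _ inj_on_subset[OF permutes_inj[OF p(1)] subset_UNIV]])
 then have "p : column_stabilizer lam N t" using p(1) by (simp add: column_stabilizer_iff)
 then show ?thesis by (rule that) (use p(2) h(2)[OF ab] in \<open>simp add: s_def\<close>)
qed

lemma compare_row_sum:
 assumes lam: "lam : partitions n" and t: "t : tableaux lam N" and s: "s : tableaux \<mu> N"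
  and inj: "!!b. inj_on (rowof (rows_tabloid \<mu> s)) (column lam t b)"
 shows "row_sum lam <= row_sum \<mu>"
  and "row_sum lam = row_sum \<mu> ==>
   EX p:column_stabilizer lam N t. perm_tabloid p (rows_tabloid lam t) = rows_tabloid \<mu> s" proof -
 let ?R = "rows_tabloid \<mu> s"
 have R: "?R : tabloids \<mu> N" by (rule rows_tabloid_in[OF s])
 have bij: "bij_betw t (cells lam) N" using t by (simp add: tableaux_def)
 obtain p where p: "p : column_stabilizer lam N t" "!!c. c : cells lam ==> fst c <= rowof ?R (p (t c))"
  by (rule sort_columns[OF lam t _ inj]) (use rowof_pos[OF R] in auto)
 have pN: "p permutes N" using p(1) by (simp add: column_stabilizer_iff)
 have bij': "bij_betw (p o t) (cells lam) N" by (rule bij_betw_trans[OF bij permutes_imp_bij[OF pN]])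
 have eq: "(SUM c:cells lam. rowof ?R (p (t c))) = row_sum \<mu>" using sum.reindex_bij_betw[OF bij', of "rowof ?R"] sum_rowof[OF s] by simp
 show "row_sum lam <= row_sum \<mu>" unfolding eq[symmetric] unfolding row_sum_def by (rule sum_mono) (rule p(2))
 show "EX p:column_stabilizer lam N t. perm_tabloid p (rows_tabloid lam t) = ?R" if "row_sum lam = row_sum \<mu>"
 proof (rule bexI[OF _ p(1)])
  have cell: "fst c = rowof ?R (p (t c))" if c: "c : cells lam" for c proof (rule ccontr)
   assume "fst c ~= rowof ?R (p (t c))"
   then have "row_sum lam < (SUM c:cells lam. rowof ?R (p (t c)))" unfolding row_sum_def proof (intro sum_strict_mono_ex1 ballI bexI)
   show "fst c < rowof ?R (p (t c))" using p(2)[OF c] `fst c ~= rowof ?R (p (t c))` by simp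
   qed (use c p(2) in auto)
   then show False using eq `row_sum lam = row_sum \<mu>` by simp
  qed
  show "perm_tabloid p (rows_tabloid lam t) = ?R" proof (intro ext equalityI subsetI)
   fix a x assume "x : perm_tabloid p (rows_tabloid lam t) a"
   then obtain c where c: "c : cells lam" "fst c = a" "x = p (t c)" by (auto simp: perm_tabloid_def rows_tabloid_def)
   then have "x : N" using bij' by (auto simp: bij_betw_def)
   then show "x : ?R a" using rowof_iff[OF R, of x a] cell c by auto
  next
   fix a x assume x: "x : ?R a"
   then have "x : N" using R by (auto simp: tabloids_def)
   then obtain c where c: "c : cells lam" "x = p (t c)" using bij' by (auto simp: bij_betw_def)
   then have "fst c = a" using cell rowof_eq[OF R x] by simp
   then show "x : perm_tabloid p (rows_tabloid lam t) a" using c by (auto simp: perm_tabloid_def rows_tabloid_def)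
  qed
 qed
qed

lemma rows_tabloid_shape:
 assumes "lam : partitions n" "\<mu> : partitions m" "t : tableaux lam N" "s : tableaux \<mu> N"
  and "p permutes N" "perm_tabloid p (rows_tabloid lam t) = rows_tabloid \<mu> s"
 shows "lam = \<mu>" proof (rule part_eqD[OF assms(1,2)])
 fix a
 have *: "card (R a) = part l a" if "R : tabloids l N" for R l using that by (cases "a : {1..length l}") (auto simp: tabloids_def part_def)
 show "part lam a = part \<mu> a" using *[OF perm_tabloid_tabloids[OF assms(5) rows_tabloid_in[OF assms(3)]]]
   *[OF rows_tabloid_in[OF assms(4)]] assms(6) by simp
qed


section \<open>Young symmetrizers\<close>

lemma permutes_o_inv:
 assumes "p permutes N"
 shows "p o inv' p = id" "inv' p o p = id" using permutes_bij[OF assms] by (auto simp: bij_def surj_iff)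

lemma column_stabilizerD: "p : column_stabilizer lam N t ==> p permutes N" by (simp add: column_stabilizer_iff)

lemma row_stabilizerD: "p : row_stabilizer lam N t ==> p permutes N" by (simp add: row_stabilizer_def)

text \<open>Row and column symmetrizers are both sums over a group against a character with values 1 and -1.\<close>
definition wsum :: "((nat => nat) => int) => (nat => nat) set => (tabloid => complex) => tabloid => complex" where
 "wsum w G f = (SUM p:G. cscale (of_int (w p)) (tact p f))"

definition sign_character :: "nat set => ((nat => nat) => int) => (nat => nat) set => bool" where
 "sign_character N w G \<longleftrightarrow> (ALL p:G. p permutes N & inv' p : G & w (inv' p) = w p & w p * w p = 1) &
   (ALL p:G. ALL q:G. p o q : G & w (p o q) = w p * w q)"

lemma clin_wsum: "clin (wsum w G)" unfolding wsum_def by (rule clin_combination[OF clin_tact])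

context
 fixes N w G assumes G: "sign_character N w G"
begin

lemma
 shows character_permutes: "p : G ==> p permutes N"
  and character_inv: "p : G ==> inv' p : G" "p : G ==> w (inv' p) = w p"
  and character_square: "p : G ==> w p * w p = 1"
  and character_comp: "p : G ==> q : G ==> p o q : G" "p : G ==> q : G ==> w (p o q) = w p * w q"
 using G unfolding sign_character_def by blast+

lemma wsum_shift:
 assumes c: "c : G" and h: "bij_betw h G G" "!!p. p : G ==> w (h p) = w p * w c"
 shows "(SUM p:G. cscale (of_int (w p)) (tact (h p) f)) = cscale (of_int (w c)) (wsum w G f)" proof -
 have "cscale (of_int (w c)) (wsum w G f) = (SUM p:G. cscale (of_int (w c * w p)) (tact p f))" by (simp add: wsum_def cs.scale_sum_right)
 also have "... = (SUM p:G. cscale (of_int (w c * w (h p))) (tact (h p) f))" by (rule sum.reindex_bij_betw[OF h(1), symmetric])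
 also have "... = (SUM p:G. cscale (of_int (w p)) (tact (h p) f))" proof (rule sum.cong[OF refl])
  fix p assume "p : G"
  then have "w c * w (h p) = w p * (w c * w c)" by (simp only: h(2) ac_simps)
  then show "cscale (of_int (w c * w (h p))) (tact (h p) f) = cscale (of_int (w p)) (tact (h p) f)"
   by (simp only: character_square[OF c] mult_1_right)
 qed
 finally show ?thesis ..
qed

lemma wsum_tact:
 assumes c: "c : G"
 shows "wsum w G (tact c f) = cscale (of_int (w c)) (wsum w G f)"
  and "tact c (wsum w G f) = cscale (of_int (w c)) (wsum w G f)" proof -
 note bij = permutes_bij[OF character_permutes] and oi = permutes_o_inv[OF character_permutes[OF c]]
 have "bij_betw (%p. p o c) G G" by (rule bij_betw_byWitness[where f' = "%p. p o inv' c"])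
   (auto simp: comp_assoc oi intro: character_comp(1) character_inv(1) c)
 from wsum_shift[OF c this, of f]
 show "wsum w G (tact c f) = cscale (of_int (w c)) (wsum w G f)" by (simp add: wsum_def tact_comp bij c character_comp(2))
 have "bij_betw (%p. c o p) G G" by (rule bij_betw_byWitness[where f' = "%p. inv' c o p"])
   (auto simp: comp_assoc[symmetric] oi intro: character_comp(1) character_inv(1) c)
 from wsum_shift[OF c this, of f]
 show "tact c (wsum w G f) = cscale (of_int (w c)) (wsum w G f)"
  by (simp add: wsum_def clin_lincomb[OF clin_tact] tact_comp bij c character_comp(2) mult.commute)
qed

lemma wsum_free: "f : free (tabloids \<mu> N) ==> wsum w G f : free (tabloids \<mu> N)" unfolding wsum_def
 by (intro cs.subspace_sum[OF subspace_free] cs.subspace_scale[OF subspace_free] tact_free[OF character_permutes])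

end

definition column_sym :: "nat list => nat set => (cell => nat) => (tabloid => complex) => tabloid => complex" where
 "column_sym lam N t = wsum sign (column_stabilizer lam N t)"

definition row_sym :: "nat list => nat set => (cell => nat) => (tabloid => complex) => tabloid => complex" where
 "row_sym lam N t = wsum (%_. 1) (row_stabilizer lam N t)"

definition young_sym :: "nat list => nat set => (cell => nat) => (tabloid => complex) => tabloid => complex" where
 "young_sym lam N t f = column_sym lam N t (row_sym lam N t f)"

lemma column_character:
 assumes "finite N"
 shows "sign_character N sign (column_stabilizer lam N t)" proof -
 have "permutation p" if "p : column_stabilizer lam N t" for p using column_stabilizerD[OF that] assms permutation_permutes by blast
 then show ?thesis by (auto simp: sign_character_def sign_inverse sign_compose sign_idempotent
   intro: column_stabilizerD column_stabilizer_inv column_stabilizer_comp)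
qed

lemma row_character: "sign_character N (%_. 1) (row_stabilizer lam N t)"
 by (auto simp: sign_character_def intro: row_stabilizerD row_stabilizer_inv row_stabilizer_comp)

lemma column_sym_eq: "column_sym lam N t f = (SUM p:column_stabilizer lam N t. cscale (of_int (sign p)) (tact p f))"
 by (simp add: column_sym_def wsum_def)

lemma row_sym_eq: "row_sym lam N t f = (SUM p:row_stabilizer lam N t. tact p f)" by (simp add: row_sym_def wsum_def)

lemma clin_column_sym: "clin (column_sym lam N t)" and clin_row_sym: "clin (row_sym lam N t)"
 unfolding column_sym_def row_sym_def by (rule clin_wsum)+

lemma clin_young_sym: "clin (young_sym lam N t)" unfolding young_sym_def by (rule clin_comp[OF clin_column_sym clin_row_sym])

lemmas column_sym_tact = wsum_tact(1)[OF column_character, folded column_sym_def]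
 and tact_column_sym = wsum_tact(2)[OF column_character, folded column_sym_def]
 and column_sym_free = wsum_free[OF column_character, folded column_sym_def]
 and row_sym_free = wsum_free[OF row_character, folded row_sym_def]

lemma row_sym_tact: "c : row_stabilizer lam N t ==> row_sym lam N t (tact c f) = row_sym lam N t f"
 using wsum_tact(1)[OF row_character] by (simp add: row_sym_def)

lemma young_sym_expand:
 "young_sym lam N t f = (SUM (c, \<rho>):column_stabilizer lam N t \<times> row_stabilizer lam N t.
   cscale (of_int (sign c)) (tact (c o \<rho>) f))"
 unfolding young_sym_def column_sym_eq row_sym_eq clin_sum[OF clin_tact] cs.scale_sum_right sum.cartesian_product
 by (rule sum.cong) (auto simp: tact_comp permutes_bij[OF column_stabilizerD] permutes_bij[OF row_stabilizerD])

lemma polytabloid_eq: "polytabloid lam N t = column_sym lam N t (basis_vec (rows_tabloid lam t))" unfolding polytabloid_def column_sym_eq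
 by (rule sum.cong[OF refl]) (simp add: tact_basis permutes_bij[OF column_stabilizerD])
lemma vec_neg_eq_zero:
 fixes v :: "'x => complex"
 assumes "v = cscale (-1) v"
 shows "v = 0" proof
 fix x
 have "v x = - v x" using fun_cong[OF assms, of x] by (simp add: cscale_def)
 then show "v x = 0 x" by simp
qed

lemma column_sym_basis_zero:
 assumes N: "finite N" and t: "t : tableaux lam N" and R: "R : tabloids \<mu> N"
  and xy: "x : column lam t b" "y : column lam t b" "x ~= y" "rowof R x = rowof R y"
 shows "column_sym lam N t (basis_vec R) = 0" proof (rule vec_neg_eq_zero)
 let ?\<tau> = "transpose x y"
 have \<tau>: "?\<tau> : column_stabilizer lam N t" by (rule transpose_column_stabilizer[OF t xy(1,2)])
 have xyN: "x : N" "y : N" using xy column_subset[OF t] by blast+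
 have "tact ?\<tau> (basis_vec R) = basis_vec R"
  using tact_basis[OF permutes_bij[OF column_stabilizerD[OF \<tau>]]] transpose_tabloid[OF R xyN xy(4)] by simp
 then have "column_sym lam N t (basis_vec R) = column_sym lam N t (tact ?\<tau> (basis_vec R))" by simp
 also have "... = cscale (of_int (sign ?\<tau>)) (column_sym lam N t (basis_vec R))" by (rule column_sym_tact[OF N \<tau>])
 also have "of_int (sign ?\<tau>) = (-1 :: complex)" using xy(3) by (simp add: sign_swap_id)
 finally show "column_sym lam N t (basis_vec R) = cscale (-1) (column_sym lam N t (basis_vec R))" .
qed

lemma free_induct_lin:
 assumes "f : free X" "finite X" "clin L" "cs.subspace U" "!!x. x : X ==> L (basis_vec x) : U"
 shows "L f : U" using assms(1) unfolding free_eq_cspan[OF assms(2)] by (rule span_induct_lin[OF _ _ assms(3,4)]) (use assms(5) in auto)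

lemma column_sym_line:
 assumes N: "finite N" and lam: "lam : partitions n" and t: "t : tableaux lam N"
  and f: "f : free (tabloids lam N)"
 shows "EX z. column_sym lam N t f = cscale z (polytabloid lam N t)" proof -
 have "column_sym lam N t f : {cscale z (polytabloid lam N t) | z. True}"
 proof (rule free_induct_lin[OF f finite_tabloids[OF N] clin_column_sym subspace_line])
  fix R assume R: "R : tabloids lam N"
  obtain s where s: "s : tableaux lam N" "rows_tabloid lam s = R" by (rule tabloid_eq_rows[OF R N])
  show "column_sym lam N t (basis_vec R) : {cscale z (polytabloid lam N t) | z. True}"
  proof (cases "ALL b. inj_on (rowof R) (column lam t b)")
   case True
   then obtain p where p: "p : column_stabilizer lam N t" "perm_tabloid p (rows_tabloid lam t) = R"
   using compare_row_sum(2)[OF lam t s(1)] s(2) by blast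
   have "basis_vec R = tact p (basis_vec (rows_tabloid lam t))" using p tact_basis[OF permutes_bij[OF column_stabilizerD[OF p(1)]]] by simp
   then have "column_sym lam N t (basis_vec R) = cscale (of_int (sign p)) (polytabloid lam N t)"
   using column_sym_tact[OF N p(1)] by (simp add: polytabloid_eq)
   then show ?thesis by blast
  next
   case False
   then obtain b x y where "x : column lam t b" "y : column lam t b" "x ~= y" "rowof R x = rowof R y" by (auto simp: inj_on_def)
   from column_sym_basis_zero[OF N t R this] have "column_sym lam N t (basis_vec R) = 0" .
   then show ?thesis using cs.subspace_0[OF subspace_line] by simp
  qed
 qed
 then show ?thesis by blast
qed

lemma column_sym_other:
 assumes N: "finite N" and lam: "lam : partitions n" and \<mu>: "\<mu> : partitions m"
  and t: "t : tableaux lam N" and f: "f : free (tabloids \<mu> N)"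
  and ne: "\<mu> ~= lam" and le: "row_sum \<mu> <= row_sum lam"
 shows "column_sym lam N t f = 0" proof -
 have "column_sym lam N t f : {0}" proof (rule free_induct_lin[OF f finite_tabloids[OF N] clin_column_sym subspace_singleton_zero])
  fix R assume R: "R : tabloids \<mu> N"
  obtain s where s: "s : tableaux \<mu> N" "rows_tabloid \<mu> s = R" by (rule tabloid_eq_rows[OF R N])
  have "~ (ALL b. inj_on (rowof R) (column lam t b))" proof
   assume "ALL b. inj_on (rowof R) (column lam t b)"
   then have inj: "inj_on (rowof (rows_tabloid \<mu> s)) (column lam t b)" for b using s(2) by simp
   then have "row_sum lam = row_sum \<mu>" using compare_row_sum(1)[OF lam t s(1) inj] le by simp
   then obtain p where p: "p : column_stabilizer lam N t" "perm_tabloid p (rows_tabloid lam t) = rows_tabloid \<mu> s"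
   using compare_row_sum(2)[OF lam t s(1) inj] by blast
   from rows_tabloid_shape[OF lam \<mu> t s(1) column_stabilizerD[OF p(1)] p(2)] ne show False by simp
  qed
  then obtain b x y where "x : column lam t b" "y : column lam t b" "x ~= y" "rowof R x = rowof R y" by (auto simp: inj_on_def)
  from column_sym_basis_zero[OF N t R this] show "column_sym lam N t (basis_vec R) : {0}" by simp
 qed
 then show ?thesis by simp
qed

lemma row_sym_other:
 assumes N: "finite N" and \<mu>: "\<mu> : partitions m"
  and t: "t : tableaux lam N" and s: "s : tableaux \<mu> N" and less: "row_sum lam < row_sum \<mu>"
 shows "row_sym lam N t (polytabloid \<mu> N s) = 0" proof (rule vec_neg_eq_zero)
 let ?R = "rows_tabloid lam t"
 have R: "?R : tabloids lam N" by (rule rows_tabloid_in[OF t])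
 have "~ (ALL b. inj_on (rowof ?R) (column \<mu> s b))" using compare_row_sum(1)[OF \<mu> s t] less by force
 then obtain b x y where xy: "x : column \<mu> s b" "y : column \<mu> s b" "x ~= y" "rowof ?R x = rowof ?R y" by (auto simp: inj_on_def)
 let ?\<tau> = "transpose x y"
 have \<tau>: "?\<tau> : column_stabilizer \<mu> N s" by (rule transpose_column_stabilizer[OF s xy(1,2)])
 have xyN: "x : N" "y : N" using xy column_subset[OF s] by blast+
 have \<tau>': "?\<tau> : row_stabilizer lam N t"
  using column_stabilizerD[OF \<tau>] transpose_tabloid[OF R xyN xy(4)] by (simp add: row_stabilizer_def)
 have "row_sym lam N t (polytabloid \<mu> N s) = row_sym lam N t (tact ?\<tau> (polytabloid \<mu> N s))"
  by (rule row_sym_tact[OF \<tau>', symmetric])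
 also have "... = cscale (of_int (sign ?\<tau>)) (row_sym lam N t (polytabloid \<mu> N s))"
  unfolding polytabloid_eq tact_column_sym[OF N \<tau>] by (rule clin_scale[OF clin_row_sym])
 also have "of_int (sign ?\<tau>) = (-1 :: complex)" using xy(3) by (simp add: sign_swap_id)
 finally show "row_sym lam N t (polytabloid \<mu> N s) = cscale (-1) (row_sym lam N t (polytabloid \<mu> N s))" .
qed

lemma specht_subset_free: "finite N ==> specht lam N <= free (tabloids lam N)" using specht_free tabloids_eq_rows by metis

lemma subspace_specht: "cs.subspace (specht lam N)" unfolding specht_def by (rule subspace_cspan)

lemma polytabloid_in_specht: "t : tableaux lam N ==> polytabloid lam N t : specht lam N" unfolding specht_def by (rule cspan_base) simp

theorem young_sym_other:
 assumes N: "finite N" and lam: "lam : partitions n" and \<mu>: "\<mu> : partitions m" and ne: "\<mu> ~= lam"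
  and t: "t : tableaux lam N" and f: "f : specht \<mu> N"
 shows "young_sym lam N t f = 0" proof (cases "row_sum \<mu> <= row_sum lam")
 case True
 have "row_sym lam N t f : free (tabloids \<mu> N)" using f specht_subset_free[OF N] by (intro row_sym_free) blast
 then show ?thesis unfolding young_sym_def by (rule column_sym_other[OF N lam \<mu> t _ ne True])
next
 case False
 have "row_sym lam N t f : {0}" using f unfolding specht_def proof (rule span_induct_lin[OF _ _ clin_row_sym subspace_singleton_zero])
  fix e assume "e : polytabloid \<mu> N ` tableaux \<mu> N"
  then show "row_sym lam N t e : {0}" using row_sym_other[OF N \<mu> t] False by auto
 qed
 then show ?thesis unfolding young_sym_def using clin_zero[OF clin_column_sym] by simp
qed

theorem young_sym_line:
 assumes N: "finite N" and lam: "lam : partitions n" and t: "t : tableaux lam N"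
  and f: "f : free (tabloids lam N)"
 shows "EX z. young_sym lam N t f = cscale z (polytabloid lam N t)"
 unfolding young_sym_def by (rule column_sym_line[OF N lam t row_sym_free[OF f]])

section \<open>Specht modules as cyclic modules\<close>

lemma polytabloid_cong:
 assumes "!!c. c : cells lam ==> t c = t' c"
 shows "polytabloid lam N t = polytabloid lam N t'" proof -
 have im: "t ` {c : cells lam. P c} = t' ` {c : cells lam. P c}" for P using assms by (intro image_cong) auto
 show ?thesis unfolding polytabloid_def column_stabilizer_def rows_tabloid_def by (simp only: im)
qed

lemma column_stabilizer_conj:
 assumes p: "p permutes N" and c: "c : column_stabilizer lam N t"
 shows "p o c o inv' p : column_stabilizer lam N (p o t)" proof -
 have col: "column lam (p o t) b = p ` column lam t b" for b by (simp add: column_def image_comp)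
 have "(p o c o inv' p) ` p ` A = p ` c ` A" for A by (simp add: image_image permutes_inverses(2)[OF p])
 then show ?thesis unfolding column_stabilizer_iff col using c p permutes_inv[OF p] by (simp add: permutes_compose column_stabilizer_iff)
qed

lemma tact_polytabloid:
 assumes N: "finite N" and p: "p permutes N"
 shows "tact p (polytabloid lam N t) = polytabloid lam N (p o t)" proof -
 let ?C = "column_stabilizer lam N t" and ?h = "%c. p o c o inv' p"
 note oi = permutes_o_inv[OF p] and ip = permutes_inv[OF p]
 have perm: "permutation q" if "q permutes N" for q using that N permutation_permutes by blast
 have rows: "rows_tabloid lam (p o t) = perm_tabloid p (rows_tabloid lam t)" by (simp add: rows_tabloid_def perm_tabloid_def image_comp)
 have back_in: "inv' p o c o p : ?C" if "c : column_stabilizer lam N (p o t)" for c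
  using column_stabilizer_conj[OF ip that] by (simp add: inv_inv_eq[OF permutes_bij[OF p]] comp_assoc[symmetric] oi)
 have b: "bij_betw ?h ?C (column_stabilizer lam N (p o t))" by (rule bij_betw_byWitness[where f' = "%c. inv' p o c o p"])
   (auto simp: fun_eq_iff permutes_inverses[OF p] intro: column_stabilizer_conj[OF p] back_in)
 have "polytabloid lam N (p o t) =
   (SUM c:?C. cscale (of_int (sign (?h c))) (basis_vec (perm_tabloid (?h c) (rows_tabloid lam (p o t)))))"
  unfolding polytabloid_def by (rule sum.reindex_bij_betw[OF b, symmetric])
 also have "... = (SUM c:?C. cscale (of_int (sign c)) (basis_vec (perm_tabloid p (perm_tabloid c (rows_tabloid lam t)))))"
 proof (rule sum.cong[OF refl])
  fix c assume "c : ?C"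
  then have cN: "c permutes N" by (rule column_stabilizerD)
  have "sign (?h c) = sign p * sign c * sign (inv' p)" by (simp add: sign_compose perm permutes_compose p ip cN)
  then have "sign (?h c) = sign c" using sign_inverse[OF perm[OF p]] by simp
  then show "cscale (of_int (sign (?h c))) (basis_vec (perm_tabloid (?h c) (rows_tabloid lam (p o t)))) =
   cscale (of_int (sign c)) (basis_vec (perm_tabloid p (perm_tabloid c (rows_tabloid lam t))))"
   by (simp add: rows perm_tabloid_comp permutes_bij[OF p])
 qed
 also have "... = tact p (polytabloid lam N t)" unfolding polytabloid_def clin_lincomb[OF clin_tact] tact_basis[OF permutes_bij[OF p]] ..
 finally show ?thesis ..
qed

lemma comp_tableaux: "p permutes N ==> t : tableaux lam N ==> p o t : tableaux lam N"
 unfolding tableaux_def mem_Collect_eq by (rule bij_betw_trans[OF _ permutes_imp_bij])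

lemma tact_specht:
 assumes "finite N" "p permutes N" "f : specht lam N"
 shows "tact p f : specht lam N" using assms(3) unfolding specht_def by (rule span_induct_lin[OF _ _ clin_tact subspace_cspan])
   (auto simp: tact_polytabloid[OF assms(1,2)] intro!: cspan_base comp_tableaux assms(2))

lemma specht_cyclic:
 assumes N: "finite N" and t: "t : tableaux lam N"
 shows "specht lam N = cspan {tact p (polytabloid lam N t) | p. p permutes N}" proof
 show "cspan {tact p (polytabloid lam N t) | p. p permutes N} <= specht lam N" by (rule cspan_minimal[OF _ subspace_specht])
   (auto intro: tact_specht[OF N] polytabloid_in_specht[OF t])
 have bij: "bij_betw t (cells lam) N" using t by (simp add: tableaux_def)
 show "specht lam N <= cspan {tact p (polytabloid lam N t) | p. p permutes N}" unfolding specht_def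
 proof (rule cspan_minimal[OF _ subspace_cspan], rule image_subsetI)
  fix s assume "s : tableaux lam N"
  then have bs: "bij_betw s (cells lam) N" by (simp add: tableaux_def)
  obtain p where p: "p permutes N" "!!c. c : cells lam ==> p (t c) = s c" by (rule bij_betw_permutes[OF bij bs]) blast
  have "polytabloid lam N s = polytabloid lam N (p o t)" by (rule polytabloid_cong) (simp add: p(2))
  also have "... = tact p (polytabloid lam N t)" by (rule tact_polytabloid[OF N p(1), symmetric])
  finally show "polytabloid lam N s : cspan {tact p (polytabloid lam N t) | p. p permutes N}" using p(1) by (auto intro: cspan_base)
 qed
qed

lemma stabilizers_trivial:
 assumes t: "t : tableaux lam N" and p: "p : column_stabilizer lam N t"
  and fix': "perm_tabloid p (rows_tabloid lam t) = rows_tabloid lam t"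
 shows "p = id" proof
 fix x
 show "p x = id x" proof (cases "x : N")
  case True
  have bij: "bij_betw t (cells lam) N" using t by (simp add: tableaux_def)
  then obtain c where c: "c : cells lam" "x = t c" using True by (auto simp: bij_betw_def)
  have "p x : p ` column lam t (snd c)" using c by (auto simp: column_def)
  then have "p x : column lam t (snd c)" using p by (simp add: column_stabilizer_iff)
  then obtain c1 where c1: "c1 : cells lam" "snd c1 = snd c" "p x = t c1" by (auto simp: column_def)
  have "p x : perm_tabloid p (rows_tabloid lam t) (fst c)" using c by (auto simp: perm_tabloid_def rows_tabloid_def)
  then have "p x : rows_tabloid lam t (fst c)" by (simp add: fix')
  then obtain c2 where c2: "c2 : cells lam" "fst c2 = fst c" "p x = t c2" by (auto simp: rows_tabloid_def)
  have "c1 = c2" using c1 c2 bij by (auto simp: bij_betw_def dest: inj_onD)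
  then have "c1 = c" using c1 c2 by (simp add: prod_eq_iff)
  then show ?thesis using c1 c by simp
 next
  case False
  then show ?thesis using column_stabilizerD[OF p] by (simp add: permutes_not_in)
 qed
qed

lemma polytabloid_diag:
 assumes N: "finite N" and t: "t : tableaux lam N"
 shows "polytabloid lam N t (rows_tabloid lam t) = 1" proof -
 let ?C = "column_stabilizer lam N t"
 have "polytabloid lam N t (rows_tabloid lam t) =
   (SUM p:?C. of_int (sign p) * (if rows_tabloid lam t = perm_tabloid p (rows_tabloid lam t) then 1 else 0))"
  by (simp add: polytabloid_def sum_apply cscale_apply basis_vec_def)
 also have "... = (SUM p:?C. if p = id then 1 else 0)"
  by (rule sum.cong) (use stabilizers_trivial[OF t] in \<open>auto simp: sign_id\<close>)
 also have "... = 1" using finite_stabilizers(1)[OF N] column_stabilizer_id by simp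
 finally show ?thesis .
qed

section \<open>The invariant bilinear form\<close>

text \<open>Row and column symmetrizers are self-adjoint for this bilinear form; together with complex
conjugation it shows that no nonzero vector of a Specht module is killed by all of them.\<close>
definition form :: "'x set => ('x => complex) => ('x => complex) => complex" where
 "form X f h = (SUM x:X. f x * h x)"

lemma form_commute: "form X f h = form X h f" by (simp add: form_def mult.commute)

lemma form_sum_left: "form X (SUM i:I. cscale (c i) (f i)) h = (SUM i:I. c i * form X (f i) h)" proof -
 have "form X (SUM i:I. cscale (c i) (f i)) h = (SUM x:X. SUM i:I. c i * (f i x * h x))"
  by (simp add: form_def sum_apply cscale_apply sum_distrib_right mult.assoc)
 also have "... = (SUM i:I. SUM x:X. c i * (f i x * h x))" by (rule sum.swap)
 finally show ?thesis by (simp add: form_def sum_distrib_left)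
qed

lemma form_sum_right: "form X h (SUM i:I. cscale (c i) (f i)) = (SUM i:I. c i * form X h (f i))"
 using form_sum_left[of X c f I h] by (simp add: form_commute)

lemma form_scale_right: "form X h (cscale c f) = c * form X h f" by (simp add: form_def cscale_def sum_distrib_left algebra_simps)

lemma form_scale_left: "form X (cscale c f) h = c * form X f h" by (simp add: form_def cscale_def sum_distrib_left algebra_simps)

lemma form_tact:
 assumes "p permutes N"
 shows "form (tabloids \<mu> N) (tact p f) h = form (tabloids \<mu> N) f (tact (inv' p) h)" unfolding form_def
proof (rule sum.reindex_bij_witness[of _ "perm_tabloid p" "perm_tabloid (inv' p)"])
 note b = permutes_bij[OF assms]
 fix R assume R: "R : tabloids \<mu> N"
 show "perm_tabloid p (perm_tabloid (inv' p) R) = R" "perm_tabloid (inv' p) (perm_tabloid p R) = R" using b by simp_all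
 show "perm_tabloid (inv' p) R : tabloids \<mu> N" "perm_tabloid p R : tabloids \<mu> N"
  using perm_tabloid_tabloids[OF permutes_inv[OF assms] R] perm_tabloid_tabloids[OF assms R] .
 show "f (perm_tabloid (inv' p) R) * tact (inv' p) h (perm_tabloid (inv' p) R) = tact p f R * h R"
  using b by (simp add: tact_def inv_inv_eq)
qed

lemma form_wsum:
 assumes G: "sign_character N w G"
 shows "form (tabloids \<mu> N) (wsum w G f) h = form (tabloids \<mu> N) f (wsum w G h)" proof -
 let ?X = "tabloids \<mu> N"
 have b: "bij_betw inv' G G" by (rule bij_betw_byWitness[where f' = "inv'"])
   (auto simp: inv_inv_eq permutes_bij[OF character_permutes[OF G]] intro: character_inv[OF G])
 have "form ?X (wsum w G f) h = (SUM p:G. of_int (w p) * form ?X (tact p f) h)" unfolding wsum_def by (rule form_sum_left)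
 also have "... = (SUM p:G. of_int (w (inv' p)) * form ?X f (tact (inv' p) h))"
  by (rule sum.cong) (simp_all add: form_tact[OF character_permutes[OF G]] character_inv[OF G])
 also have "... = form ?X f (wsum w G h)" unfolding wsum_def form_sum_right by (rule sum.reindex_bij_betw[OF b])
 finally show ?thesis .
qed

lemmas form_column_sym = form_wsum[OF column_character, folded column_sym_def]
 and form_row_sym = form_wsum[OF row_character, folded row_sym_def]

lemma form_basis:
 assumes "finite X" "x : X"
 shows "form X f (basis_vec x) = f x" proof -
 have "form X f (basis_vec x) = (SUM y:X. if y = x then f x else 0)" unfolding form_def by (rule sum.cong) (auto simp: basis_vec_def)
 then show ?thesis using assms by simp
qed

definition conj_vec :: "('x => complex) => 'x => complex" where
 "conj_vec f = (%x. cnj (f x))"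

lemma form_conj_zero:
 assumes "finite X" "f : free X" "form X f (conj_vec f) = 0"
 shows "f = 0" proof
 fix x
 have "(SUM x:X. complex_of_real ((cmod (f x))\<^sup>2)) = 0" using assms(3) by (simp only: form_def conj_vec_def complex_norm_square)
 then have "(SUM x:X. (cmod (f x))\<^sup>2) = 0" by (metis of_real_sum of_real_eq_0_iff)
 then have "x : X ==> f x = 0" using assms(1) by (simp add: sum_nonneg_eq_0_iff)
 then show "f x = 0 x" using assms(2) by (cases "x : X") (auto simp: free_def)
qed

lemma conj_tact: "conj_vec (tact p f) = tact p (conj_vec f)" by (simp add: conj_vec_def tact_def)

lemma conj_sum: "conj_vec (SUM i:I. cscale (c i) (f i)) = (SUM i:I. cscale (cnj (c i)) (conj_vec (f i)))"
 by (rule ext) (simp add: conj_vec_def sum_apply cscale_apply)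

lemma conj_polytabloid: "conj_vec (polytabloid lam N t) = polytabloid lam N t" proof -
 have b: "conj_vec (basis_vec R) = basis_vec R" for R :: tabloid by (auto simp: conj_vec_def basis_vec_def)
 show ?thesis unfolding polytabloid_def conj_sum b by simp
qed

lemma conj_row_sym: "conj_vec (row_sym lam N t f) = row_sym lam N t (conj_vec f)" unfolding row_sym_def wsum_def conj_sum conj_tact by simp

lemma conj_specht:
 assumes "f : specht lam N"
 shows "conj_vec f : specht lam N" proof -
 have "conj_vec f : cspan (polytabloid lam N ` tableaux lam N)" using assms unfolding specht_def cspan_def
 proof (induction rule: cs.span_induct_alt)
  case base
  have "conj_vec (0::tabloid => complex) = 0" by (auto simp: conj_vec_def fun_eq_iff)
  then show ?case using cs.span_zero by metis
 next
  case (step c x y)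
  have "conj_vec (cscale c x + y) = cscale (cnj c) x + conj_vec y"
   using step(1) conj_polytabloid by (auto simp: conj_vec_def cscale_def fun_eq_iff)
  then show ?case using step by (metis cs.span_add cs.span_scale cs.span_base)
 qed
 then show ?thesis by (simp add: specht_def)
qed

lemma row_sym_row_sym:
 "row_sym lam N t (row_sym lam N t f) = cscale (of_nat (card (row_stabilizer lam N t))) (row_sym lam N t f)" proof -
 have "row_sym lam N t (row_sym lam N t f) = (SUM p:row_stabilizer lam N t. row_sym lam N t (tact p f))"
  by (subst (2) row_sym_eq) (rule clin_sum[OF clin_row_sym])
 also have "... = (SUM p:row_stabilizer lam N t. row_sym lam N t f)" by (rule sum.cong) (simp_all add: row_sym_tact)
 finally show ?thesis by (simp add: fun_eq_iff cscale_def sum_apply)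
qed

lemma row_sym_polytabloid_diag:
 assumes N: "finite N" and t: "t : tableaux lam N"
 shows "row_sym lam N t (polytabloid lam N t) (rows_tabloid lam t) = of_nat (card (row_stabilizer lam N t))" proof -
 let ?R = "rows_tabloid lam t"
 have "tact p (polytabloid lam N t) ?R = 1" if p: "p : row_stabilizer lam N t" for p
  using row_stabilizer_inv[OF p] polytabloid_diag[OF N t] by (simp add: tact_def row_stabilizer_def)
 then show ?thesis by (simp add: row_sym_eq sum_apply)
qed

lemma card_row_stabilizer_pos:
 assumes "finite N"
 shows "card (row_stabilizer lam N t) > 0" using finite_stabilizers(2)[OF assms, of lam t] row_stabilizer_id[of lam N t]
 unfolding card_gt_0_iff by blast

text \<open>
  The Young symmetrizer does not vanish on the generator of its Specht module: the coefficient is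
  the squared norm of a real non-zero vector.
\<close>

lemma young_sym_polytabloid:
 assumes N: "finite N" and lam: "lam : partitions n" and t: "t : tableaux lam N"
 obtains z where "z ~= 0" "young_sym lam N t (polytabloid lam N t) = cscale z (polytabloid lam N t)" proof -
 let ?e = "polytabloid lam N t" and ?X = "tabloids lam N" and ?R = "rows_tabloid lam t"
 let ?r = "row_sym lam N t" and ?m = "of_nat (card (row_stabilizer lam N t)) :: complex"
 have m: "?m ~= 0" using card_row_stabilizer_pos[OF N, of lam t] by simp
 have fin: "finite ?X" by (rule finite_tabloids[OF N])
 have R: "?R : ?X" by (rule rows_tabloid_in[OF t])
 have e: "?e : free ?X" using specht_subset_free[OF N] polytabloid_in_specht[OF t] by blast
 obtain z where z: "young_sym lam N t ?e = cscale z ?e" using young_sym_line[OF N lam t e] by blast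
 have "z = young_sym lam N t ?e ?R" using polytabloid_diag[OF N t] by (simp add: z cscale_apply)
 also have "... = form ?X (column_sym lam N t (?r ?e)) (basis_vec ?R)" unfolding young_sym_def by (rule form_basis[OF fin R, symmetric])
 also have "... = form ?X (?r ?e) ?e" unfolding form_column_sym[OF N] polytabloid_eq ..
 finally have z1: "z = form ?X (?r ?e) ?e" .
 have "z ~= 0" proof
  assume "z = 0"
  then have "?m * form ?X (?r ?e) ?e = 0" using z1 by simp
  then have "form ?X (?r (?r ?e)) ?e = 0" unfolding row_sym_row_sym form_scale_left .
  then have "form ?X (?r ?e) (conj_vec (?r ?e)) = 0" unfolding form_row_sym[where f = "?r ?e"] conj_row_sym conj_polytabloid .
  then have "?r ?e = 0" by (rule form_conj_zero[OF fin row_sym_free[OF e]])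
  then show False using row_sym_polytabloid_diag[OF N t] m by simp
 qed
 then show ?thesis using z that by blast
qed

theorem young_sym_detects:
 assumes N: "finite N" and lam: "lam : partitions n" and t: "t : tableaux lam N"
  and s: "s : specht lam N" "s ~= 0"
 shows "EX p. p permutes N & young_sym lam N t (tact p s) ~= 0" proof (rule ccontr)
 assume "~ ?thesis"
 then have zero: "young_sym lam N t (tact p s) = 0" if "p permutes N" for p using that by blast
 let ?e = "polytabloid lam N t" and ?X = "tabloids lam N" and ?R = "rows_tabloid lam t"
 let ?r = "row_sym lam N t" and ?k = "column_sym lam N t"
 have fin: "finite ?X" by (rule finite_tabloids[OF N])
 have R: "?R : ?X" by (rule rows_tabloid_in[OF t])
 have sX: "s : free ?X" using s specht_subset_free[OF N] by blast
 have 1: "form ?X s (tact p (?r ?e)) = 0" if p: "p permutes N" for p proof -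
  have ip: "inv' p permutes N" by (rule permutes_inv[OF p])
  have "0 = form ?X (young_sym lam N t (tact (inv' p) s)) (basis_vec ?R)" by (simp add: zero[OF ip] form_def)
  also have "... = form ?X (tact (inv' p) s) (?r ?e)" unfolding young_sym_def form_column_sym[OF N] form_row_sym polytabloid_eq ..
  also have "... = form ?X s (tact p (?r ?e))" unfolding form_tact[OF ip] by (simp add: inv_inv_eq[OF permutes_bij[OF p]])
  finally show ?thesis by simp
 qed
 obtain z where z: "z ~= 0" "young_sym lam N t ?e = cscale z ?e" by (rule young_sym_polytabloid[OF N lam t])
 have 2: "form ?X s (tact p ?e) = 0" if p: "p permutes N" for p proof -
  have "z * form ?X s (tact p ?e) = form ?X s (tact p (?k (?r ?e)))"
   using z(2) by (simp add: young_sym_def clin_scale[OF clin_tact] form_scale_right)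
  also have "tact p (?k (?r ?e)) = (SUM c:column_stabilizer lam N t. cscale (of_int (sign c)) (tact (p o c) (?r ?e)))"
   unfolding column_sym_eq clin_lincomb[OF clin_tact]
   by (intro sum.cong refl arg_cong2[where f = cscale] tact_comp[symmetric] permutes_bij[OF p]
   permutes_bij[OF column_stabilizerD])
  also have "form ?X s ... = 0" unfolding form_sum_right by (rule sum.neutral) (auto simp: 1 permutes_compose[OF column_stabilizerD p])
  finally show ?thesis using z(1) by simp
 qed
 have "form ?X s h = 0" if "h : specht lam N" for h using that unfolding specht_cyclic[OF N t] cspan_def
 proof (induction rule: cs.span_induct_alt)
  case base
  then show ?case by (simp add: form_def)
 next
  case (step c x y)
  have "form ?X s (cscale c x + y) = c * form ?X s x + form ?X s y"
   by (simp add: form_def cscale_def algebra_simps sum.distrib sum_distrib_left)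
  moreover have "form ?X s x = 0" using step(1) 2 by blast
  ultimately have "form ?X s (cscale c x + y) = 0" using step(2) by (simp only: mult_zero_right add_0)
  then show ?case .
 qed
 from this[OF conj_specht[OF s(1)]] have "s = 0" by (rule form_conj_zero[OF fin sX])
 then show False using s(2) by simp
qed


section \<open>Rearrangement and triangularity\<close>

lemma sum_le_sum_upset:
 fixes pos :: "'a => nat"
 assumes A: "finite A" and B: "B <= A" and C: "C <= A" and card: "card B = card C"
  and up: "!!x y. x : B ==> y : A - B ==> pos y < pos x"
 shows "sum pos C <= sum pos B" and "sum pos C = sum pos B ==> B = C" proof -
 have fin: "finite B" "finite C" using A B C finite_subset by blast+
 have "card (B - C) = card (C - B)" using card fin card_Diff_subset_Int[of B C] card_Diff_subset_Int[of C B] by (simp add: Int_commute)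
 then obtain h where h: "bij_betw h (B - C) (C - B)" using finite_same_card_bij fin by (metis finite_Diff)
 have lt: "pos (h x) < pos x" if "x : B - C" for x using that h C by (intro up) (auto simp: bij_betw_def)
 have eqC: "sum pos C = sum pos (C \<inter> B) + (SUM x:B - C. pos (h x))"
  using sum.Int_Diff[OF fin(2), of pos B] sum.reindex_bij_betw[OF h, of pos] by simp
 have eqB: "sum pos B = sum pos (C \<inter> B) + (SUM x:B - C. pos x)" using sum.Int_Diff[OF fin(1), of pos C] by (simp add: Int_commute)
 have "(SUM x:B - C. pos (h x)) <= (SUM x:B - C. pos x)" by (rule sum_mono) (use lt in force)
 then show "sum pos C <= sum pos B" using eqB eqC by simp
 show "B = C" if "sum pos C = sum pos B" proof -
  have "B - C = {}" proof (rule ccontr)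
   assume "B - C ~= {}"
   then have "(SUM x:B - C. pos (h x)) < (SUM x:B - C. pos x)" using fin lt by (intro sum_strict_mono) auto
   then show False using that eqB eqC by simp
  qed
  then show ?thesis using card_subset_eq[OF fin(2), of B] card by auto
 qed
qed

lemma rearrangement:
 fixes pos val :: "'a => nat"
 assumes A: "finite A" and inj: "inj_on pos A"
  and mono: "!!x y. x : A ==> y : A ==> pos x < pos y ==> val x <= val y"
  and \<pi>: "bij_betw \<pi> A A"
 shows "(SUM x:A. pos x * val (\<pi> x)) <= (SUM x:A. pos x * val x)"
  and "(SUM x:A. pos x * val (\<pi> x)) = (SUM x:A. pos x * val x) ==> x : A ==> val (\<pi> x) = val x" proof -
 define M where "M = Max (insert 0 (val ` A))"
 have M: "val x <= M" if "x : A" for x using A that by (simp add: M_def)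
 let ?B = "%j. {x : A. j < val x}" and ?C = "%j. {x : A. j < val (\<pi> x)}"
 have \<pi>A: "\<pi> x : A" if "x : A" for x using \<pi> that by (auto simp: bij_betw_def)
 have layer: "(SUM x:A. pos x * f x) = (\<Sum>j<M. sum pos {x : A. j < f x})" if "!!x. x : A ==> f x <= M" for f proof -
  have "pos x * f x = (\<Sum>j<M. if j < f x then pos x else 0)" if "x : A" for x proof -
   have "(\<Sum>j<M. if j < f x then pos x else 0) = (SUM j:{..<f x}. pos x)"
   using `!!x. x : A ==> f x <= M`[OF that] by (intro sum.mono_neutral_cong_right) auto
   then show ?thesis by simp
  qed
  then have "(SUM x:A. pos x * f x) = (SUM x:A. \<Sum>j<M. if j < f x then pos x else 0)" by simp
  also have "... = (\<Sum>j<M. SUM x:A. if j < f x then pos x else 0)" by (rule sum.swap)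
  also have "... = (\<Sum>j<M. sum pos {x : A. j < f x})" by (rule sum.cong) (simp_all add: sum.inter_filter[OF A])
  finally show ?thesis .
 qed
 have cardBC: "card (?B j) = card (?C j)" for j proof -
  have im: "\<pi> ` ?C j = ?B j" proof (intro equalityI subsetI)
   fix x assume x: "x : ?B j"
   then have "x : \<pi> ` A" using \<pi> by (simp add: bij_betw_def)
   then show "x : \<pi> ` ?C j" using x by auto
  qed (use \<pi>A in auto)
  have "inj_on \<pi> (?C j)" using \<pi> by (auto simp: bij_betw_def intro: inj_on_subset)
  then have "bij_betw \<pi> (?C j) (?B j)" using im unfolding bij_betw_def by blast
  from bij_betw_same_card[OF this] show ?thesis by simp
 qed
 have up: "pos y < pos x" if "x : ?B j" "y : A - ?B j" for x y j proof (rule ccontr)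
  assume "~ pos y < pos x"
  then consider "pos x < pos y" | "pos x = pos y" by linarith
  then show False proof cases
   case 1
   then show ?thesis using mono[of x y] that by auto
  next
   case 2
   then have "x = y" using inj that by (auto dest: inj_onD)
   then show ?thesis using that by simp
  qed
 qed
 have le: "sum pos (?C j) <= sum pos (?B j)" for j by (rule sum_le_sum_upset(1)[OF A _ _ cardBC up]) auto
 have eq: "(SUM x:A. pos x * val (\<pi> x)) = (\<Sum>j<M. sum pos (?C j))"
  "(SUM x:A. pos x * val x) = (\<Sum>j<M. sum pos (?B j))" by (rule layer, simp add: M \<pi>A)+
 show "(SUM x:A. pos x * val (\<pi> x)) <= (SUM x:A. pos x * val x)" unfolding eq by (rule sum_mono) (rule le)
 show "val (\<pi> x) = val x" if e: "(SUM x:A. pos x * val (\<pi> x)) = (SUM x:A. pos x * val x)" and x: "x : A" proof -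
  have "?B j = ?C j" if j: "j < M" for j proof (rule sum_le_sum_upset(2)[OF A _ _ cardBC up])
   show "sum pos (?C j) = sum pos (?B j)" proof (rule ccontr)
   assume "sum pos (?C j) ~= sum pos (?B j)"
   then have lt: "sum pos (?C j) < sum pos (?B j)" using le[of j] by linarith
   have "(\<Sum>j<M. sum pos (?C j)) < (\<Sum>j<M. sum pos (?B j))" by (rule sum_strict_mono_ex1) (use le j lt in blast)+
   then show False using e eq by simp
   qed
  qed auto
  then have *: "j < val x \<longleftrightarrow> j < val (\<pi> x)" if "j < M" for j using that x by blast
  show ?thesis proof (rule linorder_cases[of "val (\<pi> x)" "val x"])
   assume "val (\<pi> x) < val x"
   then show ?thesis using *[of "val (\<pi> x)"] M[OF x] by simp
  next
   assume "val x < val (\<pi> x)"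
   then show ?thesis using *[of "val x"] M[OF \<pi>A[OF x]] by simp
  qed
 qed
qed

definition monotone_in_classes :: "'a set => ('a => nat) => ('a => nat) => ('a => nat) => bool" where
 "monotone_in_classes D cls pos val \<longleftrightarrow>
   (ALL x:D. ALL y:D. cls x = cls y & pos x < pos y --> val x <= val y)"

text \<open>Reduction to one class: the keys combine the class number with the position and with the value,
and the resulting cross terms do not depend on the permutation.\<close>
lemma rearrangement_classes:
 fixes pos val cls :: "'a => nat"
 assumes D: "finite D" and inj: "!!x y. x : D ==> y : D ==> cls x = cls y ==> pos x = pos y ==> x = y"
  and mono: "monotone_in_classes D cls pos val"
  and \<pi>: "bij_betw \<pi> D D" "!!x. x : D ==> cls (\<pi> x) = cls x"
 shows "(SUM x:D. pos x * val (\<pi> x)) <= (SUM x:D. pos x * val x)"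
  and "(SUM x:D. pos x * val (\<pi> x)) = (SUM x:D. pos x * val x) ==> x : D ==> val (\<pi> x) = val x" proof -
 obtain P where P: "!!x. x : D ==> pos x < P" using finite_nat_set_iff_bounded[of "pos ` D"] D by auto
 obtain Q where Q: "!!x. x : D ==> val x < Q" using finite_nat_set_iff_bounded[of "val ` D"] D by auto
 define p where "p x = cls x * P + pos x" for x
 define v where "v x = cls x * Q + val x" for x
 have lt: "cls x * B + f x < cls y * B + f y" if "cls x < cls y" "f x < B" for x y B and f :: "'a => nat"
  using mult_le_mono1[of "Suc (cls x)" "cls y" B] that by simp
 have "inj_on p D" proof (rule inj_onI)
  fix x y assume xy: "x : D" "y : D" "p x = p y"
  then have "cls x = cls y" using lt[of x y pos P] lt[of y x pos P] P unfolding p_def by (metis less_irrefl linorder_neqE_nat)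
  then show "x = y" using xy inj by (simp add: p_def)
 qed
 moreover have "v x <= v y" if xy: "x : D" "y : D" "p x < p y" for x y proof (cases "cls x = cls y")
  case True
  then show ?thesis using xy mono by (simp add: p_def v_def monotone_in_classes_def)
 next
  case False
  then have "cls x < cls y" using lt[of y x pos P] P[OF xy(2)] xy(3) unfolding p_def by (metis less_asym linorder_neqE_nat)
  then show ?thesis using lt[of x y val Q] Q[OF xy(1)] by (simp add: v_def)
 qed
 ultimately have R: "(SUM x:D. p x * v (\<pi> x)) <= (SUM x:D. p x * v x)"
  "(SUM x:D. p x * v (\<pi> x)) = (SUM x:D. p x * v x) ==> x : D ==> v (\<pi> x) = v x" for x
  using rearrangement[OF D, of p v, OF _ _ \<pi>(1)] by blast+
 have "(SUM x:D. p x * v (\<pi> x)) = (SUM x:D. p x * (cls x * Q)) + P * (SUM x:D. cls x * val (\<pi> x)) + (SUM x:D. pos x * val (\<pi> x))"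
  unfolding sum_distrib_left sum.distrib[symmetric] by (rule sum.cong) (simp_all add: p_def v_def \<pi>(2) algebra_simps)
 also have "(SUM x:D. cls x * val (\<pi> x)) = (SUM x:D. cls (\<pi> x) * val (\<pi> x))" by (rule sum.cong) (simp_all add: \<pi>(2))
 also have "... = (SUM x:D. cls x * val x)" by (rule sum.reindex_bij_betw[OF \<pi>(1)])
 finally have E: "(SUM x:D. p x * v (\<pi> x)) =
  (SUM x:D. p x * (cls x * Q)) + P * (SUM x:D. cls x * val x) + (SUM x:D. pos x * val (\<pi> x))" .
 have E': "(SUM x:D. p x * v x) = (SUM x:D. p x * (cls x * Q)) + P * (SUM x:D. cls x * val x) + (SUM x:D. pos x * val x)"
  unfolding sum_distrib_left sum.distrib[symmetric] by (rule sum.cong) (simp_all add: p_def v_def algebra_simps)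
 show "(SUM x:D. pos x * val (\<pi> x)) <= (SUM x:D. pos x * val x)" using R(1) unfolding E E' by simp
 show "val (\<pi> x) = val x" if "(SUM x:D. pos x * val (\<pi> x)) = (SUM x:D. pos x * val x)" "x : D"
  using R(2)[OF _ that(2)] \<pi>(2)[OF that(2)] that(1) unfolding E E' by (simp add: v_def)
qed

lemma sorted_unique:
 fixes pos val val' cls :: "'a => nat"
 assumes D: "finite D" and inj: "!!x y. x : D ==> y : D ==> cls x = cls y ==> pos x = pos y ==> x = y"
  and mono: "monotone_in_classes D cls pos val" "monotone_in_classes D cls pos val'"
  and \<pi>: "bij_betw \<pi> D D" "!!x. x : D ==> cls (\<pi> x) = cls x"
  and eq: "!!x. x : D ==> val (\<pi> x) = val' x" and x: "x : D"
 shows "val x = val' x" proof -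
 let ?\<rho> = "inv_into D \<pi>"
 have \<rho>: "bij_betw ?\<rho> D D" by (rule bij_betw_inv_into[OF \<pi>(1)])
 have r: "?\<rho> x : D" "\<pi> (?\<rho> x) = x" if "x : D" for x
  using that \<pi>(1) by (auto simp: bij_betw_def inv_into_into f_inv_into_f)
 have "(SUM x:D. pos x * val' x) = (SUM x:D. pos x * val (\<pi> x))" by (rule sum.cong) (simp_all add: eq)
 moreover have "(SUM x:D. pos x * val (\<pi> x)) <= (SUM x:D. pos x * val x)" by (rule rearrangement_classes(1)[OF D inj mono(1) \<pi>])
 moreover have "(SUM x:D. pos x * val x) = (SUM x:D. pos x * val' (?\<rho> x))" by (rule sum.cong) (use eq r in metis)+
 moreover have "(SUM x:D. pos x * val' (?\<rho> x)) <= (SUM x:D. pos x * val' x)"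
  by (rule rearrangement_classes(1)[OF D inj mono(2) \<rho>]) (use \<pi>(2) r in metis)+
 ultimately have "(SUM x:D. pos x * val (\<pi> x)) = (SUM x:D. pos x * val x)" by linarith
 from rearrangement_classes(2)[OF D inj mono(1) \<pi> this x] eq[OF x] show ?thesis by (rule trans[OF sym])
qed

lemma triangular_independent:
 fixes v :: "'a => 'x => complex" and wt :: "'a => nat"
 assumes T: "finite T" and diag: "!!a. a : T ==> v a (pt a) ~= 0"
  and tri: "!!a b. a : T ==> b : T ==> a ~= b ==> v a (pt b) ~= 0 ==> wt b < wt a"
  and zero: "(SUM a:T. cscale (k a) (v a)) = 0" and a: "a : T"
 shows "k a = 0" proof (rule ccontr)
 assume "k a ~= 0"
 define S where "S = {a : T. k a ~= 0}"
 have S: "finite S" "S ~= {}" using T a `k a ~= 0` by (auto simp: S_def)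
 have "Max (wt ` S) : wt ` S" using S by (intro Max_in) auto
 then obtain b where bM: "b : S" "wt b = Max (wt ` S)" by auto
 then have b: "b : S" "!!c. c : S ==> wt c <= wt b" using S by simp_all
 have bT: "b : T" "k b ~= 0" using b(1) by (auto simp: S_def)
 have "0 = (SUM a:T. k a * v a (pt b))" using fun_cong[OF zero, of "pt b"] by (simp add: sum_apply cscale_apply)
 also have "... = (SUM a:T. if a = b then k b * v b (pt b) else 0)" proof (rule sum.cong[OF refl])
  fix c assume c: "c : T"
  show "k c * v c (pt b) = (if c = b then k b * v b (pt b) else 0)" using tri[OF c bT(1)] b(2)[of c] c by (force simp: S_def)
 qed
 also have "... = k b * v b (pt b)" using T bT by simp
 finally show False using bT diag by simp
qed

section \<open>The maps attached to semistandard tableaux\<close>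

lemma cell_inj: "fst c = fst c' ==> snd c = snd c' ==> c = (c' :: cell)" by (rule prod_eqI)

lemma semistandard_rows:
 assumes "\<tau> : semistandard lam \<mu>"
 shows "monotone_in_classes (cells lam) fst snd \<tau>"
 using assms unfolding monotone_in_classes_def semistandard_def by (auto simp: split_paired_all)

lemma semistandard_columns_strict:
 assumes "\<tau> : semistandard lam \<mu>" "x : cells lam" "y : cells lam" "snd x = snd y" "fst x < fst y"
 shows "\<tau> x < \<tau> y" proof -
 have "ALL a a' b. (a, b) : cells lam & (a', b) : cells lam & a < a' --> \<tau> (a, b) < \<tau> (a', b)"
  using assms(1) by (simp add: semistandard_def)
 then show ?thesis using assms(2-) by (metis prod.collapse)
qed

lemma semistandard_columns:
 assumes "\<tau> : semistandard lam \<mu>"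
 shows "monotone_in_classes (cells lam) snd fst \<tau>" unfolding monotone_in_classes_def
 by (intro ballI impI) (rule less_imp_le, rule semistandard_columns_strict[OF assms], auto)

lemma semistandard_ext: "\<tau> : semistandard lam \<mu> ==> \<tau> : extensional (cells lam)" by (auto simp: semistandard_def PiE_def)

lemma finite_semistandard: "finite (semistandard lam \<mu>)"
 by (rule finite_subset[of _ "cells lam \<rightarrow>\<^sub>E {1..length \<mu>}"])
   (auto simp: semistandard_def intro!: finite_PiE)

lemma row_equivalent_self:
 assumes "\<tau> : extensional (cells lam)"
 shows "\<tau> : row_equivalent lam \<tau>" unfolding row_equivalent_def mem_Collect_eq
 by (rule exI[of _ id]) (simp add: permutes_id extensional_restrict[OF assms])

lemma finite_row_equivalent: "finite (row_equivalent lam \<tau>)" proof -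
 have "row_equivalent lam \<tau> <= (%\<pi>. restrict (\<tau> o \<pi>) (cells lam)) ` {\<pi>. \<pi> permutes cells lam}"
  by (auto simp: row_equivalent_def)
 then show ?thesis using finite_permutations[OF finite_cells] finite_surj by blast
qed

lemma star_tabloid_mem:
 assumes "t : tableaux lam N" "c : cells lam"
 shows "t c : star_tabloid lam \<chi> t a \<longleftrightarrow> \<chi> c = a" proof -
 have "inj_on t (cells lam)" using assms(1) by (simp add: tableaux_def bij_betw_def)
 then show ?thesis using assms(2) unfolding star_tabloid_def inj_on_def by blast
qed

lemma star_tabloid_perm: "star_tabloid lam \<chi> (p o t) = perm_tabloid p (star_tabloid lam \<chi> t)"
 by (auto simp: star_tabloid_def perm_tabloid_def)

lemma tableaux_relabel:
 assumes t: "t : tableaux lam N" and t': "t' : tableaux lam N"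
 obtains \<pi> where "\<pi> permutes cells lam" "!!c. c : cells lam ==> t (\<pi> c) = t' c" proof -
 let ?D = "cells lam"
 have b: "bij_betw t ?D N" "bij_betw t' ?D N" using t t' by (auto simp: tableaux_def)
 obtain \<pi> where \<pi>: "\<pi> permutes ?D" "!!x. x : N ==> \<pi> (inv_into ?D t' x) = inv_into ?D t x"
  using bij_betw_permutes[OF bij_betw_inv_into[OF b(2)] bij_betw_inv_into[OF b(1)]] by blast
 have "t (\<pi> c) = t' c" if "c : ?D" for c proof -
  have "t' c : N" using that b by (auto simp: bij_betw_def)
  then show ?thesis using \<pi>(2)[of "t' c"] b that by (simp add: bij_betw_def f_inv_into_f)
 qed
 then show ?thesis by (rule that[OF \<pi>(1)])
qed

lemma tableau_on_tabloid_rows: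
 assumes t: "t : tableaux lam N"
 shows "tableau_on_tabloid lam N \<tau> (rows_tabloid lam t) =
  (SUM \<tau>':row_equivalent lam \<tau>. basis_vec (star_tabloid lam \<tau>' t))" proof -
 let ?D = "cells lam"
 define t' where "t' = (SOME t'. t' : tableaux lam N & rows_tabloid lam t' = rows_tabloid lam t)"
 have "EX t'. t' : tableaux lam N & rows_tabloid lam t' = rows_tabloid lam t" using t by blast
 from someI_ex[OF this] have t': "t' : tableaux lam N" "rows_tabloid lam t' = rows_tabloid lam t" unfolding t'_def by blast+
 obtain \<pi> where \<pi>: "\<pi> permutes ?D" "!!c. c : ?D ==> t' (\<pi> c) = t c" by (rule tableaux_relabel[OF t'(1) t]) blast
 have \<pi>D: "\<pi> c : ?D \<longleftrightarrow> c : ?D" for c by (rule permutes_in_image[OF \<pi>(1)])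
 have row: "fst (\<pi> c) = fst c" if c: "c : ?D" for c proof -
  have "fst (\<pi> c) = rowof (rows_tabloid lam t') (t' (\<pi> c))" using rowof_rows[OF t'(1), of "\<pi> c"] \<pi>D c by simp
  also have "... = fst c" using rowof_rows[OF t c] t'(2) \<pi>(2)[OF c] by simp
  finally show ?thesis .
 qed
 have i\<pi>: "inv' \<pi> permutes ?D" by (rule permutes_inv[OF \<pi>(1)])
 have irow: "fst (inv' \<pi> c) = fst c" if "c : ?D" for c
  using row[of "inv' \<pi> c"] that permutes_in_image[OF i\<pi>] permutes_inverses(1)[OF \<pi>(1)] by simp
 have "tableau_on_tabloid lam N \<tau> (rows_tabloid lam t) =
  (SUM \<tau>':row_equivalent lam \<tau>. basis_vec (star_tabloid lam \<tau>' t'))"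
  unfolding tableau_on_tabloid_def Let_def t'_def[symmetric] ..
 also have "... = (SUM \<tau>':row_equivalent lam \<tau>. basis_vec (star_tabloid lam \<tau>' t))"
 proof (rule sum.reindex_bij_witness[of _ "%\<tau>'. restrict (\<tau>' o inv' \<pi>) ?D" "%\<tau>'. restrict (\<tau>' o \<pi>) ?D"])
  have closed: "restrict (\<tau>' o \<rho>) ?D : row_equivalent lam \<tau>"
   if re: "\<tau>' : row_equivalent lam \<tau>" and "\<rho> permutes ?D" "!!c. c : ?D ==> fst (\<rho> c) = fst c" for \<tau>' \<rho> proof -
   obtain \<rho>' where r: "\<rho>' permutes ?D" "ALL c:?D. fst (\<rho>' c) = fst c" "\<tau>' = restrict (\<tau> o \<rho>') ?D"
   using re unfolding row_equivalent_def by blast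
   have "restrict (\<tau>' o \<rho>) ?D = restrict (\<tau> o (\<rho>' o \<rho>)) ?D"
   using permutes_in_image[OF that(2)] by (auto simp: r(3) restrict_def fun_eq_iff)
   moreover have "ALL c:?D. fst ((\<rho>' o \<rho>) c) = fst c" using r(2) that(3) permutes_in_image[OF that(2)] by auto
   ultimately show ?thesis using permutes_compose[OF that(2) r(1)] unfolding row_equivalent_def by blast
  qed
  fix \<tau>' assume \<tau>': "\<tau>' : row_equivalent lam \<tau>"
  then have ext: "\<tau>' : extensional ?D" by (auto simp: row_equivalent_def)
  show "restrict (\<tau>' o \<pi>) ?D : row_equivalent lam \<tau>" by (rule closed[OF \<tau>' \<pi>(1) row])
  show "restrict (\<tau>' o inv' \<pi>) ?D : row_equivalent lam \<tau>" by (rule closed[OF \<tau>' i\<pi> irow])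
  show "restrict (restrict (\<tau>' o \<pi>) ?D o inv' \<pi>) ?D = \<tau>'"
   using ext permutes_in_image[OF i\<pi>] permutes_inverses[OF \<pi>(1)] by (auto simp: fun_eq_iff restrict_def extensional_def)
  show "restrict (restrict (\<tau>' o inv' \<pi>) ?D o \<pi>) ?D = \<tau>'" using ext \<pi>D permutes_inverses[OF \<pi>(1)]
   by (auto simp: fun_eq_iff restrict_def extensional_def)
  have "star_tabloid lam (restrict (\<tau>' o \<pi>) ?D) t a = star_tabloid lam \<tau>' t' a" for a proof (intro equalityI subsetI)
   fix x assume "x : star_tabloid lam (restrict (\<tau>' o \<pi>) ?D) t a"
   then obtain c where c: "c : ?D" "\<tau>' (\<pi> c) = a" "x = t c" by (auto simp: star_tabloid_def)
   then have "x = t' (\<pi> c)" "\<pi> c : ?D" using \<pi>(2)[of c] \<pi>D[of c] by simp_all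
   then show "x : star_tabloid lam \<tau>' t' a" using c(2) unfolding star_tabloid_def by blast
  next
   fix x assume "x : star_tabloid lam \<tau>' t' a"
   then obtain c where c: "c : ?D" "\<tau>' c = a" "x = t' c" by (auto simp: star_tabloid_def)
   then have "inv' \<pi> c : ?D" "\<pi> (inv' \<pi> c) = c" using permutes_in_image[OF i\<pi>] permutes_inverses[OF \<pi>(1)] by auto
   moreover from this have "x = t (inv' \<pi> c)" "restrict (\<tau>' o \<pi>) ?D (inv' \<pi> c) = a"
   using c \<pi>(2)[of "inv' \<pi> c"] by simp_all
   ultimately show "x : star_tabloid lam (restrict (\<tau>' o \<pi>) ?D) t a" unfolding star_tabloid_def by blast
  qed
  then have "star_tabloid lam (restrict (\<tau>' o \<pi>) ?D) t = star_tabloid lam \<tau>' t'" by (rule HOL.ext)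
  then show "basis_vec (star_tabloid lam (restrict (\<tau>' o \<pi>) ?D) t) = basis_vec (star_tabloid lam \<tau>' t')" by (rule arg_cong)
 qed
 finally show ?thesis .
qed

definition tmap :: "nat list => nat set => (cell => nat) => (tabloid => complex) => (tabloid => complex)" where
 "tmap lam N \<tau> f = (SUM R:tabloids lam N. cscale (f R) (tableau_on_tabloid lam N \<tau> R))"

lemma clin_tmap: "clin (tmap lam N \<tau>)" proof (rule clinI)
 show "tmap lam N \<tau> (f + g) = tmap lam N \<tau> f + tmap lam N \<tau> g" for f g
  unfolding tmap_def by (simp only: plus_fun_apply cs.scale_left_distrib sum.distrib)
 show "tmap lam N \<tau> (cscale c f) = cscale c (tmap lam N \<tau> f)" for c f
  unfolding tmap_def by (simp only: cs.scale_sum_right cs.scale_scale cscale_apply)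
qed

lemma tableau_map_eq:
 assumes "finite N" "f : free (tabloids lam N)"
 shows "tableau_map lam N \<tau> f = tmap lam N \<tau> f"
 unfolding tableau_map_def tmap_def by (rule lin_ext_finite[OF assms(2) finite_tabloids[OF assms(1)]])

lemma tmap_basis:
 assumes "finite N" "R : tabloids lam N"
 shows "tmap lam N \<tau> (basis_vec R) = tableau_on_tabloid lam N \<tau> R" proof -
 have "tmap lam N \<tau> (basis_vec R) = (SUM R':tabloids lam N. if R' = R then tableau_on_tabloid lam N \<tau> R else 0)"
  unfolding tmap_def by (rule sum.cong) (auto simp: basis_vec_def)
 then show ?thesis using assms finite_tabloids by simp
qed

lemma tmap_tact:
 assumes N: "finite N" and p: "p permutes N" and f: "f : free (tabloids lam N)"
 shows "tmap lam N \<tau> (tact p f) = tact p (tmap lam N \<tau> f)" proof -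
 have "tmap lam N \<tau> (tact p f) - tact p (tmap lam N \<tau> f) : {0}"
 proof (rule free_induct_lin[OF f finite_tabloids[OF N] _ subspace_singleton_zero])
  show "clin (%f. tmap lam N \<tau> (tact p f) - tact p (tmap lam N \<tau> f))"
   by (rule clin_diff[OF clin_comp[OF clin_tmap clin_tact] clin_comp[OF clin_tact clin_tmap]])
  fix R assume R: "R : tabloids lam N"
  obtain t where t: "t : tableaux lam N" "rows_tabloid lam t = R" by (rule tabloid_eq_rows[OF R N])
  have b: "bij p" by (rule permutes_bij[OF p])
  have R': "perm_tabloid p R = rows_tabloid lam (p o t)" by (simp add: t(2)[symmetric] rows_tabloid_def perm_tabloid_def image_comp)
  have "tmap lam N \<tau> (tact p (basis_vec R)) = tableau_on_tabloid lam N \<tau> (perm_tabloid p R)"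
   using tact_basis[OF b] tmap_basis[OF N perm_tabloid_tabloids[OF p R]] by simp
  also have "... = (SUM \<tau>':row_equivalent lam \<tau>. basis_vec (perm_tabloid p (star_tabloid lam \<tau>' t)))"
   unfolding R' tableau_on_tabloid_rows[OF comp_tableaux[OF p t(1)]] star_tabloid_perm ..
  also have "... = tact p (tableau_on_tabloid lam N \<tau> R)"
   unfolding t(2)[symmetric] tableau_on_tabloid_rows[OF t(1)] clin_sum[OF clin_tact] tact_basis[OF b] ..
  also have "... = tact p (tmap lam N \<tau> (basis_vec R))" by (simp only: tmap_basis[OF N R])
  finally show "tmap lam N \<tau> (tact p (basis_vec R)) - tact p (tmap lam N \<tau> (basis_vec R)) : {0}" by simp
 qed
 then show ?thesis by simp
qed

lemma tmap_young_sym: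
 assumes N: "finite N" and f: "f : free (tabloids lam N)"
 shows "tmap lam N \<tau> (young_sym lam' N t f) = young_sym lam' N t (tmap lam N \<tau> f)" proof -
 have *: "tmap lam N \<tau> (tact (c o \<rho>) f) = tact (c o \<rho>) (tmap lam N \<tau> f)"
  if "(c, \<rho>) : column_stabilizer lam' N t \<times> row_stabilizer lam' N t" for c \<rho>
  using that by (intro tmap_tact[OF N _ f] permutes_compose) (auto dest: column_stabilizerD row_stabilizerD)
 show ?thesis unfolding young_sym_expand case_prod_beta clin_lincomb[OF clin_tmap] by (rule sum.cong[OF refl]) (use * in auto)
qed

lemma tmap_polytabloid:
 assumes N: "finite N" and t: "t : tableaux lam N"
 shows "tmap lam N \<tau> (polytabloid lam N t) =
  (SUM c:column_stabilizer lam N t. cscale (of_int (sign c))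
   (SUM \<tau>':row_equivalent lam \<tau>. basis_vec (star_tabloid lam \<tau>' (c o t))))"
 unfolding polytabloid_def clin_lincomb[OF clin_tmap] proof (intro sum.cong refl arg_cong2[where f = cscale])
 fix c assume c: "c : column_stabilizer lam N t"
 have "perm_tabloid c (rows_tabloid lam t) = rows_tabloid lam (c o t)" by (simp add: rows_tabloid_def perm_tabloid_def image_comp)
 moreover have ct: "c o t : tableaux lam N" by (rule comp_tableaux[OF column_stabilizerD[OF c] t])
 ultimately show "tmap lam N \<tau> (basis_vec (perm_tabloid c (rows_tabloid lam t))) =
   (SUM \<tau>':row_equivalent lam \<tau>. basis_vec (star_tabloid lam \<tau>' (c o t)))"
  by (simp only: tmap_basis[OF N rows_tabloid_in[OF ct]] tableau_on_tabloid_rows[OF ct])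
qed

definition col_weight :: "nat list => (cell => nat) => nat" where
 "col_weight lam \<tau> = (SUM c:cells lam. snd c * \<tau> c)"

definition row_weight :: "nat list => (cell => nat) => nat" where
 "row_weight lam \<tau> = (SUM c:cells lam. fst c * \<tau> c)"

lemma column_stabilizer_cells:
 assumes t: "t : tableaux lam N" and c: "c : column_stabilizer lam N t"
 obtains \<pi> where "\<pi> permutes cells lam" "!!d. d : cells lam ==> t (\<pi> d) = c (t d)"
  "!!d. d : cells lam ==> snd (\<pi> d) = snd d" proof -
 have ct: "c o t : tableaux lam N" by (rule comp_tableaux[OF column_stabilizerD[OF c] t])
 obtain \<pi> where \<pi>: "\<pi> permutes cells lam" "!!d. d : cells lam ==> t (\<pi> d) = (c o t) d"
  by (rule tableaux_relabel[OF t ct]) blast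
 have snd: "snd (\<pi> d) = snd d" if d: "d : cells lam" for d proof -
  have "c (t d) : c ` column lam t (snd d)" using d by (auto simp: column_def)
  then have "t (\<pi> d) : column lam t (snd d)" using c \<pi>(2)[OF d] by (simp add: column_stabilizer_iff)
  moreover have "t (\<pi> d) : column lam t (snd (\<pi> d))" using d permutes_in_image[OF \<pi>(1)] by (auto simp: column_def)
  ultimately show ?thesis using column_disjoint[OF t] by blast
 qed
 show ?thesis by (rule that[OF \<pi>(1) _ snd]) (simp_all add: \<pi>(2))
qed

text \<open>By the rearrangement inequality within rows and within columns, \<tau> is the filling of largest weight
whose tabloid occurs in the image of the polytabloid of t, and it occurs only once. This triangularity
yields linear independence.\<close>
lemma star_tabloid_triangular:
 assumes t: "t : tableaux lam N" and c: "c : column_stabilizer lam N t"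
  and \<tau>: "\<tau> : semistandard lam \<mu>" and \<tau>0: "\<tau>0 : semistandard lam \<mu>"
  and \<tau>': "\<tau>' : row_equivalent lam \<tau>"
  and eq: "star_tabloid lam \<tau>0 t = star_tabloid lam \<tau>' (c o t)"
 shows "col_weight lam \<tau>0 <= col_weight lam \<tau>"
  and "col_weight lam \<tau>0 = col_weight lam \<tau> ==> \<tau>0 = \<tau> & \<tau>' = \<tau> & c = id" proof -
 let ?D = "cells lam"
 obtain \<pi> where \<pi>: "\<pi> permutes ?D" "!!d. d : ?D ==> t (\<pi> d) = c (t d)" "!!d. d : ?D ==> snd (\<pi> d) = snd d"
  by (rule column_stabilizer_cells[OF t c]) blast
 obtain \<rho> where "\<rho> permutes ?D & (ALL d:?D. fst (\<rho> d) = fst d) & \<tau>' = restrict (\<tau> o \<rho>) ?D"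
  using \<tau>' unfolding row_equivalent_def by blast
 then have \<rho>: "\<rho> permutes ?D" "!!d. d : ?D ==> fst (\<rho> d) = fst d" "\<tau>' = restrict (\<tau> o \<rho>) ?D" by blast+
 have b\<pi>: "bij_betw \<pi> ?D ?D" and b\<rho>: "bij_betw \<rho> ?D ?D" using \<pi>(1) \<rho>(1) by (simp_all add: permutes_imp_bij)
 have ct: "c o t : tableaux lam N" by (rule comp_tableaux[OF column_stabilizerD[OF c] t])
 have val: "\<tau>0 (\<pi> d) = \<tau> (\<rho> d)" if d: "d : ?D" for d proof -
  have "(c o t) d : star_tabloid lam \<tau>' (c o t) (\<tau>' d)" using star_tabloid_mem[OF ct d] by simp
  then have "t (\<pi> d) : star_tabloid lam \<tau>0 t (\<tau>' d)" using \<pi>(2)[OF d] eq by simp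
  then have "\<tau>0 (\<pi> d) = \<tau>' d" using star_tabloid_mem[OF t, of "\<pi> d"] d permutes_in_image[OF \<pi>(1)] by simp
  then show ?thesis using d \<rho>(3) by simp
 qed
 have "col_weight lam \<tau>0 = (SUM d:?D. snd (\<pi> d) * \<tau>0 (\<pi> d))"
  unfolding col_weight_def by (rule sum.reindex_bij_betw[OF b\<pi>, symmetric])
 also have "... = (SUM d:?D. snd d * \<tau> (\<rho> d))" by (rule sum.cong) (simp_all add: \<pi>(3) val)
 finally have w0: "col_weight lam \<tau>0 = (SUM d:?D. snd d * \<tau> (\<rho> d))" .
 show "col_weight lam \<tau>0 <= col_weight lam \<tau>" unfolding w0 unfolding col_weight_def
  by (rule rearrangement_classes(1)[OF finite_cells cell_inj semistandard_rows[OF \<tau>] b\<rho> \<rho>(2)])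
 show "\<tau>0 = \<tau> & \<tau>' = \<tau> & c = id" if w: "col_weight lam \<tau>0 = col_weight lam \<tau>" proof -
  have \<tau>\<rho>: "\<tau> (\<rho> d) = \<tau> d" if "d : ?D" for d
  proof (rule rearrangement_classes(2)[OF finite_cells cell_inj semistandard_rows[OF \<tau>] b\<rho> \<rho>(2) _ that])
   show "(SUM x:?D. snd x * \<tau> (\<rho> x)) = (SUM x:?D. snd x * \<tau> x)" using w w0 by (simp add: col_weight_def)
  qed
  have 1: "\<tau>' = \<tau>" by (rule extensionalityI[of _ ?D]) (use \<rho>(3) \<tau>\<rho> semistandard_ext[OF \<tau>] in auto)
  have 2: "\<tau>0 = \<tau>" proof (rule extensionalityI[OF semistandard_ext[OF \<tau>0] semistandard_ext[OF \<tau>]])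
   show "\<tau>0 d = \<tau> d" if d: "d : ?D" for d
   by (rule sorted_unique[OF finite_cells _ semistandard_columns[OF \<tau>0] semistandard_columns[OF \<tau>] b\<pi> \<pi>(3) _ d])
   (auto simp: val \<tau>\<rho> intro: cell_inj)
  qed
  have \<pi>id: "\<pi> d = d" if d: "d : ?D" for d proof -
   have d': "\<pi> d : ?D" using d permutes_in_image[OF \<pi>(1)] by simp
   have "\<tau> (\<pi> d) = \<tau> d" using val[OF d] \<tau>\<rho>[OF d] 2 by simp
   then have "fst (\<pi> d) = fst d"
   using semistandard_columns_strict[OF \<tau> d d'] semistandard_columns_strict[OF \<tau> d' d] \<pi>(3)[OF d]
   by (metis less_irrefl linorder_neqE_nat)
   then show ?thesis using \<pi>(3)[OF d] by (rule cell_inj)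
  qed
  have "c x = id x" for x proof (cases "x : N")
   case True
   then obtain d where "d : ?D" "x = t d" using t by (auto simp: tableaux_def bij_betw_def)
   then show ?thesis using \<pi>(2)[of d] \<pi>id[of d] by simp
  next
   case False
   then show ?thesis using column_stabilizerD[OF c] by (simp add: permutes_not_in)
  qed
  then show ?thesis using 1 2 by auto
 qed
qed

theorem tmap_polytabloid_independent:
 assumes N: "finite N" and t: "t : tableaux lam N"
  and zero: "(SUM \<tau>:semistandard lam \<mu>. cscale (k \<tau>) (tmap lam N \<tau> (polytabloid lam N t))) = 0"
  and \<tau>: "\<tau> : semistandard lam \<mu>"
 shows "k \<tau> = 0"
proof (rule triangular_independent[where pt = "%\<tau>. star_tabloid lam \<tau> t" and wt = "col_weight lam", OF finite_semistandard _ _ zero \<tau>])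
 let ?C = "column_stabilizer lam N t"
 have coeff: "tmap lam N \<tau> (polytabloid lam N t) R = (SUM c:?C. SUM \<tau>':row_equivalent lam \<tau>.
   of_int (sign c) * (if R = star_tabloid lam \<tau>' (c o t) then 1 else 0))" for \<tau> R
  unfolding tmap_polytabloid[OF N t] by (simp add: sum_apply cscale_apply basis_vec_def sum_distrib_left)
 fix \<tau> assume \<tau>: "\<tau> : semistandard lam \<mu>"
 have ext: "\<tau> : extensional (cells lam)" by (rule semistandard_ext[OF \<tau>])
 have "tmap lam N \<tau> (polytabloid lam N t) (star_tabloid lam \<tau> t) =
   (SUM c:?C. SUM \<tau>':row_equivalent lam \<tau>. if \<tau>' = \<tau> then (if c = id then 1 else 0) else 0)" unfolding coeff
 proof (intro sum.cong refl)
  fix c \<tau>' assume c: "c : ?C" and \<tau>': "\<tau>' : row_equivalent lam \<tau>"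
  show "of_int (sign c) * (if star_tabloid lam \<tau> t = star_tabloid lam \<tau>' (c o t) then 1 else 0) =
   (if \<tau>' = \<tau> then (if c = id then 1 else 0) else 0)" proof (cases "star_tabloid lam \<tau> t = star_tabloid lam \<tau>' (c o t)")
   case True
   from star_tabloid_triangular(2)[OF t c \<tau> \<tau> \<tau>' this refl] show ?thesis by (simp add: sign_id)
  next
   case False
   then have "~ (\<tau>' = \<tau> & c = id)" by auto
   then show ?thesis using False by auto
  qed
 qed
 also have "... = 1" using finite_row_equivalent row_equivalent_self[OF ext] finite_stabilizers(1)[OF N] column_stabilizer_id by simp
 finally show "tmap lam N \<tau> (polytabloid lam N t) (star_tabloid lam \<tau> t) ~= 0" by simp
 fix \<tau>0 assume \<tau>0: "\<tau>0 : semistandard lam \<mu>" and ne: "\<tau> ~= \<tau>0"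
  and nz: "tmap lam N \<tau> (polytabloid lam N t) (star_tabloid lam \<tau>0 t) ~= 0"
 obtain c \<tau>' where c: "c : ?C" "\<tau>' : row_equivalent lam \<tau>" "star_tabloid lam \<tau>0 t = star_tabloid lam \<tau>' (c o t)"
 proof (rule ccontr)
  assume "~ thesis"
  then have "tmap lam N \<tau> (polytabloid lam N t) (star_tabloid lam \<tau>0 t) = 0"
   unfolding coeff using that by (intro sum.neutral ballI) auto
  then show False using nz by simp
 qed
 show "col_weight lam \<tau>0 < col_weight lam \<tau>" using star_tabloid_triangular[OF t c(1) \<tau> \<tau>0 c(2,3)] ne by force
qed

lemma standard_bij:
 assumes "lam : partitions n" "\<tau> : semistandard lam (replicate n 1)"
 shows "bij_betw \<tau> (cells lam) {1..n}" proof -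
 have rng: "\<tau> ` cells lam <= {1..n}" using assms(2) by (auto simp: semistandard_def)
 have fib: "card {c : cells lam. \<tau> c = i} = 1" if "i : {1..n}" for i using assms(2) that by (auto simp: semistandard_def part_def)
 have "inj_on \<tau> (cells lam)" proof (rule inj_onI)
  fix c c' assume "c : cells lam" "c' : cells lam" "\<tau> c = \<tau> c'"
  moreover have "\<tau> c : {1..n}" using rng `c : cells lam` by blast
  from fib[OF this] obtain d where "{c' : cells lam. \<tau> c' = \<tau> c} = {d}" by (auto simp: card_1_singleton_iff)
  ultimately show "c = c'" by (metis (mono_tags, lifting) mem_Collect_eq singletonD)
 qed
 moreover have "{1..n} <= \<tau> ` cells lam" proof
  fix i assume "i : {1..n}"
  from fib[OF this] obtain d where "{c' : cells lam. \<tau> c' = i} = {d}" by (auto simp: card_1_singleton_iff)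
  then have "d : {c' : cells lam. \<tau> c' = i}" by simp
  then show "i : \<tau> ` cells lam" by auto
 qed
 ultimately show ?thesis using rng by (auto simp: bij_betw_def)
qed

theorem standard_polytabloids_independent:
 assumes N: "finite N" and lam: "lam : partitions (card N)" and e: "bij_betw e {1..card N} N"
  and zero: "(SUM \<tau>:semistandard lam (replicate (card N) 1). cscale (k \<tau>) (polytabloid lam N (e o \<tau>))) = 0"
  and \<tau>: "\<tau> : semistandard lam (replicate (card N) 1)"
 shows "k \<tau> = 0"
proof (rule triangular_independent[where pt = "%\<tau>. rows_tabloid lam (e o \<tau>)" and wt = "row_weight lam", OF finite_semistandard _ _ zero \<tau>])
 let ?D = "cells lam"
 have tab: "e o \<tau> : tableaux lam N" if "\<tau> : semistandard lam (replicate (card N) 1)" for \<tau>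
  unfolding tableaux_def using bij_betw_trans[OF standard_bij[OF lam that] e] by simp
 fix \<tau> assume \<tau>: "\<tau> : semistandard lam (replicate (card N) 1)"
 show "polytabloid lam N (e o \<tau>) (rows_tabloid lam (e o \<tau>)) ~= 0" using polytabloid_diag[OF N tab[OF \<tau>]] by simp
 fix \<tau>0 assume \<tau>0: "\<tau>0 : semistandard lam (replicate (card N) 1)" and ne: "\<tau> ~= \<tau>0"
  and nz: "polytabloid lam N (e o \<tau>) (rows_tabloid lam (e o \<tau>0)) ~= 0"
 let ?t = "e o \<tau>" and ?s = "e o \<tau>0"
 have t: "?t : tableaux lam N" and t0: "?s : tableaux lam N" using tab \<tau> \<tau>0 by auto
 obtain c where c: "c : column_stabilizer lam N ?t" "rows_tabloid lam ?s = perm_tabloid c (rows_tabloid lam ?t)" proof (rule ccontr)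
  assume "~ thesis"
  then have "ALL c:column_stabilizer lam N ?t. rows_tabloid lam ?s ~= perm_tabloid c (rows_tabloid lam ?t)" using that by blast
  then have "polytabloid lam N ?t (rows_tabloid lam ?s) = 0"
   unfolding polytabloid_def sum_apply cscale_apply basis_vec_def by (intro sum.neutral ballI) simp
  then show False using nz by simp
 qed
 obtain \<pi> where \<pi>: "\<pi> permutes ?D" "!!d. d : ?D ==> ?t (\<pi> d) = c (?t d)" "!!d. d : ?D ==> snd (\<pi> d) = snd d"
  by (rule column_stabilizer_cells[OF t c(1)]) blast
 have ct: "c o ?t : tableaux lam N" by (rule comp_tableaux[OF column_stabilizerD[OF c(1)] t])
 obtain \<sigma> where \<sigma>: "\<sigma> permutes ?D" "!!d. d : ?D ==> ?s (\<sigma> d) = (c o ?t) d"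
  by (rule tableaux_relabel[OF t0 ct]) blast
 have \<sigma>row: "fst (\<sigma> d) = fst d" if d: "d : ?D" for d proof -
  have "fst (\<sigma> d) = rowof (rows_tabloid lam ?s) (?s (\<sigma> d))"
   using rowof_rows[OF t0, of "\<sigma> d"] d permutes_in_image[OF \<sigma>(1)] by simp
  also have "rows_tabloid lam ?s = rows_tabloid lam (c o ?t)"
   unfolding c(2) by (simp add: rows_tabloid_def perm_tabloid_def image_comp comp_assoc)
  also have "rowof ... (?s (\<sigma> d)) = fst d" unfolding \<sigma>(2)[OF d] by (rule rowof_rows[OF ct d])
  finally show ?thesis .
 qed
 have val: "\<tau>0 (\<sigma> d) = \<tau> (\<pi> d)" if d: "d : ?D" for d proof -
  have "e (\<tau>0 (\<sigma> d)) = e (\<tau> (\<pi> d))" using \<sigma>(2)[OF d] \<pi>(2)[OF d] by simp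
  moreover have "\<tau>0 (\<sigma> d) : {1..card N}" "\<tau> (\<pi> d) : {1..card N}"
   using standard_bij[OF lam \<tau>0] standard_bij[OF lam \<tau>] d permutes_in_image[OF \<sigma>(1)] permutes_in_image[OF \<pi>(1)]
   unfolding bij_betw_def by blast+
  ultimately show ?thesis using e by (auto simp: bij_betw_def dest: inj_onD)
 qed
 have b\<pi>: "bij_betw \<pi> ?D ?D" and b\<sigma>: "bij_betw \<sigma> ?D ?D" using \<pi>(1) \<sigma>(1) by (simp_all add: permutes_imp_bij)
 have "row_weight lam \<tau>0 = (SUM d:?D. fst (\<sigma> d) * \<tau>0 (\<sigma> d))"
  unfolding row_weight_def by (rule sum.reindex_bij_betw[OF b\<sigma>, symmetric])
 also have "... = (SUM d:?D. fst d * \<tau> (\<pi> d))" by (rule sum.cong) (simp_all add: \<sigma>row val)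
 finally have w0: "row_weight lam \<tau>0 = (SUM d:?D. fst d * \<tau> (\<pi> d))" .
 have inj': "x = y" if "snd x = snd y" "fst x = fst y" for x y :: cell using that by (intro cell_inj)
 have "row_weight lam \<tau>0 <= row_weight lam \<tau>" unfolding w0 unfolding row_weight_def
  by (rule rearrangement_classes(1)[OF finite_cells inj' semistandard_columns[OF \<tau>] b\<pi> \<pi>(3)])
 moreover have "row_weight lam \<tau>0 ~= row_weight lam \<tau>" proof
  assume w: "row_weight lam \<tau>0 = row_weight lam \<tau>"
  have \<tau>\<pi>: "\<tau> (\<pi> d) = \<tau> d" if "d : ?D" for d
  proof (rule rearrangement_classes(2)[OF finite_cells inj' semistandard_columns[OF \<tau>] b\<pi> \<pi>(3) _ that])
   show "(SUM x:?D. fst x * \<tau> (\<pi> x)) = (SUM x:?D. fst x * \<tau> x)" using w w0 by (simp add: row_weight_def)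
  qed
  have "\<tau>0 = \<tau>" proof (rule extensionalityI[OF semistandard_ext[OF \<tau>0] semistandard_ext[OF \<tau>]])
   show "\<tau>0 d = \<tau> d" if d: "d : ?D" for d
   by (rule sorted_unique[OF finite_cells cell_inj semistandard_rows[OF \<tau>0] semistandard_rows[OF \<tau>] b\<sigma> \<sigma>row _ d])
   (auto simp: val \<tau>\<pi>)
  qed
  then show False using ne by simp
 qed
 ultimately show "row_weight lam \<tau>0 < row_weight lam \<tau>" by simp
qed


section \<open>Counting: Young diagrams\<close>

definition diagrams :: "nat => cell set set" where
 "diagrams n = {D. finite D & card D = n &
   (ALL a b. (a, b) : D --> 1 <= a & 1 <= b) &
   (ALL a b a' b'. (a, b) : D & 1 <= a' & a' <= a & 1 <= b' & b' <= b --> (a', b') : D)}"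

lemma diagramsI:
 assumes "finite D" "card D = n" "!!a b. (a, b) : D ==> 1 <= a & 1 <= b"
  "!!a b a' b'. (a, b) : D ==> 1 <= a' ==> a' <= a ==> 1 <= b' ==> b' <= b ==> (a', b') : D"
 shows "D : diagrams n" unfolding diagrams_def using assms by blast

lemma
 assumes "D : diagrams n"
 shows diagrams_finite: "finite D" and diagrams_card: "card D = n"
  and diagrams_pos: "(a, b) : D ==> 1 <= a" "(a, b) : D ==> 1 <= b"
  and diagrams_down: "(a, b) : D ==> 1 <= a' ==> a' <= a ==> 1 <= b' ==> b' <= b ==> (a', b') : D"
 using assms unfolding diagrams_def by blast+

definition row_length :: "cell set => nat => nat" where
 "row_length D a = card {b. (a, b) : D}"

lemma row_length:
 assumes D: "D : diagrams n"
 shows "(a, b) : D \<longleftrightarrow> 1 <= a & 1 <= b & b <= row_length D a" proof -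
 have "{b. (a, b) : D} = {1..card {b. (a, b) : D}}" proof (rule initial_segment_nat)
  show "finite {b. (a, b) : D}" by (rule finite_subset[OF _ finite_imageI[OF diagrams_finite[OF D], of snd]]) force
  show "0 ~: {b. (a, b) : D}" using diagrams_pos(2)[OF D, of a 0] by auto
  show "b' : {b. (a, b) : D}" if "b : {b. (a, b) : D}" "1 <= b'" "b' <= b" for b b'
   using diagrams_down[OF D, of a b a b'] diagrams_pos(1)[OF D, of a b] that by simp
 qed
 then have "b : {b. (a, b) : D} \<longleftrightarrow> b : {1..row_length D a}" unfolding row_length_def by simp
 then show ?thesis using diagrams_pos(1)[OF D, of a b] by auto
qed

lemma row_length_mono:
 assumes D: "D : diagrams n" and "1 <= a'" "a' <= a"
 shows "row_length D a <= row_length D a'" proof (cases "row_length D a = 0")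
 case False
 then have "(a, row_length D a) : D" using row_length[OF D] assms by simp
 then have "(a', row_length D a) : D" using diagrams_down[OF D] assms(2,3) False by simp
 then show ?thesis using row_length[OF D] by simp
qed simp

lemma bij_cells: "bij_betw cells (partitions n) (diagrams n)" unfolding bij_betw_def proof (intro conjI inj_onI equalityI subsetI)
 fix lam \<mu> assume lam: "lam : partitions n" and \<mu>: "\<mu> : partitions n" and eq: "cells lam = cells \<mu>"
 have p: "part l a = card {b. (a, b) : cells l}" for l a proof (cases "a : {1..length l}")
  case True
  then have "{b. (a, b) : cells l} = {1..part l a}" by (auto simp: cells_def)
  then show ?thesis by simp
 next
  case False
  then have "{b. (a, b) : cells l} = {}" by (auto simp: cells_def)
  then show ?thesis using False by (auto simp: part_def)
 qed
 show "lam = \<mu>" by (rule part_eqD[OF lam \<mu>]) (simp add: p eq)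
next
 fix D assume "D : cells ` partitions n"
 then obtain lam where lam: "lam : partitions n" "D = cells lam" by blast
 show "D : diagrams n" unfolding lam(2) proof (rule diagramsI)
  show "card (cells lam) = n" using lam(1) by (simp add: card_cells partitions_def)
  show "1 <= a & 1 <= b" if "(a, b) : cells lam" for a b using that by (auto simp: cells_def)
 qed (simp, rule cells_down[OF lam(1)])
next
 fix D assume D: "D : diagrams n"
 let ?L = "row_length D"
 define h where "h = card {a. (a, 1) : D}"
 have h: "{a. (a, 1) : D} = {1..h}" unfolding h_def proof (rule initial_segment_nat)
  show "finite {a. (a, 1) : D}" by (rule finite_subset[OF _ finite_imageI[OF diagrams_finite[OF D], of fst]]) force
  show "0 ~: {a. (a, 1) : D}" using diagrams_pos(1)[OF D, of 0 1] by auto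
  show "a' : {a. (a, 1) : D}" if "a : {a. (a, 1) : D}" "1 <= a'" "a' <= a" for a a' using diagrams_down[OF D, of a 1 a' 1] that by simp
 qed
 have pos: "?L a > 0 \<longleftrightarrow> a : {1..h}" if "a >= 1" for a proof -
  have "?L a > 0 \<longleftrightarrow> (a, 1) : D" using row_length[OF D, of a 1] that by auto
  also have "... \<longleftrightarrow> a : {1..h}" using h by blast
  finally show ?thesis .
 qed
 define lam where "lam = map (%i. ?L (i + 1)) [0..<h]"
 have part: "part lam a = (if a : {1..h} then ?L a else 0)" for a by (auto simp: part_def lam_def)
 have cells: "cells lam = D" proof (rule Set.set_eqI, clarify)
  fix a b
  have "(a, b) : cells lam \<longleftrightarrow> a : {1..h} & 1 <= b & b <= ?L a" using part[of a] by (auto simp: cells_def lam_def)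
  also have "... \<longleftrightarrow> (a, b) : D" using row_length[OF D, of a b] pos[of a] by auto
  finally show "(a, b) : cells lam \<longleftrightarrow> (a, b) : D" .
 qed
 have "sorted_wrt (>=) lam"
  unfolding lam_def sorted_wrt_map by (rule sorted_wrt_mono_rel[OF _ sorted_wrt_upt]) (auto intro: row_length_mono[OF D])
 moreover have "0 ~: set lam" proof
  assume "0 : set lam"
  then obtain i where "i < h" "?L (i + 1) = 0" by (auto simp: lam_def)
  then show False using pos[of "i + 1"] by simp
 qed
 moreover have "sum_list lam = n" using card_cells[of lam] cells diagrams_card[OF D] by simp
 ultimately have "lam : partitions n" by (simp add: partitions_def)
 then show "D : cells ` partitions n" using cells by blast
qed

lemma diagrams_bound:
 assumes D: "D : diagrams n"
 shows "D <= {1..n} \<times> {1..n}" proof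
 fix c assume "c : D"
 then obtain a b where c: "c = (a, b)" "(a, b) : D" by (cases c) auto
 have p: "1 <= a" "1 <= b" using diagrams_pos[OF D c(2)] by auto
 have "{1..a} \<times> {1} <= D" "{1} \<times> {1..b} <= D" using diagrams_down[OF D c(2)] p by auto
 from this[THEN card_mono[OF diagrams_finite[OF D]]] have "a <= n" "b <= n"
  using diagrams_card[OF D] by (simp_all add: card_cartesian_product)
 then show "c : {1..n} \<times> {1..n}" using c p by simp
qed

lemma finite_diagrams: "finite (diagrams n)" by (rule finite_subset[of _ "Pow ({1..n} \<times> {1..n})"]) (use diagrams_bound in auto)

lemma finite_partitions: "finite (partitions n)" using bij_betw_finite[OF bij_cells] finite_diagrams by blast

definition removable :: "cell set => cell set" where
 "removable D = {c : D. D - {c} : diagrams (card D - 1)}"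

definition addable :: "cell set => cell set" where
 "addable D = {c. c ~: D & insert c D : diagrams (card D + 1)}"

lemma removable_iff: "D : diagrams (Suc n) ==> c : removable D \<longleftrightarrow> c : D & D - {c} : diagrams n"
 by (simp add: removable_def diagrams_card)

lemma addable_iff: "D : diagrams n ==> c : addable D \<longleftrightarrow> c ~: D & insert c D : diagrams (Suc n)"
 by (simp add: addable_def diagrams_card)

lemma finite_removable: "D : diagrams n ==> finite (removable D)" by (rule finite_subset[OF _ diagrams_finite]) (auto simp: removable_def)

lemma finite_addable:
 assumes "D : diagrams n"
 shows "finite (addable D)" proof (rule finite_subset)
 show "addable D <= {1..Suc n} \<times> {1..Suc n}" proof
  fix c assume "c : addable D"
  then have "insert c D : diagrams (Suc n)" by (simp add: addable_iff[OF assms])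
  from diagrams_bound[OF this] show "c : {1..Suc n} \<times> {1..Suc n}" by blast
 qed
qed simp

lemma card_addable:
 assumes D: "D : diagrams n"
 shows "card (removable D) + 1 <= card (addable D)" proof -
 let ?L = "row_length D"
 note L = row_length[OF D]
 define A where "A = {a. 1 <= a & ?L (Suc a) < ?L a}"
 have rem: "removable D <= (%a. (a, ?L a)) ` A" proof
  fix c assume "c : removable D"
  then have c: "c : D" "D - {c} : diagrams (card D - 1)" by (auto simp: removable_def)
  obtain a b where ab: "c = (a, b)" by (cases c)
  have p: "1 <= a" "1 <= b" "b <= ?L a" using c ab L by auto
  have stuck: "(a', b') ~: D - {c}" if "a <= a'" "b <= b'" for a' b' using diagrams_down[OF c(2), of a' b' a b] p ab that by auto
  have "b = ?L a" using stuck[of a "?L a"] p L ab by auto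
  moreover have "?L (Suc a) < ?L a" using stuck[of "Suc a" b] p L ab calculation by auto
  ultimately show "c : (%a. (a, ?L a)) ` A" using ab p by (auto simp: A_def)
 qed
 have add: "(%a. (a, ?L a + 1)) ` insert 1 (Suc ` A) <= addable D" proof
  fix c assume "c : (%a. (a, ?L a + 1)) ` insert 1 (Suc ` A)"
  then obtain a where a: "a = 1 \<or> (EX a'. a = Suc a' & a' : A)" "c = (a, ?L a + 1)" by auto
  have cD: "c ~: D" using a L by auto
  moreover have "insert c D : diagrams (card D + 1)" proof (rule diagramsI)
   show "finite (insert c D)" "card (insert c D) = card D + 1" using diagrams_finite[OF D] cD by auto
   show "1 <= a & 1 <= b" if "(a, b) : insert c D" for a b using that diagrams_pos[OF D] a by auto
   fix a2 b2 a' b' assume h: "(a2, b2) : insert c D" "1 <= a'" "a' <= a2" "1 <= b'" "b' <= b2"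
   show "(a', b') : insert c D" proof (cases "(a2, b2) = c")
   case False
   then show ?thesis using diagrams_down[OF D, of a2 b2 a' b'] h by simp
   next
   case e: True
   show ?thesis proof (cases "a' = a")
   case True
   then show ?thesis using h e a L[of a b'] by (cases "b' = ?L a + 1") auto
   next
   case False
   then obtain a0 where a0: "a = Suc a0" "a0 : A" using a h e by auto
   then have "?L a0 <= ?L a'" using False h e a by (intro row_length_mono[OF D]) auto
   then show ?thesis using h e a a0 L by (auto simp: A_def)
   qed
   qed
  qed
  ultimately show "c : addable D" by (simp add: addable_def)
 qed
 have "A <= fst ` D" using L by (force simp: A_def image_iff)
 then have fin: "finite A" using diagrams_finite[OF D] finite_surj by blast
 have "card (removable D) + 1 <= card A + 1" using card_mono[OF _ rem] card_image_le[OF fin] fin by (meson add_le_mono1 finite_imageI le_trans)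
 also have "... = card (insert 1 (Suc ` A))" using fin by (simp add: card_image A_def image_iff)
 also have "... = card ((%a. (a, ?L a + 1)) ` insert 1 (Suc ` A))" by (rule card_image[symmetric]) (auto simp: inj_on_def)
 also have "... <= card (addable D)" by (rule card_mono[OF finite_addable[OF D] add])
 finally show ?thesis .
qed

definition fillings :: "cell set => nat list => (cell => nat) set" where
 "fillings D \<mu> =
   {\<tau> : D \<rightarrow>\<^sub>E {1..length \<mu>}.
   (ALL i:{1..length \<mu>}. card {c : D. \<tau> c = i} = part \<mu> i) &
   (ALL a b b'. (a, b) : D & (a, b') : D & b < b' --> \<tau> (a, b) <= \<tau> (a, b')) &
   (ALL a a' b. (a, b) : D & (a', b) : D & a < a' --> \<tau> (a, b) < \<tau> (a', b))}"

lemma semistandard_fillings: "semistandard lam \<mu> = fillings (cells lam) \<mu>" by (simp only: semistandard_def fillings_def)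

lemma finite_fillings: "finite D ==> finite (fillings D \<mu>)" by (rule finite_subset[of _ "D \<rightarrow>\<^sub>E {1..length \<mu>}"])
   (auto simp: fillings_def intro!: finite_PiE)

lemma card_fillings_snoc:
 assumes D: "D : diagrams (Suc n)"
 shows "(SUM c:removable D. card (fillings (D - {c}) \<mu>)) <= card (fillings D (\<mu> @ [1]))" proof -
 let ?h = "Suc (length \<mu>)"
 let ?S = "Sigma (removable D) (%c. fillings (D - {c}) \<mu>)"
 let ?f = "%(c, \<sigma>). \<sigma>(c := ?h)"
 have le: "\<sigma> d : {1..length \<mu>}" if "\<sigma> : fillings (D - {c}) \<mu>" "d : D" "d ~= c" for \<sigma> c d
  using that by (auto simp: fillings_def PiE_iff)
 have und: "\<sigma> c = undefined" if "\<sigma> : fillings (D - {c}) \<mu>" for \<sigma> c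
  using that PiE_arb[of \<sigma> "D - {c}" "%_. {1..length \<mu>}" c] by (simp add: fillings_def)
 have "inj_on ?f ?S" proof (rule inj_onI, clarify)
  fix c \<sigma> c' \<sigma>' assume c: "c : removable D" "c' : removable D"
   and \<sigma>: "\<sigma> : fillings (D - {c}) \<mu>" "\<sigma>' : fillings (D - {c'}) \<mu>" and e: "\<sigma>(c := ?h) = \<sigma>'(c' := ?h)"
  have "c = c'" using fun_cong[OF e, of c] le[OF \<sigma>(2), of c] c by (auto simp: removable_def split: if_splits)
  then show "c = c' & \<sigma> = \<sigma>'" using fun_upd_eqD[OF e[folded `c = c'`]] und \<sigma> e by (metis fun_upd_triv fun_upd_upd)
 qed
 moreover have "?f ` ?S <= fillings D (\<mu> @ [1])" proof clarify
  fix c \<sigma> assume c: "c : removable D" and \<sigma>: "\<sigma> : fillings (D - {c}) \<mu>"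
  have cD: "c : D" "D - {c} : diagrams n" using c removable_iff[OF D] by auto
  have corner: "(a, b) ~= c" if "(a', b') : D" "(a, b) ~= (a', b')" "(a, b) : D" "a <= a'" "b <= b'" for a b a' b'
   using diagrams_down[OF cD(2), of a' b' a b] diagrams_pos[OF D, of a b] that by auto
  have row: "\<sigma> (a, b) <= \<sigma> (a, b')" if "(a, b) : D - {c}" "(a, b') : D - {c}" "b < b'" for a b b'
   using \<sigma> that by (simp add: fillings_def)
  have col: "\<sigma> (a, b) < \<sigma> (a', b)" if "(a, b) : D - {c}" "(a', b) : D - {c}" "a < a'" for a b a'
   using \<sigma> that by (simp add: fillings_def)
  have \<sigma>E: "\<sigma> : (D - {c}) \<rightarrow>\<^sub>E {1..length \<mu>}" using \<sigma> by (simp add: fillings_def)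
  have cnt: "card {d : D - {c}. \<sigma> d = i} = part \<mu> i" if "i : {1..length \<mu>}" for i
   using \<sigma> that by (simp add: fillings_def)
  note le = le[OF \<sigma>]
  show "\<sigma>(c := ?h) : fillings D (\<mu> @ [1])" unfolding fillings_def mem_Collect_eq proof (intro conjI ballI allI impI)
   show "\<sigma>(c := ?h) : D \<rightarrow>\<^sub>E {1..length (\<mu> @ [1])}" proof (rule PiE_I)
   show "(\<sigma>(c := ?h)) d : {1..length (\<mu> @ [1])}" if "d : D" for d using le[of d] that by (cases "d = c") auto
   show "(\<sigma>(c := ?h)) d = undefined" if "d ~: D" for d using that cD(1) PiE_arb[OF \<sigma>E, of d] by auto
   qed
   show "card {d : D. (\<sigma>(c := ?h)) d = i} = part (\<mu> @ [1]) i" if i: "i : {1..length (\<mu> @ [1])}" for i proof (cases "i = ?h")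
   case True
   have "\<sigma> d ~= ?h" if "d : D" "d ~= c" for d using le[OF that] by simp
   then have "{d : D. (\<sigma>(c := ?h)) d = i} = {c}" using cD(1) True by auto
   then show ?thesis using True by (simp add: part_def)
   next
   case False
   then have "{d : D. (\<sigma>(c := ?h)) d = i} = {d : D - {c}. \<sigma> d = i}" by auto
   moreover have i': "i : {1..length \<mu>}" using i False by auto
   ultimately have "card {d : D. (\<sigma>(c := ?h)) d = i} = part \<mu> i" using cnt[OF i'] by simp
   then show ?thesis using i' by (auto simp: part_def nth_append)
   qed
   fix a b b' assume h: "(a, b) : D & (a, b') : D & b < b'"
   then have "(a, b) ~= c" using corner[of a b' a b] by simp
   moreover have "\<sigma> (a, b) <= \<sigma> (a, b')" if "(a, b') ~= c" using row[of a b b'] h that calculation by simp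
   ultimately show "(\<sigma>(c := ?h)) (a, b) <= (\<sigma>(c := ?h)) (a, b')" using le[of "(a, b)"] h by auto
  next
   fix a a' b assume h: "(a, b) : D & (a', b) : D & a < a'"
   then have "(a, b) ~= c" using corner[of a' b a b] by simp
   moreover have "\<sigma> (a, b) < \<sigma> (a', b)" if "(a', b) ~= c" using col[of a b a'] h that calculation by simp
   ultimately show "(\<sigma>(c := ?h)) (a, b) < (\<sigma>(c := ?h)) (a', b)" using le[of "(a, b)"] h by auto
  qed
 qed
 ultimately have "card ?S <= card (fillings D (\<mu> @ [1]))" by (rule card_inj_on_le[OF _ _ finite_fillings[OF diagrams_finite[OF D]]])
 moreover have "card ?S = (SUM c:removable D. card (fillings (D - {c}) \<mu>))"
  using finite_removable[OF D] diagrams_finite[OF D] finite_fillings by (intro card_SigmaI) auto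
 ultimately show ?thesis by simp
qed

text \<open>The number of ways to remove the cells one after another, i.e. of standard fillings.\<close>
fun walks :: "nat => cell set => nat" where
 "walks 0 D = 1"
| "walks (Suc n) D = (SUM c:removable D. walks n (D - {c}))"

lemma fillings_empty: "fillings {} [] = {%_. undefined}" by (auto simp: fillings_def)

lemma walks_le: "D : diagrams n ==> walks n D <= card (fillings D (replicate n 1))" proof (induction n arbitrary: D)
 case 0
 then have "D = {}" using diagrams_finite diagrams_card by force
 then show ?case by (simp add: fillings_empty)
next
 case (Suc n)
 have "walks (Suc n) D <= (SUM c:removable D. card (fillings (D - {c}) (replicate n 1)))"
  unfolding walks.simps by (rule sum_mono) (use Suc removable_iff in blast)
 also have "... <= card (fillings D (replicate n 1 @ [1]))" by (rule card_fillings_snoc[OF Suc.prems])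
 finally show ?case by (simp only: replicate_append_same replicate_Suc)
qed

lemma diagrams_Un:
 assumes "D : diagrams n" "E : diagrams m" "card (D \<union> E) = l"
 shows "D \<union> E : diagrams l" proof (rule diagramsI)
 show "(a', b') : D \<union> E" if "(a, b) : D \<union> E" "1 <= a'" "a' <= a" "1 <= b'" "b' <= b" for a b a' b'
  using that diagrams_down[OF assms(1), of a b a' b'] diagrams_down[OF assms(2), of a b a' b'] by auto
 show "1 <= a & 1 <= b" if "(a, b) : D \<union> E" for a b
  using that diagrams_pos[OF assms(1), of a b] diagrams_pos[OF assms(2), of a b] by auto
qed (use assms diagrams_finite in auto)

lemma remove_add_swap:
 assumes D: "D : diagrams n" and c': "c' : removable D" and c: "c : addable (D - {c'})" "c ~= c'"
 shows "c : addable D" and "c' : removable (insert c D)" proof -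
 obtain m where n: "n = Suc m" using c' diagrams_card[OF D] diagrams_finite[OF D] by (cases n) (auto simp: removable_def)
 note D = D[unfolded n]
 have 1: "c' : D" "D - {c'} : diagrams m" using removable_iff[OF D] c' by auto
 then have 2: "c ~: D" "insert c (D - {c'}) : diagrams (Suc m)" using c addable_iff[OF 1(2)] by auto
 have "D \<union> insert c (D - {c'}) = insert c D" by auto
 moreover have "card (insert c D) = Suc (Suc m)" using 2(1) diagrams_card[OF D] diagrams_finite[OF D] by simp
 ultimately have 3: "insert c D : diagrams (Suc (Suc m))" using diagrams_Un[OF D 2(2), of "Suc (Suc m)"] by simp
 moreover have "insert c (D - {c'}) = insert c D - {c'}" using c(2) by auto
 ultimately show "c : addable D" "c' : removable (insert c D)" using 1 2 removable_iff[OF 3] addable_iff[OF D] by simp_all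
qed

text \<open>Adding and removing two different cells commute, and the terms where the same cell is added and
removed are counted by the excess of addable over removable cells.\<close>
theorem walks_addable: "D : diagrams n ==> Suc n * walks n D <= (SUM c:addable D. walks (Suc n) (insert c D))"
proof (induction n arbitrary: D rule: less_induct)
 case (less n)
 note D = less.prems
 let ?A = "addable D" and ?R = "removable D" and ?w = "walks n"
 let ?in = "%c'. SUM c:addable (D - {c'}) - {c'}. ?w (insert c (D - {c'}))"
 have fin: "finite ?A" "finite ?R" using finite_addable[OF D] finite_removable[OF D] .
 have ins: "insert c D : diagrams (Suc n)" "c ~: D" if "c : ?A" for c using that addable_iff[OF D] by auto
 have step: "walks (Suc n) (insert c D) = ?w D + (SUM c':removable (insert c D) - {c}. ?w (insert c D - {c'}))" if c: "c : ?A" for c proof -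
  have "c : removable (insert c D)" using ins[OF c] D removable_iff[OF ins(1)[OF c]] by simp
  then show ?thesis using sum.remove[OF finite_removable[OF ins(1)[OF c]], of c "%c'. ?w (insert c D - {c'})"] ins(2)[OF c] by simp
 qed
 let ?T = "Sigma ?A (%c. removable (insert c D) - {c})" and ?U = "Sigma ?R (%c'. addable (D - {c'}) - {c'})"
 have del: "D - {c} : diagrams (n - 1)" "c : D" if "c : ?R" for c using that diagrams_card[OF D] by (auto simp: removable_def)
 have sub: "prod.swap ` ?U <= ?T" proof (rule image_subsetI)
  fix x assume "x : ?U"
  then obtain c' c where x: "x = (c', c)" "c' : ?R" "c : addable (D - {c'})" "c ~= c'" by auto
  then show "prod.swap x : ?T" using remove_add_swap[OF D x(2-4)] by simp
 qed
 have "(SUM c':?R. ?in c') = (SUM (c', c):?U. ?w (insert c (D - {c'})))" using fin finite_addable[OF del(1)] by (intro sum.Sigma) auto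
 also have "... = (SUM (c, c'):prod.swap ` ?U. ?w (insert c D - {c'}))"
  by (subst sum.reindex) (auto intro!: sum.cong arg_cong[where f = ?w])
 also have "... <= (SUM (c, c'):?T. ?w (insert c D - {c'}))"
  using fin finite_removable[OF ins(1)] sub by (intro sum_mono2 finite_SigmaI) auto
 also have "... = (SUM c:?A. SUM c':removable (insert c D) - {c}. ?w (insert c D - {c'}))"
  using fin finite_removable[OF ins(1)] by (intro sum.Sigma[symmetric]) auto
 finally have swap: "(SUM c':?R. ?in c') <= ..." .
 have undo: "n * walks (n - 1) (D - {c'}) <= ?in c' + ?w D" and pos: "n ~= 0" if c': "c' : ?R" for c' proof -
  show n: "n ~= 0" using del(2)[OF c'] diagrams_card[OF D] diagrams_finite[OF D] by (metis card_0_eq empty_iff)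
  have i: "insert c' (D - {c'}) = D" using del(2)[OF c'] by auto
  have "c' : addable (D - {c'})" using n del[OF c'] D addable_iff[OF del(1)[OF c']] i by simp
  then have "(SUM c:addable (D - {c'}). ?w (insert c (D - {c'}))) = ?in c' + ?w D"
   using sum.remove[OF finite_addable[OF del(1)[OF c']], of c' "%c. ?w (insert c (D - {c'}))"] i by simp
  then show "n * walks (n - 1) (D - {c'}) <= ?in c' + ?w D" using less.IH[OF _ del(1)[OF c']] n by simp
 qed
 have "n * ?w D <= (SUM c':?R. n * walks (n - 1) (D - {c'}))" by (cases n) (simp_all add: sum_distrib_left)
 also have "... <= (SUM c':?R. ?in c' + ?w D)" by (rule sum_mono) (rule undo)
 also have "... = (SUM c':?R. ?in c') + card ?R * ?w D" by (simp add: sum.distrib)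
 finally have "Suc n * ?w D <= (SUM c':?R. ?in c') + (card ?R + 1) * ?w D" by simp
 also have "... <= (SUM c:?A. SUM c':removable (insert c D) - {c}. ?w (insert c D - {c'})) + card ?A * ?w D"
  by (intro add_mono swap mult_right_mono card_addable[OF D]) simp
 also have "... = (SUM c:?A. walks (Suc n) (insert c D))" by (simp add: step sum.distrib del: walks.simps)
 finally show ?case .
qed

definition total :: "nat => nat list => nat" where
 "total n \<mu> = (SUM D:diagrams n. walks n D * card (fillings D \<mu>))"

lemma total_snoc: "Suc n * total n \<mu> <= total (Suc n) (\<mu> @ [1])" proof -
 let ?S = "Sigma (diagrams (Suc n)) removable" and ?T = "Sigma (diagrams n) addable"
 have "Suc n * total n \<mu> = (SUM E:diagrams n. Suc n * walks n E * card (fillings E \<mu>))"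
  unfolding total_def sum_distrib_left by (simp only: mult.assoc)
 also have "... <= (SUM E:diagrams n. SUM c:addable E. walks (Suc n) (insert c E) * card (fillings E \<mu>))"
  unfolding sum_distrib_right[symmetric] by (intro sum_mono mult_right_mono walks_addable) auto
 also have "... = (SUM (E, c):?T. walks (Suc n) (insert c E) * card (fillings E \<mu>))"
  using finite_diagrams finite_addable by (intro sum.Sigma) auto
 also have "... = (SUM (D, c):?S. walks (Suc n) D * card (fillings (D - {c}) \<mu>))"
  by (rule sum.reindex_bij_witness[of _ "%(D, c). (D - {c}, c)" "%(E, c). (insert c E, c)"])
   (auto simp: removable_iff addable_iff insert_absorb simp del: walks.simps)
 also have "... = (SUM D:diagrams (Suc n). walks (Suc n) D * (SUM c:removable D. card (fillings (D - {c}) \<mu>)))"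
  unfolding sum_distrib_left using finite_diagrams finite_removable by (intro sum.Sigma[symmetric]) auto
 also have "... <= total (Suc n) (\<mu> @ [1])" unfolding total_def by (intro sum_mono mult_left_mono card_fillings_snoc) auto
 finally show ?thesis .
qed

lemma total_pos:
 assumes D: "D : diagrams n" and "1 <= walks n D" and \<tau>: "\<tau> : fillings D \<mu>"
 shows "1 <= total n \<mu>" proof -
 have "card (fillings D \<mu>) ~= 0" using finite_fillings[OF diagrams_finite[OF D], of \<mu>] \<tau> by auto
 then have "1 <= walks n D * card (fillings D \<mu>)" using assms(2) by simp
 also have "... <= total n \<mu>" unfolding total_def by (rule member_le_sum[OF D _ finite_diagrams]) simp
 finally show ?thesis .
qed

lemma total_row_pos: "1 <= total m [m]" proof (rule total_pos)
 let ?D = "%m. {1} \<times> {1..m} :: cell set"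
 show D: "?D m : diagrams m" for m by (rule diagramsI) auto
 show "1 <= walks m (?D m)" proof (induction m)
  case (Suc m)
  have e: "?D (Suc m) - {(1, Suc m)} = ?D m" by auto
  then have "(1, Suc m) : removable (?D (Suc m))" using removable_iff[OF D] D[of m] by auto
  from member_le_sum[OF this, of "%c. walks m (?D (Suc m) - {c})"] show ?case using Suc finite_removable[OF D] e by simp
 qed simp
 have "{c : ?D m. restrict (%c. 1) (?D m) c = (1::nat)} = ?D m" by auto
 then show "restrict (%c. 1) (?D m) : fillings (?D m) [m]" by (auto simp: fillings_def part_def)
qed

lemma total_empty_pos: "1 <= total 0 []" by (rule total_pos[of "{}"]) (auto intro!: diagramsI simp: fillings_empty)

lemma card_tabloids_snoc:
 assumes N: "finite N" "card N = Suc n" and le: "!!x. x : N ==> card (tabloids \<mu> (N - {x})) <= m"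
 shows "card (tabloids (\<mu> @ [1]) N) <= Suc n * m" proof -
 let ?h = "Suc (length \<mu>)"
 let ?S = "Sigma N (%x. tabloids \<mu> (N - {x}))"
 let ?g = "%(x, R). (R :: tabloid)(?h := {x})"
 have "tabloids (\<mu> @ [1]) N <= ?g ` ?S" proof
  fix R assume R: "R : tabloids (\<mu> @ [1]) N"
  have "part (\<mu> @ [1]) ?h = 1" by (simp add: part_def)
  then have "card (R ?h) = 1" using tabloid_card[OF R, of ?h] by simp
  then obtain x where x: "R ?h = {x}" by (auto simp: card_1_singleton_iff)
  have RN: "R a <= N" for a by (rule tabloid_subset[OF R])
  have xN: "x : N" using x RN by blast
  have notx: "x ~: R a" if "a ~= ?h" for a using tabloid_disjoint[OF R, of x a ?h] x that by auto
  have un: "(\<Union>a. R a) = N" by (rule tabloid_Union[OF R])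
  have "R(?h := {}) : tabloids \<mu> (N - {x})" unfolding tabloids_def mem_Collect_eq proof (intro conjI ballI allI impI)
   show "card ((R(?h := {})) a) = part \<mu> a" if "a : {1..length \<mu>}" for a proof -
   have "card (R a) = part (\<mu> @ [1]) a" by (rule tabloid_card[OF R])
   then show ?thesis using that by (auto simp: part_def nth_append)
   qed
   show "(R(?h := {})) a = {}" if "a ~: {1..length \<mu>}" for a using tabloid_empty[OF R, of a] that by auto
   show "disjoint_family (R(?h := {}))" unfolding disjoint_family_on_def using tabloid_disjoint[OF R] by auto
   show "(\<Union>a. (R(?h := {})) a) = N - {x}" proof (intro equalityI subsetI)
   fix y assume "y : N - {x}"
   then obtain a where "y : R a" "y ~= x" using un by auto
   then have "y : (R(?h := {})) a" using x by (cases "a = ?h") auto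
   then show "y : (\<Union>a. (R(?h := {})) a)" by blast
   next
   fix y assume "y : (\<Union>a. (R(?h := {})) a)"
   then obtain a where "y : R a" "a ~= ?h" by (auto split: if_splits)
   then show "y : N - {x}" using RN notx by auto
   qed
  qed
  then have "(x, R(?h := {})) : ?S" using xN by simp
  moreover have "R = ?g (x, R(?h := {}))" using x by (auto simp: fun_eq_iff)
  ultimately show "R : ?g ` ?S" by blast
 qed
 moreover have fin: "finite ?S" using N(1) by (intro finite_SigmaI finite_tabloids) auto
 ultimately have "card (tabloids (\<mu> @ [1]) N) <= card (?g ` ?S)" by (intro card_mono) auto
 also have "... <= card ?S" by (rule card_image_le[OF fin])
 also have "... = (SUM x:N. card (tabloids \<mu> (N - {x})))" using N(1) finite_tabloids by (intro card_SigmaI) auto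
 also have "... <= (SUM x:N. m)" by (rule sum_mono) (rule le)
 finally show ?thesis using N(2) by simp
qed

lemma card_tabloids_append_ones:
 assumes base: "!!N. finite N ==> card N = n ==> card (tabloids \<mu> N) <= total n \<mu>"
 shows "finite N ==> card N = n + q ==> card (tabloids (\<mu> @ replicate q 1) N) <= total (n + q) (\<mu> @ replicate q 1)"
proof (induction q arbitrary: N)
 case 0
 then show ?case using base by simp
next
 case (Suc q)
 have e: "\<mu> @ replicate (Suc q) 1 = (\<mu> @ replicate q 1) @ [1]" by (simp add: replicate_append_same)
 have c: "card N = Suc (n + q)" using Suc.prems(2) by simp
 have "card (tabloids (\<mu> @ replicate q 1) (N - {x})) <= total (n + q) (\<mu> @ replicate q 1)" if "x : N" for x
  by (rule Suc.IH) (use Suc.prems(1) c that in simp_all)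
 from card_tabloids_snoc[OF Suc.prems(1) c this]
 have "card (tabloids ((\<mu> @ replicate q 1) @ [1]) N) <= total (Suc (n + q)) ((\<mu> @ replicate q 1) @ [1])"
  by (rule le_trans[OF _ total_snoc])
 then show ?case unfolding e add_Suc_right .
qed

definition row_then_ones :: "nat list => bool" where
 "row_then_ones \<mu> \<longleftrightarrow> (EX q. \<mu> = replicate q 1 \<or> (EX m. \<mu> = m # replicate q 1))"

text \<open>Both sides are compared when a last row of length one is appended to \<mu>. The opposite inequality
will follow from linear independence.\<close>
theorem card_tabloids_le_total:
 assumes \<mu>: "row_then_ones \<mu>" and N: "finite N" "card N = sum_list \<mu>"
 shows "card (tabloids \<mu> N) <= total (card N) \<mu>" proof -
 have empty: "card (tabloids [] N) <= total 0 []" for N proof -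
  have "tabloids [] N <= {%_. {}}" proof
   fix R assume "R : tabloids [] N"
   then have "R a = {}" for a using tabloid_empty[of R "[]" N a] by simp
   then show "R : {%_. {}}" by (simp add: fun_eq_iff)
  qed
  then have "card (tabloids [] N) <= card {%_ :: nat. {} :: nat set}" by (rule card_mono[rotated]) simp
  also have "... = 1" by simp
  also have "... <= total 0 []" by (rule total_empty_pos)
  finally show ?thesis .
 qed
 have row: "card (tabloids [m] N) <= total m [m]" for m N proof -
  have "tabloids [m] N <= {(%_. {})(1 := N)}" proof
   fix R assume R: "R : tabloids [m] N"
   have z: "R a = {}" if "a ~= 1" for a using tabloid_empty[OF R, of a] that by simp
   have "R 1 = N" proof
   show "R 1 <= N" by (rule tabloid_subset[OF R])
   show "N <= R 1" proof
   fix x assume "x : N"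
   then obtain a where "x : R a" using tabloid_Union[OF R] by blast
   then show "x : R 1" using z[of a] by (cases "a = 1") auto
   qed
   qed
   then show "R : {(%_. {})(1 := N)}" using z by (simp add: fun_eq_iff)
  qed
  then have "card (tabloids [m] N) <= card {(%_ :: nat. {})(1 := N)}" by (rule card_mono[rotated]) simp
  also have "... = 1" by simp
  also have "... <= total m [m]" by (rule total_row_pos)
  finally show ?thesis .
 qed
 from \<mu> show ?thesis unfolding row_then_ones_def proof (elim exE disjE)
  fix q assume q: "\<mu> = replicate q 1"
  have "card N = 0 + q" using N(2) by (simp add: q sum_list_replicate)
  from card_tabloids_append_ones[OF empty N(1) this] show ?thesis using `card N = 0 + q` by (simp only: q append_Nil)
 next
  fix q m assume q: "\<mu> = m # replicate q 1"
  have "card N = m + q" using N(2) by (simp add: q sum_list_replicate)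
  from card_tabloids_append_ones[OF row N(1) this] show ?thesis using `card N = m + q` by (simp only: q append_Cons append_Nil)
 qed
qed


section \<open>Decomposition of the permutation modules\<close>

definition some_tableau :: "nat list => nat set => cell => nat" where
 "some_tableau lam N = (SOME t. t : tableaux lam N)"

definition specht_gen :: "nat list => nat set => tabloid => complex" where
 "specht_gen lam N = polytabloid lam N (some_tableau lam N)"

definition ysym :: "nat list => nat set => (tabloid => complex) => tabloid => complex" where
 "ysym lam N = young_sym lam N (some_tableau lam N)"

lemma some_tableau:
 assumes "finite N" "lam : partitions (card N)"
 shows "some_tableau lam N : tableaux lam N" unfolding some_tableau_def using tableaux_nonempty[OF assms(2,1)] by (simp add: some_in_eq)

lemma clin_ysym: "clin (ysym lam N)" unfolding ysym_def by (rule clin_young_sym)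

context
 fixes N :: "nat set" and lam :: "nat list"
 assumes N: "finite N" and lam: "lam : partitions (card N)"
begin

lemma specht_gen_in: "specht_gen lam N : specht lam N" unfolding specht_gen_def by (rule polytabloid_in_specht[OF some_tableau[OF N lam]])

lemma specht_gen_nonzero: "specht_gen lam N ~= 0" using polytabloid_diag[OF N some_tableau[OF N lam]] unfolding specht_gen_def by auto

lemma specht_gen_span: "specht lam N = cspan {tact p (specht_gen lam N) | p. p permutes N}"
 unfolding specht_gen_def by (rule specht_cyclic[OF N some_tableau[OF N lam]])

lemma ysym_line: "f : specht lam N ==> EX z. ysym lam N f = cscale z (specht_gen lam N)" unfolding specht_gen_def ysym_def
 by (rule young_sym_line[OF N lam some_tableau[OF N lam]]) (use specht_subset_free[OF N] in blast)

lemma ysym_other: "\<mu> : partitions m ==> \<mu> ~= lam ==> f : specht \<mu> N ==> ysym lam N f = 0"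
 unfolding ysym_def by (rule young_sym_other[OF N lam _ _ some_tableau[OF N lam]])

lemma ysym_detects: "s : specht lam N ==> s ~= 0 ==> EX p. p permutes N & ysym lam N (tact p s) ~= 0"
 unfolding ysym_def by (rule young_sym_detects[OF N lam some_tableau[OF N lam]])

lemma specht_image_eq: "specht_image lam N \<tau> = tmap lam N \<tau> ` specht lam N" unfolding specht_image_def
 by (rule image_cong[OF refl], rule tableau_map_eq[OF N]) (use specht_subset_free[OF N] in blast)

lemma subspace_specht_image: "cs.subspace (specht_image lam N \<tau>)"
 unfolding specht_image_eq by (rule subspace_image[OF clin_tmap subspace_specht])

lemma tmap_tact_specht: "p permutes N ==> s : specht lam N ==> tmap lam N \<tau> (tact p s) = tact p (tmap lam N \<tau> s)"
 by (rule tmap_tact[OF N _ subsetD[OF specht_subset_free[OF N]]])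

lemma tmap_ysym_specht: "s : specht lam N ==> tmap lam N \<tau> (ysym lam' N s) = ysym lam' N (tmap lam N \<tau> s)"
 unfolding ysym_def by (rule tmap_young_sym[OF N subsetD[OF specht_subset_free[OF N]]])

lemma tact_specht_image:
 assumes "p permutes N" "v : specht_image lam N \<tau>"
 shows "tact p v : specht_image lam N \<tau>" proof -
 obtain s where s: "s : specht lam N" "v = tmap lam N \<tau> s" using assms(2) unfolding specht_image_eq by blast
 show ?thesis unfolding s(2) tmap_tact_specht[OF assms(1) s(1), symmetric] specht_image_eq by (intro imageI tact_specht[OF N assms(1) s(1)])
qed

lemma tmap_gen_in: "tmap lam N \<tau> (specht_gen lam N) : specht_image lam N \<tau>" unfolding specht_image_eq using specht_gen_in by blast

lemma tmap_gen_nonzero: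
 assumes "\<tau> : semistandard lam \<mu>"
 shows "tmap lam N \<tau> (specht_gen lam N) ~= 0" proof
 assume z: "tmap lam N \<tau> (specht_gen lam N) = 0"
 have "(SUM \<tau>':semistandard lam \<mu>. cscale (if \<tau>' = \<tau> then 1 else 0) (tmap lam N \<tau>' (specht_gen lam N))) = 0"
  by (rule sum.neutral) (auto simp: z)
 from tmap_polytabloid_independent[OF N some_tableau[OF N lam] this[unfolded specht_gen_def] assms]
 show False by simp
qed

lemma ysym_image_line:
 assumes "v : specht_image lam N \<tau>"
 shows "EX z. ysym lam N v = cscale z (tmap lam N \<tau> (specht_gen lam N))" proof -
 obtain s where s: "s : specht lam N" "v = tmap lam N \<tau> s" using assms unfolding specht_image_eq by blast
 obtain z where "ysym lam N s = cscale z (specht_gen lam N)" using ysym_line[OF s(1)] by blast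
 then show ?thesis unfolding s(2) tmap_ysym_specht[OF s(1), symmetric] by (metis clin_scale[OF clin_tmap])
qed

lemma ysym_image_detects:
 assumes \<tau>: "\<tau> : semistandard lam \<mu>" and v: "v : specht_image lam N \<tau>" "v ~= 0"
 shows "EX p. p permutes N & ysym lam N (tact p v) ~= 0" proof -
 obtain s where s: "s : specht lam N" "v = tmap lam N \<tau> s" using v(1) unfolding specht_image_eq by blast
 have "s ~= 0" using v(2) s(2) clin_zero[OF clin_tmap] by blast
 then obtain p where p: "p permutes N" "ysym lam N (tact p s) ~= 0" using ysym_detects[OF s(1)] by blast
 have ps: "tact p s : specht lam N" by (rule tact_specht[OF N p(1) s(1)])
 obtain z where z: "ysym lam N (tact p s) = cscale z (specht_gen lam N)" using ysym_line[OF ps] by blast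
 have "z ~= 0" using p(2) z by auto
 have "ysym lam N (tact p v) = cscale z (tmap lam N \<tau> (specht_gen lam N))"
  unfolding s(2) tmap_tact_specht[OF p(1) s(1), symmetric] tmap_ysym_specht[OF ps, symmetric] z by (rule clin_scale[OF clin_tmap])
 then have "ysym lam N (tact p v) ~= 0" using `z ~= 0` tmap_gen_nonzero[OF \<tau>] by (simp add: cs.scale_eq_0_iff)
 then show ?thesis using p(1) by blast
qed

lemma specht_image_span:
 "specht_image lam N \<tau> = cspan {tact p (tmap lam N \<tau> (specht_gen lam N)) | p. p permutes N}" proof
 show "cspan {tact p (tmap lam N \<tau> (specht_gen lam N)) | p. p permutes N} <= specht_image lam N \<tau>"
  by (rule cspan_minimal[OF _ subspace_specht_image]) (use tact_specht_image tmap_gen_in in blast)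
 show "specht_image lam N \<tau> <= cspan {tact p (tmap lam N \<tau> (specht_gen lam N)) | p. p permutes N}" unfolding specht_image_eq
 proof (rule image_subsetI)
  fix s assume "s : specht lam N"
  then have "s : cspan {tact p (specht_gen lam N) | p. p permutes N}" using specht_gen_span by simp
  then show "tmap lam N \<tau> s : cspan {tact p (tmap lam N \<tau> (specht_gen lam N)) | p. p permutes N}"
  proof (rule span_induct_lin[OF _ _ clin_tmap subspace_cspan])
   fix u assume "u : {tact p (specht_gen lam N) | p. p permutes N}"
   then obtain p where p: "p permutes N" "u = tact p (specht_gen lam N)" by blast
   show "tmap lam N \<tau> u : cspan {tact p (tmap lam N \<tau> (specht_gen lam N)) | p. p permutes N}"
   unfolding p(2) tmap_tact_specht[OF p(1) specht_gen_in] using p(1) by (blast intro: cspan_base)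
  qed
 qed
qed

end

lemma tmap_specht_independent:
 assumes N: "finite N"
  and s: "!!lam \<tau>. lam : partitions (card N) ==> \<tau> : semistandard lam \<mu> ==> s (lam, \<tau>) : specht lam N"
  and zero: "(SUM (lam, \<tau>):Sigma (partitions (card N)) (%lam. semistandard lam \<mu>). tmap lam N \<tau> (s (lam, \<tau>))) = 0"
  and l: "lam : partitions (card N)" "\<tau> : semistandard lam \<mu>"
 shows "s (lam, \<tau>) = 0" proof (rule ccontr)
 assume "s (lam, \<tau>) ~= 0"
 then obtain p where p: "p permutes N" "ysym lam N (tact p (s (lam, \<tau>))) ~= 0" using ysym_detects[OF N l(1) s[OF l]] by blast
 let ?P = "partitions (card N)" and ?S = "%lam. semistandard lam \<mu>"
 let ?L = "%f. ysym lam N (tact p f)"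
 have cl: "clin ?L" by (rule clin_comp[OF clin_ysym clin_tact])
 have tr: "?L (tmap lam' N \<tau>' (s (lam', \<tau>'))) = tmap lam' N \<tau>' (?L (s (lam', \<tau>')))"
  if "lam' : ?P" "\<tau>' : ?S lam'" for lam' \<tau>' using tmap_tact_specht[OF N that(1) p(1) s[OF that]]
   tmap_ysym_specht[OF N that(1) tact_specht[OF N p(1) s[OF that]]] by simp
 have "EX z. ?L (s (lam, \<tau>')) = cscale z (specht_gen lam N)" if "\<tau>' : ?S lam" for \<tau>'
  by (rule ysym_line[OF N l(1) tact_specht[OF N p(1) s[OF l(1) that]]])
 then obtain z where z: "!!\<tau>'. \<tau>' : ?S lam ==> ?L (s (lam, \<tau>')) = cscale (z \<tau>') (specht_gen lam N)" by metis
 have "0 = ?L (SUM (lam, \<tau>):Sigma ?P ?S. tmap lam N \<tau> (s (lam, \<tau>)))" unfolding zero by (rule clin_zero[OF cl, symmetric])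
 also have "... = (SUM (lam', \<tau>'):Sigma ?P ?S. tmap lam' N \<tau>' (?L (s (lam', \<tau>'))))"
  unfolding clin_sum[OF cl] by (rule sum.cong[OF refl]) (auto simp: tr)
 also have "... = (SUM lam':?P. SUM \<tau>':?S lam'. tmap lam' N \<tau>' (?L (s (lam', \<tau>'))))"
  by (rule sum.Sigma[symmetric]) (simp_all add: finite_partitions finite_semistandard)
 also have "... = (SUM lam':?P. if lam' = lam then SUM \<tau>':?S lam. tmap lam N \<tau>' (?L (s (lam, \<tau>'))) else 0)"
 proof (rule sum.cong[OF refl])
  fix lam' assume l': "lam' : ?P"
  show "(SUM \<tau>':?S lam'. tmap lam' N \<tau>' (?L (s (lam', \<tau>')))) =
   (if lam' = lam then SUM \<tau>':?S lam. tmap lam N \<tau>' (?L (s (lam, \<tau>'))) else 0)" proof (cases "lam' = lam")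
   case False
   have "?L (s (lam', \<tau>')) = 0" if "\<tau>' : ?S lam'" for \<tau>'
   by (rule ysym_other[OF N l(1) l' False tact_specht[OF N p(1) s[OF l' that]]])
   then have "(SUM \<tau>':?S lam'. tmap lam' N \<tau>' (?L (s (lam', \<tau>')))) = 0"
   using clin_zero[OF clin_tmap] by (intro sum.neutral) metis
   then show ?thesis using False by simp
  qed simp
 qed
 also have "... = (SUM \<tau>':?S lam. tmap lam N \<tau>' (?L (s (lam, \<tau>'))))" using l(1) finite_partitions by simp
 also have "... = (SUM \<tau>':?S lam. cscale (z \<tau>') (tmap lam N \<tau>' (specht_gen lam N)))"
  by (rule sum.cong[OF refl]) (simp only: z clin_scale[OF clin_tmap])
 finally have "z \<tau> = 0" using tmap_polytabloid_independent[OF N some_tableau[OF N l(1)], of z \<mu> \<tau>] l(2)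
  by (simp only: specht_gen_def)
 then have "?L (s (lam, \<tau>)) = 0" using z[OF l(2)] by (simp only: cs.scale_zero_left)
 then show False using p(2) by simp
qed

lemma family_independent:
 assumes J: "finite J" and ind: "!!k j. (SUM j:J. cscale (k j) (g j)) = 0 ==> j : J ==> k j = 0"
 shows "inj_on g J" and "cs.independent (g ` J)" proof -
 show inj: "inj_on g J" proof (rule inj_onI, rule ccontr)
  fix i j assume ij: "i : J" "j : J" "g i = g j" "i ~= j"
  let ?k = "%l. if l = i then 1 else if l = j then -1 else (0 :: complex)"
  have "(SUM l:J. cscale (?k l) (g l)) = (SUM l:{i, j}. cscale (?k l) (g l))" by (rule sum.mono_neutral_right) (use J ij in auto)
  also have "... = 0" using ij by (auto simp: cscale_def fun_eq_iff)
  finally have "?k i = 0" by (rule ind) (rule ij(1))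
  then show False by simp
 qed
 show "cs.independent (g ` J)" proof (rule cs.independent_if_scalars_zero)
  show "finite (g ` J)" using J by simp
  fix c x assume z: "(SUM x:g ` J. cscale (c x) x) = 0" and x: "x : g ` J"
  then obtain j where j: "j : J" "x = g j" by blast
  have "(SUM j:J. cscale (c (g j)) (g j)) = 0" using z sum.reindex[OF inj, of "%x. cscale (c x) x"] by simp
  from ind[OF this j(1)] show "c x = 0" using j(2) by simp
 qed
qed

lemma independent_spans_free:
 assumes X: "finite X" and B: "finite B" "cs.independent B" "B <= free X" and card: "card X <= card B"
 shows "free X <= cspan B" proof
 fix f assume f: "f : free X"
 show "f : cspan B" proof (rule ccontr)
  assume nf: "f ~: cspan B"
  then have "cs.independent (insert f B)" using B(2) unfolding cspan_def by (rule cs.independent_insertI)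
  moreover have "insert f B <= cs.span (basis_vec ` X)" using f B(3) free_eq_cspan[OF X] unfolding cspan_def by blast
  ultimately have "card (insert f B) <= card (basis_vec ` X :: ('a => complex) set)"
   using cs.independent_span_bound[OF finite_imageI[OF X]] by blast
  also have "... <= card X" by (rule card_image_le[OF X])
  finally have "card (insert f B) <= card B" using card by simp
  moreover have "f ~: B" using nf cspan_base by blast
  ultimately show False using B(1) by simp
 qed
qed

lemma independent_family_spans:
 assumes X: "finite X" and J: "finite J" and g: "!!j. j : J ==> g j : free X" and card: "card X <= card J"
  and ind: "!!k j. (SUM j:J. cscale (k j) (g j)) = 0 ==> j : J ==> k j = 0" and f: "f : free X"
 shows "EX k. f = (SUM j:J. cscale (k j) (g j))" proof -
 have inj: "inj_on g J" by (rule family_independent(1)[OF J]) (rule ind)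
 have indep: "cs.independent (g ` J)" by (rule family_independent(2)[OF J]) (rule ind)
 have "free X <= cspan (g ` J)" by (rule independent_spans_free[OF X _ indep]) (use J g card card_image[OF inj] in auto)
 then have "f : range (%u. SUM v:g ` J. cscale (u v) v)" using f J unfolding cspan_def by (auto simp: cs.span_finite)
 then obtain u where "f = (SUM v:g ` J. cscale (u v) v)" by blast
 then have "f = (SUM j:J. cscale (u (g j)) (g j))" by (simp add: sum.reindex[OF inj])
 then show ?thesis by (intro exI)
qed

text \<open>Symmetrizing a relation between images isolates one partition and replaces its vectors by multiples
of one polytabloid, so that triangularity applies. The standard polytabloids then give as many independent
vectors as there are tabloids.\<close>
theorem specht_images_decompose:
 assumes N: "finite N" and \<mu>: "row_then_ones \<mu>" "sum_list \<mu> = card N"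
 shows "decomposes (Sigma (partitions (card N)) (%lam. semistandard lam \<mu>))
  (%(lam, \<tau>). specht_image lam N \<tau>) (free (tabloids \<mu> N))" proof -
 let ?n = "card N" and ?X = "tabloids \<mu> N"
 let ?P = "partitions ?n" and ?S = "%lam. semistandard lam \<mu>"
 let ?I = "Sigma ?P ?S" and ?F = "%lam. semistandard lam (replicate ?n 1)"
 let ?V = "%(lam, \<tau>). specht_image lam N \<tau>"
 have finI: "finite ?I" by (intro finite_SigmaI finite_partitions finite_semistandard)
 have sub: "cs.subspace (?V c)" "?V c <= free ?X" if "c : ?I" for c
  using that subspace_specht_image[OF N, of "fst c" "snd c"] specht_image_free[of "snd c" "fst c" \<mu> N]
  by (simp_all add: case_prod_beta mem_Sigma_iff[of "fst c" "snd c", simplified prod.collapse])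
 have indep: "v c = 0" if v: "!!c. c : ?I ==> v c : ?V c" and z: "(SUM c:?I. v c) = 0" and c: "c : ?I" for v c proof -
  have "ALL c:?I. EX s. s : specht (fst c) N & v c = tmap (fst c) N (snd c) s" proof
   fix c assume c: "c : ?I"
   then have "v c : specht_image (fst c) N (snd c)" using v[OF c] by (simp add: case_prod_beta)
   then show "EX s. s : specht (fst c) N & v c = tmap (fst c) N (snd c) s"
   using c unfolding mem_Sigma_iff by (subst (asm) specht_image_eq[OF N]) auto
  qed
  then obtain s where s: "!!c. c : ?I ==> s c : specht (fst c) N & v c = tmap (fst c) N (snd c) (s c)" by metis
  have "(SUM (lam, \<tau>):?I. tmap lam N \<tau> (s (lam, \<tau>))) = (SUM c:?I. v c)" by (rule sum.cong[OF refl]) (use s in auto)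
  then have "(SUM (lam, \<tau>):?I. tmap lam N \<tau> (s (lam, \<tau>))) = 0" using z by simp
  from tmap_specht_independent[OF N _ this, of "fst c" "snd c"]
  have "s c = 0" using s c by (auto simp: mem_Times_iff)
  then show ?thesis using s[OF c] clin_zero[OF clin_tmap] by metis
 qed
 obtain e where e: "bij_betw e {1..?n} N" using ex_bij_betw_nat_finite_1[OF N] by blast
 define J where "J = Sigma ?I (%c. ?F (fst c))"
 define g where "g = (%(c, \<sigma>). tmap (fst c) N (snd c) (polytabloid (fst c) N (e o \<sigma>)))"
 have finJ: "finite J" unfolding J_def by (intro finite_SigmaI finI finite_semistandard)
 have tab: "e o \<sigma> : tableaux lam N" if "lam : ?P" "\<sigma> : ?F lam" for lam \<sigma>
  unfolding tableaux_def using bij_betw_trans[OF standard_bij[OF that] e] by simp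
 have gV: "g (c, \<sigma>) : ?V c" if "c : ?I" "\<sigma> : ?F (fst c)" for c \<sigma> proof -
  have "fst c : ?P" using that(1) by auto
  then have "g (c, \<sigma>) : specht_image (fst c) N (snd c)" unfolding specht_image_eq[OF N `fst c : ?P`] g_def prod.case
   by (intro imageI polytabloid_in_specht tab that(2))
  then show ?thesis by (simp add: case_prod_beta)
 qed
 have gind: "k j = 0" if z: "(SUM j:J. cscale (k j) (g j)) = 0" and j: "j : J" for k j proof -
  obtain c \<sigma> where c: "j = (c, \<sigma>)" "c : ?I" "\<sigma> : ?F (fst c)" using j by (auto simp: J_def)
  define s where "s c = (SUM \<sigma>:?F (fst c). cscale (k (c, \<sigma>)) (polytabloid (fst c) N (e o \<sigma>)))" for c
  have "(SUM (lam, \<tau>):?I. tmap lam N \<tau> (s (lam, \<tau>))) = (SUM c:?I. SUM \<sigma>:?F (fst c). cscale (k (c, \<sigma>)) (g (c, \<sigma>)))"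
   by (rule sum.cong[OF refl]) (auto simp: s_def g_def clin_lincomb[OF clin_tmap])
  also have "... = (SUM (c, \<sigma>):J. cscale (k (c, \<sigma>)) (g (c, \<sigma>)))"
   unfolding J_def by (rule sum.Sigma) (simp_all add: finI finite_semistandard)
  also have "... = 0" using z by (simp add: case_prod_beta)
  finally have z': "(SUM (lam, \<tau>):?I. tmap lam N \<tau> (s (lam, \<tau>))) = 0" .
  have ss: "s (lam, \<tau>) : specht lam N" if "lam : ?P" "\<tau> : ?S lam" for lam \<tau> unfolding s_def fst_conv
   by (intro cs.subspace_sum[OF subspace_specht] cs.subspace_scale[OF subspace_specht] polytabloid_in_specht tab that(1))
  have c1: "fst c : ?P" "snd c : ?S (fst c)" using c(2) by auto
  have "s (fst c, snd c) = 0" by (rule tmap_specht_independent[OF N ss z' c1])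
  then have "(SUM \<sigma>:?F (fst c). cscale (k (c, \<sigma>)) (polytabloid (fst c) N (e o \<sigma>))) = 0" by (simp add: s_def)
  from standard_polytabloids_independent[OF N c1(1) e this c(3)] show ?thesis using c(1) by simp
 qed
 have "card ?X <= total ?n \<mu>" by (rule card_tabloids_le_total[OF \<mu>(1) N]) (simp add: \<mu>(2))
 also have "... = (SUM lam:?P. walks ?n (cells lam) * card (fillings (cells lam) \<mu>))"
  unfolding total_def by (rule sum.reindex_bij_betw[OF bij_cells, symmetric])
 also have "... <= (SUM lam:?P. SUM \<tau>:?S lam. card (?F lam))" proof (rule sum_mono)
  fix lam assume "lam : ?P"
  then have "walks ?n (cells lam) <= card (?F lam)" unfolding semistandard_fillings by (rule walks_le[OF bspec[OF bij_betwE[OF bij_cells]]])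
  then have "walks ?n (cells lam) * card (?S lam) <= card (?F lam) * card (?S lam)" by (rule mult_le_mono1)
  then show "walks ?n (cells lam) * card (fillings (cells lam) \<mu>) <= (SUM \<tau>:?S lam. card (?F lam))"
   by (simp only: semistandard_fillings sum_constant mult.commute of_nat_id)
 qed
 also have "... = (SUM (lam, \<tau>):?I. card (?F lam))" by (rule sum.Sigma) (simp_all add: finite_partitions finite_semistandard)
 also have "... = card J" unfolding J_def case_prod_beta by (rule card_SigmaI[symmetric]) (simp_all add: finI finite_semistandard)
 finally have card: "card ?X <= card J" .
 have gX: "g j : free ?X" if "j : J" for j proof -
  obtain c \<sigma> where "c : ?I" "\<sigma> : ?F (fst c)" "j = (c, \<sigma>)" using `j : J` by (auto simp: J_def)
  then show ?thesis using gV sub(2) by blast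
 qed
 show ?thesis proof (rule decomposesI)
  show "finite ?I" by (rule finI)
  show "cs.subspace (?V c)" "?V c <= free ?X" if "c : ?I" for c using sub[OF that] .
  show "v c = 0" if "!!c. c : ?I ==> v c : ?V c" "(SUM c:?I. v c) = 0" "c : ?I" for v c by (rule indep[OF that])
  fix f assume f: "f : free ?X"
  have "EX k. f = (SUM j:J. cscale (k j) (g j))"
   by (rule independent_family_spans[OF finite_tabloids[OF N] finJ gX card _ f]) (assumption | rule gind)+
  then obtain k where k: "f = (SUM j:J. cscale (k j) (g j))" by blast
  let ?v = "%c. SUM \<sigma>:?F (fst c). cscale (k (c, \<sigma>)) (g (c, \<sigma>))"
  have "f = (SUM (c, \<sigma>):J. cscale (k (c, \<sigma>)) (g (c, \<sigma>)))" unfolding k by (rule sum.cong[OF refl]) auto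
  also have "... = (SUM c:?I. ?v c)" unfolding J_def by (rule sum.Sigma[symmetric]) (simp_all add: finI finite_semistandard)
  finally have "f = (SUM c:?I. ?v c)" .
  moreover have "?v c : ?V c" if c: "c : ?I" for c
   by (rule cs.subspace_sum[OF sub(1)[OF c]], rule cs.subspace_scale[OF sub(1)[OF c]], rule gV[OF c])
  ultimately show "EX v. (ALL c:?I. v c : ?V c) & f = (SUM c:?I. v c)" by (intro exI[of _ ?v]) blast
 qed
qed


section \<open>Wreath products\<close>

lemma wreath_carrier:
 "(\<alpha>, \<beta>) : carrier (wreath d k H) \<longleftrightarrow> \<alpha> : {1..k} \<rightarrow>\<^sub>E {p. p permutes {1..d}} & \<beta> : H"
 by (simp add: wreath_def sym_group_def)

lemma wreath_mult: "(\<alpha>, \<beta>) \<otimes>\<^bsub>wreath d k H\<^esub> (\<eta>, \<zeta>) = (\<lambda>i\<in>{1..k}. \<alpha> i o \<eta> (inv' \<beta> i), \<beta> o \<zeta>)"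
 by (simp add: wreath_def)

lemma wreath_one: "\<one>\<^bsub>wreath d k H\<^esub> = (\<lambda>i\<in>{1..k}. id, id)" by (simp add: wreath_def)

definition perm_group :: "nat => (nat => nat) set => bool" where
 "perm_group k H \<longleftrightarrow> (ALL \<beta>:H. \<beta> permutes {1..k}) & id : H &
   (ALL \<beta>:H. ALL \<zeta>:H. \<beta> o \<zeta> : H) & (ALL \<beta>:H. inv' \<beta> : H)"

lemma
 assumes "perm_group k H"
 shows perm_groupD: "\<beta> : H ==> \<beta> permutes {1..k}"
  and perm_group_id: "id : H"
  and perm_group_comp: "\<beta> : H ==> \<zeta> : H ==> \<beta> o \<zeta> : H"
  and perm_group_inv: "\<beta> : H ==> inv' \<beta> : H" using assms unfolding perm_group_def by blast+

lemma perm_group_sym: "perm_group k (carrier (sym_group k))"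
 by (auto simp: perm_group_def sym_group_def permutes_id permutes_compose permutes_inv)

definition winv :: "nat => wr => wr" where
 "winv k = (%(\<alpha>, \<beta>). (\<lambda>i\<in>{1..k}. inv' (\<alpha> (\<beta> i)), inv' \<beta>))"

lemma wreath_perm:
 assumes "(\<alpha>, \<beta>) : carrier (wreath d k H)" "i : {1..k}"
 shows "\<alpha> i permutes {1..d}" using assms by (auto simp: wreath_carrier PiE_iff)

context
 fixes d k :: nat and H :: "(nat => nat) set"
 assumes H: "perm_group k H"
begin

lemma wreath_closed:
 assumes "g : carrier (wreath d k H)" "h : carrier (wreath d k H)"
 shows "g \<otimes>\<^bsub>wreath d k H\<^esub> h : carrier (wreath d k H)" proof -
 obtain \<alpha> \<beta> \<eta> \<zeta> where gh: "g = (\<alpha>, \<beta>)" "h = (\<eta>, \<zeta>)" by (cases g, cases h)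
 have \<beta>: "\<beta> : H" "\<zeta> : H" using assms gh by (auto simp: wreath_carrier)
 have "\<alpha> i o \<eta> (inv' \<beta> i) permutes {1..d}" if i: "i : {1..k}" for i proof -
  have "inv' \<beta> i : {1..k}" using i permutes_in_image[OF permutes_inv[OF perm_groupD[OF H \<beta>(1)]]] by blast
  then show ?thesis using assms gh i by (intro permutes_compose wreath_perm) auto
 qed
 then have "(\<lambda>i\<in>{1..k}. \<alpha> i o \<eta> (inv' \<beta> i)) : {1..k} \<rightarrow>\<^sub>E {p. p permutes {1..d}}"
  by (simp add: restrict_PiE_iff)
 then show ?thesis unfolding gh wreath_mult wreath_carrier using perm_group_comp[OF H \<beta>] by blast
qed

lemma wreath_one_closed: "\<one>\<^bsub>wreath d k H\<^esub> : carrier (wreath d k H)"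
 unfolding wreath_one wreath_carrier using perm_group_id[OF H] by (auto simp: permutes_id)

lemma winv_closed:
 assumes "g : carrier (wreath d k H)"
 shows "winv k g : carrier (wreath d k H)" proof -
 obtain \<alpha> \<beta> where g: "g = (\<alpha>, \<beta>)" by (cases g)
 have \<beta>: "\<beta> : H" using assms g by (simp add: wreath_carrier)
 have "inv' (\<alpha> (\<beta> i)) permutes {1..d}" if i: "i : {1..k}" for i proof -
  have "\<beta> i : {1..k}" using i permutes_in_image[OF perm_groupD[OF H \<beta>]] by blast
  then show ?thesis using assms g by (intro permutes_inv wreath_perm) auto
 qed
 then have "(\<lambda>i\<in>{1..k}. inv' (\<alpha> (\<beta> i))) : {1..k} \<rightarrow>\<^sub>E {p. p permutes {1..d}}"
  by (simp add: restrict_PiE_iff)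
 then show ?thesis unfolding g winv_def prod.case wreath_carrier using perm_group_inv[OF H \<beta>] by blast
qed

lemma winv_left:
 assumes "g : carrier (wreath d k H)"
 shows "winv k g \<otimes>\<^bsub>wreath d k H\<^esub> g = \<one>\<^bsub>wreath d k H\<^esub>" proof -
 obtain \<alpha> \<beta> where g: "g = (\<alpha>, \<beta>)" by (cases g)
 have \<beta>: "\<beta> permutes {1..k}" using assms g perm_groupD[OF H] by (simp add: wreath_carrier)
 have "inv' (\<alpha> (\<beta> i)) o \<alpha> (inv' (inv' \<beta>) i) = id" if i: "i : {1..k}" for i proof -
  have "\<beta> i : {1..k}" using i permutes_in_image[OF \<beta>] by blast
  then have "\<alpha> (\<beta> i) permutes {1..d}" using assms g by (intro wreath_perm) auto
  then show ?thesis using permutes_o_inv(2) inv_inv_eq[OF permutes_bij[OF \<beta>]] by simp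
 qed
 then show ?thesis unfolding g winv_def prod.case wreath_mult wreath_one using permutes_o_inv(2)[OF \<beta>] by (auto intro!: restrict_ext)
qed

lemma wreath_group: "group (wreath d k H)" proof (rule groupI)
 show "EX y:carrier (wreath d k H). y \<otimes>\<^bsub>wreath d k H\<^esub> x = \<one>\<^bsub>wreath d k H\<^esub>"
  if "x : carrier (wreath d k H)" for x using winv_closed[OF that] winv_left[OF that] by blast
 show "\<one>\<^bsub>wreath d k H\<^esub> \<otimes>\<^bsub>wreath d k H\<^esub> x = x" if x: "x : carrier (wreath d k H)" for x proof -
  obtain \<alpha> \<beta> where g: "x = (\<alpha>, \<beta>)" by (cases x)
  have "(\<lambda>i\<in>{1..k}. (\<lambda>i\<in>{1..k}. id) i o \<alpha> (inv' id i)) = \<alpha>"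
   by (rule extensionalityI[of _ "{1..k}"]) (use x g in \<open>simp_all add: wreath_carrier PiE_iff inv_id\<close>)
  then show ?thesis unfolding g wreath_one wreath_mult by simp
 qed
 show "x \<otimes>\<^bsub>wreath d k H\<^esub> y \<otimes>\<^bsub>wreath d k H\<^esub> z = x \<otimes>\<^bsub>wreath d k H\<^esub> (y \<otimes>\<^bsub>wreath d k H\<^esub> z)"
  if x: "x : carrier (wreath d k H)" and y: "y : carrier (wreath d k H)" and z: "z : carrier (wreath d k H)" for x y z proof -
  obtain \<alpha> \<beta> \<eta> \<zeta> \<theta> \<xi> where g: "x = (\<alpha>, \<beta>)" "y = (\<eta>, \<zeta>)" "z = (\<theta>, \<xi>)" by (cases x, cases y, cases z)
  have \<beta>: "\<beta> permutes {1..k}" "\<zeta> permutes {1..k}" using x y g perm_groupD[OF H] by (auto simp: wreath_carrier)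
  have "inv' (\<beta> o \<zeta>) = inv' \<zeta> o inv' \<beta>" by (rule o_inv_distrib[OF permutes_bij[OF \<beta>(1)] permutes_bij[OF \<beta>(2)]])
  moreover have "inv' \<beta> i : {1..k}" if "i : {1..k}" for i using that permutes_in_image[OF permutes_inv[OF \<beta>(1)]] by blast
  ultimately show ?thesis unfolding g wreath_mult by (auto simp: comp_assoc intro!: restrict_ext)
 qed
qed (rule wreath_closed, assumption+, rule wreath_one_closed)

lemma winv_eq:
 assumes "g : carrier (wreath d k H)"
 shows "inv\<^bsub>wreath d k H\<^esub> g = winv k g"
 by (rule group.inv_equality[OF wreath_group winv_left[OF assms] assms winv_closed[OF assms]])

end

lemma finite_wreath:
 assumes "finite H"
 shows "finite (carrier (wreath d k H))" proof -
 have "finite {p. p permutes {1..d}}" by (rule finite_permutations) simp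
 then have "finite ({1..k} \<rightarrow>\<^sub>E {p. p permutes {1..d}})" by (intro finite_PiE) auto
 then show ?thesis using assms by (simp add: wreath_def sym_group_def)
qed

section \<open>Permutation representations and submodules\<close>

lemma representationI:
 assumes "group G" "vector_space (scal M)" "module.subspace (scal M) (vecs M)"
  "!!g. g : carrier G ==> linear_between M M (act M g)"
  "!!x. x : vecs M ==> act M \<one>\<^bsub>G\<^esub> x = x"
  "!!g h x. g : carrier G ==> h : carrier G ==> x : vecs M ==> act M (g \<otimes>\<^bsub>G\<^esub> h) x = act M g (act M h x)"
 shows "representation G M" using assms by (simp add: representation_def representation_axioms_def)

lemma
 assumes "representation G M"
 shows rep_group: "group G" and rep_vector_space: "vector_space (scal M)"
  and rep_subspace: "module.subspace (scal M) (vecs M)"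
  and rep_linear: "g : carrier G ==> linear_between M M (act M g)"
  and rep_one: "x : vecs M ==> act M \<one>\<^bsub>G\<^esub> x = x"
  and rep_mult: "g : carrier G ==> h : carrier G ==> x : vecs M ==> act M (g \<otimes>\<^bsub>G\<^esub> h) x = act M g (act M h x)"
 using assms by (simp_all add: representation_def representation_axioms_def)

lemma
 assumes "linear_between M N f" "x : vecs M"
 shows linear_between_in: "f x : vecs N"
  and linear_between_add: "y : vecs M ==> f (x + y) = f x + f y"
  and linear_between_scale: "f (scal M c x) = scal N c (f x)" using assms unfolding linear_between_def by blast+

lemma submodule_representation:
 assumes M: "representation G M" and U: "submodule G M U"
 shows "representation G (M(|vecs := U|))" proof (rule representationI)
 have sub: "U <= vecs M" and inv: "!!g x. g : carrier G ==> x : U ==> act M g x : U"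
  and ss: "module.subspace (scal M) U" using U unfolding submodule_def by blast+
 show "group G" "vector_space (scal (M(|vecs := U|)))" using rep_group[OF M] rep_vector_space[OF M] by simp_all
 show "module.subspace (scal (M(|vecs := U|))) (vecs (M(|vecs := U|)))" using ss by simp
 show "linear_between (M(|vecs := U|)) (M(|vecs := U|)) (act (M(|vecs := U|)) g)" if g: "g : carrier G" for g
  using rep_linear[OF M g] sub inv[OF g] unfolding linear_between_def by (simp add: subset_iff)
 show "act (M(|vecs := U|)) \<one>\<^bsub>G\<^esub> x = x" if "x : vecs (M(|vecs := U|))" for x using rep_one[OF M] sub that by auto
 show "act (M(|vecs := U|)) (g \<otimes>\<^bsub>G\<^esub> h) x = act (M(|vecs := U|)) g (act (M(|vecs := U|)) h x)"
  if "g : carrier G" "h : carrier G" "x : vecs (M(|vecs := U|))" for g h x using rep_mult[OF M that(1,2)] sub that(3) by auto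
qed

definition perm_action :: "('g, 'm) monoid_scheme => 'x set => ('g => 'x => 'x) => bool" where
 "perm_action G X \<phi> \<longleftrightarrow> group G & finite X & (ALL g:carrier G. ALL x:X. \<phi> g x : X) &
   (ALL x:X. \<phi> \<one>\<^bsub>G\<^esub> x = x) &
   (ALL g:carrier G. ALL h:carrier G. ALL x:X. \<phi> (g \<otimes>\<^bsub>G\<^esub> h) x = \<phi> g (\<phi> h x))"

lemma perm_ext_action:
 fixes G (structure)
 assumes P: "perm_action G X \<phi>" and g: "g : carrier G" and f: "f : free X"
 shows "perm_ext \<phi> g f = (%y. if y : X then f (\<phi> (inv\<^bsub>G\<^esub> g) y) else 0)" proof
 interpret group G using P by (simp add: perm_action_def)
 have fin: "finite X" and cl: "!!g x. g : carrier G ==> x : X ==> \<phi> g x : X"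
  and one: "!!x. x : X ==> \<phi> \<one> x = x"
  and mult: "!!g h x. g : carrier G ==> h : carrier G ==> x : X ==> \<phi> (g \<otimes> h) x = \<phi> g (\<phi> h x)"
  using P unfolding perm_action_def by blast+
 have ig: "inv g : carrier G" using g by simp
 have li: "\<phi> (inv g) (\<phi> g x) = x" "\<phi> g (\<phi> (inv g) x) = x" if "x : X" for x
  using mult[OF ig g that] mult[OF g ig that] g one[OF that] by simp_all
 have inj: "inj_on (\<phi> g) X" by (rule inj_on_inverseI) (rule li(1))
 fix y
 show "perm_ext \<phi> g f y = (if y : X then f (\<phi> (inv g) y) else 0)" proof (cases "y : X")
  case True
  have "perm_ext \<phi> g f (\<phi> g (\<phi> (inv g) y)) = f (\<phi> (inv g) y)"
   by (rule perm_ext_apply(1)[where X = X and \<phi> = \<phi> and g = g, OF f fin inj cl[OF ig True]])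
  then show ?thesis using True li(2)[OF True] by simp
 next
  case False
  then have "y ~: \<phi> g ` X" using cl[OF g] by blast
  then have "perm_ext \<phi> g f y = 0" by (rule perm_ext_apply(2)[where X = X and \<phi> = \<phi> and g = g, OF f fin inj])
  then show ?thesis using False by simp
 qed
qed

lemma perm_representation:
 fixes G (structure)
 assumes P: "perm_action G X \<phi>"
 shows "representation G (|vecs = free X, scal = cscale, act = perm_ext \<phi>|)" proof (rule representationI)
 interpret group G using P by (simp add: perm_action_def)
 show "group G" ..
 have cl: "!!g x. g : carrier G ==> x : X ==> \<phi> g x : X"
  and one: "!!x. x : X ==> \<phi> \<one> x = x"
  and mult: "!!g h x. g : carrier G ==> h : carrier G ==> x : X ==> \<phi> (g \<otimes> h) x = \<phi> g (\<phi> h x)"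
  using P unfolding perm_action_def by blast+
 note eq = perm_ext_action[OF P]
 have in_free: "perm_ext \<phi> g f : free X" if "g : carrier G" "f : free X" for g f by (simp add: eq[OF that] free_def)
 let ?M = "(|vecs = free X, scal = cscale, act = perm_ext \<phi>|)"
 show "vector_space (scal ?M)" by (simp add: vector_space_cscale)
 show "module.subspace (scal ?M) (vecs ?M)" by (simp add: subspace_free)
 show "linear_between ?M ?M (act ?M g)" if g: "g : carrier G" for g proof -
  have "perm_ext \<phi> g (x + y) = perm_ext \<phi> g x + perm_ext \<phi> g y" if xy: "x : free X" "y : free X" for x y
   using eq[OF g cs.subspace_add[OF subspace_free xy]] eq[OF g xy(1)] eq[OF g xy(2)] by (auto simp: fun_eq_iff)
  moreover have "perm_ext \<phi> g (cscale c x) = cscale c (perm_ext \<phi> g x)" if x: "x : free X" for c x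
   using eq[OF g cs.subspace_scale[OF subspace_free x]] eq[OF g x] by (auto simp: fun_eq_iff cscale_def)
  ultimately show ?thesis using in_free[OF g] by (simp add: linear_between_def)
 qed
 show "act ?M \<one> f = f" if f: "f : vecs ?M" for f proof -
  have "f : free X" using f by simp
  from eq[OF one_closed this] show ?thesis using f one by (auto simp: fun_eq_iff free_def)
 qed
 show "act ?M (g \<otimes> h) f = act ?M g (act ?M h f)" if g: "g : carrier G" and h: "h : carrier G" and f: "f : vecs ?M" for g h f proof -
  have f': "f : free X" using f by simp
  have "perm_ext \<phi> g (perm_ext \<phi> h f) = (%y. if y : X then f (\<phi> (inv h) (\<phi> (inv g) y)) else 0)"
   unfolding eq[OF g in_free[OF h f']] using eq[OF h f'] cl[of "inv g"] g by (auto simp: fun_eq_iff)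
  also have "... = perm_ext \<phi> (g \<otimes> h) f"
   unfolding eq[OF m_closed[OF g h] f'] using mult[of "inv h" "inv g"] g h by (auto simp: fun_eq_iff inv_mult_group)
  finally show ?thesis by simp
 qed
qed

section \<open>Induced modules\<close>

definition pscale :: "complex => ('g => 'x => complex) => 'g => 'x => complex" where
 "pscale c F = (%g. cscale c (F g))"

interpretation ps: vector_space "pscale :: complex => ('g => 'x => complex) => _"
 by unfold_locales (auto simp: pscale_def cscale_def fun_eq_iff algebra_simps)

locale induction_setup = group G for G :: "('g, 'm) monoid_scheme" (structure) +
 fixes H :: "'g set" and M :: "('g, 'x => complex) rep"
 assumes finG: "finite (carrier G)" and subH: "subgroup H G"
  and repM: "representation (G(|carrier := H|)) M" and scalM: "scal M = cscale"
begin

lemma H_carrier: "h : H ==> h : carrier G" using subgroup.subset[OF subH] by blast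

lemma H_inv: "h : H ==> inv h : H" by (rule subgroup.m_inv_closed[OF subH])

lemma H_mult: "h : H ==> h' : H ==> h \<otimes> h' : H" by (rule subgroup.m_closed[OF subH])

lemma H_one: "\<one> : H" by (rule subgroup.one_closed[OF subH])

lemma M_subspace: "cs.subspace (vecs M)" using rep_subspace[OF repM] by (simp add: scalM)

lemma M_act: "h : H ==> x : vecs M ==> act M h x : vecs M" using linear_between_in[OF rep_linear[OF repM]] by simp

lemma M_add: "h : H ==> x : vecs M ==> y : vecs M ==> act M h (x + y) = act M h x + act M h y"
 using linear_between_add[OF rep_linear[OF repM]] by simp

lemma M_scale: "h : H ==> x : vecs M ==> act M h (cscale c x) = cscale c (act M h x)"
 using linear_between_scale[OF rep_linear[OF repM], of h x c] by (simp add: scalM)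

lemma M_one: "x : vecs M ==> act M \<one> x = x" using rep_one[OF repM] by simp

lemma M_mult: "h : H ==> h' : H ==> x : vecs M ==> act M (h \<otimes> h') x = act M h (act M h' x)" using rep_mult[OF repM] by simp

lemma M_zero: "h : H ==> act M h 0 = 0" using M_scale[of h 0 0] cs.subspace_0[OF M_subspace] by (simp add: cs.scale_zero_left)

abbreviation "Ind \<equiv> induced G H M"

lemma ind_iff: "F : vecs Ind \<longleftrightarrow> (ALL g:carrier G. F g : vecs M) & (ALL g. g ~: carrier G --> F g = 0) &
  (ALL g:carrier G. ALL h:H. F (g \<otimes> h) = act M (inv h) (F g))" by (simp add: induced_def)

lemma ind_in: "F : vecs Ind ==> g : carrier G ==> F g : vecs M"
 and ind_out: "F : vecs Ind ==> g ~: carrier G ==> F g = 0"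
 and ind_equiv: "F : vecs Ind ==> g : carrier G ==> h : H ==> F (g \<otimes> h) = act M (inv h) (F g)" by (simp_all add: ind_iff)

lemma ind_act: "act Ind x F = (%g. if g : carrier G then F (inv x \<otimes> g) else 0)" by (simp add: induced_def)

lemma ind_scal: "scal Ind = pscale" by (simp add: induced_def scalM pscale_def fun_eq_iff)

lemma ind_subspace: "ps.subspace (vecs Ind)" unfolding ps.subspace_def proof (intro conjI ballI allI)
 show "0 : vecs Ind" using cs.subspace_0[OF M_subspace] M_zero H_inv by (simp add: ind_iff)
 fix F F' c assume F: "F : vecs Ind"
 show "pscale c F : vecs Ind" unfolding ind_iff pscale_def
  using cs.subspace_scale[OF M_subspace ind_in[OF F]] ind_out[OF F] ind_equiv[OF F] M_scale[OF H_inv ind_in[OF F]] by simp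
 assume F': "F' : vecs Ind"
 show "F + F' : vecs Ind" unfolding ind_iff using cs.subspace_add[OF M_subspace ind_in[OF F] ind_in[OF F']] ind_out[OF F] ind_out[OF F']
   ind_equiv[OF F] ind_equiv[OF F'] M_add[OF H_inv ind_in[OF F] ind_in[OF F']] by simp
qed

lemma ind_act_in:
 assumes F: "F : vecs Ind" and x: "x : carrier G"
 shows "act Ind x F : vecs Ind" proof -
 have "act M (inv h) (F (inv x \<otimes> g)) = F (inv x \<otimes> (g \<otimes> h))" if "g : carrier G" "h : H" for g h
  using ind_equiv[OF F, of "inv x \<otimes> g" h] that x H_carrier by (simp add: m_assoc)
 then show ?thesis unfolding ind_iff ind_act using ind_in[OF F] x H_carrier by simp
qed

lemma ind_representation: "representation G Ind" proof (rule representationI)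
 show "group G" ..
 show "vector_space (scal Ind)" unfolding ind_scal ..
 show "module.subspace (scal Ind) (vecs Ind)" unfolding ind_scal by (rule ind_subspace)
 show "linear_between Ind Ind (act Ind x)" if x: "x : carrier G" for x unfolding linear_between_def ind_scal using ind_act_in[OF _ x]
  by (auto simp: ind_act pscale_def fun_eq_iff cscale_def)
 show "act Ind \<one> F = F" if "F : vecs Ind" for F using ind_out[OF that] by (auto simp: ind_act fun_eq_iff)
 show "act Ind (x \<otimes> y) F = act Ind x (act Ind y F)" if "x : carrier G" "y : carrier G" for x y F
  using that by (auto simp: ind_act fun_eq_iff inv_mult_group m_assoc)
qed

lemma ind_act_one: "F : vecs Ind ==> h : H ==> act Ind h F \<one> = act M h (F \<one>)"
 using ind_equiv[of F \<one> "inv h"] H_inv[of h] H_carrier[of h] by (simp add: ind_act)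

definition delta :: "('x => complex) => 'g => 'x => complex" where
 "delta m = (%g. if g : H then act M (inv g) m else 0)"

lemma delta_in:
 assumes m: "m : vecs M"
 shows "delta m : vecs Ind" proof -
 have "delta m (g \<otimes> h) = act M (inv h) (delta m g)" if g: "g : carrier G" and h: "h : H" for g h proof (cases "g : H")
  case True
  then show ?thesis using h m H_mult H_inv H_carrier M_mult[of "inv h" "inv g" m] by (simp add: delta_def inv_mult_group)
 next
  case False
  have "g \<otimes> h ~: H" proof
   assume "g \<otimes> h : H"
   then have "(g \<otimes> h) \<otimes> inv h : H" using h H_inv H_mult by blast
   then show False using False g h H_carrier by (simp add: m_assoc)
  qed
  then show ?thesis using False h H_inv M_zero by (simp add: delta_def)
 qed
 then show ?thesis unfolding ind_iff using m M_act H_inv H_carrier cs.subspace_0[OF M_subspace] by (auto simp: delta_def)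
qed

lemma delta_act:
 assumes m: "m : vecs M" and h: "h : H"
 shows "delta (act M h m) = act Ind h (delta m)" proof
 fix g
 show "delta (act M h m) g = act Ind h (delta m) g" proof (cases "g : H")
  case True
  then show ?thesis using m h H_mult H_inv H_carrier M_mult[of "inv g" h m] by (simp add: delta_def ind_act inv_mult_group)
 next
  case False
  have "inv h \<otimes> g ~: H" if "g : carrier G" proof
   assume "inv h \<otimes> g : H"
   then have "h \<otimes> (inv h \<otimes> g) : H" using h H_mult by blast
   then show False using False h that H_carrier by (simp add: m_assoc[symmetric])
  qed
  then show ?thesis using False by (simp add: delta_def ind_act)
 qed
qed

lemma supported_eq_delta:
 assumes F: "F : vecs Ind" and supp: "!!g. g : carrier G ==> g ~: H ==> F g = 0"
 shows "F = delta (F \<one>)" proof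
 fix g
 show "F g = delta (F \<one>) g" proof (cases "g : H")
  case True
  then show ?thesis using ind_equiv[OF F one_closed True] H_carrier by (simp add: delta_def)
 next
  case False
  then show ?thesis using supp ind_out[OF F] by (cases "g : carrier G") (auto simp: delta_def)
 qed
qed

lemma ind_sum_delta:
 assumes F: "F : vecs Ind"
 shows "pscale (of_nat (card H)) F = (SUM g:carrier G. act Ind g (delta (F g)))" proof
 fix x
 show "pscale (of_nat (card H)) F x = (SUM g:carrier G. act Ind g (delta (F g))) x" proof (cases "x : carrier G")
  case x: True
  have tm: "act Ind g (delta (F g)) x = (if inv g \<otimes> x : H then F x else 0)" if g: "g : carrier G" for g
  proof (cases "inv g \<otimes> x : H")
   case True
   have "F (g \<otimes> (inv g \<otimes> x)) = act M (inv (inv g \<otimes> x)) (F g)" by (rule ind_equiv[OF F g True])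
   then show ?thesis using True x g by (simp add: ind_act delta_def m_assoc[symmetric])
  next
   case False
   then show ?thesis using x by (simp add: ind_act delta_def)
  qed
  have "card {g : carrier G. inv g \<otimes> x : H} = card H" proof (rule bij_betw_same_card[of "%g. inv g \<otimes> x"])
   show "bij_betw (%g. inv g \<otimes> x) {g : carrier G. inv g \<otimes> x : H} H"
   proof (rule bij_betw_byWitness[where f' = "%h. x \<otimes> inv h"])
   show "ALL g:{g : carrier G. inv g \<otimes> x : H}. x \<otimes> inv (inv g \<otimes> x) = g"
   using x by (simp add: inv_mult_group m_assoc[symmetric])
   show "ALL h:H. inv (x \<otimes> inv h) \<otimes> x = h" using x H_carrier by (simp add: inv_mult_group m_assoc)
   show "(%h. x \<otimes> inv h) ` H <= {g : carrier G. inv g \<otimes> x : H}" using x H_carrier by (auto simp: inv_mult_group m_assoc)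
   qed auto
  qed
  then have "(SUM g:carrier G. if inv g \<otimes> x : H then F x else 0) = cscale (of_nat (card H)) (F x)"
   using finG by (simp add: sum.inter_filter[symmetric] fun_eq_iff cscale_def sum_apply)
  moreover have "(SUM g:carrier G. act Ind g (delta (F g)) x) = (SUM g:carrier G. if inv g \<otimes> x : H then F x else 0)"
   by (rule sum.cong) (simp_all add: tm)
  ultimately show ?thesis by (subst sum_apply) (simp only: pscale_def)
 next
  case False
  then have "(SUM g:carrier G. act Ind g (delta (F g))) x = 0" by (subst sum_apply) (intro sum.neutral, simp add: ind_act)
  then show ?thesis using False ind_out[OF F] by (simp add: pscale_def)
 qed
qed

lemma delta_lin:
 assumes x: "x : vecs M" and y: "y : vecs M"
 shows "delta (cscale c x + y) = pscale c (delta x) + delta y" using x y H_inv M_scale M_add cs.subspace_scale[OF M_subspace x]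
 by (auto simp: delta_def pscale_def fun_eq_iff cscale_apply)

lemma delta_zero: "delta 0 = 0" using M_zero H_inv by (auto simp: delta_def fun_eq_iff)

lemma ind_conj:
 assumes F: "F : vecs Ind" and g: "g : carrier G" and y: "y : carrier G" and z: "z : H"
  and eq: "y \<otimes> g = g \<otimes> z"
 shows "act Ind y F g = act M z (F g)" proof -
 have zG: "z : carrier G" by (rule H_carrier[OF z])
 have "inv y \<otimes> g = inv y \<otimes> (g \<otimes> z) \<otimes> inv z" using g y zG by (simp add: m_assoc)
 also have "... = g \<otimes> inv z" unfolding eq[symmetric] using g y zG by (simp add: m_assoc[symmetric])
 finally show ?thesis using ind_equiv[OF F g H_inv[OF z]] g zG by (simp add: ind_act)
qed

context
 fixes U assumes U: "submodule G Ind U"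
begin

lemma sub_vecs: "F : U ==> F : vecs Ind"
 and sub_space: "ps.subspace U"
 and sub_act: "g : carrier G ==> F : U ==> act Ind g F : U" using U unfolding submodule_def ind_scal by blast+

lemma delta_part_subspace: "cs.subspace {m : vecs M. delta m : U}" unfolding cs.subspace_def mem_Collect_eq
proof (intro conjI ballI allI; (unfold mem_Collect_eq)?)
 show "0 : vecs M" by (rule cs.subspace_0[OF M_subspace])
 show "delta 0 : U" unfolding delta_zero by (rule ps.subspace_0[OF sub_space])
 fix x c assume x: "x : vecs M & delta x : U"
 show "cscale c x : vecs M" using x by (intro cs.subspace_scale[OF M_subspace]) simp
 have "delta (cscale c x + 0) = pscale c (delta x) + delta 0" using x by (intro delta_lin cs.subspace_0[OF M_subspace]) simp
 then show "delta (cscale c x) : U" using x by (simp add: delta_zero ps.subspace_scale[OF sub_space])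
 fix y assume y: "y : vecs M & delta y : U"
 show "x + y : vecs M" using x y by (intro cs.subspace_add[OF M_subspace]) simp_all
 have "delta (cscale 1 x + y) = pscale 1 (delta x) + delta y" using x y by (intro delta_lin) simp_all
 then show "delta (x + y) : U" using x y by (simp add: ps.subspace_add[OF sub_space])
qed

lemma delta_part_act: "h : H ==> m : vecs M ==> delta m : U ==> delta (act M h m) : U" by (simp only: delta_act sub_act[OF H_carrier])

lemma sub_combination:
 assumes "!!i. i : I ==> x i : carrier G" "F : U"
 shows "(SUM i:I. pscale (c i) (act Ind (x i) F)) : U"
 by (intro ps.subspace_sum[OF sub_space] ps.subspace_scale[OF sub_space] sub_act assms)

lemma sub_nonzero_at_one:
 assumes "U ~= {0}"
 shows "EX F:U. F \<one> ~= 0" proof -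
 obtain F where F: "F : U" "F ~= 0" using assms ps.subspace_0[OF sub_space] by blast
 then obtain g where g: "F g ~= 0" by (auto simp: fun_eq_iff)
 then have gG: "g : carrier G" using ind_out[OF sub_vecs[OF F(1)]] by blast
 have "act Ind (inv g) F \<one> = F g" using gG by (simp add: ind_act)
 then show ?thesis using sub_act[OF inv_closed[OF gG] F(1)] g by metis
qed

end

text \<open>The translates of the function supported on the subgroup with the generator as value at the
identity span the induced module.\<close>
theorem induced_irreducible:
 assumes m0: "m0 : vecs M" "m0 ~= 0" and gen: "vecs M <= cspan {act M h m0 | h. h : H}"
  and red: "!!U. submodule G Ind U ==> U ~= {0} ==> delta m0 : U"
 shows "irreducible_rep G Ind" unfolding irreducible_rep_def proof (intro conjI allI impI)
 show "representation G Ind" by (rule ind_representation)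
 show "vecs Ind ~= {0}" proof
  assume "vecs Ind = {0}"
  then have "delta m0 \<one> = 0" using delta_in[OF m0(1)] by simp
  then show False using m0 H_one M_one by (simp add: delta_def)
 qed
 fix U assume U: "submodule G Ind U"
 show "U = {0} \<or> U = vecs Ind" proof (cases "U = {0}")
  case False
  have "cspan {act M h m0 | h. h : H} <= {m : vecs M. delta m : U}" by (rule cspan_minimal[OF _ delta_part_subspace[OF U]])
   (use M_act m0(1) delta_part_act[OF U] red[OF U False] in blast)
  then have all: "delta m : U" if "m : vecs M" for m using gen that by blast have "vecs Ind <= U" proof
   fix F assume F: "F : vecs Ind"
   have "pscale (of_nat (card H)) F : U"
   unfolding ind_sum_delta[OF F] by (intro ps.subspace_sum[OF sub_space[OF U]] sub_act[OF U] all ind_in[OF F])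
   then have "pscale (1 / of_nat (card H)) (pscale (of_nat (card H)) F) : U" by (rule ps.subspace_scale[OF sub_space[OF U]])
   moreover have "card H ~= 0" using finite_subset[OF subgroup.subset[OF subH] finG] H_one by auto
   ultimately show "F : U" by simp
  qed
  then show ?thesis using sub_vecs[OF U] by blast
 qed simp
qed

end


section \<open>Positions of the rows of the tabloids\<close>

lemma single_row_partition: "1 <= d ==> [d] : partitions d" by (simp add: partitions_def)

lemma ell_pos: "1 <= d ==> 1 <= ell d"
 using single_row_partition[of d] finite_partitions[of d] by (auto simp: ell_def Suc_le_eq card_gt_0_iff)

lemma nu_bij: "bij_betw (nu d) {1..ell d} (partitions d)" proof -
 let ?L = "rev (sorted_list_of_set (partitions d))"
 have L: "distinct ?L" "set ?L = partitions d" using finite_partitions[of d] by simp_all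
 then have len: "length ?L = ell d" using distinct_card[OF L(1)] by (simp add: ell_def)
 have b: "bij_betw (%i. ?L ! i) {..<length ?L} (partitions d)" by (rule bij_betw_nth[OF L(1) refl L(2)[symmetric]])
 have c: "bij_betw (%a. a - 1) {1..ell d} {..<length ?L}" unfolding len by (rule bij_betw_byWitness[where f' = Suc]) auto
 show ?thesis using bij_betw_trans[OF c b] by (simp add: nu_def[abs_def] comp_def)
qed

lemma nu_in: "a : {1..ell d} ==> nu d a : partitions d" using bij_betwE[OF nu_bij[of d]] by blast

lemma nu_inj: "a : {1..ell d} ==> b : {1..ell d} ==> nu d a = nu d b ==> a = b" by (rule inj_onD[OF bij_betw_imp_inj_on[OF nu_bij[of d]]])

lemma partition_le_row:
 assumes "lam : partitions d"
 shows "lam <= [d]" proof (cases lam)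
 case (Cons x xs)
 have s: "x + sum_list xs = d" and nz: "0 ~: set xs" using assms Cons by (auto simp: partitions_def)
 show ?thesis proof (cases "x = d")
  case True
  then have "sum_list xs = 0" using s by simp
  then have "xs = []" using nz by (cases xs) auto
  then show ?thesis using True Cons by simp
 next
  case False
  then have "x < d" using s by simp
  then show ?thesis using Cons by simp
 qed
qed simp

lemma nu_one:
 assumes "1 <= d"
 shows "nu d 1 = [d]" proof -
 let ?S = "sorted_list_of_set (partitions d)"
 have S: "sorted ?S" "set ?S = partitions d" "?S ~= []" using finite_partitions[of d] single_row_partition[OF assms] by auto
 have "nu d 1 = last ?S" using S(3) by (simp add: nu_def hd_conv_nth[symmetric] hd_rev)
 moreover have "last ?S <= [d]" using S by (intro partition_le_row) (metis last_in_set)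
 moreover have "[d] <= last ?S" proof -
  have "[d] : set ?S" using S(2) single_row_partition[OF assms] by simp
  then obtain i where i: "i < length ?S" "?S ! i = [d]" by (auto simp: in_set_conv_nth)
  have "?S ! i <= ?S ! (length ?S - 1)" using i(1) by (intro sorted_nth_mono[OF S(1)]) auto
  then show ?thesis using i(2) last_conv_nth[OF S(3)] by simp
 qed
 ultimately show ?thesis by simp
qed

locale placement =
 fixes d k r :: nat and j :: "nat => nat"
 assumes rk: "r <= k" and j: "j : {1..r} \<rightarrow>\<^sub>E {1..ell d}" and d: "1 <= d"
begin

definition "cls a = jtilde_class k r j a"
definition "fib a = {i : {1..r}. j i = a}"
definition "color p = (if p <= r then j p else 1)"
definition "off a = (if a = (1::nat) then 1 else 0 :: nat)"
definition "Wset = PiE {1..ell d} (%a. tabloids (gamma k r j a) (cls a))"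
definition "Tens \<Lambda> \<tau> = tensor_space {1..ell d} (%a. specht_image (\<Lambda> a) (cls a) (\<tau> a))"

lemma cls_iff: "p : cls a \<longleftrightarrow> p : {1..k} & color p = a" by (auto simp: cls_def jtilde_class_def color_def)

lemma finite_cls: "finite (cls a)" by (rule finite_subset[of _ "{1..k}"]) (auto simp: cls_iff)

lemma finite_fib: "finite (fib a)" by (simp add: fib_def)

lemma j_in: "i : {1..r} ==> j i : {1..ell d}" using j by (rule PiE_mem)

lemma color_in: "p : {1..k} ==> color p : {1..ell d}" using j_in[of p] ell_pos[OF d] by (auto simp: color_def)

lemma color_fib: "i : {1..r} ==> color i = j i" by (simp add: color_def)

lemma fib_cls: "fib a <= cls a" using rk by (auto simp: fib_def cls_iff color_def)

lemma cls_fib: "a ~= 1 ==> cls a = fib a" by (auto simp: fib_def cls_iff color_def split: if_splits) (use rk in auto)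

lemma cls_one: "cls 1 = fib 1 \<union> {r+1..k}" using rk by (auto simp: fib_def cls_iff color_def split: if_splits)

lemma card_cls_one: "card (cls 1) = card (fib 1) + (k - r)" proof -
 have "fib 1 \<inter> {r+1..k} = {}" by (auto simp: fib_def)
 then show ?thesis unfolding cls_one by (subst card_Un_disjoint[OF finite_fib]) auto
qed

lemma gamma_eq: "gamma k r j a = (if a = 1 then [k - r] else []) @ replicate (card (fib a)) 1" by (simp add: gamma_def fib_def)

lemma length_gamma: "length (gamma k r j a) = off a + card (fib a)" by (simp add: gamma_eq off_def)

lemma sum_gamma: "sum_list (gamma k r j a) = card (cls a)" using card_cls_one cls_fib[of a] by (simp add: gamma_eq sum_list_replicate)

lemma row_then_ones_gamma: "row_then_ones (gamma k r j a)" by (cases "a = 1") (auto simp: row_then_ones_def gamma_eq)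

lemma part_gamma:
 assumes "b : {off a + 1..off a + card (fib a)}"
 shows "part (gamma k r j a) b = 1" using assms by (auto simp: part_def gamma_eq off_def nth_append nth_Cons')

lemma row_index_bij: "bij_betw (row_index j) (fib a) {off a + 1..off a + card (fib a)}" proof -
 let ?S = "%i. {i' : {1..i}. j i' = a}"
 have ri: "row_index j i = off a + card (?S i)" if "i : fib a" for i using that by (simp add: row_index_def off_def fib_def)
 have sub: "?S i <= fib a" if "i : fib a" for i using that by (auto simp: fib_def)
 have inj: "inj_on (row_index j) (fib a)" proof (rule linorder_inj_onI')
  fix x y assume xy: "x : fib a" "y : fib a" "x < y"
  have "?S x \<subset> ?S y" proof
   show "?S x <= ?S y" using xy(3) by auto
   have "y : ?S y" "y ~: ?S x" using xy by (auto simp: fib_def)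
   then show "?S x ~= ?S y" by blast
  qed
  then have "card (?S x) < card (?S y)" by (intro psubset_card_mono) auto
  then show "row_index j x ~= row_index j y" using ri xy by simp
 qed
 have "row_index j ` fib a <= {off a + 1..off a + card (fib a)}" proof (rule image_subsetI)
  fix i assume i: "i : fib a"
  have "i : ?S i" using i by (auto simp: fib_def)
  moreover have "finite (?S i)" by simp
  ultimately have "card (?S i) > 0" unfolding card_gt_0_iff by blast
  moreover have "card (?S i) <= card (fib a)" by (rule card_mono[OF finite_fib sub[OF i]])
  ultimately show "row_index j i : {off a + 1..off a + card (fib a)}" using ri[OF i] by simp
 qed
 then have "row_index j ` fib a = {off a + 1..off a + card (fib a)}" by (rule card_subset_eq[rotated]) (simp_all add: card_image[OF inj])
 then show ?thesis using inj by (simp add: bij_betw_def)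
qed

lemma row_index_in: "i : fib a ==> row_index j i : {off a + 1..off a + card (fib a)}" using bij_betwE[OF row_index_bij] by blast

lemma row_index_inj: "i : fib a ==> i' : fib a ==> row_index j i = row_index j i' ==> i = i'"
 by (rule inj_onD[OF bij_betw_imp_inj_on[OF row_index_bij]])

lemma fib_self: "i : {1..r} ==> i : fib (j i)" by (simp add: fib_def)

lemma Wset_tabloid: "w : Wset ==> a : {1..ell d} ==> w a : tabloids (gamma k r j a) (cls a)" unfolding Wset_def by (rule PiE_mem)

lemma finite_Wset: "finite Wset" unfolding Wset_def by (intro finite_PiE finite_tabloids finite_cls) simp

context
 fixes w assumes w: "w : Wset"
begin

lemma entry_row:
 assumes i: "i : {1..r}"
 shows "w (j i) (row_index j i) = {entry j w i}" proof -
 have "row_index j i : {off (j i) + 1..off (j i) + card (fib (j i))}" by (rule row_index_in[OF fib_self[OF i]])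
 then have "card (w (j i) (row_index j i)) = 1" using tabloid_card[OF Wset_tabloid[OF w j_in[OF i]]] part_gamma by simp
 then obtain p where "w (j i) (row_index j i) = {p}" by (auto simp: card_1_singleton_iff)
 then show ?thesis by (simp add: entry_def)
qed

lemma entry_in: "i : {1..r} ==> entry j w i : cls (j i)"
 using entry_row[of i] tabloid_subset[OF Wset_tabloid[OF w j_in], of i "row_index j i"] by simp

lemma entry_k: "i : {1..r} ==> entry j w i : {1..k}" using entry_in cls_iff by blast

lemma color_entry: "i : {1..r} ==> color (entry j w i) = j i" using entry_in cls_iff by blast

lemma entry_inj: "inj_on (entry j w) {1..r}" proof (rule inj_onI)
 fix i i' assume i: "i : {1..r}" "i' : {1..r}" and eq: "entry j w i = entry j w i'"
 have c: "j i = j i'" using color_entry[OF i(1)] color_entry[OF i(2)] eq by simp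
 have "entry j w i : w (j i) (row_index j i)" unfolding entry_row[OF i(1)] by (rule singletonI)
 moreover have "entry j w i : w (j i) (row_index j i')" unfolding c entry_row[OF i(2)] eq by (rule singletonI)
 ultimately have "row_index j i = row_index j i'" by (rule tabloid_disjoint[OF Wset_tabloid[OF w j_in[OF i(1)]]])
 then show "i = i'" using fib_self[OF i(1)] fib_self[OF i(2)] c by (intro row_index_inj[of i "j i"]) simp_all
qed

lemma entry_surj:
 assumes "a ~= 1" "p : cls a"
 obtains i where "i : {1..r}" "j i = a" "entry j w i = p" proof -
 have "entry j w ` fib a <= cls a" proof (rule image_subsetI)
  fix i assume "i : fib a"
  then have "i : {1..r}" "j i = a" by (simp_all add: fib_def)
  then show "entry j w i : cls a" using entry_in[of i] by simp
 qed
 moreover have "inj_on (entry j w) (fib a)" by (rule inj_on_subset[OF entry_inj]) (auto simp: fib_def)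
 ultimately have "entry j w ` fib a = fib a" using endo_inj_surj[OF finite_fib, of "entry j w" a] unfolding cls_fib[OF assms(1)] by blast
 then have "p : entry j w ` fib a" using assms(2) cls_fib[OF assms(1)] by simp
 then obtain i where "i : fib a" "p = entry j w i" by (rule imageE)
 then show ?thesis using that[of i] by (simp add: fib_def)
qed

lemma row_eq_entry:
 assumes "a : {1..ell d}" "b : {off a + 1..off a + card (fib a)}"
 obtains i where "i : {1..r}" "j i = a" "w a b = {entry j w i}" "row_index j i = b" proof -
 have "b : row_index j ` fib a" using assms(2) bij_betw_imp_surj_on[OF row_index_bij[of a]] by simp
 then obtain i where i: "i : fib a" "row_index j i = b" by blast
 then have "i : {1..r}" "j i = a" by (simp_all add: fib_def)
 then show ?thesis using that[of i] entry_row[of i] i(2) by simp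
qed

lemma first_row: "w 1 1 = cls 1 - entry j w ` fib 1" proof (intro equalityI subsetI)
 have 1: "1 : {1..ell d}" using ell_pos[OF d] by simp
 note t = Wset_tabloid[OF w 1]
 fix p assume p: "p : w 1 1"
 have "p ~: entry j w ` fib 1" proof
  assume "p : entry j w ` fib 1"
  then obtain i where "i : fib 1" and p3: "p = entry j w i" by blast
  then have i: "i : {1..r}" "j i = 1" by (simp_all add: fib_def)
  have "p : w (j i) (row_index j i)" unfolding entry_row[OF i(1)] p3 by (rule singletonI)
  then have "p : w 1 (row_index j i)" by (simp only: i(2))
  then have "row_index j i = 1" using tabloid_disjoint[OF t _ p] by blast
  moreover have "row_index j i : {off 1 + 1..off 1 + card (fib 1)}" using row_index_in[OF fib_self[OF i(1)]] i(2) by simp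
  ultimately show False by (simp add: off_def)
 qed
 then show "p : cls 1 - entry j w ` fib 1" using tabloid_subset[OF t] p by blast
next
 have 1: "1 : {1..ell d}" using ell_pos[OF d] by simp
 note t = Wset_tabloid[OF w 1]
 fix p assume p: "p : cls 1 - entry j w ` fib 1"
 then obtain b where b: "p : w 1 b" using tabloid_Union[OF t] by blast
 have "b : {1..length (gamma k r j 1)}" using tabloid_empty[OF t, of b] b by blast
 then have b': "b = 1 \<or> b : {off 1 + 1..off 1 + card (fib 1)}" unfolding length_gamma by (cases "b = 1") (simp_all add: off_def)
 have "b = 1" proof (rule ccontr)
  assume "b ~= 1"
  then have b1: "b : {off 1 + 1..off 1 + card (fib 1)}" using b' by blast
  obtain i where i: "i : {1..r}" "j i = 1" "w 1 b = {entry j w i}" "row_index j i = b" by (rule row_eq_entry[OF 1 b1])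
  have "i : fib 1" using i by (simp add: fib_def)
  moreover have "p = entry j w i" using b i(3) by simp
  ultimately have "p : entry j w ` fib 1" by blast
  then show False using p by blast
 qed
 then show "p : w 1 1" using b by simp
qed

end

lemma Wset_eqI:
 assumes w: "w : Wset" and w': "w' : Wset" and eq: "!!i. i : {1..r} ==> entry j w i = entry j w' i"
 shows "w = w'" proof (rule extensionalityI[of _ "{1..ell d}"])
 show "w : extensional {1..ell d}" "w' : extensional {1..ell d}" using w w' by (auto simp: Wset_def PiE_iff)
 fix a assume a: "a : {1..ell d}"
 note t = Wset_tabloid[OF w a] and t' = Wset_tabloid[OF w' a]
 show "w a = w' a" proof
  fix b
  have "b : {off a + 1..off a + card (fib a)} \<or> (a = 1 & b = 1) \<or> b ~: {1..length (gamma k r j a)}"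
   by (cases "a = 1") (simp_all add: length_gamma off_def, arith)
  then consider "b : {off a + 1..off a + card (fib a)}" | "a = 1" "b = 1" | "b ~: {1..length (gamma k r j a)}" by blast
  then show "w a b = w' a b" proof cases
   case 1
   obtain i where i: "i : {1..r}" "j i = a" "w a b = {entry j w i}" "row_index j i = b" by (rule row_eq_entry[OF w a 1])
   have "w' a b = {entry j w' i}" using entry_row[OF w' i(1)] i(2,4) by simp
   then show ?thesis using i(3) eq[OF i(1)] by simp
  next
   case 2
   have "entry j w ` fib 1 = entry j w' ` fib 1" by (rule image_cong[OF refl]) (use eq in \<open>auto simp: fib_def\<close>)
   then show ?thesis using 2 first_row[OF w] first_row[OF w'] by simp
  next
   case 3
   then show ?thesis using tabloid_empty[OF t] tabloid_empty[OF t'] by simp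
  qed
 qed
qed

text \<open>A tuple of tabloids is determined by the entries of its rows of length one: the only other row is
filled by what remains of the first class.\<close>
lemma Wset_ex:
 assumes inj: "inj_on p {1..r}" and col: "!!i. i : {1..r} ==> p i : cls (j i)"
 obtains w where "w : Wset" "!!i. i : {1..r} ==> entry j w i = p i" proof -
 let ?I = "%a. {off a + 1..off a + card (fib a)}"
 have pf: "p ` fib a <= cls a" for a using col unfolding fib_def by blast
 have injf: "inj_on p (fib a)" for a by (rule inj_on_subset[OF inj]) (auto simp: fib_def)
 define f where "f a x = (if x : p ` fib a then row_index j (inv_into (fib a) p x) else 1)" for a x
 define w where "w = (\<lambda>a\<in>{1..ell d}. %b. {x : cls a. f a x = b})"
 have fp: "f a (p i) = row_index j i" if "i : fib a" for a i using inv_into_f_f[OF injf that] that by (simp add: f_def)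
 have fo: "f a x = 1" if "x ~: p ` fib a" for a x using that by (simp add: f_def)
 have out: "a = 1" if "x : cls a" "x ~: p ` fib a" for a x proof (rule ccontr)
  assume a: "a ~= 1"
  have "p ` fib a = fib a" using pf[of a] injf[of a] unfolding cls_fib[OF a] by (intro endo_inj_surj finite_fib)
  then show False using that unfolding cls_fib[OF a] by simp
 qed
 have tab: "(%b. {x : cls a. f a x = b}) : tabloids (gamma k r j a) (cls a)" for a proof (rule fibres_tabloid)
  fix x assume x: "x : cls a"
  show "f a x : {1..length (gamma k r j a)}" proof (cases "x : p ` fib a")
   case True
   then obtain i where "i : fib a" "x = p i" by blast
   then show ?thesis using fp row_index_in[of i a] by (simp add: length_gamma)
  next
   case False
   then show ?thesis using out[OF x] fo by (simp add: length_gamma off_def)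
  qed
 next
  fix b assume b: "b : {1..length (gamma k r j a)}"
  show "card {x : cls a. f a x = b} = part (gamma k r j a) b" proof (cases "b : ?I a")
   case True
   then have "b : row_index j ` fib a" using bij_betw_imp_surj_on[OF row_index_bij[of a]] by simp
   then obtain i where i: "i : fib a" "row_index j i = b" by blast
   have "x = p i" if x: "x : cls a" "f a x = b" for x proof (cases "x : p ` fib a")
   case True
   then obtain i' where i': "i' : fib a" "x = p i'" by blast
   then show ?thesis using row_index_inj[OF i'(1) i(1)] fp[OF i'(1)] x(2) i(2) by simp
   next
   case False
   then show ?thesis using out[OF x(1)] fo x(2) `b : ?I a` by (simp add: off_def)
   qed
   moreover have "p i : cls a" "f a (p i) = b" using pf[of a] i fp[OF i(1)] by auto
   ultimately have "{x : cls a. f a x = b} = {p i}" by blast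
   then show ?thesis using part_gamma[OF True] by simp
  next
   case False
   then have ab: "a = 1" "b = 1" using b by (auto simp: length_gamma off_def split: if_splits)
   have "f 1 (p i) ~= 1" if "i : fib 1" for i using fp[OF that] row_index_in[OF that] by (simp add: off_def)
   then have "f 1 x = 1 \<longleftrightarrow> x ~: p ` fib 1" for x using fo[of x 1] by (metis imageE)
   then have "{x : cls 1. f 1 x = 1} = cls 1 - p ` fib 1" by blast
   also have "card ... = k - r" unfolding card_Diff_subset[OF finite_imageI[OF finite_fib] pf] card_image[OF injf] card_cls_one by simp
   finally show ?thesis unfolding ab by (simp add: part_def gamma_eq)
  qed
 qed
 have "w : Wset" using tab by (simp add: w_def Wset_def restrict_PiE_iff)
 moreover have "entry j w i = p i" if i: "i : {1..r}" for i proof -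
  have "p i : w (j i) (row_index j i)" using fp[OF fib_self[OF i]] col[OF i] j_in[OF i] by (simp add: w_def)
  then show ?thesis using entry_row[OF `w : Wset` i] by simp
 qed
 ultimately show ?thesis by (rule that)
qed

section \<open>The action of the stabilizer of the colouring\<close>

abbreviation "Sj \<equiv> S_j k r j"
abbreviation "GG \<equiv> wreath_sym d k"
abbreviation gmult (infixl "\<cdot>" 70) where "g \<cdot> h \<equiv> g \<otimes>\<^bsub>GG\<^esub> h"
abbreviation "ginv \<equiv> m_inv GG"
abbreviation "HH \<equiv> wreath d k Sj"

lemma Sj_iff: "\<beta> : Sj \<longleftrightarrow> \<beta> permutes {1..k} & (ALL a. \<beta> ` cls a = cls a)" by (simp add: S_j_def cls_def)

lemma Sj_color:
 assumes "\<beta> permutes {1..k}"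
 shows "\<beta> : Sj \<longleftrightarrow> (ALL p:{1..k}. color (\<beta> p) = color p)" proof
 assume "\<beta> : Sj"
 then show "ALL p:{1..k}. color (\<beta> p) = color p" proof (intro ballI)
  fix p assume "\<beta> : Sj" "p : {1..k}"
  then have "p : cls (color p)" "\<beta> ` cls (color p) = cls (color p)" by (simp_all add: cls_iff Sj_iff)
  then have "\<beta> p : cls (color p)" by blast
  then show "color (\<beta> p) = color p" by (simp add: cls_iff)
 qed
next
 assume c: "ALL p:{1..k}. color (\<beta> p) = color p"
 have "\<beta> ` cls a = cls a" for a proof (rule endo_inj_surj[OF finite_cls])
  show "\<beta> ` cls a <= cls a" proof (rule image_subsetI)
   fix p assume "p : cls a"
   then have "p : {1..k}" "color p = a" by (simp_all only: cls_iff)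
   then show "\<beta> p : cls a" using c permutes_in_image[OF assms, of p] unfolding cls_iff by blast
  qed
  show "inj_on \<beta> (cls a)" by (rule inj_on_subset[OF permutes_inj[OF assms]]) simp
 qed
 then show "\<beta> : Sj" using assms by (simp add: Sj_iff)
qed

lemma Sj_perm_group: "perm_group k Sj" unfolding perm_group_def proof (intro conjI ballI)
 show "\<beta> permutes {1..k}" if "\<beta> : Sj" for \<beta> using that by (simp add: Sj_iff)
 show "id : Sj" by (simp add: Sj_iff permutes_id)
 show "\<beta> o \<zeta> : Sj" if "\<beta> : Sj" "\<zeta> : Sj" for \<beta> \<zeta> proof -
  have "(\<beta> o \<zeta>) ` cls a = \<beta> ` \<zeta> ` cls a" for a by (rule image_comp[symmetric])
  then show ?thesis using that unfolding Sj_iff by (simp add: permutes_compose del: image_comp)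
 qed
 show "inv' \<beta> : Sj" if "\<beta> : Sj" for \<beta> proof -
  have b: "\<beta> permutes {1..k}" using that by (simp add: Sj_iff)
  have "inv' \<beta> ` \<beta> ` cls a = cls a" for a by (rule image_inv_f_f[OF permutes_inj[OF b]])
  then have "inv' \<beta> ` cls a = cls a" for a using that unfolding Sj_iff by metis
  then show ?thesis using permutes_inv[OF b] by (simp add: Sj_iff)
 qed
qed

lemma Sj_permutes: "\<beta> : Sj ==> \<beta> permutes {1..k}" by (simp add: Sj_iff)

lemma HH_group: "group HH" by (rule wreath_group[OF Sj_perm_group])

lemma GG_group: "group GG" by (rule wreath_group[OF perm_group_sym])

lemma HH_sub: "carrier HH <= carrier GG" using Sj_permutes by (auto simp: wreath_def sym_group_def)

lemma HH_eq: "GG(|carrier := carrier HH|) = HH" by (simp add: wreath_def)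

lemma HH_subgroup: "subgroup (carrier HH) GG" by (rule group.group_incl_imp_subgroup[OF GG_group HH_sub]) (simp add: HH_eq HH_group)

lemma finite_GG: "finite (carrier GG)" by (rule finite_wreath) (simp add: sym_group_def finite_permutations)

definition wact :: "(nat => nat) => (nat => tabloid) => nat => tabloid" where
 "wact \<beta> w = (\<lambda>a\<in>{1..ell d}. perm_tabloid \<beta> (w a))"

lemma wact_in:
 assumes "\<beta> : Sj" "w : Wset"
 shows "wact \<beta> w : Wset" unfolding Wset_def wact_def proof (rule restrict_PiE_iff[THEN iffD2], rule ballI)
 fix a assume a: "a : {1..ell d}"
 show "perm_tabloid \<beta> (w a) : tabloids (gamma k r j a) (cls a)"
  by (rule perm_tabloid_image[OF permutes_inj[OF Sj_permutes[OF assms(1)]] _ Wset_tabloid[OF assms(2) a]])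
   (use assms(1) in \<open>simp add: Sj_iff\<close>)
qed

lemma entry_wact:
 assumes "w : Wset" "i : {1..r}"
 shows "entry j (wact \<beta> w) i = \<beta> (entry j w i)" proof -
 have "wact \<beta> w (j i) (row_index j i) = {\<beta> (entry j w i)}"
  using entry_row[OF assms] j_in[OF assms(2)] by (simp add: wact_def perm_tabloid_def)
 then show ?thesis by (simp add: entry_def[of j "wact \<beta> w"])
qed

lemma wact_comp: "wact (\<beta> o \<zeta>) w = wact \<beta> (wact \<zeta> w)" by (auto simp: wact_def perm_tabloid_comp fun_eq_iff)

lemma wact_id: "w : Wset ==> wact id w = w" by (auto simp: wact_def Wset_def PiE_iff extensional_def fun_eq_iff)

lemma act_base_eq:
 "act_base d r j (\<alpha>, \<beta>) (b, w) = (\<lambda>i\<in>{1..r}. perm_tabloid (\<alpha> (\<beta> (entry j w i))) (b i), wact \<beta> w)"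
 by (simp add: act_base_def wact_def)

definition Bset :: "(nat => nat) => (nat => tabloid) set" where
 "Bset q = PiE {1..r} (%i. tabloids (mu d (q i)) {1..d})"

lemma finite_Bset: "finite (Bset q)" unfolding Bset_def by (intro finite_PiE finite_tabloids) auto

lemma act_base_action: "perm_action HH (Bset q \<times> Wset) (act_base d r j)" unfolding perm_action_def proof (intro conjI ballI)
 show "group HH" by (rule HH_group)
 show "finite (Bset q \<times> Wset)" using finite_Bset finite_Wset by simp
next
 fix g x assume g: "g : carrier HH" and x: "x : Bset q \<times> Wset"
 obtain \<alpha> \<beta> b w where e: "g = (\<alpha>, \<beta>)" "x = (b, w)" by (cases g, cases x)
 have \<beta>: "\<beta> : Sj" and bw: "b : Bset q" "w : Wset" using g x e by (auto simp: wreath_carrier)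
 have "perm_tabloid (\<alpha> (\<beta> (entry j w i))) (b i) : tabloids (mu d (q i)) {1..d}" if i: "i : {1..r}" for i
 proof (rule perm_tabloid_tabloids)
  have "\<beta> (entry j w i) : {1..k}" using entry_k[OF bw(2) i] permutes_in_image[OF Sj_permutes[OF \<beta>]] by blast
  then show "\<alpha> (\<beta> (entry j w i)) permutes {1..d}" using g e wreath_perm by blast
  show "b i : tabloids (mu d (q i)) {1..d}" using bw(1) i by (auto simp: Bset_def)
 qed
 then show "act_base d r j g x : Bset q \<times> Wset"
  unfolding e act_base_eq using wact_in[OF \<beta> bw(2)] by (simp add: Bset_def restrict_PiE_iff)
next
 fix x assume x: "x : Bset q \<times> Wset"
 obtain b w where e: "x = (b, w)" by (cases x)
 have bw: "b : Bset q" "w : Wset" using x e by auto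
 have "perm_tabloid ((\<lambda>i\<in>{1..k}. id) (entry j w i)) (b i) = b i" if "i : {1..r}" for i using entry_k[OF bw(2) that] by simp
 then have "(\<lambda>i\<in>{1..r}. perm_tabloid ((\<lambda>i\<in>{1..k}. id) (entry j w i)) (b i)) = restrict b {1..r}"
  by (rule restrict_ext)
 also have "... = b" using bw(1) by (intro extensional_restrict) (simp add: Bset_def PiE_iff)
 finally have "(\<lambda>i\<in>{1..r}. perm_tabloid ((\<lambda>i\<in>{1..k}. id) (entry j w i)) (b i)) = b" .
 then show "act_base d r j \<one>\<^bsub>HH\<^esub> x = x" unfolding e wreath_one act_base_eq using wact_id[OF bw(2)] by simp
next
 fix g h x assume g: "g : carrier HH" and h: "h : carrier HH" and x: "x : Bset q \<times> Wset"
 obtain \<alpha> \<beta> \<eta> \<zeta> b w where e: "g = (\<alpha>, \<beta>)" "h = (\<eta>, \<zeta>)" "x = (b, w)" by (cases g, cases h, cases x)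
 have \<beta>: "\<beta> : Sj" "\<zeta> : Sj" and bw: "b : Bset q" "w : Wset" using g h x e by (auto simp: wreath_carrier)
 have fac: "perm_tabloid ((\<lambda>i\<in>{1..k}. \<alpha> i o \<eta> (inv' \<beta> i)) ((\<beta> o \<zeta>) (entry j w i))) (b i) =
   perm_tabloid (\<alpha> (\<beta> (entry j (wact \<zeta> w) i))) (perm_tabloid (\<eta> (\<zeta> (entry j w i))) (b i))"
  if i: "i : {1..r}" for i proof -
  have "\<zeta> (entry j w i) : {1..k}" using entry_k[OF bw(2) i] permutes_in_image[OF Sj_permutes[OF \<beta>(2)]] by blast
  then have "\<beta> (\<zeta> (entry j w i)) : {1..k}" using permutes_in_image[OF Sj_permutes[OF \<beta>(1)]] by blast
  then show ?thesis using permutes_inverses(2)[OF Sj_permutes[OF \<beta>(1)]] by (simp add: entry_wact[OF bw(2) i] perm_tabloid_comp)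
 qed
 show "act_base d r j (g \<otimes>\<^bsub>HH\<^esub> h) x = act_base d r j g (act_base d r j h x)"
  unfolding e wreath_mult act_base_eq wact_comp by (intro arg_cong2[where f = Pair] restrict_ext refl) (simp only: restrict_apply' fac)
qed

end


section \<open>Vectors attached to positions\<close>

lemma specht_row_trivial:
 assumes N: "finite N" "card N = d" "1 <= d" and p: "p permutes N" and s: "s : specht [d] N"
 shows "tact p s = s" proof -
 have fixR: "perm_tabloid p R = R" if R: "R : tabloids [d] N" for R proof
  fix a
  show "perm_tabloid p R a = R a" proof (cases "a = 1")
   case True
   have "R 1 = N" by (rule card_subset_eq[OF N(1) tabloid_subset[OF R]]) (simp add: tabloid_card[OF R] part_def N(2))
   then show ?thesis using True permutes_image[OF p] by (simp add: perm_tabloid_def)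
  next
   case False
   then have "R a = {}" by (intro tabloid_empty[OF R]) simp
   then show ?thesis by (simp add: perm_tabloid_def)
  qed
 qed
 have sf: "s : free (tabloids [d] N)" using s specht_subset_free[OF N(1)] by blast
 have "tact p s - s : {0}" proof (rule free_induct_lin[OF sf finite_tabloids[OF N(1)] _ subspace_singleton_zero])
  show "clin (%f. tact p f - f)" by (rule clin_diff[OF clin_tact clin_id])
  show "tact p (basis_vec R) - basis_vec R : {0}" if "R : tabloids [d] N" for R
   using tact_basis[OF permutes_bij[OF p]] fixR[OF that] by simp
 qed
 then show ?thesis by simp
qed

definition yindex :: "nat list => nat set => ((nat => nat) \<times> (nat => nat)) set" where
 "yindex lam N = column_stabilizer lam N (some_tableau lam N) \<times> row_stabilizer lam N (some_tableau lam N)"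

definition ycoeff :: "(nat => nat) \<times> (nat => nat) => complex" where
 "ycoeff y = of_int (sign (fst y))"

definition yperm :: "(nat => nat) \<times> (nat => nat) => nat => nat" where
 "yperm y = fst y o snd y"

lemma ysym_expand: "ysym lam N f = (SUM y:yindex lam N. cscale (ycoeff y) (tact (yperm y) f))"
 unfolding ysym_def young_sym_expand yindex_def ycoeff_def yperm_def by (simp add: case_prod_beta)

lemma yperm_permutes: "y : yindex lam N ==> yperm y permutes N" unfolding yindex_def yperm_def
 by (auto intro!: permutes_compose dest: column_stabilizerD row_stabilizerD)

lemma ysym_tact_expand:
 assumes "s permutes N"
 shows "ysym lam N (tact s f) = (SUM y:yindex lam N. cscale (ycoeff y) (tact (yperm y o s) f))" unfolding ysym_expand
 by (intro sum.cong refl arg_cong2[where f = cscale] tact_comp[symmetric] permutes_bij[OF yperm_permutes]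
   permutes_bij[OF assms])

definition ytotal :: "nat list => nat set => complex" where
 "ytotal lam N = (SUM y:yindex lam N. ycoeff y)"

context
 fixes N :: "nat set" and d :: nat
 assumes N: "finite N" "card N = d" "1 <= d"
begin

lemma row_partition: "[d] : partitions (card N)" using single_row_partition[OF N(3)] N(2) by simp

lemma ysym_row:
 assumes s: "s : specht [d] N"
 shows "ysym lam N s = cscale (ytotal lam N) s" proof -
 have "ysym lam N s = (SUM y:yindex lam N. cscale (ycoeff y) s)" unfolding ysym_expand
  by (intro sum.cong refl arg_cong2[where f = cscale] specht_row_trivial[OF N yperm_permutes s])
 then show ?thesis by (simp only: ytotal_def cs.scale_sum_left)
qed

lemma ytotal_row: "ytotal [d] N ~= 0" proof
 assume z: "ytotal [d] N = 0"
 note g = specht_gen_in[OF N(1) row_partition]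
 obtain p where p: "p permutes N" "ysym [d] N (tact p (specht_gen [d] N)) ~= 0"
  using ysym_detects[OF N(1) row_partition g specht_gen_nonzero[OF N(1) row_partition]] by blast
 have "ysym [d] N (tact p (specht_gen [d] N)) = cscale 0 (specht_gen [d] N)" unfolding specht_row_trivial[OF N p(1) g] ysym_row[OF g] z ..
 then show False using p(2) by (simp only: cs.scale_zero_left)
qed

lemma ytotal_other:
 assumes "lam : partitions (card N)" "lam ~= [d]"
 shows "ytotal lam N = 0" proof -
 note g = specht_gen_in[OF N(1) row_partition]
 have "cscale (ytotal lam N) (specht_gen [d] N) = 0" unfolding ysym_row[OF g, symmetric]
  by (rule ysym_other[OF N(1) assms(1) row_partition _ g]) (use assms(2) in simp)
 then show ?thesis using specht_gen_nonzero[OF N(1) row_partition] by (simp only: cs.scale_eq_0_iff simp_thms)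
qed

end

locale placed_tensors = placement +
 fixes q :: "nat => nat" and \<sigma> :: "nat => cell => nat"
 assumes \<sigma>: "!!i. i : {1..r} ==> \<sigma> i : semistandard (nu d (j i)) (mu d (q i))"
begin

abbreviation "Nd \<equiv> {1..d}"
abbreviation "\<nu> p \<equiv> nu d (j p)"

definition "X = Bset q \<times> Wset"

lemma Nd: "finite Nd" "card Nd = d" "1 <= d" using d by simp_all

lemma nu_part: "p : {1..r} ==> \<nu> p : partitions (card Nd)" using nu_in[OF j_in] by simp

lemma nu_color_part: "p : {1..k} ==> nu d (color p) : partitions (card Nd)" using nu_in[OF color_in] by simp

lemma nu_color_one: "color p = 1 ==> nu d (color p) = [d]" using nu_one[OF d] by simp

lemma nu_color_ne:
 assumes "p : {1..k}" "p' : {1..k}" "color p ~= color p'"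
 shows "nu d (color p) ~= nu d (color p')" using nu_inj[OF color_in[OF assms(1)] color_in[OF assms(2)]] assms(3) by blast

lemma color_ne_one: "p : {1..k} ==> color p ~= 1 ==> p : {1..r} & j p = color p" by (auto simp: color_def split: if_splits)

text \<open>The permutation action on functions, extended by zero. It is used as an explicit formula because it
is linear on all functions.\<close>
definition bact :: "wr => (base => complex) => base => complex" where
 "bact h f = (%x. if x : X then f (act_base d r j (winv k h) x) else 0)"

lemma clin_bact: "clin (bact h)" by (rule clinI) (auto simp: bact_def fun_eq_iff cscale_def)

lemma perm_ext_bact:
 assumes "h : carrier HH" "f : free X"
 shows "perm_ext (act_base d r j) h f = bact h f" proof -
 have "perm_ext (act_base d r j) h f = (%y. if y : X then f (act_base d r j (inv\<^bsub>HH\<^esub> h) y) else 0)"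
  unfolding X_def by (rule perm_ext_action[OF act_base_action assms(1) assms(2)[unfolded X_def]])
 then show ?thesis unfolding bact_def winv_eq[OF Sj_perm_group assms(1)] .
qed

definition "us u \<longleftrightarrow> (ALL p:{1..r}. u p : specht (\<nu> p) Nd)"

lemma usD: "us u ==> p : {1..r} ==> u p : specht (\<nu> p) Nd" by (simp add: us_def)

definition slotv :: "(nat => tabloid => complex) => (nat => tabloid) => nat => tabloid => complex" where
 "slotv u w i = tmap (\<nu> i) Nd (\<sigma> i) (u (position j w i))"

definition placed :: "(nat => tabloid => complex) => ((nat => tabloid) => complex) => base => complex" where
 "placed u x = (%(b, w). x w * pure_tensor {1..r} (slotv u w) b)"

lemma position_in:
 assumes w: "w : Wset" and i: "i : {1..r}"
 shows "position j w i : {1..r}" and "j (position j w i) = j i" proof -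
 have "position j w i : {1..r} & j (position j w i) = j i" proof (cases "j i = 1")
  case True
  then show ?thesis using i by (simp add: position_def)
 next
  case False
  then show ?thesis using color_ne_one[OF entry_k[OF w i]] color_entry[OF w i] by (simp add: position_def)
 qed
 then show "position j w i : {1..r}" and "j (position j w i) = j i" by blast+
qed

lemma slotv_in:
 assumes "us u" "w : Wset" "i : {1..r}"
 shows "slotv u w i : specht_image (\<nu> i) Nd (\<sigma> i)" proof -
 have "u (position j w i) : specht (\<nu> i) Nd" using usD[OF assms(1) position_in(1)[OF assms(2,3)]] position_in(2)[OF assms(2,3)] by simp
 then show ?thesis unfolding slotv_def specht_image_eq[OF Nd(1) nu_part[OF assms(3)]] by (rule imageI)
qed

lemma image_free: "i : {1..r} ==> specht_image (\<nu> i) Nd (\<sigma> i) <= free (tabloids (mu d (q i)) Nd)"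
 by (rule specht_image_free[OF \<sigma>])

lemma placed_free:
 assumes u: "us u" and x: "x : free Wset"
 shows "placed u x : free X" unfolding free_def mem_Collect_eq proof (intro allI impI)
 fix y assume y: "y ~: X"
 obtain b w where bw: "y = (b, w)" by (cases y)
 show "placed u x y = 0" proof (cases "w : Wset")
  case True
  then have b: "b ~: PiE {1..r} (%i. tabloids (mu d (q i)) Nd)" using y bw by (simp add: X_def Bset_def)
  have "pure_tensor {1..r} (slotv u w) : tensor_space {1..r} (%i. specht_image (\<nu> i) Nd (\<sigma> i))"
   by (rule pure_tensor_in) (rule slotv_in[OF u True])
  also have "... <= free (PiE {1..r} (%i. tabloids (mu d (q i)) Nd))" by (rule tensor_space_free) (simp, rule image_free)
  finally have "pure_tensor {1..r} (slotv u w) b = 0" using b unfolding free_def by blast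
  then show ?thesis by (simp add: placed_def bw)
 next
  case False
  then have "x w = 0" using x unfolding free_def by blast
  then show ?thesis by (simp add: placed_def bw)
 qed
qed

lemma placed_cong:
 assumes "!!p. p : {1..r} ==> u p = u' p" and x: "x : free Wset"
 shows "placed u x = placed u' x" proof (rule HOL.ext, clarify)
 fix b w
 have "pure_tensor {1..r} (slotv u w) = pure_tensor {1..r} (slotv u' w)" if "w : Wset"
  by (rule pure_tensor_cong) (simp only: slotv_def assms(1)[OF position_in(1)[OF that]])
 then show "placed u x (b, w) = placed u' x (b, w)" using free_zero[OF x, of w] by (cases "w : Wset") (simp_all add: placed_def)
qed

lemma placed_tensor_eq:
 assumes u: "us u" and x: "x : free Wset"
 shows "placed_tensor d r j \<sigma> u x = placed u x" proof (rule HOL.ext, clarify)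
 fix b w
 have "pure_tensor {1..r} (%i. tableau_map (\<nu> i) Nd (\<sigma> i) (u (position j w i))) = pure_tensor {1..r} (slotv u w)"
  if w: "w : Wset" proof (rule pure_tensor_cong)
  fix i assume i: "i : {1..r}"
  have "u (position j w i) : free (tabloids (\<nu> i) Nd)"
   using usD[OF u position_in(1)[OF w i]] position_in(2)[OF w i] specht_subset_free[OF Nd(1)] by auto
  then show "tableau_map (\<nu> i) Nd (\<sigma> i) (u (position j w i)) = slotv u w i"
   unfolding slotv_def by (rule tableau_map_eq[OF Nd(1)])
 qed
 then show "placed_tensor d r j \<sigma> u x (b, w) = placed u x (b, w)"
  using free_zero[OF x, of w] by (cases "w : Wset") (simp_all add: placed_def placed_tensor_def)
qed

text \<open>How a group element acts on the two ingredients of a placed tensor: vectors of colour other than 1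
move with their positions, while those of colour 1 span a trivial module.\<close>
definition pu :: "(nat => nat => nat) => (nat => nat) => (nat => tabloid => complex) => nat => tabloid => complex" where
 "pu \<alpha> \<beta> u = (%p. if p : {1..r} & j p ~= 1 then tact (\<alpha> p) (u (inv' \<beta> p)) else u p)"

definition px :: "(nat => nat) => ((nat => tabloid) => complex) => (nat => tabloid) => complex" where
 "px \<beta> x = (%w. if w : Wset then x (wact (inv' \<beta>) w) else 0)"

lemma px_free: "px \<beta> x : free Wset" by (simp add: px_def free_def)

lemma clin_px: "clin (px \<beta>)" by (rule clinI) (auto simp: px_def fun_eq_iff cscale_def)

lemma Sj_inv_color:
 assumes "\<beta> : Sj" "p : {1..k}"
 shows "inv' \<beta> p : {1..k}" "color (inv' \<beta> p) = color p" proof -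
 have i: "inv' \<beta> : Sj" by (rule perm_group_inv[OF Sj_perm_group assms(1)])
 show "inv' \<beta> p : {1..k}" using permutes_in_image[OF Sj_permutes[OF i]] assms(2) by blast
 show "color (inv' \<beta> p) = color p" using Sj_color[OF Sj_permutes[OF i]] i assms(2) by blast
qed

lemma us_pu:
 assumes h: "(\<alpha>, \<beta>) : carrier HH" and u: "us u"
 shows "us (pu \<alpha> \<beta> u)" unfolding us_def proof
 fix p assume p: "p : {1..r}"
 have \<beta>: "\<beta> : Sj" using h by (simp add: wreath_carrier)
 have pk: "p : {1..k}" using p rk by simp
 show "pu \<alpha> \<beta> u p : specht (\<nu> p) Nd" proof (cases "j p = 1")
  case True
  then show ?thesis using usD[OF u p] by (simp add: pu_def)
 next
  case False
  then have c: "color (inv' \<beta> p) ~= 1" "color (inv' \<beta> p) = j p" using Sj_inv_color(2)[OF \<beta> pk] color_fib[OF p] by simp_all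
  have p': "inv' \<beta> p : {1..r}" "j (inv' \<beta> p) = j p" using color_ne_one[OF Sj_inv_color(1)[OF \<beta> pk] c(1)] c(2) by simp_all
  have "tact (\<alpha> p) (u (inv' \<beta> p)) : specht (\<nu> p) Nd"
   using tact_specht[OF Nd(1) wreath_perm[OF h pk] usD[OF u p'(1)]] p'(2) by simp
  then show ?thesis using False p by (simp add: pu_def)
 qed
qed

lemma bact_placed:
 assumes h: "(\<alpha>, \<beta>) : carrier HH" and u: "us u" and x: "x : free Wset"
 shows "bact (\<alpha>, \<beta>) (placed u x) = placed (pu \<alpha> \<beta> u) (px \<beta> x)" proof
 fix y :: base
 show "bact (\<alpha>, \<beta>) (placed u x) y = placed (pu \<alpha> \<beta> u) (px \<beta> x) y" proof (cases "y : X")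
  case False
  then have "placed (pu \<alpha> \<beta> u) (px \<beta> x) y = 0"
   using placed_free[OF us_pu[OF h u] px_free, of \<beta> x] unfolding free_def by blast
  then show ?thesis using False by (simp add: bact_def)
 next
  case True
  obtain b w where y: "y = (b, w)" by (cases y)
  have b: "b : Bset q" and w: "w : Wset" using True y by (simp_all add: X_def)
  have bext: "b : extensional {1..r}" using b by (simp add: Bset_def PiE_iff)
  have \<beta>: "\<beta> : Sj" using h by (simp add: wreath_carrier)
  have i\<beta>: "inv' \<beta> : Sj" by (rule perm_group_inv[OF Sj_perm_group \<beta>])
  let ?w = "wact (inv' \<beta>) w"
  have w': "?w : Wset" by (rule wact_in[OF i\<beta> w])
  let ?b = "\<lambda>i\<in>{1..r}. perm_tabloid (inv' (\<alpha> (entry j w i))) (b i)"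
  have "act_base d r j (winv k (\<alpha>, \<beta>)) (b, w) = (?b, ?w)" unfolding winv_def prod.case act_base_eq
  proof (intro arg_cong2[where f = Pair] restrict_ext refl)
   fix i assume i: "i : {1..r}"
   have "inv' \<beta> (entry j w i) : {1..k}" by (rule Sj_inv_color(1)[OF \<beta> entry_k[OF w i]])
   then show "perm_tabloid ((\<lambda>i\<in>{1..k}. inv' (\<alpha> (\<beta> i))) (inv' \<beta> (entry j w i))) (b i) =
   perm_tabloid (inv' (\<alpha> (entry j w i))) (b i)" by (simp only: restrict_apply' permutes_inverses(1)[OF Sj_permutes[OF \<beta>]])
  qed
  then have L: "bact (\<alpha>, \<beta>) (placed u x) y = x ?w * pure_tensor {1..r} (slotv u ?w) ?b"
   using True y by (simp add: bact_def placed_def)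
  have "slotv u ?w i (?b i) = slotv (pu \<alpha> \<beta> u) w i (b i)" if i: "i : {1..r}" for i proof -
   let ?e = "entry j w i"
   have ek: "?e : {1..k}" by (rule entry_k[OF w i])
   have ap: "\<alpha> ?e permutes Nd" by (rule wreath_perm[OF h ek])
   have us': "u (position j ?w i) : specht (\<nu> i) Nd" using usD[OF u position_in(1)[OF w' i]] position_in(2)[OF w' i] by simp
   have "slotv u ?w i (?b i) = tact (\<alpha> ?e) (slotv u ?w i) (b i)" using i by (simp add: tact_def)
   also have "tact (\<alpha> ?e) (slotv u ?w i) = tmap (\<nu> i) Nd (\<sigma> i) (tact (\<alpha> ?e) (u (position j ?w i)))"
   unfolding slotv_def by (rule tmap_tact_specht[OF Nd(1) nu_part[OF i] ap us', symmetric])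
   also have "tact (\<alpha> ?e) (u (position j ?w i)) = pu \<alpha> \<beta> u (position j w i)" proof (cases "j i = 1")
   case True
   then have "\<nu> i = [d]" using nu_one[OF d] by simp
   then have "tact (\<alpha> ?e) (u (position j ?w i)) = u (position j ?w i)" using specht_row_trivial[OF Nd ap] us' by simp
   then show ?thesis using True by (simp add: position_def pu_def)
   next
   case False
   have e: "?e : {1..r}" "j ?e = j i" using position_in[OF w i] False by (simp_all add: position_def)
   then show ?thesis using False by (simp add: position_def pu_def entry_wact[OF w i])
   qed
   finally show ?thesis by (simp only: slotv_def)
  qed
  then have "pure_tensor {1..r} (slotv u ?w) ?b = pure_tensor {1..r} (slotv (pu \<alpha> \<beta> u) w) b"
   using bext by (simp add: pure_tensor_def)
  then show ?thesis unfolding L using w by (simp add: y placed_def px_def)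
 qed
qed

definition ins :: "nat => (nat => nat) => wr" where
 "ins p s = (\<lambda>i\<in>{1..k}. if i = p then s else id, id)"

lemma ins_in: "s permutes Nd ==> ins p s : carrier HH" unfolding ins_def wreath_carrier restrict_PiE_iff
 using perm_group_id[OF Sj_perm_group] by (simp add: permutes_id)

lemma bact_ins_placed:
 assumes s: "s permutes Nd" and u: "us u" and x: "x : free Wset"
 shows "bact (ins p s) (placed u x) =
  (if p : {1..r} & j p ~= 1 then placed (u(p := tact s (u p))) x else placed u x)" proof -
 let ?\<alpha> = "\<lambda>i\<in>{1..k}. if i = p then s else id"
 have x': "px id x = x" proof
  fix w
  show "px id x w = x w" proof (cases "w : Wset")
   case True
   then show ?thesis by (simp only: px_def if_True inv_id wact_id)
  next
   case False
   then show ?thesis using x unfolding free_def px_def by simp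
  qed
 qed
 have "bact (ins p s) (placed u x) = placed (pu ?\<alpha> id u) x"
  using bact_placed[OF ins_in[OF s, of p, unfolded ins_def] u x] by (simp only: ins_def x')
 also have "... = (if p : {1..r} & j p ~= 1 then placed (u(p := tact s (u p))) x else placed u x)" proof (cases "p : {1..r} & j p ~= 1")
  case True
  have "placed (pu ?\<alpha> id u) x = placed (u(p := tact s (u p))) x" proof (rule placed_cong[OF _ x])
   fix p' assume "p' : {1..r}"
   then show "pu ?\<alpha> id u p' = (u(p := tact s (u p))) p'" using True rk by (auto simp: pu_def inv_id)
  qed
  then show ?thesis unfolding if_P[OF True] .
 next
  case False
  have "placed (pu ?\<alpha> id u) x = placed u x" proof (rule placed_cong[OF _ x])
   fix p' assume "p' : {1..r}"
   then show "pu ?\<alpha> id u p' = u p'" using False rk by (auto simp: pu_def inv_id)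
  qed
  then show ?thesis unfolding if_not_P[OF False] .
 qed
 finally show ?thesis .
qed

lemma position_inj:
 assumes w: "w : Wset"
 shows "inj_on (position j w) {1..r}" proof (rule inj_onI)
 fix i i' assume i: "i : {1..r}" "i' : {1..r}" and e: "position j w i = position j w i'"
 have c: "j i = j i'" using position_in(2)[OF w i(1)] position_in(2)[OF w i(2)] e by simp
 show "i = i'" proof (cases "j i = 1")
  case True
  then show ?thesis using e c by (simp add: position_def)
 next
  case False
  then have "entry j w i = entry j w i'" using e c by (simp add: position_def)
  then show ?thesis by (rule inj_onD[OF entry_inj[OF w] _ i])
 qed
qed

lemma position_image: "w : Wset ==> position j w ` {1..r} = {1..r}"
 by (rule endo_inj_surj[OF finite_atLeastAtMost _ position_inj]) (use position_in(1) in blast)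

lemma clin_placed_slot:
 assumes p: "p : {1..r}" and x: "x : free Wset"
 shows "clin (%v. placed (u(p := v)) x)" proof -
 have pt: "EX c i. ALL v. placed (u(p := v)) x y = c * tmap (\<nu> i) Nd (\<sigma> i) v (fst y i)" for y :: base proof -
  obtain b w where y: "y = (b, w)" by (cases y)
  show ?thesis proof (cases "w : Wset")
   case False
   then have "x w = 0" using x unfolding free_def by blast
   then show ?thesis by (intro exI[of _ 0]) (simp add: placed_def y)
  next
   case True
   have "p : position j w ` {1..r}" using p unfolding position_image[OF True] .
   then obtain i where i: "i : {1..r}" "position j w i = p" by blast
   have "slotv (u(p := v)) w i' = slotv u w i'" if "i' : {1..r} - {i}" for v i'
   using inj_onD[OF position_inj[OF True], of i' i] that i by (auto simp: slotv_def)
   then have prod: "(PROD i':{1..r}-{i}. slotv (u(p := v)) w i' (b i')) = (PROD i':{1..r}-{i}. slotv u w i' (b i'))" for v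
   by (intro prod.cong) simp_all
   have pi: "slotv (u(p := v)) w i = tmap (\<nu> i) Nd (\<sigma> i) v" for v using i by (simp add: slotv_def)
   define c where "c = x w * (if b : extensional {1..r} then (PROD i':{1..r}-{i}. slotv u w i' (b i')) else 0)"
   have "placed (u(p := v)) x y = c * tmap (\<nu> i) Nd (\<sigma> i) v (fst y i)" for v
   using prod.remove[of "{1..r}" i "%i'. slotv (u(p := v)) w i' (b i')"] i(1) prod[of v] pi[of v]
   by (simp add: placed_def y pure_tensor_def c_def mult_ac)
   then show ?thesis by blast
  qed
 qed
 show ?thesis proof (rule clinI; rule HOL.ext)
  fix f g and y :: base
  obtain c i where "!!v. placed (u(p := v)) x y = c * tmap (\<nu> i) Nd (\<sigma> i) v (fst y i)" using pt[of y] by blast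
  then show "placed (u(p := f + g)) x y = (placed (u(p := f)) x + placed (u(p := g)) x) y"
   by (simp add: clin_add[OF clin_tmap] algebra_simps)
 next
  fix a f and y :: base
  obtain c i where "!!v. placed (u(p := v)) x y = c * tmap (\<nu> i) Nd (\<sigma> i) v (fst y i)" using pt[of y] by blast
  then show "placed (u(p := cscale a f)) x y = cscale a (placed (u(p := f)) x) y" by (simp add: clin_scale[OF clin_tmap] cscale_apply)
 qed
qed

lemma clin_placed: "clin (placed u)" by (rule clinI) (auto simp: placed_def fun_eq_iff cscale_def algebra_simps)

definition opf :: "nat => 'i set => ('i => complex) => ('i => nat => nat) => (base => complex) => base => complex" where
 "opf p I c y f = (SUM i:I. cscale (c i) (bact (ins p (y i)) f))"

lemma clin_opf: "clin (opf p I c y)" unfolding opf_def by (rule clin_combination[OF clin_bact])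

lemma opf_placed:
 assumes y: "!!i. i : I ==> y i permutes Nd" and u: "us u" and x: "x : free Wset"
 shows "opf p I c y (placed u x) = (if p : {1..r} & j p ~= 1
  then placed (u(p := (SUM i:I. cscale (c i) (tact (y i) (u p))))) x
  else cscale (SUM i:I. c i) (placed u x))" proof (cases "p : {1..r} & j p ~= 1")
 case True
 have "opf p I c y (placed u x) = (SUM i:I. cscale (c i) (placed (u(p := tact (y i) (u p))) x))"
  unfolding opf_def by (rule sum.cong[OF refl]) (simp only: bact_ins_placed[OF y u x] True if_True simp_thms)
 also have "... = placed (u(p := (SUM i:I. cscale (c i) (tact (y i) (u p))))) x"
  using clin_lincomb[OF clin_placed_slot[OF _ x], of p u c "%i. tact (y i) (u p)" I] True by simp
 finally show ?thesis using True by simp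
next
 case False
 have "opf p I c y (placed u x) = (SUM i:I. cscale (c i) (placed u x))"
  unfolding opf_def by (rule sum.cong[OF refl]) (simp only: bact_ins_placed[OF y u x] False if_False simp_thms)
 then show ?thesis using False by (simp only: cs.scale_sum_left if_False)
qed

definition opE :: "nat => (nat => nat) => (base => complex) => base => complex" where
 "opE p s = opf p (yindex (nu d (color p)) Nd) ycoeff (%y. yperm y o s)"

lemma clin_opE: "clin (opE p s)" unfolding opE_def by (rule clin_opf)

lemma yperm_s: "s permutes Nd ==> y : yindex lam Nd ==> yperm y o s permutes Nd" by (rule permutes_compose[OF _ yperm_permutes])

lemma opE_placed:
 assumes p: "p : {1..k}" and s: "s permutes Nd" and u: "us u" and x: "x : free Wset"
 shows "color p ~= 1 ==> opE p s (placed u x) = placed (u(p := ysym (\<nu> p) Nd (tact s (u p)))) x"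
  and "color p = 1 ==> opE p s (placed u x) = cscale (ytotal [d] Nd) (placed u x)" proof -
 have o: "opE p s (placed u x) = (if p : {1..r} & j p ~= 1
   then placed (u(p := (SUM y:yindex (nu d (color p)) Nd. cscale (ycoeff y) (tact (yperm y o s) (u p))))) x
   else cscale (SUM y:yindex (nu d (color p)) Nd. ycoeff y) (placed u x))" unfolding opE_def by (rule opf_placed[OF yperm_s[OF s] u x])
 show "opE p s (placed u x) = placed (u(p := ysym (\<nu> p) Nd (tact s (u p)))) x" if c: "color p ~= 1" proof -
  have pr: "p : {1..r} & j p ~= 1" "color p = j p" using color_ne_one[OF p c] c by simp_all
  have "opE p s (placed u x) =
   placed (u(p := (SUM y:yindex (nu d (color p)) Nd. cscale (ycoeff y) (tact (yperm y o s) (u p))))) x" unfolding o if_P[OF pr(1)] ..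
  then show ?thesis unfolding pr(2) ysym_tact_expand[OF s] .
 qed
 show "opE p s (placed u x) = cscale (ytotal [d] Nd) (placed u x)" if c: "color p = 1" proof -
  have pr: "~ (p : {1..r} & j p ~= 1)" using c color_fib[of p] by metis
  have "opE p s (placed u x) = cscale (SUM y:yindex (nu d (color p)) Nd. ycoeff y) (placed u x)" unfolding o if_not_P[OF pr] ..
  then show ?thesis unfolding nu_color_one[OF c] ytotal_def .
 qed
qed

definition "egen p = specht_gen (\<nu> p) Nd"

lemma egen_us: "us egen" unfolding us_def egen_def using specht_gen_in[OF Nd(1) nu_part] by blast

text \<open>Here A is the set of positions already normalized to the generating polytabloid; the irreducibility
proof enlarges A one position at a time.\<close>
definition gens :: "nat set => ((nat => tabloid) => complex) set => (base => complex) set" where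
 "gens A T = {placed u x | u x. us u & (ALL p:A \<inter> {1..r}. u p = egen p) & x : T}"

definition MA :: "nat set => ((nat => tabloid) => complex) set => (base => complex) set" where
 "MA A T = cspan (gens A T)"

lemma subspace_MA: "cs.subspace (MA A T)" unfolding MA_def by (rule subspace_cspan)

lemma MA_mono: "A' <= A ==> T <= T' ==> MA A T <= MA A' T'" unfolding MA_def proof (rule cspan_minimal[OF _ subspace_cspan])
 assume "A' <= A" "T <= T'"
 then have "gens A T <= gens A' T'" unfolding gens_def by blast
 then show "gens A T <= cspan (gens A' T')" using cspan_base by blast
qed

lemma MA_free:
 assumes "T <= free Wset"
 shows "MA A T <= free X" unfolding MA_def proof (rule cspan_free, rule subsetI)
 fix f assume "f : gens A T"
 then obtain u x where "f = placed u x" "us u" "x : T" by (auto simp: gens_def)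
 then show "f : free X" using placed_free assms by blast
qed

lemma MA_induct:
 assumes "f : MA A T" "clin L" "cs.subspace V"
  and "!!u x. us u ==> (!!p. p : A ==> p : {1..r} ==> u p = egen p) ==> x : T ==> L (placed u x) : V"
 shows "L f : V" using assms(1) unfolding MA_def proof (rule span_induct_lin[OF _ _ assms(2,3)])
 fix g assume "g : gens A T"
 then obtain u x where g: "g = placed u x" "us u" "ALL p:A \<inter> {1..r}. u p = egen p" "x : T" unfolding gens_def by blast
 show "L g : V" unfolding g(1) by (rule assms(4)[OF g(2) _ g(4)]) (use g(3) in blast)
qed

lemma us_upd: "us u ==> v : specht (\<nu> p) Nd ==> us (u(p := v))" by (simp add: us_def)

lemma egen_line:
 assumes p: "p : {1..r}" "j p = 1" and u: "us u"
 shows "EX z. u p = cscale z (egen p)" proof -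
 have n: "\<nu> p = [d]" using p(2) nu_one[OF d] by simp
 have up: "u p : specht [d] Nd" using usD[OF u p(1)] n by simp
 obtain z where z: "ysym [d] Nd (u p) = cscale z (egen p)" using ysym_line[OF Nd(1) row_partition[OF Nd] up] unfolding egen_def n by blast
 let ?t = "ytotal [d] Nd"
 have "cscale (1 / ?t) (cscale ?t (u p)) = cscale (1 / ?t) (cscale z (egen p))" using z ysym_row[OF Nd up] by simp
 then have "u p = cscale (z / ?t) (egen p)" using ytotal_row[OF Nd] by simp
 then show ?thesis by blast
qed

lemma placed_upd_in:
 assumes u: "us u" "!!p. p : A ==> p : {1..r} ==> u p = egen p" and x: "x : T" "T <= free Wset" and p: "p : {1..r}"
 shows "placed (u(p := cscale z (egen p))) x : MA (insert p A) T" proof -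
 have "us (u(p := egen p))" using us_upd[OF u(1)] usD[OF egen_us p] by blast
 then have "placed (u(p := egen p)) x : gens (insert p A) T"
  using u(2) x(1) unfolding gens_def by (intro CollectI exI[of _ "u(p := egen p)"] exI[of _ x]) auto
 then show ?thesis unfolding clin_scale[OF clin_placed_slot[OF p subsetD[OF x(2,1)]]] MA_def cspan_def by (intro cs.span_scale cs.span_base)
qed

lemma opE_maps:
 assumes p: "p : {1..k}" and s: "s permutes Nd" and T: "T <= free Wset" and f: "f : MA A T"
 shows "opE p s f : MA (insert p A) T" using f proof (rule MA_induct[OF _ clin_opE subspace_MA])
 fix u x assume u: "us u" "!!p. p : A ==> p : {1..r} ==> u p = egen p" and x: "x : T"
 have xf: "x : free Wset" using x T by blast
 show "opE p s (placed u x) : MA (insert p A) T" proof (cases "color p = 1")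
  case True
  have "placed u x : MA (insert p A) T" proof (cases "p : {1..r}")
   case p: True
   then obtain z where "u p = cscale z (egen p)" using egen_line[OF p _ u(1)] True color_fib[OF p] by auto
   then show ?thesis using placed_upd_in[OF u x T p, where z = z] by (metis fun_upd_triv)
  next
   case False
   then show ?thesis using u x unfolding MA_def gens_def by (intro cspan_base) blast
  qed
  then show ?thesis unfolding opE_placed(2)[OF p s u(1) xf True] by (rule cs.subspace_scale[OF subspace_MA])
 next
  case False
  have pr: "p : {1..r}" using color_ne_one[OF p False] by simp
  have "tact s (u p) : specht (\<nu> p) Nd" by (rule tact_specht[OF Nd(1) s usD[OF u(1) pr]])
  then obtain z where z: "ysym (\<nu> p) Nd (tact s (u p)) = cscale z (egen p)"
   using ysym_line[OF Nd(1) nu_part[OF pr]] unfolding egen_def by blast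
  show ?thesis unfolding opE_placed(1)[OF p s u(1) xf False] z by (rule placed_upd_in[OF u x T pr])
 qed
qed

lemma opE_color_one:
 assumes p: "p : {1..k}" "color p = 1" and s: "s permutes Nd" and T: "T <= free Wset" and f: "f : MA A T"
 shows "opE p s f = cscale (ytotal [d] Nd) f" proof -
 have cl: "clin (%f :: base => complex. cscale (ytotal [d] Nd) f)" by (rule clinI) (simp_all add: cs.scale_right_distrib mult.commute)
 have "opE p s f - cscale (ytotal [d] Nd) f : {0}" using f proof (rule MA_induct[OF _ clin_diff[OF clin_opE cl] subspace_singleton_zero])
  fix u x assume "us u" "x : T"
  then show "opE p s (placed u x) - cscale (ytotal [d] Nd) (placed u x) : {0}" using opE_placed(2)[OF p(1) s _ _ p(2)] T by auto
 qed
 then show ?thesis by simp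
qed

definition bslice :: "(base => complex) => (nat => tabloid) => nat => (nat => tabloid) => tabloid => complex" where
 "bslice f w i b = (%R. f (b(i := R), w))"

lemma clin_bslice: "clin (%f. bslice f w i b)" by (rule clinI) (auto simp: bslice_def cscale_def)

lemma bslice_in:
 assumes w: "w : Wset" and i: "i : {1..r}" and T: "T <= free Wset" and f: "f : MA A T"
 shows "bslice f w i b : specht_image (\<nu> i) Nd (\<sigma> i)" using f
proof (rule MA_induct[OF _ clin_bslice subspace_specht_image[OF Nd(1) nu_part[OF i]]])
 fix u x assume u: "us u"
 have "bslice (placed u x) w i b = cscale (x w) (slice (pure_tensor {1..r} (slotv u w)) i b)"
  by (auto simp: bslice_def placed_def slice_def cscale_def)
 also have "... : specht_image (\<nu> i) Nd (\<sigma> i)" unfolding pure_tensor_slice[OF finite_atLeastAtMost i]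
  by (intro cs.subspace_scale[OF subspace_specht_image[OF Nd(1) nu_part[OF i]]] slotv_in[OF u w i])
 finally show "bslice (placed u x) w i b : specht_image (\<nu> i) Nd (\<sigma> i)" .
qed

lemma bact_ins_value:
 assumes bw: "(b, w) : X" and i: "i : {1..r}" and s: "s permutes Nd"
 shows "bact (ins (entry j w i) s) f (b, w) = f (b(i := perm_tabloid (inv' s) (b i)), w)" proof -
 have b: "b : Bset q" and w: "w : Wset" using bw by (simp_all add: X_def)
 let ?p = "entry j w i"
 have "act_base d r j (winv k (ins ?p s)) (b, w) = (b(i := perm_tabloid (inv' s) (b i)), w)"
  unfolding ins_def winv_def prod.case act_base_eq proof (intro arg_cong2[where f = Pair])
  show "wact (inv' id) w = w" using wact_id[OF w] by (simp add: inv_id)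
  show "(\<lambda>i'\<in>{1..r}. perm_tabloid ((\<lambda>i'\<in>{1..k}. inv' ((\<lambda>i\<in>{1..k}. if i = ?p then s else id) (id i'))) (inv' id (entry j w i'))) (b i')) =
   b(i := perm_tabloid (inv' s) (b i))" proof (rule extensionalityI[of _ "{1..r}"])
   show "b(i := perm_tabloid (inv' s) (b i)) : extensional {1..r}" using b i by (auto simp: Bset_def PiE_iff extensional_def)
   fix i' assume i': "i' : {1..r}"
   have "entry j w i' : {1..k}" by (rule entry_k[OF w i'])
   moreover have "entry j w i' = ?p \<longleftrightarrow> i' = i" using inj_onD[OF entry_inj[OF w] _ i' i] by blast
   ultimately show "(\<lambda>i'\<in>{1..r}. perm_tabloid ((\<lambda>i'\<in>{1..k}. inv' ((\<lambda>i\<in>{1..k}. if i = ?p then s else id) (id i'))) (inv' id (entry j w i'))) (b i')) i' =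
   (b(i := perm_tabloid (inv' s) (b i))) i'" using i' by (simp add: inv_id del: atLeastAtMost_iff)
  qed simp
 qed
 then show ?thesis using bw by (simp add: bact_def)
qed

lemma opE_detects:
 assumes p: "p : {1..k}" and T: "T <= free Wset" and f: "f : MA A T" "f ~= 0"
 shows "EX s. s permutes Nd & opE p s f ~= 0" proof (cases "color p = 1")
 case True
 have "opE p id f = cscale (ytotal [d] Nd) f" by (rule opE_color_one[OF p True permutes_id T f(1)])
 then have "opE p id f ~= 0" using f(2) ytotal_row[OF Nd] by (simp add: cs.scale_eq_0_iff)
 then show ?thesis using permutes_id by blast
next
 case False
 obtain b w where nz: "f (b, w) ~= 0" using f(2) by (auto simp: fun_eq_iff)
 have "f : free X" using f(1) MA_free[OF T] by blast
 then have bw: "(b, w) : X" using nz unfolding free_def by blast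
 then have b: "b : Bset q" and w: "w : Wset" by (simp_all add: X_def)
 have "p : cls (color p)" using p by (simp only: cls_iff simp_thms)
 then obtain i where i: "i : {1..r}" "j i = color p" "entry j w i = p" using entry_surj[OF w False] by blast
 let ?v = "bslice f w i b"
 have v: "?v : specht_image (\<nu> i) Nd (\<sigma> i)" by (rule bslice_in[OF w i(1) T f(1)])
 have "?v (b i) ~= 0" using nz by (simp add: bslice_def)
 then have "?v ~= 0" by auto
 then obtain s where s: "s permutes Nd" "ysym (\<nu> i) Nd (tact s ?v) ~= 0"
  using ysym_image_detects[OF Nd(1) nu_part[OF i(1)] \<sigma>[OF i(1)] v] by blast
 then obtain R where R: "ysym (\<nu> i) Nd (tact s ?v) R ~= 0" by (auto simp: fun_eq_iff)
 have sv: "tact s ?v : specht_image (\<nu> i) Nd (\<sigma> i)" by (rule tact_specht_image[OF Nd(1) nu_part[OF i(1)] s(1) v])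
 have "ysym (\<nu> i) Nd (tact s ?v) : free (tabloids (mu d (q i)) Nd)" unfolding ysym_def young_sym_def
  by (intro column_sym_free row_sym_free finite_atLeastAtMost) (use sv image_free[OF i(1)] in blast)
 then have Rt: "R : tabloids (mu d (q i)) Nd" using R unfolding free_def by blast
 have bR: "(b(i := R), w) : X" using b w Rt i(1) by (auto simp: X_def Bset_def PiE_iff extensional_def)
 have val: "bact (ins p y) f (b(i := R), w) = tact y ?v R" if y: "y permutes Nd" for y
  using bact_ins_value[OF bR i(1) y, of f] i(3) by (simp add: tact_def bslice_def)
 have "opE p s f (b(i := R), w) = ysym (\<nu> i) Nd (tact s ?v) R"
  unfolding opE_def opf_def ysym_tact_expand[OF s(1)] sum_apply cscale_apply i(2)
  by (rule sum.cong[OF refl]) (simp only: val[OF yperm_s[OF s(1)]])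
 then have "opE p s f ~= 0" using R by auto
 then show ?thesis using s(1) by blast
qed

lemma MA_all:
 assumes T: "T <= free Wset" "cs.subspace T" and f: "f : MA {1..k} T"
 shows "EX x:T. f = placed egen x" proof -
 have "f : placed egen ` T" proof (rule MA_induct[OF f clin_id subspace_image[OF clin_placed T(2)]])
  fix u x assume u: "us u" "!!p. p : {1..k} ==> p : {1..r} ==> u p = egen p" and x: "x : T"
  have "placed u x = placed egen x" by (rule placed_cong) (use u(2) rk x T(1) in auto)
  then show "placed u x : placed egen ` T" using x by blast
 qed
 then show ?thesis by blast
qed

lemma placed_egen_zero:
 assumes x: "x : free Wset" and z: "placed egen x = 0"
 shows "x = 0" proof
 fix w
 show "x w = 0 w" proof (cases "w : Wset")
  case False
  then show ?thesis using x unfolding free_def by simp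
 next
  case True
  have "EX R. slotv egen w i R ~= 0" if i: "i : {1..r}" for i proof -
   have "slotv egen w i = tmap (\<nu> i) Nd (\<sigma> i) (specht_gen (\<nu> i) Nd)"
   using position_in(2)[OF True i] by (simp add: slotv_def egen_def)
   then have "slotv egen w i ~= 0" using tmap_gen_nonzero[OF Nd(1) nu_part[OF i] \<sigma>[OF i]] by simp
   then show ?thesis by (auto simp: fun_eq_iff)
  qed
  then obtain R where R: "!!i. i : {1..r} ==> slotv egen w i (R i) ~= 0" by metis
  have "placed egen x (restrict R {1..r}, w) = x w * (PROD i:{1..r}. slotv egen w i (R i))" by (simp add: placed_def pure_tensor_def)
  moreover have "(PROD i:{1..r}. slotv egen w i (R i)) ~= 0" using R by simp
  ultimately show ?thesis using z by simp
 qed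
qed

text \<open>A relation is tested with a Young symmetrizer at one position after the other, until all vectors are
the fixed generators and only the second factor varies.\<close>
theorem MA_decomposes:
 assumes D: "decomposes I T (free Wset)"
 shows "decomposes I (%c. MA {} (T c)) (MA {} (free Wset))" proof (rule decomposesI)
 show "finite I" by (rule decomposes_finite[OF D])
 show "cs.subspace (MA {} (T c))" for c by (rule subspace_MA)
 show "MA {} (T c) <= MA {} (free Wset)" if "c : I" for c by (rule MA_mono[OF order_refl decomposes_subset[OF D that]])
 fix f assume f: "f : MA {} (free Wset)"
 let ?W = "{SUM c:I. v c | v. ALL c:I. v c : MA {} (T c)}"
 have "f : ?W" proof (rule MA_induct[OF f clin_id subspace_sums[OF subspace_MA]])
  fix u x assume u: "us u" and x: "x : free Wset"
  obtain v where v: "!!c. c : I ==> v c : T c" "x = (SUM c:I. v c)" using decomposes_ex[OF D x] by blast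
  have "placed u x = (SUM c:I. placed u (v c))" unfolding v(2) by (rule clin_sum[OF clin_placed])
  moreover have "placed u (v c) : MA {} (T c)" if "c : I" for c
   unfolding MA_def by (rule cspan_base) (use u v(1)[OF that] in \<open>auto simp: gens_def\<close>)
  ultimately show "placed u x : ?W" by blast
 qed
 then show "EX v. (ALL c:I. v c : MA {} (T c)) & f = (SUM c:I. v c)" by blast
next
 fix y c0 assume y: "!!c. c : I ==> y c : MA {} (T c)" and z: "(SUM c:I. y c) = 0" and c0: "c0 : I"
 note TW = decomposes_subset[OF D] and TS = decomposes_subspace[OF D]
 show "y c0 = 0" proof (rule ccontr)
  assume nz: "y c0 ~= 0"
  have "EX L. clin L & L (y c0) ~= 0 & (ALL c:I. L (y c) : MA A (T c))" if "A <= {1..k}" for A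
   using finite_subset[OF that finite_atLeastAtMost] that proof (induction A rule: finite_induct)
   case empty
   show "EX L. clin L & L (y c0) ~= 0 & (ALL c:I. L (y c) : MA {} (T c))" using nz y clin_id by (intro exI[of _ "%f. f"]) simp
  next
   case (insert p A)
   have "A <= {1..k}" using insert.prems by simp
   from insert.IH[OF this]
   obtain L where L: "clin L" "L (y c0) ~= 0" "!!c. c : I ==> L (y c) : MA A (T c)" by blast
   have p: "p : {1..k}" using insert.prems by simp
   obtain s where s: "s permutes Nd" "opE p s (L (y c0)) ~= 0" using opE_detects[OF p TW[OF c0] L(3)[OF c0] L(2)] by blast
   have "ALL c:I. opE p s (L (y c)) : MA (insert p A) (T c)" using opE_maps[OF p s(1) TW L(3)] by blast
   then show ?case using clin_comp[OF clin_opE L(1)] s(2) by (intro exI[of _ "%f. opE p s (L f)"]) blast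
  qed
  from this[OF order_refl] obtain L where L: "clin L" "L (y c0) ~= 0" "!!c. c : I ==> L (y c) : MA {1..k} (T c)" by blast
  have "ALL c:I. EX x:T c. L (y c) = placed egen x" using MA_all[OF TW TS L(3)] by blast
  then obtain x where x: "!!c. c : I ==> x c : T c" "!!c. c : I ==> L (y c) = placed egen (x c)" by metis
  have "placed egen (SUM c:I. x c) = (SUM c:I. L (y c))" unfolding clin_sum[OF clin_placed] by (rule sum.cong) (simp_all add: x(2))
  also have "... = L (SUM c:I. y c)" by (rule clin_sum[OF L(1), symmetric])
  also have "... = 0" unfolding z by (rule clin_zero[OF L(1)])
  finally have "(SUM c:I. x c) = 0" by (rule placed_egen_zero[rotated]) (intro cs.subspace_sum[OF subspace_free] subsetD[OF TW x(1)])
  from decomposes_indep[OF D x(1) this c0] have "x c0 = 0" .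
  then show False using L(2) x(2)[OF c0] clin_zero[OF clin_placed] by metis
 qed
qed

end


section \<open>Irreducibility of the induced modules\<close>

lemma pure_tensor_slot:
 assumes I: "finite I" "i : I"
 shows "clin (%f. pure_tensor I (v(i := f)))" proof -
 have e: "(PROD l:I. (v(i := f)) l (b l)) = f (b i) * (PROD l:I-{i}. v l (b l))" for f b proof -
  have "(PROD l:I-{i}. (v(i := f)) l (b l)) = (PROD l:I-{i}. v l (b l))" by (rule prod.cong) simp_all
  then show ?thesis unfolding prod.remove[OF I] by simp
 qed
 show ?thesis by (rule clinI) (auto simp: pure_tensor_def fun_eq_iff cscale_apply e algebra_simps simp del: fun_upd_apply)
qed

locale irreducible_setup = placed_tensors +
 fixes \<Lambda> :: "nat => nat list" and \<tau> :: "nat => cell => nat"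
 assumes \<Lambda>: "!!a. a : {1..ell d} ==> \<Lambda> a : partitions (card (cls a))"
  and \<tau>: "!!a. a : {1..ell d} ==> \<tau> a : semistandard (\<Lambda> a) (gamma k r j a)"
begin

abbreviation "La \<equiv> {1..ell d}"
abbreviation "SI a \<equiv> specht_image (\<Lambda> a) (cls a) (\<tau> a)"
abbreviation "M \<equiv> base_rep d k r j \<sigma> \<Lambda> \<tau>"

definition "cgen a = tmap (\<Lambda> a) (cls a) (\<tau> a) (specht_gen (\<Lambda> a) (cls a))"
abbreviation "T2 \<equiv> Tens \<Lambda> \<tau>"

lemma SI_subspace: "a : La ==> cs.subspace (SI a)" by (rule subspace_specht_image[OF finite_cls \<Lambda>])

lemma cgen_in: "a : La ==> cgen a : SI a" unfolding cgen_def by (rule tmap_gen_in[OF finite_cls \<Lambda>])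

lemma cgen_nonzero: "a : La ==> cgen a ~= 0" unfolding cgen_def by (rule tmap_gen_nonzero[OF finite_cls \<Lambda> \<tau>])

lemma T2_free: "T2 <= free Wset" unfolding Tens_def Wset_def by (rule tensor_space_free) (simp, rule specht_image_free[OF \<tau>])

lemma T2_subspace: "cs.subspace T2" unfolding Tens_def tensor_space_def by (rule subspace_cspan)

lemma M_vecs: "vecs M = MA {} T2" proof -
 have "{placed_tensor d r j \<sigma> u x | u x. (ALL p:{1..r}. u p : specht (nu d (j p)) {1..d}) &
   x : tensor_space {1..ell d} (%a. specht_image (\<Lambda> a) (jtilde_class k r j a) (\<tau> a))} = gens {} T2"
  (is "?L = _") proof (intro equalityI subsetI)
  fix f assume "f : ?L"
  then obtain u x where f: "f = placed_tensor d r j \<sigma> u x" "us u" "x : T2" unfolding us_def Tens_def cls_def by blast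
  then have "f = placed u x" using placed_tensor_eq T2_free by blast
  then show "f : gens {} T2" using f unfolding gens_def by blast
 next
  fix f assume "f : gens {} T2"
  then obtain u x where f: "f = placed u x" "us u" "x : T2" unfolding gens_def by blast
  then have "f = placed_tensor d r j \<sigma> u x" using placed_tensor_eq[of u x] T2_free by auto
  then show "f : ?L" using f(2,3) unfolding us_def Tens_def cls_def by blast
 qed
 then show ?thesis by (simp only: base_rep_def rep.simps MA_def)
qed

definition "rb \<beta> a = (%x. if x : cls a then \<beta> x else x)"

lemma rb_permutes:
 assumes "\<beta> : Sj"
 shows "rb \<beta> a permutes cls a" proof (rule bij_imp_permutes)
 have "bij_betw \<beta> (cls a) (cls a)"
  using assms inj_on_subset[OF permutes_inj[OF Sj_permutes[OF assms]]] unfolding Sj_iff bij_betw_def by blast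
 then show "bij_betw (rb \<beta> a) (cls a) (cls a)" by (rule bij_betw_cong[THEN iffD1, rotated]) (simp add: rb_def)
 show "rb \<beta> a x = x" if "x ~: cls a" for x using that by (simp add: rb_def)
qed

lemma rb_inv:
 assumes \<beta>: "\<beta> : Sj" and x: "x : cls a"
 shows "inv' (rb \<beta> a) x = inv' \<beta> x" proof -
 have "inv' \<beta> ` cls a = cls a" using perm_group_inv[OF Sj_perm_group \<beta>] unfolding Sj_iff by blast
 then have "inv' \<beta> x : cls a" using x by blast
 then have "rb \<beta> a (inv' \<beta> x) = x" by (simp only: rb_def if_True permutes_inverses(1)[OF Sj_permutes[OF \<beta>]])
 then show ?thesis using permutes_inv_eq[OF rb_permutes[OF \<beta>]] by blast
qed

lemma rb_tabloid:
 assumes \<beta>: "\<beta> : Sj" and R: "R : tabloids \<mu> (cls a)"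
 shows "perm_tabloid (inv' (rb \<beta> a)) R = perm_tabloid (inv' \<beta>) R" unfolding perm_tabloid_def
 by (intro HOL.ext image_cong refl rb_inv[OF \<beta>]) (use tabloid_subset[OF R] in blast)

lemma tact_SI: "a : La ==> p permutes cls a ==> f : SI a ==> tact p f : SI a" by (rule tact_specht_image[OF finite_cls \<Lambda>])

lemma px_pure:
 assumes \<beta>: "\<beta> : Sj" and v: "!!a. a : La ==> v a : SI a"
 shows "px \<beta> (pure_tensor La v) = pure_tensor La (%a. tact (rb \<beta> a) (v a))" proof
 fix w
 show "px \<beta> (pure_tensor La v) w = pure_tensor La (%a. tact (rb \<beta> a) (v a)) w" proof (cases "w : Wset")
  case True
  have e: "w : extensional La" "wact (inv' \<beta>) w : extensional La" using True by (simp_all add: Wset_def PiE_iff wact_def)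
  have "v a (wact (inv' \<beta>) w a) = tact (rb \<beta> a) (v a) (w a)" if a: "a : La" for a
   using a by (simp add: tact_def wact_def rb_tabloid[OF \<beta> Wset_tabloid[OF True a]])
  then have "(PROD a:La. v a (wact (inv' \<beta>) w a)) = (PROD a:La. tact (rb \<beta> a) (v a) (w a))" by (rule prod.cong[OF refl])
  then show ?thesis using True e by (simp only: px_def pure_tensor_def if_True)
 next
  case False
  have "pure_tensor La (%a. tact (rb \<beta> a) (v a)) : T2" unfolding Tens_def by (intro pure_tensor_in tact_SI rb_permutes \<beta> v)
  then have "pure_tensor La (%a. tact (rb \<beta> a) (v a)) w = 0" using False T2_free unfolding free_def by blast
  then show ?thesis using False by (simp add: px_def)
 qed
qed

lemma T2_induct:
 assumes "x : T2" "clin L" "cs.subspace V"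
  and "!!v. (!!a. a : La ==> v a : SI a) ==> L (pure_tensor La v) : V"
 shows "L x : V" using assms(1) unfolding Tens_def tensor_space_def proof (rule span_induct_lin[OF _ _ assms(2,3)])
 fix s assume "s : {pure_tensor La v | v. ALL i:La. v i : SI i}"
 then obtain v where "s = pure_tensor La v" "ALL i:La. v i : SI i" by blast
 then show "L s : V" using assms(4)[of v] by blast
qed

lemma px_T2:
 assumes \<beta>: "\<beta> : Sj" and x: "x : T2"
 shows "px \<beta> x : T2" proof (rule T2_induct[OF x clin_px T2_subspace])
 fix v assume v: "!!a. a : La ==> v a : SI a"
 have "px \<beta> (pure_tensor La v) = pure_tensor La (%a. tact (rb \<beta> a) (v a))" by (rule px_pure[OF \<beta>]) (rule v)
 also have "... : T2" unfolding Tens_def by (intro pure_tensor_in tact_SI rb_permutes \<beta> v)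
 finally show "px \<beta> (pure_tensor La v) : T2" .
qed

lemma bact_MA:
 assumes h: "h : carrier HH" and f: "f : MA {} T2"
 shows "bact h f : MA {} T2" proof (rule MA_induct[OF f clin_bact subspace_MA])
 fix u x assume u: "us u" and x: "x : T2"
 obtain \<alpha> \<beta> where ab: "h = (\<alpha>, \<beta>)" by (cases h)
 have \<beta>: "\<beta> : Sj" using h by (simp add: ab wreath_carrier)
 have xf: "x : free Wset" using x T2_free by blast
 have "placed (pu \<alpha> \<beta> u) (px \<beta> x) : gens {} T2"
  using us_pu[OF h[unfolded ab] u] px_T2[OF \<beta> x] unfolding gens_def by blast
 then show "bact h (placed u x) : MA {} T2" unfolding ab bact_placed[OF h[unfolded ab] u xf] MA_def by (rule cspan_base)
qed

lemma M_act: "h : carrier HH ==> f : MA {} T2 ==> act M h f = bact h f"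
 using perm_ext_bact[of h f] MA_free[OF T2_free, of "{}"] by (auto simp: base_rep_def)

lemma M_representation: "representation HH M" proof -
 let ?P = "(|vecs = free X, scal = cscale, act = perm_ext (act_base d r j)|)"
 have "representation HH (?P(|vecs := MA {} T2|))" proof (rule submodule_representation)
  show "representation HH ?P" unfolding X_def by (rule perm_representation[OF act_base_action])
  show "submodule HH ?P (MA {} T2)" unfolding submodule_def rep.simps proof (intro conjI ballI)
   show "MA {} T2 <= free X" by (rule MA_free[OF T2_free])
   show "cs.subspace (MA {} T2)" by (rule subspace_MA)
   fix g x assume g: "g : carrier HH" and x: "x : MA {} T2"
   have "x : free X" using x MA_free[OF T2_free] by blast
   then show "perm_ext (act_base d r j) g x : MA {} T2" unfolding perm_ext_bact[OF g `x : free X`] by (intro bact_MA g x)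
  qed
 qed
 moreover have "?P(|vecs := MA {} T2|) = M" unfolding M_vecs[symmetric] by (simp add: base_rep_def)
 ultimately show ?thesis by simp
qed

sublocale ind: induction_setup GG "carrier HH" M proof (rule induction_setup.intro[OF GG_group], rule induction_setup_axioms.intro)
 show "finite (carrier GG)" by (rule finite_GG)
 show "subgroup (carrier HH) GG" by (rule HH_subgroup)
 show "representation (GG(|carrier := carrier HH|)) M" unfolding HH_eq by (rule M_representation)
 show "scal M = cscale" by (simp add: base_rep_def)
qed

end


context irreducible_setup
begin

abbreviation "e1 \<equiv> \<one>\<^bsub>GG\<^esub>"

lemma ins_G: "y permutes Nd ==> ins p y : carrier GG" using ins_in HH_sub by blast

lemma GG_permutes: "(\<alpha>, \<beta>) : carrier GG ==> \<beta> permutes {1..k}" by (simp add: wreath_carrier sym_group_def)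

lemma ins_conj:
 assumes g: "(\<alpha>, \<beta>) : carrier GG" and p: "p : {1..k}"
 shows "ins p y \<cdot> (\<alpha>, \<beta>) = (\<alpha>, \<beta>) \<cdot> ins (inv' \<beta> p) (inv' (\<alpha> p) o y o \<alpha> p)"
 unfolding ins_def wreath_mult proof (intro arg_cong2[where f = Pair] restrict_ext)
 note \<beta> = GG_permutes[OF g]
 fix i assume i: "i : {1..k}"
 have a: "inv' \<beta> i : {1..k}" using permutes_in_image[OF permutes_inv[OF \<beta>]] i by blast
 have b: "inv' \<beta> i = inv' \<beta> p \<longleftrightarrow> i = p" using permutes_inj[OF permutes_inv[OF \<beta>]] by (auto dest: injD)
 have c: "\<alpha> p o (inv' (\<alpha> p) o y o \<alpha> p) = y o \<alpha> p"
  unfolding o_assoc permutes_inv_o(1)[OF wreath_perm[OF g p]] by simp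
 show "(\<lambda>i\<in>{1..k}. if i = p then y else id) i o \<alpha> (inv' id i) =
   \<alpha> i o (\<lambda>i\<in>{1..k}. if i = inv' \<beta> p then inv' (\<alpha> p) o y o \<alpha> p else id) (inv' \<beta> i)"
  unfolding restrict_apply'[OF i] restrict_apply'[OF a] b inv_id using c by simp
qed simp

definition opU :: "nat => 'i set => ('i => complex) => ('i => nat => nat) => (wr => base => complex) => wr => base => complex" where
 "opU p I c y F = (SUM i:I. pscale (c i) (act ind.Ind (ins p (y i)) F))"

lemma opU_value:
 assumes F: "F : vecs ind.Ind" and g: "(\<alpha>, \<beta>) : carrier GG" and p: "p : {1..k}"
  and y: "!!i. i : I ==> y i permutes Nd"
 shows "opU p I c y F (\<alpha>, \<beta>) = opf (inv' \<beta> p) I c (%i. inv' (\<alpha> p) o y i o \<alpha> p) (F (\<alpha>, \<beta>))"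
 unfolding opU_def opf_def proof (subst sum_apply, unfold pscale_def, rule sum.cong[OF refl])
 fix i assume i: "i : I"
 let ?z = "inv' (\<alpha> p) o y i o \<alpha> p"
 note ap = wreath_perm[OF g p]
 have z: "?z permutes Nd" by (intro permutes_compose permutes_inv ap y[OF i])
 have "F (\<alpha>, \<beta>) : MA {} T2" using ind.ind_in[OF F g] by (simp only: M_vecs)
 then have "act ind.Ind (ins p (y i)) F (\<alpha>, \<beta>) = bact (ins (inv' \<beta> p) ?z) (F (\<alpha>, \<beta>))"
  unfolding ind.ind_conj[OF F g ins_G[OF y[OF i]] ins_in[OF z] ins_conj[OF g p]] by (rule M_act[OF ins_in[OF z]])
 then show "cscale (c i) (act ind.Ind (ins p (y i)) F (\<alpha>, \<beta>)) = cscale (c i) (bact (ins (inv' \<beta> p) ?z) (F (\<alpha>, \<beta>)))"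
  by simp
qed

lemma opU_one:
 assumes F: "F : vecs ind.Ind" and y: "!!i. i : I ==> y i permutes Nd"
 shows "opU p I c y F e1 = opf p I c y (F e1)" unfolding opU_def opf_def proof (subst sum_apply, unfold pscale_def, rule sum.cong[OF refl])
 fix i assume i: "i : I"
 have "F e1 : MA {} T2" using ind.ind_in[OF F group.is_monoid[OF GG_group, THEN monoid.one_closed]] by (simp only: M_vecs)
 show "cscale (c i) (act ind.Ind (ins p (y i)) F e1) = cscale (c i) (bact (ins p (y i)) (F e1))"
  unfolding ind.ind_act_one[OF F ins_in[OF y[OF i]]] M_act[OF ins_in[OF y[OF i]] `F e1 : MA {} T2`] ..
qed

text \<open>A Young symmetrizer for one partition kills every Specht module of another one; in the trivial case
of colour 1 this concerns positions carrying no vector.\<close>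
lemma opf_kill:
 assumes p: "p : {1..k}" "p' : {1..k}" "color p' ~= color p" and a: "a permutes Nd" and s: "s permutes Nd"
  and f: "f : MA A T2"
 shows "opf p' (yindex (nu d (color p)) Nd) ycoeff (%y. inv' a o (yperm y o s) o a) f = 0" proof -
 let ?Y = "yindex (nu d (color p)) Nd" and ?y = "%y. inv' a o (yperm y o s) o a"
 have yp: "?y y permutes Nd" if "y : ?Y" for y by (intro permutes_compose permutes_inv a yperm_s[OF s that])
 have sa: "s o a permutes Nd" by (rule permutes_compose[OF a s])
 have "opf p' ?Y ycoeff ?y f : {0}" proof (rule MA_induct[OF f clin_opf subspace_singleton_zero])
  fix u x assume u: "us u" and x: "x : T2"
  have xf: "x : free Wset" using x T2_free by blast
  have o: "opf p' ?Y ycoeff ?y (placed u x) = (if p' : {1..r} & j p' ~= 1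
   then placed (u(p' := (SUM y:?Y. cscale (ycoeff y) (tact (?y y) (u p'))))) x
   else cscale (SUM y:?Y. ycoeff y) (placed u x))" by (rule opf_placed[OF yp u xf])
  have "opf p' ?Y ycoeff ?y (placed u x) = 0" proof (cases "p' : {1..r} & j p' ~= 1")
   case True
   then have p'r: "p' : {1..r}" by blast
   have c: "color p' = j p'" by (rule color_fib[OF p'r])
   have "tact (?y y) (u p') = tact (inv' a) (tact (yperm y o (s o a)) (u p'))" if y: "y : ?Y" for y
   unfolding tact_comp[OF permutes_bij[OF permutes_inv[OF a]] permutes_bij[OF yperm_s[OF sa y]], symmetric] by (simp only: o_assoc)
   then have "(SUM y:?Y. cscale (ycoeff y) (tact (?y y) (u p'))) =
   (SUM y:?Y. cscale (ycoeff y) (tact (inv' a) (tact (yperm y o (s o a)) (u p'))))" by (intro sum.cong refl) simp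
   also have "... = tact (inv' a) (SUM y:?Y. cscale (ycoeff y) (tact (yperm y o (s o a)) (u p')))"
   by (rule clin_lincomb[OF clin_tact, symmetric])
   also have "... = tact (inv' a) (ysym (nu d (color p)) Nd (tact (s o a) (u p')))" unfolding ysym_tact_expand[OF sa] ..
   also have "ysym (nu d (color p)) Nd (tact (s o a) (u p')) = 0" proof (rule ysym_other[OF Nd(1) nu_color_part[OF p(1)] nu_part[OF p'r]])
   show "\<nu> p' ~= nu d (color p)" using nu_color_ne[OF p(2,1,3)] unfolding c .
   show "tact (s o a) (u p') : specht (\<nu> p') Nd" by (rule tact_specht[OF Nd(1) sa usD[OF u p'r]])
   qed
   finally have z: "(SUM y:?Y. cscale (ycoeff y) (tact (?y y) (u p'))) = 0" by (simp only: clin_zero[OF clin_tact])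
   show ?thesis unfolding o if_P[OF True] z by (rule clin_zero[OF clin_placed_slot[OF p'r xf]])
  next
   case False
   then have "color p' = 1" unfolding color_def using p(2) by auto
   have "nu d (color p) ~= [d]" using nu_color_ne[OF p(2,1,3)] nu_color_one[OF `color p' = 1`] by simp
   then have "(SUM y:?Y. ycoeff y) = 0" using ytotal_other[OF Nd nu_color_part[OF p(1)]] unfolding ytotal_def by blast
   then show ?thesis unfolding o if_not_P[OF False] by (simp only: cs.scale_zero_left)
  qed
  then show "opf p' ?Y ycoeff ?y (placed u x) : {0}" by simp
 qed
 then show ?thesis by simp
qed

context
 fixes U assumes U: "submodule GG ind.Ind U" and U0: "U ~= {0}"
begin

text \<open>A symmetrizer at p preserves the value at the identity up to normalization, but kills the values
at all elements moving p to another colour.\<close>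
lemma reduce_positions:
 assumes "A <= {1..k}"
 shows "EX F:U. F e1 ~= 0 & F e1 : MA A T2 &
  (ALL \<alpha> \<beta>. (\<alpha>, \<beta>) : carrier GG --> (EX p:A. color (inv' \<beta> p) ~= color p) --> F (\<alpha>, \<beta>) = 0)"
 using finite_subset[OF assms finite_atLeastAtMost] assms proof (induction A rule: finite_induct)
 case empty
 obtain F where F: "F : U" "F e1 ~= 0" using ind.sub_nonzero_at_one[OF U U0] by blast
 have "F e1 : MA {} T2"
  using ind.ind_in[OF ind.sub_vecs[OF U F(1)] group.is_monoid[OF GG_group, THEN monoid.one_closed]] by (simp only: M_vecs)
 then show ?case using F by blast
next
 case (insert p A)
 have p: "p : {1..k}" and A: "A <= {1..k}" using insert.prems by simp_all
 from insert.IH[OF A] obtain F where F: "F : U" "F e1 ~= 0" "F e1 : MA A T2"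
  "!!\<alpha> \<beta>. (\<alpha>, \<beta>) : carrier GG ==> (EX p:A. color (inv' \<beta> p) ~= color p) ==> F (\<alpha>, \<beta>) = 0" by blast
 note FI = ind.sub_vecs[OF U F(1)]
 obtain s where s: "s permutes Nd" "opE p s (F e1) ~= 0" using opE_detects[OF p T2_free F(3,2)] by blast
 let ?Y = "yindex (nu d (color p)) Nd" and ?y = "%y. yperm y o s"
 let ?F = "opU p ?Y ycoeff ?y F"
 have one: "?F e1 = opE p s (F e1)" unfolding opE_def by (rule opU_one[OF FI yperm_s[OF s(1)]])
 have "?F : U" unfolding opU_def by (rule ind.sub_combination[OF U ins_G[OF yperm_s[OF s(1)]] F(1)])
 moreover have "?F e1 ~= 0" using s(2) one by simp
 moreover have "?F e1 : MA (insert p A) T2" unfolding one by (rule opE_maps[OF p s(1) T2_free F(3)])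
 moreover have "?F (\<alpha>, \<beta>) = 0"
  if g: "(\<alpha>, \<beta>) : carrier GG" and ex: "EX p:insert p A. color (inv' \<beta> p) ~= color p" for \<alpha> \<beta> proof -
  have v: "?F (\<alpha>, \<beta>) = opf (inv' \<beta> p) ?Y ycoeff (%y. inv' (\<alpha> p) o (yperm y o s) o \<alpha> p) (F (\<alpha>, \<beta>))"
   by (rule opU_value[OF FI g p yperm_s[OF s(1)]])
  show ?thesis proof (cases "color (inv' \<beta> p) = color p")
   case True
   then have "EX p:A. color (inv' \<beta> p) ~= color p" using ex by blast
   then show ?thesis unfolding v F(4)[OF g `EX p:A. color (inv' \<beta> p) ~= color p`] by (intro clin_zero[OF clin_opf])
  next
   case False
   have p': "inv' \<beta> p : {1..k}" using permutes_in_image[OF permutes_inv[OF GG_permutes[OF g]]] p by blast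
   have "F (\<alpha>, \<beta>) : MA {} T2" using ind.ind_in[OF FI g] by (simp only: M_vecs)
   then show ?thesis unfolding v by (rule opf_kill[OF p p' False wreath_perm[OF g p] s(1)])
  qed
 qed
 ultimately show ?case by blast
qed

lemma reduce_support: "EX x:T2. x ~= 0 & ind.delta (placed egen x) : U" proof -
 obtain F where F: "F : U" "F e1 ~= 0" "F e1 : MA {1..k} T2"
  "!!\<alpha> \<beta>. (\<alpha>, \<beta>) : carrier GG ==> (EX p:{1..k}. color (inv' \<beta> p) ~= color p) ==> F (\<alpha>, \<beta>) = 0"
  using reduce_positions[OF order_refl] by blast
 have "F = ind.delta (F e1)" proof (rule ind.supported_eq_delta[OF ind.sub_vecs[OF U F(1)]])
  fix g assume g: "g : carrier GG" "g ~: carrier HH"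
  obtain \<alpha> \<beta> where ab: "g = (\<alpha>, \<beta>)" by (cases g)
  note \<beta> = GG_permutes[OF g(1)[unfolded ab]]
  have "\<beta> ~: Sj" using g unfolding ab wreath_carrier by blast
  then have "inv' \<beta> ~: Sj" using perm_group_inv[OF Sj_perm_group, of "inv' \<beta>"] by (simp only: inv_inv_eq[OF permutes_bij[OF \<beta>]]) blast
  then have "EX p:{1..k}. color (inv' \<beta> p) ~= color p" unfolding Sj_color[OF permutes_inv[OF \<beta>]] by blast
  then show "F g = 0" unfolding ab by (intro F(4) g(1)[unfolded ab])
 qed
 moreover obtain x where x: "x : T2" "F e1 = placed egen x" using MA_all[OF T2_free T2_subspace F(3)] by blast
 moreover have "x ~= 0" using F(2) x(2) clin_zero[OF clin_placed] by metis
 ultimately show ?thesis using F(1) by metis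
qed

end

end


context irreducible_setup
begin

definition "inS \<beta> = (\<lambda>i\<in>{1..k}. id :: nat => nat, \<beta> :: nat => nat)"

lemma inS_in: "\<beta> : Sj ==> inS \<beta> : carrier HH" unfolding inS_def wreath_carrier restrict_PiE_iff by (simp add: permutes_id)

lemma bact_inS:
 assumes \<beta>: "\<beta> : Sj" and x: "x : free Wset"
 shows "bact (inS \<beta>) (placed egen x) = placed egen (px \<beta> x)" proof -
 have "bact (inS \<beta>) (placed egen x) = placed (pu (\<lambda>i\<in>{1..k}. id) \<beta> egen) (px \<beta> x)"
  unfolding inS_def by (rule bact_placed[OF inS_in[OF \<beta>, unfolded inS_def] egen_us x])
 also have "... = placed egen (px \<beta> x)" proof (rule placed_cong[OF _ px_free])
  fix p assume p: "p : {1..r}"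
  then have pk: "p : {1..k}" using rk by simp
  show "pu (\<lambda>i\<in>{1..k}. id) \<beta> egen p = egen p" proof (cases "j p = 1")
   case False
   then have c: "color (inv' \<beta> p) ~= 1" "color (inv' \<beta> p) = j p"
   using Sj_inv_color(2)[OF \<beta> pk] color_fib[OF p] by simp_all
   have "j (inv' \<beta> p) = j p" using color_ne_one[OF Sj_inv_color(1)[OF \<beta> pk] c(1)] c(2) by simp
   then have "egen (inv' \<beta> p) = egen p" by (simp only: egen_def)
   then show ?thesis unfolding pu_def restrict_apply'[OF pk] by simp
  qed (simp add: pu_def)
 qed
 finally show ?thesis .
qed

lemma perm_cls:
 assumes y: "y permutes cls a"
 shows "y : Sj" proof -
 have yk: "y permutes {1..k}" by (rule permutes_subset[OF y]) (auto simp: cls_iff)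
 have "color (y p) = color p" if p: "p : {1..k}" for p proof (cases "p : cls a")
  case True
  then have "y p : cls a" using permutes_in_image[OF y] by blast
  then show ?thesis using True unfolding cls_iff by metis
 next
  case False
  then show ?thesis using permutes_not_in[OF y] by simp
 qed
 then show ?thesis using Sj_color[OF yk] by blast
qed

lemma rb_cls:
 assumes y: "y permutes cls a"
 shows "rb y a = y" "a' ~= a ==> rb y a' = id" proof -
 show "rb y a = y" using permutes_not_in[OF y] by (auto simp: rb_def fun_eq_iff)
 assume ne: "a' ~= a"
 have "x ~: cls a" if "x : cls a'" for x using that ne unfolding cls_iff by metis
 then show "rb y a' = id" using permutes_not_in[OF y] by (auto simp: rb_def fun_eq_iff)
qed

lemma px_slot:
 assumes y: "y permutes cls a" and v: "!!a. a : La ==> v a : SI a"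
 shows "px y (pure_tensor La v) = pure_tensor La (v(a := tact y (v a)))" proof -
 have "px y (pure_tensor La v) = pure_tensor La (%a. tact (rb y a) (v a))" by (rule px_pure[OF perm_cls[OF y]]) (rule v)
 also have "... = pure_tensor La (v(a := tact y (v a)))" by (rule pure_tensor_cong) (simp add: rb_cls[OF y])
 finally show ?thesis .
qed

text \<open>The Young symmetrizer of the class a, acting on the second factor by permuting positions.\<close>
definition cop :: "nat => (nat => nat) => ((nat => tabloid) => complex) => (nat => tabloid) => complex" where
 "cop a s x = (SUM y:yindex (\<Lambda> a) (cls a). cscale (ycoeff y) (px (yperm y o s) x))"

lemma clin_cop: "clin (cop a s)" proof -
 have "clin (%x. cop a s x)" unfolding cop_def by (rule clin_combination[OF clin_px])
 then show ?thesis .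
qed

lemma yperm_cls: "s permutes cls a ==> y : yindex lam (cls a) ==> yperm y o s permutes cls a"
 by (rule permutes_compose[OF _ yperm_permutes])

lemma cop_pure:
 assumes a: "a : La" and s: "s permutes cls a" and v: "!!a. a : La ==> v a : SI a"
 shows "cop a s (pure_tensor La v) = pure_tensor La (v(a := ysym (\<Lambda> a) (cls a) (tact s (v a))))" proof -
 have "cop a s (pure_tensor La v) =
   (SUM y:yindex (\<Lambda> a) (cls a). cscale (ycoeff y) (pure_tensor La (v(a := tact (yperm y o s) (v a)))))" unfolding cop_def
 proof (rule sum.cong[OF refl], rule arg_cong[where f = "cscale _"])
  fix y assume y: "y : yindex (\<Lambda> a) (cls a)"
  show "px (yperm y o s) (pure_tensor La v) = pure_tensor La (v(a := tact (yperm y o s) (v a)))"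
   by (rule px_slot[OF yperm_cls[OF s y]]) (rule v)
 qed
 also have "... = pure_tensor La (v(a := (SUM y:yindex (\<Lambda> a) (cls a). cscale (ycoeff y) (tact (yperm y o s) (v a)))))"
  by (rule clin_lincomb[OF pure_tensor_slot[OF finite_atLeastAtMost a], symmetric])
 finally show ?thesis unfolding ysym_tact_expand[OF s] .
qed

definition "VB B a = (if a : B then {cscale z (cgen a) | z. True} else SI a)"

lemma VB_SI: "a : La ==> VB B a <= SI a" unfolding VB_def using cs.subspace_scale[OF SI_subspace cgen_in] by auto

lemma TB_T2: "tensor_space La (VB B) <= T2" unfolding Tens_def tensor_space_def
proof (rule cspan_minimal[OF _ subspace_cspan], rule subsetI)
 fix x assume "x : {pure_tensor La v | v. ALL i:La. v i : VB B i}"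
 then obtain v where "x = pure_tensor La v" "ALL i:La. v i : VB B i" by blast
 then show "x : cspan {pure_tensor La v | v. ALL i:La. v i : SI i}" using VB_SI by (intro cspan_base) blast
qed

lemma cop_maps:
 assumes a: "a : La" and s: "s permutes cls a" and x: "x : tensor_space La (VB B)"
 shows "cop a s x : tensor_space La (VB (insert a B))" using x unfolding tensor_space_def[of La "VB B"]
proof (rule span_induct_lin[OF _ _ clin_cop])
 show "cs.subspace (tensor_space La (VB (insert a B)))" unfolding tensor_space_def by (rule subspace_cspan)
 fix x assume "x : {pure_tensor La v | v. ALL i:La. v i : VB B i}"
 then obtain v where v: "x = pure_tensor La v" "ALL i:La. v i : VB B i" by blast
 have vS: "v i : SI i" if "i : La" for i using v(2) VB_SI that by blast
 have "EX z. ysym (\<Lambda> a) (cls a) (tact s (v a)) = cscale z (cgen a)"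
  unfolding cgen_def by (rule ysym_image_line[OF finite_cls \<Lambda>[OF a] tact_SI[OF a s vS[OF a]]])
 then have new: "(v(a := ysym (\<Lambda> a) (cls a) (tact s (v a)))) i : VB (insert a B) i" if "i : La" for i proof (cases "i = a")
  case False
  then have "VB (insert a B) i = VB B i" by (simp add: VB_def)
  then show ?thesis using False v(2) that by simp
 qed (auto simp: VB_def)
 have "cop a s (pure_tensor La v) = pure_tensor La (v(a := ysym (\<Lambda> a) (cls a) (tact s (v a))))" by (rule cop_pure[OF a s]) (rule vS)
 also have "... : tensor_space La (VB (insert a B))" by (rule pure_tensor_in) (rule new)
 finally show "cop a s x : tensor_space La (VB (insert a B))" unfolding v(1) .
qed

lemma slice_cop:
 assumes a: "a : La" and s: "s permutes cls a" and x: "x : T2"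
 shows "slice (cop a s x) a w = ysym (\<Lambda> a) (cls a) (tact s (slice x a w))" proof -
 let ?L = "%x. slice (cop a s x) a w - ysym (\<Lambda> a) (cls a) (tact s (slice x a w))"
 have "?L x : {0}" proof (rule T2_induct[OF x _ subspace_singleton_zero])
  show "clin ?L" by (intro clin_diff clin_comp[OF clin_slice clin_cop] clin_comp[OF clin_ysym clin_comp[OF clin_tact clin_slice]])
  fix v assume v: "!!a. a : La ==> v a : SI a"
  define c where "c = (if w(a := undefined) : extensional La - {} then (PROD l:La-{a}. v l (w l)) else 0)"
  have e: "(PROD l:La-{a}. (v(a := f)) l (w l)) = (PROD l:La-{a}. v l (w l))" for f by (rule prod.cong) simp_all
  have "cop a s (pure_tensor La v) = pure_tensor La (v(a := ysym (\<Lambda> a) (cls a) (tact s (v a))))" by (rule cop_pure[OF a s]) (rule v)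
  then have "slice (cop a s (pure_tensor La v)) a w = cscale c (ysym (\<Lambda> a) (cls a) (tact s (v a)))"
   by (simp only: pure_tensor_slice[OF finite_atLeastAtMost a] e c_def fun_upd_same)
  moreover have "slice (pure_tensor La v) a w = cscale c (v a)" unfolding pure_tensor_slice[OF finite_atLeastAtMost a] c_def ..
  ultimately show "?L (pure_tensor La v) : {0}" by (simp add: clin_scale[OF clin_tact] clin_scale[OF clin_ysym])
 qed
 then show ?thesis by simp
qed

lemma cop_detects:
 assumes a: "a : La" and x: "x : T2" "x ~= 0"
 shows "EX s. s permutes cls a & cop a s x ~= 0" proof -
 obtain w where w: "x w ~= 0" using x(2) by (auto simp: fun_eq_iff)
 have "slice x a w : SI a" by (rule tensor_slice[OF finite_atLeastAtMost a SI_subspace[OF a] x(1)[unfolded Tens_def]])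
 moreover have "slice x a w ~= 0" using w slice_self[of x a w] by auto
 ultimately obtain s where s: "s permutes cls a" "ysym (\<Lambda> a) (cls a) (tact s (slice x a w)) ~= 0"
  using ysym_image_detects[OF finite_cls \<Lambda>[OF a] \<tau>[OF a]] by blast
 have "cop a s x ~= 0" using s(2) unfolding slice_cop[OF a s(1) x(1), symmetric] by (auto simp: slice_def)
 then show ?thesis using s(1) by blast
qed

lemma TB_all: "x : tensor_space La (VB La) ==> EX z. x = cscale z (pure_tensor La cgen)" proof -
 assume x: "x : tensor_space La (VB La)"
 have "x : {cscale z (pure_tensor La cgen) | z. True}" using x unfolding tensor_space_def
 proof (rule span_induct_lin[OF _ _ clin_id subspace_line])
  fix x assume "x : {pure_tensor La v | v. ALL i:La. v i : VB La i}"
  then obtain v where v: "x = pure_tensor La v" "ALL i:La. EX z. v i = cscale z (cgen i)" unfolding VB_def by auto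
  obtain z where z: "!!i. i : La ==> v i = cscale (z i) (cgen i)" using v(2) by metis
  have "pure_tensor La v = cscale (PROD i:La. z i) (pure_tensor La cgen)"
   by (auto simp: pure_tensor_def fun_eq_iff cscale_apply z prod.distrib)
  then show "x : {cscale z (pure_tensor La cgen) | z. True}" using v(1) by blast
 qed
 then show ?thesis by blast
qed

lemma placed_egen_vecs: "x : T2 ==> placed egen x : vecs M" unfolding M_vecs MA_def gens_def by (rule cspan_base) (use egen_us in blast)

context
 fixes U assumes U: "submodule GG ind.Ind U" and U0: "U ~= {0}"
begin

lemma reduce_classes:
 assumes "B <= La"
 shows "EX x:tensor_space La (VB B). x ~= 0 & ind.delta (placed egen x) : U" using finite_subset[OF assms finite_atLeastAtMost] assms
proof (induction B rule: finite_induct)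
 case empty
 have "tensor_space La (VB {}) = T2" by (simp add: Tens_def VB_def[abs_def])
 then show "EX x:tensor_space La (VB {}). x ~= 0 & ind.delta (placed egen x) : U" using reduce_support[OF U U0] by simp
next
 case (insert a B)
 have a: "a : La" and B: "B <= La" using insert.prems by simp_all
 from insert.IH[OF B] obtain x where x: "x : tensor_space La (VB B)" "x ~= 0" "ind.delta (placed egen x) : U" by blast
 have xT: "x : T2" using x(1) TB_T2 by blast
 have xf: "x : free Wset" using xT T2_free by blast
 obtain s where s: "s permutes cls a" "cop a s x ~= 0" using cop_detects[OF a xT x(2)] by blast
 let ?D = "{m : vecs M. ind.delta m : U}" and ?Y = "yindex (\<Lambda> a) (cls a)"
 have pc: "placed egen (cop a s x) = (SUM y:?Y. cscale (ycoeff y) (placed egen (px (yperm y o s) x)))"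
  unfolding cop_def by (rule clin_lincomb[OF clin_placed])
 have "placed egen (px (yperm y o s) x) : ?D" if y: "y : ?Y" for y proof -
  have b: "yperm y o s : Sj" by (rule perm_cls[OF yperm_cls[OF s(1) y]])
  have "act M (inS (yperm y o s)) (placed egen x) = placed egen (px (yperm y o s) x)"
   using M_act[OF inS_in[OF b]] placed_egen_vecs[OF xT] unfolding M_vecs bact_inS[OF b xf, symmetric] by blast
  then show ?thesis using ind.delta_part_act[OF U inS_in[OF b] placed_egen_vecs[OF xT] x(3)] placed_egen_vecs[OF px_T2[OF b xT]] by simp
 qed
 then have "placed egen (cop a s x) : ?D"
  unfolding pc by (intro cs.subspace_sum[OF ind.delta_part_subspace[OF U]] cs.subspace_scale[OF ind.delta_part_subspace[OF U]])
 then show ?case using cop_maps[OF a s(1) x(1)] s(2) by blast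
qed

lemma reduce_to_generator: "ind.delta (placed egen (pure_tensor La cgen)) : U" proof -
 obtain x where x: "x : tensor_space La (VB La)" "x ~= 0" "ind.delta (placed egen x) : U" using reduce_classes[OF order_refl] by blast
 obtain z where z: "x = cscale z (pure_tensor La cgen)" using TB_all[OF x(1)] by blast
 let ?D = "{m : vecs M. ind.delta m : U}" and ?g = "pure_tensor La cgen"
 have "z ~= 0" using x(2) z by (metis cs.scale_zero_left)
 then have "?g = cscale (1 / z) x" unfolding z by simp
 then have e: "placed egen ?g = cscale (1 / z) (placed egen x)" by (simp only: clin_scale[OF clin_placed])
 have "x : T2" using x(1) TB_T2 by blast
 then have "placed egen x : ?D" using x(3) placed_egen_vecs by blast
 then have "placed egen ?g : ?D" unfolding e by (rule cs.subspace_scale[OF ind.delta_part_subspace[OF U]])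
 then show ?thesis by blast
qed

end

abbreviation "m0 \<equiv> placed egen (pure_tensor La cgen)"
abbreviation "Gen \<equiv> cspan {act M h m0 | h. h : carrier HH}"

lemma pure_cgen_T2: "pure_tensor La cgen : T2" unfolding Tens_def by (rule pure_tensor_in) (rule cgen_in)

lemma Gen_bact:
 assumes h: "h : carrier HH" and f: "f : Gen"
 shows "bact h f : Gen" proof (rule span_induct_lin[OF f _ clin_bact subspace_cspan])
 fix s assume "s : {act M h m0 | h. h : carrier HH}"
 then obtain h' where h': "h' : carrier HH" "s = act M h' m0" by blast
 note mv = placed_egen_vecs[OF pure_cgen_T2]
 have "s : MA {} T2" using ind.M_act[OF h'(1) mv] h'(2) unfolding M_vecs by blast
 then have "bact h s = act M h s" using M_act[OF h] by simp
 also have "... = act M (h \<cdot> h') m0" unfolding h'(2) by (rule ind.M_mult[OF h h'(1) mv, symmetric])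
 finally show "bact h s : Gen" using ind.H_mult[OF h h'(1)] by (intro cspan_base) blast
qed

lemma m0_Gen: "m0 : Gen" proof (rule cspan_base)
 have "act M e1 m0 = m0" by (rule ind.M_one[OF placed_egen_vecs[OF pure_cgen_T2]])
 then show "m0 : {act M h m0 | h. h : carrier HH}" using ind.H_one by (intro CollectI exI[of _ e1] conjI) simp_all
qed

lemma Gen_classes:
 assumes "B <= La"
 shows "ALL v. (ALL a:B. v a : SI a) --> (ALL a:La-B. v a = cgen a) --> placed egen (pure_tensor La v) : Gen"
 using finite_subset[OF assms finite_atLeastAtMost] assms proof (induction B rule: finite_induct)
 case empty
 have "placed egen (pure_tensor La v) : Gen" if "ALL a:La. v a = cgen a" for v proof -
  have "pure_tensor La v = pure_tensor La cgen" by (rule pure_tensor_cong) (use that in blast)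
  then show ?thesis using m0_Gen by simp
 qed
 then show ?case by simp
next
 case (insert a B)
 have a: "a : La" and B: "B <= La" using insert.prems by simp_all
 note IH = insert.IH[OF B]
 show ?case proof (intro allI impI)
  fix v assume v1: "ALL a':insert a B. v a' : SI a'" and v2: "ALL a':La - insert a B. v a' = cgen a'"
  let ?v = "v(a := cgen a)"
  let ?L = "%f. placed egen (pure_tensor La (?v(a := f)))"
  have cl: "clin ?L" by (rule clin_comp[OF clin_placed pure_tensor_slot[OF finite_atLeastAtMost a]])
  have vS: "?v i : SI i" if "i : La" for i using v1 v2 cgen_in[OF that] that by (cases "i = a"; cases "i : B") auto
  have base: "placed egen (pure_tensor La ?v) : Gen" proof (rule IH[rule_format])
   show "?v i : SI i" if "i : B" for i using vS that B by blast
   show "?v i = cgen i" if "i : La - B" for i using v2 that by auto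
  qed
  have pf: "pure_tensor La ?v : free Wset" using pure_tensor_in[of La ?v SI, OF vS] T2_free unfolding Tens_def by blast
  have "?L (v a) : Gen" proof (rule span_induct_lin[OF _ _ cl subspace_cspan])
   show "v a : cspan {tact p (cgen a) | p. p permutes cls a}"
   using v1 unfolding cgen_def specht_image_span[OF finite_cls \<Lambda>[OF a], symmetric] by blast
   fix f assume "f : {tact p (cgen a) | p. p permutes cls a}"
   then obtain p where p: "p permutes cls a" "f = tact p (cgen a)" by blast
   have "px p (pure_tensor La ?v) = pure_tensor La (?v(a := tact p (?v a)))" by (rule px_slot[OF p(1)]) (rule vS)
   then have "?L f = placed egen (px p (pure_tensor La ?v))" by (simp only: p(2) fun_upd_same)
   also have "... = bact (inS p) (placed egen (pure_tensor La ?v))" by (rule bact_inS[OF perm_cls[OF p(1)] pf, symmetric])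
   finally show "?L f : Gen" using Gen_bact[OF inS_in[OF perm_cls[OF p(1)]] base] by simp
  qed
  then show "placed egen (pure_tensor La v) : Gen" by simp
 qed
qed

lemma Gen_egen:
 assumes "x : T2"
 shows "placed egen x : Gen" proof (rule T2_induct[OF assms clin_placed subspace_cspan])
 fix v assume "!!a. a : La ==> v a : SI a"
 then show "placed egen (pure_tensor La v) : Gen" using Gen_classes[OF order_refl] by blast
qed

lemma Gen_positions:
 assumes x: "x : T2" and "A <= {1..r}"
 shows "ALL u. us u --> (ALL p:{1..r}-A. u p = egen p) --> placed u x : Gen" using finite_subset[OF assms(2) finite_atLeastAtMost] assms(2)
proof (induction A rule: finite_induct)
 case empty
 have xf: "x : free Wset" using x T2_free by blast
 have "placed u x : Gen" if "ALL p:{1..r}. u p = egen p" for u proof -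
  have "placed u x = placed egen x" by (rule placed_cong[OF _ xf]) (use that in blast)
  then show ?thesis using Gen_egen[OF x] by simp
 qed
 then show ?case by simp
next
 case (insert p A)
 have p: "p : {1..r}" and A: "A <= {1..r}" using insert.prems by simp_all
 note IH = insert.IH[OF A]
 have xf: "x : free Wset" using x T2_free by blast
 show ?case proof (intro allI impI)
  fix u assume u: "us u" and u2: "ALL p':{1..r} - insert p A. u p' = egen p'"
  let ?u = "u(p := egen p)"
  have uu: "us ?u" using us_upd[OF u] usD[OF egen_us p] by blast
  have base: "placed ?u x : Gen" by (rule IH[rule_format, OF uu]) (use u2 in auto)
  have "placed (?u(p := u p)) x : Gen" proof (rule span_induct_lin[OF _ _ clin_placed_slot[OF p xf] subspace_cspan])
   show "u p : cspan {tact s (egen p) | s. s permutes Nd}"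
   using usD[OF u p] unfolding egen_def specht_gen_span[OF Nd(1) nu_part[OF p], symmetric] .
   fix f assume "f : {tact s (egen p) | s. s permutes Nd}"
   then obtain s where s: "s permutes Nd" "f = tact s (egen p)" by blast
   show "placed (?u(p := f)) x : Gen" proof (cases "j p = 1")
   case True
   have "egen p : specht [d] Nd" using usD[OF egen_us p] True nu_one[OF d] by simp
   then have "f = egen p" unfolding s(2) by (rule specht_row_trivial[OF Nd s(1)])
   then show ?thesis using base by simp
   next
   case False
   have "placed (?u(p := f)) x = bact (ins p s) (placed ?u x)" using bact_ins_placed[OF s(1) uu xf, of p] p False s(2) by simp
   then show ?thesis using Gen_bact[OF ins_in[OF s(1)] base] by simp
   qed
  qed
  then show "placed u x : Gen" by simp
 qed
qed

lemma Gen_all: "vecs M <= Gen" unfolding M_vecs MA_def proof (rule cspan_minimal[OF _ subspace_cspan], rule subsetI)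
 fix f assume "f : gens {} T2"
 then obtain u x where "f = placed u x" "us u" "x : T2" unfolding gens_def by blast
 then show "f : Gen" using Gen_positions[OF _ order_refl] by blast
qed

lemma m0_nonzero: "m0 ~= 0" proof
 assume "m0 = 0"
 then have z: "pure_tensor La cgen = 0" by (rule placed_egen_zero[rotated]) (use pure_cgen_T2 T2_free in blast)
 have "EX R. cgen a R ~= 0" if "a : La" for a using cgen_nonzero[OF that] by (auto simp: fun_eq_iff)
 then obtain R where R: "!!a. a : La ==> cgen a (R a) ~= 0" by metis
 have "pure_tensor La cgen (restrict R La) = (PROD a:La. cgen a (R a))" by (simp add: pure_tensor_def)
 moreover have "(PROD a:La. cgen a (R a)) ~= 0" using R by simp
 ultimately show False using z by simp
qed

theorem W_irreducible: "irreducible_rep GG (W d k r j \<sigma> \<Lambda> \<tau>)" unfolding W_def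
proof (rule ind.induced_irreducible[OF placed_egen_vecs[OF pure_cgen_T2] m0_nonzero Gen_all])
 show "ind.delta m0 : U" if "submodule GG ind.Ind U" "U ~= {0}" for U by (rule reduce_to_generator[OF that])
qed

end


section \<open>Direct sums of representations\<close>

lemma subspace_pullback:
 assumes "cs.subspace U" "!!g. clin (L g)" "cs.subspace Z"
 shows "cs.subspace {f : U. ALL g:G. L g f : Z}" using assms(1,3) unfolding cs.subspace_def mem_Collect_eq
 by (simp only: clin_add[OF assms(2)] clin_scale[OF assms(2)] clin_zero[OF assms(2)]) blast

lemma decomposes_pullback:
 assumes D: "decomposes C Z Z0" and U: "cs.subspace U" and L: "!!g. clin (L g)"
  and zero: "!!f. f : U ==> (!!g. g : G ==> L g f = 0) ==> f = 0"
  and lift: "!!f c v. (!!g c. g : G ==> c : C ==> v g c : Z c) ==> (!!g. g : G ==> L g f = (SUM c:C. v g c)) ==> c : C ==>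
   EX u:U. ALL g:G. L g u = v g c"
 shows "decomposes C (%c. {f : U. ALL g:G. L g f : Z c}) {f : U. ALL g:G. L g f : Z0}" proof (rule decomposesI[OF decomposes_finite[OF D]])
 show "cs.subspace {f : U. ALL g:G. L g f : Z c}" if "c : C" for c by (rule subspace_pullback[OF U L decomposes_subspace[OF D that]])
 show "{f : U. ALL g:G. L g f : Z c} <= {f : U. ALL g:G. L g f : Z0}" if "c : C" for c using decomposes_subset[OF D that] by blast
next
 fix f assume "f : {f : U. ALL g:G. L g f : Z0}"
 then have f: "f : U" and "ALL g:G. EX v. (ALL c:C. v c : Z c) & L g f = (SUM c:C. v c)" using decomposes_ex[OF D] by blast+
 from this(2) obtain v where "ALL g:G. (ALL c:C. v g c : Z c) & L g f = (SUM c:C. v g c)" by (rule bchoice[THEN exE])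
 then have v: "!!g c. g : G ==> c : C ==> v g c : Z c" "!!g. g : G ==> L g f = (SUM c:C. v g c)" by blast+
 have "ALL c:C. EX u. u : U & (ALL g:G. L g u = v g c)" using lift[OF v] by blast
 then obtain u where "ALL c:C. u c : U & (ALL g:G. L g (u c) = v g c)" by (rule bchoice[THEN exE])
 then have u: "!!c. c : C ==> u c : U" "!!c g. c : C ==> g : G ==> L g (u c) = v g c" by blast+
 have "f - (SUM c:C. u c) = 0" proof (rule zero[OF cs.subspace_diff[OF U f cs.subspace_sum[OF U u(1)]]])
  fix g assume g: "g : G"
  have "L g ((f - (SUM c:C. u c)) + (SUM c:C. u c)) = L g (f - (SUM c:C. u c)) + (SUM c:C. L g (u c))"
   unfolding clin_add[OF L] clin_sum[OF L] ..
  then show "L g (f - (SUM c:C. u c)) = 0" by (simp add: v(2)[OF g] u(2)[OF _ g])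
 qed
 then have "f = (SUM c:C. u c)" by simp
 then show "EX u. (ALL c:C. u c : {f : U. ALL g:G. L g f : Z c}) & f = (SUM c:C. u c)" using u v(1) by (intro exI[of _ u]) simp
next
 fix u c assume u: "!!c. c : C ==> u c : {f : U. ALL g:G. L g f : Z c}" and z: "(SUM c:C. u c) = 0" and c: "c : C"
 show "u c = 0" proof (rule zero)
  show "u c : U" using u[OF c] by blast
  fix g assume g: "g : G"
  have uz: "L g (u c) : Z c" if "c : C" for c using u[OF that] g by blast
  have s: "(SUM c:C. L g (u c)) = 0" unfolding clin_sum[OF L, symmetric] z by (rule clin_zero[OF L])
  show "L g (u c) = 0" by (rule decomposes_indep[OF D uz s c])
 qed
qed

lemma decomposes_Sigma:
 assumes D: "decomposes A K Z" and E: "!!a. a : A ==> decomposes (B a) (L a) (K a)"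
 shows "decomposes (Sigma A B) (%(a, b). L a b) Z" proof -
 have fA: "finite A" and fB: "!!a. a : A ==> finite (B a)" using decomposes_finite[OF D] decomposes_finite[OF E] by blast+
 have flat: "(SUM c:Sigma A B. v c) = (SUM a:A. SUM b:B a. v (a, b))" for v :: "_ => _ => complex"
  using sum.Sigma[OF fA, of B "%a b. v (a, b)"] fB by simp
 show ?thesis proof (rule decomposesI[OF finite_SigmaI[OF fA fB]])
  show "cs.subspace (case c of (a, b) => L a b)" if "c : Sigma A B" for c using that decomposes_subspace[OF E] by auto
  show "(case c of (a, b) => L a b) <= Z" if "c : Sigma A B" for c using that decomposes_subset[OF E] decomposes_subset[OF D] by blast
 next
  fix f assume "f : Z"
  then obtain v where v: "!!a. a : A ==> v a : K a" "f = (SUM a:A. v a)" using decomposes_ex[OF D] by blast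
  have "ALL a:A. EX u. (ALL b:B a. u b : L a b) & v a = (SUM b:B a. u b)" using decomposes_ex[OF E] v(1) by blast
  then obtain u where u: "ALL a:A. (ALL b:B a. u a b : L a b) & v a = (SUM b:B a. u a b)" by (rule bchoice[THEN exE])
  show "EX v. (ALL c:Sigma A B. v c : (case c of (a, b) => L a b)) & f = (SUM c:Sigma A B. v c)"
   by (rule exI[of _ "%(a, b). u a b"]) (use u in \<open>auto simp: flat v(2) intro!: sum.cong\<close>)
 next
  fix v c assume v: "!!c. c : Sigma A B ==> v c : (case c of (a, b) => L a b)"
   and z: "(SUM c:Sigma A B. v c) = 0" and c: "c : Sigma A B"
  obtain a b where ab: "c = (a, b)" "a : A" "b : B a" using c by blast
  have vL: "v (a, b) : L a b" if "a : A" "b : B a" for a b using v[of "(a, b)"] that by simp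
  have K: "(SUM b:B a. v (a, b)) : K a" if "a : A" for a
   using vL[OF that] decomposes_subset[OF E[OF that]] by (intro cs.subspace_sum[OF decomposes_subspace[OF D that]]) blast
  have "(SUM b:B a. v (a, b)) = 0" by (rule decomposes_indep[OF D K _ ab(2)]) (simp_all add: z[unfolded flat])
  from decomposes_indep[OF E[OF ab(2)] vL[OF ab(2)] this ab(3)] show "v c = 0" by (simp only: ab(1))
 qed
qed

lemma decomposes_support:
 assumes I: "finite I" and X: "X = (UN i:I. Y i)" and dis: "!!i i' x. i : I ==> i' : I ==> x : Y i ==> x : Y i' ==> i = i'"
 shows "decomposes I (%i. free (Y i)) (free X)" proof (rule decomposesI[OF I])
 have pick: "(SUM i:I. v i x) = v i0 x" if "i0 : I" "x : Y i0" "!!i. i : I ==> v i : free (Y i)" for v :: "_ => _ => complex" and i0 x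
 proof -
  have "v i x = 0" if "i : I - {i0}" for i
   using dis[of i i0 x] that `i0 : I` `x : Y i0` `!!i. i : I ==> v i : free (Y i)`[of i] unfolding free_def by blast
  then have "(SUM i:I-{i0}. v i x) = 0" by (intro sum.neutral) blast
  then show ?thesis using sum.remove[OF I that(1), of "%i. v i x"] by simp
 qed
 show "cs.subspace (free (Y i))" for i by (rule subspace_free)
 show "free (Y i) <= free X" if "i : I" for i using that X by (auto simp: free_def)
 show "EX v. (ALL i:I. v i : free (Y i)) & f = (SUM i:I. v i)" if f: "f : free X" for f
 proof (intro exI[of _ "%i x. if x : Y i then f x else 0"] conjI ballI)
  let ?v = "%i x. if x : Y i then f x else 0"
  show vi: "?v i : free (Y i)" for i by (simp add: free_def)
  show "f = (SUM i:I. ?v i)" proof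
   fix x
   show "f x = (SUM i:I. ?v i) x" proof (cases "x : X")
   case True
   then obtain i0 where i0: "i0 : I" "x : Y i0" using X by blast
   show ?thesis using pick[where v = ?v, OF i0 vi] i0 by (simp add: sum_apply)
   next
   case False
   then have "x ~: Y i" if "i : I" for i using that X by blast
   then have "(SUM i:I. ?v i x) = 0" by (intro sum.neutral) simp
   then show ?thesis using f False by (simp add: sum_apply free_def)
   qed
  qed
 qed
 show "v i = 0" if v: "!!i. i : I ==> v i : free (Y i)" and z: "(SUM i:I. v i) = 0" and i: "i : I" for v i proof
  fix x
  show "v i x = 0 x" proof (cases "x : Y i")
   case True
   have "v i x = (SUM i:I. v i) x" using pick[OF i True v] by (simp add: sum_apply)
   then show ?thesis by (simp add: z)
  next
   case False
   then show ?thesis using v[OF i] by (simp add: free_def)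
  qed
 qed
qed

lemma
 shows direct_sum_vecs: "vecs (direct_sum I M) = {F. (ALL i:I. F i : vecs (M i)) & (ALL i. i ~: I --> F i = 0)}"
  and direct_sum_scal: "scal (direct_sum I M) = (%c F i. scal (M i) c (F i))"
  and direct_sum_act: "act (direct_sum I M) = (%g F i. if i : I then act (M i) g (F i) else 0)" by (simp_all add: direct_sum_def)

lemma vector_space_zero: "vector_space s ==> s c 0 = 0" by (rule module.scale_zero_right) (simp only: module_iff_vector_space)

lemma direct_sum_vector_space:
 assumes "!!i. vector_space (scal (M i))"
 shows "vector_space (scal (direct_sum I M))" using assms unfolding vector_space_def direct_sum_scal by (simp add: fun_eq_iff)

lemma direct_sum_representation:
 assumes G: "group G" and vs: "!!i. vector_space (scal (M i))" and M: "!!i. i : I ==> representation G (M i)"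
 shows "representation G (direct_sum I M)" proof (rule representationI[OF G direct_sum_vector_space[OF vs]])
 let ?D = "direct_sum I M"
 have md: "module (scal (M i))" "module (scal ?D)" for i
  using vs direct_sum_vector_space[of M I, OF vs] by (simp_all only: module_iff_vector_space)
 show "module.subspace (scal ?D) (vecs ?D)" unfolding module.subspace_def[OF md(2)] using rep_subspace[OF M] vector_space_zero[OF vs]
  by (auto simp: module.subspace_def[OF md(1)] direct_sum_vecs direct_sum_scal)
 show "linear_between ?D ?D (act ?D g)" if g: "g : carrier G" for g proof -
  have l: "linear_between (M i) (M i) (act (M i) g)" if "i : I" for i by (rule rep_linear[OF M[OF that] g])
  show ?thesis unfolding linear_between_def[of ?D] direct_sum_vecs direct_sum_scal direct_sum_act
   using linear_between_in[OF l] linear_between_add[OF l] linear_between_scale[OF l] vector_space_zero[OF vs] by (auto simp: fun_eq_iff)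
 qed
 show "act ?D \<one>\<^bsub>G\<^esub> F = F" if "F : vecs ?D" for F
  using that rep_one[OF M] by (auto simp: direct_sum_vecs direct_sum_act fun_eq_iff)
 show "act ?D (g \<otimes>\<^bsub>G\<^esub> h) F = act ?D g (act ?D h F)" if "g : carrier G" "h : carrier G" "F : vecs ?D" for g h F
  using that rep_mult[OF M] by (auto simp: direct_sum_vecs direct_sum_act fun_eq_iff)
qed

lemma isomorphic_repsI:
 assumes "representation G M" "representation G N" "linear_between M N f" "bij_betw f (vecs M) (vecs N)"
  "!!g x. g : carrier G ==> x : vecs M ==> f (act M g x) = act N g (f x)"
 shows "isomorphic_reps G M N" using assms unfolding isomorphic_reps_def by blast

lemma isomorphic_repsE:
 assumes "isomorphic_reps G M N"
 obtains f where "linear_between M N f" "bij_betw f (vecs M) (vecs N)"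
  "!!g x. g : carrier G ==> x : vecs M ==> f (act M g x) = act N g (f x)" using assms unfolding isomorphic_reps_def by blast

lemma isomorphic_reps_trans:
 assumes "isomorphic_reps G M N" "isomorphic_reps G N K"
 shows "isomorphic_reps G M K" proof -
 obtain f where f: "linear_between M N f" "bij_betw f (vecs M) (vecs N)"
  "!!g x. g : carrier G ==> x : vecs M ==> f (act M g x) = act N g (f x)" by (rule isomorphic_repsE[OF assms(1)]) blast
 obtain h where h: "linear_between N K h" "bij_betw h (vecs N) (vecs K)"
  "!!g x. g : carrier G ==> x : vecs N ==> h (act N g x) = act K g (h x)" by (rule isomorphic_repsE[OF assms(2)]) blast
 note fi = linear_between_in[OF f(1)]
 show ?thesis proof (rule isomorphic_repsI)
  show "representation G M" "representation G K" using assms unfolding isomorphic_reps_def by blast+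
  show "linear_between M K (h o f)" using f(1) h(1) unfolding linear_between_def by simp
  show "bij_betw (h o f) (vecs M) (vecs K)" by (rule bij_betw_trans[OF f(2) h(2)])
  show "(h o f) (act M g x) = act K g ((h o f) x)" if "g : carrier G" "x : vecs M" for g x
   using f(3)[OF that] h(3)[OF that(1) fi[OF that(2)]] by simp
 qed
qed

lemma isomorphic_reps_sym:
 assumes "isomorphic_reps G M N"
 shows "isomorphic_reps G N M" proof -
 have M: "representation G M" and N: "representation G N" using assms unfolding isomorphic_reps_def by blast+
 obtain f where f: "linear_between M N f" "bij_betw f (vecs M) (vecs N)"
  "!!g x. g : carrier G ==> x : vecs M ==> f (act M g x) = act N g (f x)" by (rule isomorphic_repsE[OF assms]) blast
 interpret M: representation G M by (rule M)
 let ?h = "inv_into (vecs M) f"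
 have h: "?h y : vecs M" "f (?h y) = y" if "y : vecs N" for y
  using that bij_betw_apply[OF bij_betw_inv_into[OF f(2)]] bij_betw_inv_into_right[OF f(2)] by blast+
 have eq: "?h y = x" if "x : vecs M" "f x = y" for x y using bij_betw_inv_into_left[OF f(2) that(1)] that(2) by simp
 note l = linear_between_add[OF f(1)] linear_between_scale[OF f(1)] linear_between_in[OF M.act_linear]
 show ?thesis by (rule isomorphic_repsI[OF N M _ bij_betw_inv_into[OF f(2)]])
   (auto simp: linear_between_def h l f(3) intro!: eq M.vs.subspace_add[OF M.subspace_vecs] M.vs.subspace_scale[OF M.subspace_vecs])
qed

lemma direct_sum_flatten:
 assumes G: "group G" and v: "!!a b c e f. vector_space (scal (M a b c e f))"
  and M: "!!a b c e f. a : A ==> b : B a ==> c : C a b ==> e : D a b c ==> f : E a b c e ==> representation G (M a b c e f)"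
 shows "isomorphic_reps G
  (direct_sum (SIGMA a:A. SIGMA b:B a. SIGMA c:C a b. SIGMA e:D a b c. E a b c e) (%(a, b, c, e, f). M a b c e f))
  (direct_sum A (%a. direct_sum (B a) (%b. direct_sum (C a b) (%c. direct_sum (D a b c) (%e. direct_sum (E a b c e) (M a b c e))))))"
  (is "isomorphic_reps G ?A ?B") proof (rule isomorphic_repsI[where f = "%F a b c e f. F (a, b, c, e, f)"])
 show "representation G ?A" by (rule direct_sum_representation[OF G]) (use v M in \<open>auto split: prod.split\<close>)
 show "representation G ?B" by (intro direct_sum_representation[OF G] direct_sum_vector_space v M)
 have AB: "(%a b c e f. F (a, b, c, e, f)) : vecs ?B \<longleftrightarrow> F : vecs ?A" for F
  unfolding direct_sum_vecs by (auto simp: fun_eq_iff) blast+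
 have BA: "(%(a, b, c, e, f). F a b c e f) : vecs ?A \<longleftrightarrow> F : vecs ?B" for F
  using AB[of "%(a, b, c, e, f). F a b c e f"] by simp
 show "linear_between ?A ?B (%F a b c e f. F (a, b, c, e, f))" unfolding linear_between_def AB by (auto simp: direct_sum_scal fun_eq_iff)
 show "bij_betw (%F a b c e f. F (a, b, c, e, f)) (vecs ?A) (vecs ?B)"
  by (rule bij_betw_byWitness[where f' = "%F (a, b, c, e, f). F a b c e f"]) (auto simp: AB BA)
 show "(%a b c e f. act ?A g F (a, b, c, e, f)) = act ?B g (%a b c e f. F (a, b, c, e, f))" for g F
  by (auto simp: direct_sum_act fun_eq_iff)
qed

lemma linear_between_sum:
 fixes V :: "('g, 'x => complex) rep"
 assumes lin: "linear_between V V f" and V: "scal V = cscale" "cs.subspace (vecs V)" and C: "finite C"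
  and x: "!!c. c : C ==> x c : vecs V"
 shows "f (SUM c:C. x c) = (SUM c:C. f (x c))" using C x proof (induction C rule: finite_induct)
 case empty
 show ?case using linear_between_scale[OF lin cs.subspace_0[OF V(2)], of 0] by (simp only: V(1) cs.scale_zero_left sum.empty)
next
 case (insert a C)
 have "(SUM c:C. x c) : vecs V" by (rule cs.subspace_sum[OF V(2)]) (use insert.prems in blast)
 from linear_between_add[OF lin insert.prems[OF insertI1] this] insert.IH[OF insert.prems[OF insertI2]]
 show ?case unfolding sum.insert[OF insert.hyps] by (simp only:)
qed

lemma isomorphic_to_direct_sum:
 fixes V :: "('g, 'x => complex) rep"
 assumes V: "representation G V" "scal V = cscale" and D: "decomposes C L (vecs V)"
  and vs: "!!c. vector_space (scal (M c))" and iso: "!!c. c : C ==> isomorphic_reps G (V(|vecs := L c|)) (M c)"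
 shows "isomorphic_reps G V (direct_sum C M)" proof (rule isomorphic_reps_sym)
 have ssV: "cs.subspace (vecs V)" using rep_subspace[OF V(1)] by (simp only: V(2))
 have LV: "L c <= vecs V" if "c : C" for c by (rule decomposes_subset[OF D that])
 note fin = decomposes_finite[OF D]
 have rM: "representation G (M c)" if "c : C" for c using iso[OF that] unfolding isomorphic_reps_def by blast
 have "ALL c:C. EX f. linear_between (M c) (V(|vecs := L c|)) f & bij_betw f (vecs (M c)) (L c) &
   (ALL g:carrier G. ALL x:vecs (M c). f (act (M c) g x) = act V g (f x))"
  using isomorphic_reps_sym[OF iso] unfolding isomorphic_reps_def by simp
 then obtain f where "ALL c:C. linear_between (M c) (V(|vecs := L c|)) (f c) & bij_betw (f c) (vecs (M c)) (L c) &
   (ALL g:carrier G. ALL x:vecs (M c). f c (act (M c) g x) = act V g (f c x))" by (rule bchoice[THEN exE])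
 then have f: "!!c. c : C ==> linear_between (M c) (V(|vecs := L c|)) (f c)" "!!c. c : C ==> bij_betw (f c) (vecs (M c)) (L c)"
  "!!c g x. c : C ==> g : carrier G ==> x : vecs (M c) ==> f c (act (M c) g x) = act V g (f c x)" by blast+
 note l = linear_between_add[OF f(1)] linear_between_scale[OF f(1)]
 have FM: "F c : vecs (M c)" if "F : vecs (direct_sum C M)" "c : C" for F c using that by (simp add: direct_sum_vecs)
 have fL: "f c x : L c" if "c : C" "x : vecs (M c)" for c x using bij_betw_apply[OF f(2)[OF that(1)] that(2)] .
 have fV: "f c x : vecs V" if "c : C" "x : vecs (M c)" for c x using fL[OF that] LV[OF that(1)] by blast
 let ?f = "%F. SUM c:C. f c (F c)"
 show "isomorphic_reps G (direct_sum C M) V"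
 proof (rule isomorphic_repsI[where f = ?f, OF direct_sum_representation[OF rep_group[OF V(1)] vs rM] V(1)])
  show "linear_between (direct_sum C M) V ?f" unfolding linear_between_def direct_sum_scal
   using FM by (auto simp: l V(2) sum.distrib cs.scale_sum_right intro!: cs.subspace_sum[OF ssV] fV)
  show "bij_betw ?f (vecs (direct_sum C M)) (vecs V)" unfolding bij_betw_def proof (intro conjI equalityI subsetI)
   show "inj_on ?f (vecs (direct_sum C M))" proof (rule inj_onI)
   fix F F' assume F: "F : vecs (direct_sum C M)" "F' : vecs (direct_sum C M)" and e: "?f F = ?f F'"
   have "F c = F' c" if c: "c : C" for c by (rule inj_onD[OF bij_betw_imp_inj_on[OF f(2)[OF c]] _ FM[OF F(1) c] FM[OF F(2) c]])
   (rule decomposes_unique[OF D fL[OF _ FM[OF F(1)]] fL[OF _ FM[OF F(2)]] e c])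
   then show "F = F'" using F by (auto simp: direct_sum_vecs fun_eq_iff) metis
   qed
   show "y : vecs V" if "y : ?f ` vecs (direct_sum C M)" for y using that FM by (auto intro!: cs.subspace_sum[OF ssV] fV)
   fix x assume "x : vecs V"
   then obtain v where v: "ALL c:C. v c : L c" "x = (SUM c:C. v c)" using decomposes_ex[OF D] by blast
   let ?F = "%c. if c : C then inv_into (vecs (M c)) (f c) (v c) else 0"
   have x: "x = ?f ?F" unfolding v(2) by (rule sum.cong) (use v(1) bij_betw_inv_into_right[OF f(2)] in simp_all)
   have "?F : vecs (direct_sum C M)" using v(1) bij_betw_apply[OF bij_betw_inv_into[OF f(2)]] by (simp add: direct_sum_vecs)
   then show "x : ?f ` vecs (direct_sum C M)" using x by (intro image_eqI[where f = ?f and x = ?F])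
  qed
  show "?f (act (direct_sum C M) g F) = act V g (?f F)" if g: "g : carrier G" and F: "F : vecs (direct_sum C M)" for g F proof -
   have "act V g (?f F) = (SUM c:C. act V g (f c (F c)))"
   by (rule linear_between_sum[OF rep_linear[OF V(1) g] V(2) ssV fin]) (rule fV[OF _ FM[OF F]])
   also have "... = ?f (act (direct_sum C M) g F)" by (rule sum.cong) (simp_all add: direct_sum_act f(3)[OF _ g FM[OF F]])
   finally show ?thesis ..
  qed
 qed
qed


section \<open>Tuples with a given pattern of coincidences\<close>

lemma part_mu: "m : {1..q} ==> part (mu d q) (m + 1) = 1" by (auto simp: part_def mu_def nth_Cons')

lemma sum_mu: "q <= d ==> sum_list (mu d q) = d" by (simp add: mu_def sum_list_replicate)

lemma row_then_ones_mu: "row_then_ones (mu d q)" by (auto simp: row_then_ones_def mu_def)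

lemma mu_row:
 assumes "R : tabloids (mu d q) N" "m : {1..q}"
 shows "R (m + 1) = {the_elem (R (m + 1))}" proof -
 have "card (R (m + 1)) = 1" using tabloid_card[OF assms(1), of "m + 1"] part_mu[OF assms(2)] by simp
 then obtain x where "R (m + 1) = {x}" by (rule card_1_singletonE)
 then show ?thesis by (simp only: the_elem_eq)
qed

text \<open>The tabloids of shape \<open>mu d q\<close> are those of the first class for the constant colouring.\<close>

definition "one_color q = (\<lambda>i\<in>{1..q}. 1 :: nat)"

lemma one_color: "i : {1..q} ==> one_color q i = 1" by (simp add: one_color_def)

context
 fixes d q :: nat
 assumes d: "1 <= d" and q: "q <= d"
begin

interpretation pl: placement 1 d q "one_color q" by unfold_locales (use q ell_pos[of 1] in \<open>auto simp: one_color_def\<close>)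

lemma gamma_mu: "gamma d q (one_color q) 1 = mu d q" proof -
 have "{i : {1..q}. one_color q i = 1} = {1..q}" using one_color by blast
 then show ?thesis unfolding gamma_def mu_def by simp
qed

lemma row_index_const: "i : {1..q} ==> row_index (one_color q) i = i + 1" proof -
 assume i: "i : {1..q}"
 have "one_color q i' = 1" if "i' : {1..i}" for i' using i that by (intro one_color) simp
 then have "{i' : {1..i}. one_color q i' = one_color q i} = {1..i}" unfolding one_color[OF i] by blast
 then show ?thesis unfolding row_index_def if_P[OF one_color[OF i]] by simp
qed

lemma color_const: "p : {1..d} ==> pl.color p = 1" unfolding pl.color_def by (cases "p <= q") (simp_all add: one_color_def)

lemma cls_const: "pl.cls 1 = {1..d}" unfolding set_eq_iff pl.cls_iff using color_const by blast

lemma entry_const: "i : {1..q} ==> entry (one_color q) w i = the_elem (w 1 (i + 1))"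
 unfolding entry_def by (simp only: row_index_const one_color)

lemma mu_tabloid_ex:
 assumes "inj_on c {1..q}" "!!m. m : {1..q} ==> c m : {1..d}"
 shows "EX R:tabloids (mu d q) {1..d}. ALL m:{1..q}. the_elem (R (m + 1)) = c m" proof -
 have c: "c i : pl.cls (one_color q i)" if "i : {1..q}" for i unfolding one_color[OF that] cls_const by (rule assms(2)[OF that])
 obtain w where w: "w : pl.Wset" "!!i. i : {1..q} ==> entry (one_color q) w i = c i" by (rule pl.Wset_ex[OF assms(1) c]) blast+
 have 1: "1 : {1..ell 1}" using ell_pos[of 1] by simp
 have "w 1 : tabloids (mu d q) {1..d}" using pl.Wset_tabloid[OF w(1) 1] unfolding gamma_mu cls_const .
 moreover have "the_elem (w 1 (m + 1)) = c m" if "m : {1..q}" for m using w(2)[OF that] unfolding entry_const[OF that] .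
 ultimately show ?thesis by blast
qed

lemma mu_tabloid_eqI:
 assumes R: "R : tabloids (mu d q) {1..d}" and R': "R' : tabloids (mu d q) {1..d}"
  and eq: "!!m. m : {1..q} ==> the_elem (R (m + 1)) = the_elem (R' (m + 1))"
 shows "R = R'" proof -
 have i: "inj_on (%i. i) {1..q}" by simp
 have c: "i : pl.cls (one_color q i)" if "i : {1..q}" for i unfolding one_color[OF that] cls_const using that q by simp
 obtain w where w: "w : pl.Wset" by (rule pl.Wset_ex[OF i c]) blast+
 have 1: "1 : {1..ell 1}" using ell_pos[of 1] by simp
 have W: "w(1 := S) : pl.Wset" if S: "S : tabloids (mu d q) {1..d}" for S unfolding pl.Wset_def proof (rule PiE_I)
  fix a assume a: "a : {1..ell 1}"
  show "(w(1 := S)) a : tabloids (gamma d q (one_color q) a) (pl.cls a)" proof (cases "a = 1")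
   case True
   show ?thesis unfolding True fun_upd_same gamma_mu cls_const by (rule S)
  next
   case False
   show ?thesis unfolding fun_upd_other[OF False] by (rule pl.Wset_tabloid[OF w a])
  qed
 next
  fix a assume a: "a ~: {1..ell 1}"
  then have "a ~= 1" using 1 by blast
  then show "(w(1 := S)) a = undefined" using PiE_arb[OF w[unfolded pl.Wset_def] a] by (rule fun_upd_other[THEN trans])
 qed
 have "w(1 := R) = w(1 := R')" proof (rule pl.Wset_eqI[OF W[OF R] W[OF R']])
  fix m assume m: "m : {1..q}"
  show "entry (one_color q) (w(1 := R)) m = entry (one_color q) (w(1 := R')) m" unfolding entry_const[OF m] fun_upd_same by (rule eq[OF m])
 qed
 then show ?thesis by (metis fun_upd_same)
qed

end

lemma act_tuple_action: "perm_action (wreath_sym d k) ({1..t} \<rightarrow>\<^sub>E {1..d} \<times> {1..k}) (act_tuple t)"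
 unfolding perm_action_def proof (intro conjI ballI)
 let ?T = "{1..t} \<rightarrow>\<^sub>E {1..d} \<times> {1..k}"
 show "group (wreath_sym d k)" by (rule wreath_group[OF perm_group_sym])
 show "finite ?T" by (intro finite_PiE finite_cartesian_product) auto
 have perm: "\<beta> permutes {1..k}" if "(\<alpha>, \<beta>) : carrier (wreath_sym d k)" for \<alpha> \<beta>
  using that by (simp add: wreath_carrier sym_group_def)
 fix x assume x: "x : ?T"
 have xs: "x s : {1..d} \<times> {1..k}" if "s : {1..t}" for s using x that by (rule PiE_mem)
 have xe: "x : extensional {1..t}" using x by (simp add: PiE_iff)
 show "act_tuple t \<one>\<^bsub>wreath_sym d k\<^esub> x = x" proof (rule extensionalityI[OF _ xe])
  show "act_tuple t \<one>\<^bsub>wreath_sym d k\<^esub> x s = x s" if s: "s : {1..t}" for s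
   using xs[OF s] s by (cases "x s") (simp add: act_tuple_def act_point_def wreath_one)
 qed (simp add: act_tuple_def)
 fix g assume g: "g : carrier (wreath_sym d k)"
 obtain \<alpha> \<beta> where ab: "g = (\<alpha>, \<beta>)" by (cases g)
 note \<beta> = perm[OF g[unfolded ab]]
 have pt: "act_point (\<alpha>, \<beta>) y : {1..d} \<times> {1..k}" if y: "y : {1..d} \<times> {1..k}" for y proof -
  obtain i j where y': "y = (i, j)" "i : {1..d}" "j : {1..k}" using y by blast
  have "\<beta> j : {1..k}" using permutes_in_image[OF \<beta>] y'(3) by blast
  moreover have "\<alpha> (\<beta> j) i : {1..d}"
   using permutes_in_image[OF wreath_perm[OF g[unfolded ab] `\<beta> j : {1..k}`]] y'(2) by blast
  ultimately show ?thesis by (simp add: act_point_def y'(1))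
 qed
 show "act_tuple t g x : ?T" unfolding act_tuple_def ab restrict_PiE_iff using pt xs by blast
 fix h assume h: "h : carrier (wreath_sym d k)"
 obtain \<eta> \<zeta> where ez: "h = (\<eta>, \<zeta>)" by (cases h)
 note \<zeta> = perm[OF h[unfolded ez]]
 show "act_tuple t (g \<otimes>\<^bsub>wreath_sym d k\<^esub> h) x = act_tuple t g (act_tuple t h x)" unfolding act_tuple_def
 proof (rule restrict_ext)
  fix s assume s: "s : {1..t}"
  obtain i j where ij: "x s = (i, j)" "j : {1..k}" using xs[OF s] by blast
  have z: "\<zeta> j : {1..k}" using permutes_in_image[OF \<zeta>] ij(2) by blast
  have bz: "\<beta> (\<zeta> j) : {1..k}" using permutes_in_image[OF \<beta>] z by blast
  show "act_point (g \<otimes>\<^bsub>wreath_sym d k\<^esub> h) (x s) = act_point g ((\<lambda>s\<in>{1..t}. act_point h (x s)) s)"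
   unfolding restrict_apply'[OF s] ab ez wreath_mult ij(1) act_point_def prod.case comp_apply
   restrict_apply'[OF bz] permutes_inverses(2)[OF \<beta>] ..
 qed
qed

text \<open>pi and bi number the part and the block containing each of the t indices, so they record which entries
of a tuple agree in the second coordinate and which agree completely.\<close>
locale pattern =
 fixes d k r t :: nat and q pi bi :: "nat => nat"
 assumes d1: "1 <= d" and qd: "!!i. i : {1..r} ==> q i <= d"
  and pis: "pi ` {1..t} = {1..r}" and bis: "!!i. i : {1..r} ==> bi ` {s : {1..t}. pi s = i} = {1..q i}"
begin

definition "Tup = {1..t} \<rightarrow>\<^sub>E {1..d} \<times> {1..k}"
definition "Bs = PiE {1..r} (%i. tabloids (mu d (q i)) {1..d})"
definition "Inj = {p. p ` {1..r} <= {1..k} & inj_on p {1..r}}"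
definition "Phi p b = (\<lambda>s\<in>{1..t}. (the_elem (b (pi s) (bi s + 1)), p (pi s)))"
definition "XP = {x : Tup. ALL s:{1..t}. ALL s':{1..t}. (snd (x s) = snd (x s') \<longleftrightarrow> pi s = pi s') &
  (x s = x s' \<longleftrightarrow> pi s = pi s' & bi s = bi s')}"

lemma pi_in: "s : {1..t} ==> pi s : {1..r}" using pis by blast

lemma bi_in: "s : {1..t} ==> bi s : {1..q (pi s)}" using bis[OF pi_in] by blast

lemma Bs_tabloid: "b : Bs ==> i : {1..r} ==> b i : tabloids (mu d (q i)) {1..d}" unfolding Bs_def by (rule PiE_mem)

lemma Bs_row:
 assumes "b : Bs" "s : {1..t}"
 shows "b (pi s) (bi s + 1) = {the_elem (b (pi s) (bi s + 1))}" "the_elem (b (pi s) (bi s + 1)) : {1..d}" proof -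
 note b = Bs_tabloid[OF assms(1) pi_in[OF assms(2)]]
 show e: "b (pi s) (bi s + 1) = {the_elem (b (pi s) (bi s + 1))}" by (rule mu_row[OF b bi_in[OF assms(2)]])
 have "the_elem (b (pi s) (bi s + 1)) : b (pi s) (bi s + 1)" by (subst (2) e) (rule singletonI)
 then show "the_elem (b (pi s) (bi s + 1)) : {1..d}" using tabloid_subset[OF b] by blast
qed

lemma Phi_cong: "(!!i. i : {1..r} ==> p i = p' i) ==> Phi p b = Phi p' b" unfolding Phi_def by (rule restrict_ext) (use pi_in in simp)

lemma Phi_in:
 assumes p: "p : Inj" and b: "b : Bs"
 shows "Phi p b : XP" unfolding XP_def mem_Collect_eq proof (intro conjI ballI)
 have pk: "p i : {1..k}" if "i : {1..r}" for i using p that unfolding Inj_def by blast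
 show "Phi p b : Tup" unfolding Tup_def Phi_def restrict_PiE_iff using Bs_row(2)[OF b] pk[OF pi_in] by blast
 fix s s' assume s: "s : {1..t}" "s' : {1..t}"
 have inj: "p (pi s) = p (pi s') \<longleftrightarrow> pi s = pi s'" proof -
  have "inj_on p {1..r}" using p unfolding Inj_def by blast
  then show ?thesis by (rule inj_on_eq_iff[OF _ pi_in[OF s(1)] pi_in[OF s(2)]])
 qed
 show "snd (Phi p b s) = snd (Phi p b s') \<longleftrightarrow> pi s = pi s'"
  unfolding Phi_def restrict_apply'[OF s(1)] restrict_apply'[OF s(2)] snd_conv by (rule inj)
 have imp: "bi s = bi s'" if pe: "pi s = pi s'" and e: "the_elem (b (pi s) (bi s + 1)) = the_elem (b (pi s') (bi s' + 1))" proof -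
  note bt = Bs_tabloid[OF b pi_in[OF s(1)]]
  have "the_elem (b (pi s) (bi s + 1)) : b (pi s) (bi s + 1)" by (subst (2) Bs_row(1)[OF b s(1)]) (rule singletonI)
  moreover have "the_elem (b (pi s) (bi s + 1)) : b (pi s) (bi s' + 1)"
   unfolding e unfolding pe by (subst (2) Bs_row(1)[OF b s(2)]) (rule singletonI)
  ultimately have "bi s + 1 = bi s' + 1" by (rule tabloid_disjoint[OF bt])
  then show ?thesis by simp
 qed
 have conv: "the_elem (b (pi s) (bi s + 1)) = the_elem (b (pi s') (bi s' + 1))" if "pi s = pi s'" "bi s = bi s'" by (simp only: that)
 have eq: "Phi p b s = Phi p b s' \<longleftrightarrow>
   the_elem (b (pi s) (bi s + 1)) = the_elem (b (pi s') (bi s' + 1)) & p (pi s) = p (pi s')"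
  unfolding Phi_def restrict_apply'[OF s(1)] restrict_apply'[OF s(2)] prod.inject ..
 show "Phi p b s = Phi p b s' \<longleftrightarrow> pi s = pi s' & bi s = bi s'" unfolding eq inj using imp conv by blast
qed

lemma Phi_inj:
 assumes b: "b : Bs" "b' : Bs" and eq: "Phi p b = Phi p' b'"
 shows "!!i. i : {1..r} ==> p i = p' i" and "b = b'" proof -
 have s: "the_elem (b (pi s) (bi s + 1)) = the_elem (b' (pi s) (bi s + 1))" "p (pi s) = p' (pi s)" if "s : {1..t}" for s
  using fun_cong[OF eq, of s] that by (simp_all add: Phi_def)
 show "p i = p' i" if "i : {1..r}" for i proof -
  have "i : pi ` {1..t}" using pis that by simp
  then obtain s0 where "s0 : {1..t}" "i = pi s0" by blast
  then show ?thesis using s(2) by simp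
 qed
 show "b = b'" proof (rule extensionalityI[of _ "{1..r}"])
  show "b : extensional {1..r}" "b' : extensional {1..r}" using b by (simp_all add: Bs_def PiE_iff)
  fix i assume i: "i : {1..r}"
  show "b i = b' i" proof (rule mu_tabloid_eqI[OF d1 qd[OF i] Bs_tabloid[OF b(1) i] Bs_tabloid[OF b(2) i]])
   fix m assume "m : {1..q i}"
   then have "m : bi ` {s : {1..t}. pi s = i}" using bis[OF i] by simp
   then obtain s0 where "s0 : {1..t}" "pi s0 = i" "m = bi s0" by blast
   then show "the_elem (b i (m + 1)) = the_elem (b' i (m + 1))" using s(1)[of s0] by simp
  qed
 qed
qed

definition "PP x = (\<lambda>i\<in>{1..r}. snd (x (inv_into {1..t} pi i)))"

lemma PP_eq:
 assumes x: "x : XP" and s: "s : {1..t}"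
 shows "PP x (pi s) = snd (x s)" proof -
 have i: "pi s : {1..r}" "pi s : pi ` {1..t}" using s pi_in by blast+
 let ?s = "inv_into {1..t} pi (pi s)"
 have "?s : {1..t}" "pi ?s = pi s" using inv_into_into[OF i(2)] f_inv_into_f[OF i(2)] by blast+
 then have "snd (x ?s) = snd (x s)" using x s unfolding XP_def by blast
 then show ?thesis unfolding PP_def restrict_apply'[OF i(1)] .
qed

lemma PP_in:
 assumes x: "x : XP"
 shows "PP x : Inj" proof -
 have sur: "EX s:{1..t}. pi s = i" if "i : {1..r}" for i using pis that by (metis imageE)
 have "PP x i : {1..k}" if i: "i : {1..r}" for i proof -
  obtain s where s: "s : {1..t}" "pi s = i" using sur[OF i] by blast
  have "x s : {1..d} \<times> {1..k}" using x s(1) unfolding XP_def Tup_def by blast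
  then show ?thesis using PP_eq[OF x s(1)] s(2) by auto
 qed
 moreover have "inj_on (PP x) {1..r}" proof (rule inj_onI)
  fix i i' assume i: "i : {1..r}" "i' : {1..r}" and eq: "PP x i = PP x i'"
  obtain s s' where s: "s : {1..t}" "pi s = i" "s' : {1..t}" "pi s' = i'" using sur[OF i(1)] sur[OF i(2)] by blast
  have "snd (x s) = snd (x s')" using eq PP_eq[OF x s(1)] PP_eq[OF x s(3)] s by simp
  then show "i = i'" using x s unfolding XP_def by blast
 qed
 ultimately show ?thesis unfolding Inj_def by blast
qed

lemma BB_ex:
 assumes x: "x : XP"
 shows "EX b:Bs. x = Phi (PP x) b" proof -
 define sb where "sb i m = (SOME s. s : {1..t} & pi s = i & bi s = m)" for i m
 have sb: "sb i m : {1..t}" "pi (sb i m) = i" "bi (sb i m) = m" if i: "i : {1..r}" and m: "m : {1..q i}" for i m proof -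
  have "m : bi ` {s : {1..t}. pi s = i}" using bis[OF i] m by simp
  then have "EX s. s : {1..t} & pi s = i & bi s = m" by blast
  from someI_ex[OF this] show "sb i m : {1..t}" "pi (sb i m) = i" "bi (sb i m) = m" unfolding sb_def by blast+
 qed
 have "ALL i:{1..r}. EX R:tabloids (mu d (q i)) {1..d}. ALL m:{1..q i}. the_elem (R (m + 1)) = fst (x (sb i m))"
 proof (intro ballI mu_tabloid_ex[OF d1 qd])
  fix i assume i: "i : {1..r}"
  show "fst (x (sb i m)) : {1..d}" if "m : {1..q i}" for m proof -
   have "x (sb i m) : {1..d} \<times> {1..k}" using x sb(1)[OF i that] unfolding XP_def Tup_def by blast
   then show ?thesis by auto
  qed
  show "inj_on (%m. fst (x (sb i m))) {1..q i}" proof (rule inj_onI)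
   fix m m' assume m: "m : {1..q i}" "m' : {1..q i}" and eq: "fst (x (sb i m)) = fst (x (sb i m'))"
   have "snd (x (sb i m)) = snd (x (sb i m'))" using x sb[OF i m(1)] sb[OF i m(2)] unfolding XP_def by simp
   then have "x (sb i m) = x (sb i m')" using eq by (simp add: prod_eq_iff)
   then have "bi (sb i m) = bi (sb i m')" using x sb(1)[OF i m(1)] sb(1)[OF i m(2)] unfolding XP_def by blast
   then show "m = m'" unfolding sb(3)[OF i m(1)] sb(3)[OF i m(2)] .
  qed
 qed
 then obtain R where R: "ALL i:{1..r}. R i : tabloids (mu d (q i)) {1..d} & (ALL m:{1..q i}. the_elem (R i (m + 1)) = fst (x (sb i m)))"
  unfolding Bex_def by (rule bchoice[THEN exE])
 have "restrict R {1..r} : Bs" unfolding Bs_def restrict_PiE_iff using R by blast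
 moreover have "x = Phi (PP x) (restrict R {1..r})" proof (rule extensionalityI[of _ "{1..t}"])
  show "x : extensional {1..t}" using x by (simp add: XP_def Tup_def PiE_iff)
  show "Phi (PP x) (restrict R {1..r}) : extensional {1..t}" by (simp add: Phi_def)
  fix s assume s: "s : {1..t}"
  note i = pi_in[OF s] and m = bi_in[OF s]
  have "x (sb (pi s) (bi s)) = x s" using x s sb[OF i m] unfolding XP_def by simp
  then have "fst (x s) = the_elem (R (pi s) (bi s + 1))" using R i m by simp
  then show "x s = Phi (PP x) (restrict R {1..r}) s"
   unfolding Phi_def restrict_apply'[OF s] restrict_apply'[OF i] PP_eq[OF x s] by (simp add: prod_eq_iff)
 qed
 ultimately show ?thesis by blast
qed

definition "BB x = (SOME b. b : Bs & x = Phi (PP x) b)"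

lemma BB:
 assumes "x : XP"
 shows "BB x : Bs" "Phi (PP x) (BB x) = x" proof -
 have "EX b. b : Bs & x = Phi (PP x) b" using BB_ex[OF assms] by blast
 from someI_ex[OF this] have "BB x : Bs & x = Phi (PP x) (BB x)" unfolding BB_def .
 then show "BB x : Bs" "Phi (PP x) (BB x) = x" by simp_all
qed

lemma PP_BB_Phi:
 assumes p: "p : Inj" and b: "b : Bs"
 shows "PP (Phi p b) = restrict p {1..r}" "BB (Phi p b) = b" proof -
 note x = Phi_in[OF p b]
 note e = Phi_inj[OF BB(1)[OF x] b BB(2)[OF x]]
 show "BB (Phi p b) = b" by (rule e(2))
 show "PP (Phi p b) = restrict p {1..r}" by (rule extensionalityI[of _ "{1..r}"]) (use e(1) in \<open>simp_all add: PP_def\<close>)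
qed

lemma Phi_act:
 assumes g: "(\<alpha>, \<beta>) : carrier (wreath_sym d k)" and b: "b : Bs"
 shows "act_tuple t (\<alpha>, \<beta>) (Phi p b) = Phi (\<beta> o p) (\<lambda>i\<in>{1..r}. perm_tabloid (\<alpha> (\<beta> (p i))) (b i))"
 unfolding act_tuple_def Phi_def proof (rule restrict_ext)
 fix s assume s: "s : {1..t}"
 have "the_elem (perm_tabloid a (b (pi s)) (bi s + 1)) = a (the_elem (b (pi s) (bi s + 1)))" for a
  unfolding perm_tabloid_def by (subst Bs_row(1)[OF b s]) simp
 then show "act_point (\<alpha>, \<beta>) ((\<lambda>s\<in>{1..t}. (the_elem (b (pi s) (bi s + 1)), p (pi s))) s) =
   (the_elem ((\<lambda>i\<in>{1..r}. perm_tabloid (\<alpha> (\<beta> (p i))) (b i)) (pi s) (bi s + 1)), (\<beta> o p) (pi s))"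
  unfolding restrict_apply'[OF s] restrict_apply'[OF pi_in[OF s]] by (simp add: act_point_def)
qed

lemma act_Bs:
 assumes "!!i. i : {1..r} ==> a i permutes {1..d}" "b : Bs"
 shows "(\<lambda>i\<in>{1..r}. perm_tabloid (a i) (b i)) : Bs"
 unfolding Bs_def restrict_PiE_iff by (intro ballI perm_tabloid_tabloids assms Bs_tabloid)

lemma act_Inj:
 assumes \<beta>: "\<beta> permutes {1..k}" and p: "p : Inj"
 shows "\<beta> o p : Inj" proof -
 have "p ` {1..r} <= {1..k}" and i: "inj_on p {1..r}" using p unfolding Inj_def by blast+
 then have "(\<beta> o p) ` {1..r} <= {1..k}" using permutes_in_image[OF \<beta>] by (auto simp: image_subset_iff)
 moreover have "inj_on (\<beta> o p) {1..r}" by (rule comp_inj_on[OF i inj_on_subset[OF permutes_inj[OF \<beta>]]]) simp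
 ultimately show ?thesis unfolding Inj_def by blast
qed

lemma XP_act:
 assumes g: "g : carrier (wreath_sym d k)" and x: "x : XP"
 shows "act_tuple t g x : XP" proof -
 obtain \<alpha> \<beta> where ab: "g = (\<alpha>, \<beta>)" by (cases g)
 have \<beta>: "\<beta> permutes {1..k}" using g ab by (simp add: wreath_carrier sym_group_def)
 have "act_tuple t g (Phi (PP x) (BB x)) : XP" unfolding ab Phi_act[OF g[unfolded ab] BB(1)[OF x]]
 proof (intro Phi_in act_Inj[OF \<beta> PP_in[OF x]] act_Bs BB(1)[OF x] wreath_perm[OF g[unfolded ab]])
  fix i assume "i : {1..r}"
  then have "PP x i : {1..k}" using PP_in[OF x] unfolding Inj_def by blast
  then show "\<beta> (PP x i) : {1..k}" using permutes_in_image[OF \<beta>] by blast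
 qed
 then show ?thesis unfolding BB(2)[OF x] .
qed

definition "pslice f p = (%b. if b : Bs then f (Phi p b) else 0 :: complex)"

lemma clin_pslice: "clin (%f. pslice f p)" by (rule clinI) (auto simp: pslice_def fun_eq_iff cscale_def)

definition "KS S = {f : free XP. ALL p:Inj. pslice f p : S}"

lemma KS_decomposes:
 assumes D: "decomposes C S (free Bs)"
 shows "decomposes C (%c. KS (S c)) (free XP)" proof -
 have "decomposes C (%c. KS (S c)) {f : free XP. ALL p:Inj. pslice f p : free Bs}" unfolding KS_def
 proof (rule decomposes_pullback[OF D subspace_free clin_pslice])
  fix f assume f: "f : free XP" and z: "!!p. p : Inj ==> pslice f p = 0"
  show "f = 0" proof
   fix x
   show "f x = 0 x" proof (cases "x : XP")
   case True
   have "pslice f (PP x) (BB x) = 0" using z[OF PP_in[OF True]] by simp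
   then show ?thesis using BB[OF True] by (simp add: pslice_def)
   qed (use free_zero[OF f] in simp)
  qed
 next
  fix f c and v :: "_ => _ => _ => complex"
  assume v: "!!p c. p : Inj ==> c : C ==> v p c : S c" and s: "!!p. p : Inj ==> pslice f p = (SUM c:C. v p c)"
   and c: "c : C"
  let ?u = "%x. if x : XP then v (PP x) c (BB x) else 0"
  have "pslice ?u p = v p c" if p: "p : Inj" for p proof
   fix b
   have p': "restrict p {1..r} : Inj" using p by (simp add: Inj_def inj_on_restrict_eq image_restrict_eq)
   have P: "Phi (restrict p {1..r}) = Phi p" by (rule HOL.ext, rule Phi_cong) (rule restrict_apply')
   have "pslice f (restrict p {1..r}) = pslice f p" unfolding pslice_def P ..
   then have e: "v (restrict p {1..r}) c = v p c" by (intro decomposes_unique[OF D v[OF p'] v[OF p] _ c]) (simp_all only: s[OF p'] s[OF p])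
   show "pslice ?u p b = v p c b" proof (cases "b : Bs")
   case True
   show ?thesis unfolding pslice_def if_P[OF True] if_P[OF Phi_in[OF p True]] PP_BB_Phi[OF p True] e ..
   next
   case False
   then show ?thesis using free_zero[OF subsetD[OF decomposes_subset[OF D c] v[OF p c]]] by (simp add: pslice_def)
   qed
  qed
  then show "EX u:free XP. ALL p:Inj. pslice u p = v p c" by (intro bexI[of _ ?u]) (simp_all add: free_def)
 qed
 moreover have "{f : free XP. ALL p:Inj. pslice f p : free Bs} = free XP" by (auto simp: pslice_def free_def)
 ultimately show ?thesis by simp
qed

end


definition "slots d r j \<sigma> = tensor_space {1..r} (%i. specht_image (nu d (j i)) {1..d} (\<sigma> i))"

lemma injection_extends:
 assumes inj: "inj_on p {1..r}" and im: "p ` {1..r} <= {1..k}" and rk: "r <= (k :: nat)"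
 shows "EX \<beta>. \<beta> permutes {1..k} & (ALL i:{1..r}. \<beta> i = p i)" proof -
 have sub: "{1..r} <= {1..k}" using rk by simp
 have "card ({1..k} - {1..r}) = card ({1..k} - p ` {1..r})"
  using card_image[OF inj] by (simp only: card_Diff_subset[OF finite_atLeastAtMost sub] card_Diff_subset[OF finite_imageI[OF finite_atLeastAtMost] im])
 then obtain e where e: "bij_betw e ({1..k} - {1..r}) ({1..k} - p ` {1..r})"
  using finite_same_card_bij[of "{1..k} - {1..r}" "{1..k} - p ` {1..r}"] by auto
 let ?b = "%x. if x : {1..r} then p x else if x : {1..k} then e x else x"
 have "bij_betw ?b ({1..r} \<union> ({1..k} - {1..r})) (p ` {1..r} \<union> ({1..k} - p ` {1..r}))" proof (rule bij_betw_combine)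
  have "bij_betw p {1..r} (p ` {1..r})" using inj by (simp add: bij_betw_def)
  then show "bij_betw ?b {1..r} (p ` {1..r})" by (rule bij_betw_cong[THEN iffD1, rotated]) simp
  show "bij_betw ?b ({1..k} - {1..r}) ({1..k} - p ` {1..r})" using e by (rule bij_betw_cong[THEN iffD1, rotated]) auto
 qed blast
 then have "bij_betw ?b {1..k} {1..k}" using sub im by (simp only: Un_Diff_cancel Un_absorb1)
 then have "?b permutes {1..k}" by (rule bij_imp_permutes) (use rk in auto)
 then show ?thesis by (intro exI[of _ ?b]) simp
qed

locale pattern_placed = placed_tensors d k r j q \<sigma> + pattern d k r t q pi bi
 for d k r :: nat and j q :: "nat => nat" and \<sigma> :: "nat => cell => nat" and t :: nat and pi bi :: "nat => nat"
begin

lemma Bset_Bs: "Bset q = Bs" by (simp add: Bset_def Bs_def)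

lemma X_iff: "(b, w) : X \<longleftrightarrow> b : Bs & w : Wset" by (simp add: X_def Bset_Bs)

text \<open>The tuple whose i-th part sits at the position of the i-th row and whose entries are read off
the tabloids; it embeds the basis of the module of the stabilizer into the tuples.\<close>
definition phi :: "base => nat => nat \<times> nat" where
 "phi y = Phi (entry j (snd y)) (fst y)"

definition Theta :: "((nat => nat \<times> nat) => complex) => wr => base => complex" where
 "Theta f g = (%y. if g : carrier GG & y : X then f (act_tuple t g (phi y)) else 0)"

lemma clin_Theta: "clin (%f. Theta f g)" by (rule clinI) (auto simp: Theta_def fun_eq_iff cscale_def)

lemma Theta_free: "Theta f g : free X" by (simp add: Theta_def free_def)

lemma entry_Inj: "w : Wset ==> entry j w : Inj" unfolding Inj_def using entry_k entry_inj by blast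

lemma phi_in: "y : X ==> phi y : XP" by (cases y) (simp add: phi_def X_iff Phi_in entry_Inj)

lemma act_mult:
 assumes "g : carrier GG" "h : carrier GG" "x : XP"
 shows "act_tuple t (g \<cdot> h) x = act_tuple t g (act_tuple t h x)"
 using act_tuple_action[of d k t] assms unfolding perm_action_def XP_def Tup_def by blast

lemma act_inv:
 assumes g: "g : carrier GG" and x: "x : XP"
 shows "act_tuple t (ginv g) (act_tuple t g x) = x" "act_tuple t g (act_tuple t (ginv g) x) = x" proof -
 interpret group GG by (rule GG_group)
 have "act_tuple t \<one>\<^bsub>GG\<^esub> x = x" using act_tuple_action[of d k t] x unfolding perm_action_def XP_def Tup_def by blast
 then show "act_tuple t (ginv g) (act_tuple t g x) = x" "act_tuple t g (act_tuple t (ginv g) x) = x"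
  using g x by (simp_all add: act_mult[symmetric])
qed

lemma phi_act:
 assumes h: "h : carrier HH" and y: "y : X"
 shows "act_tuple t h (phi y) = phi (act_base d r j h y)" proof -
 obtain \<alpha> \<beta> b w where e: "h = (\<alpha>, \<beta>)" "y = (b, w)" by (cases h, cases y)
 have b: "b : Bs" and w: "w : Wset" using y by (simp_all add: e X_iff)
 have g: "(\<alpha>, \<beta>) : carrier GG" using h HH_sub e by blast
 show ?thesis unfolding e phi_def fst_conv snd_conv act_base_eq Phi_act[OF g b] by (rule Phi_cong) (simp only: comp_apply entry_wact[OF w])
qed

lemma act_X: "h : carrier HH ==> y : X ==> act_base d r j h y : X"
 unfolding X_def using act_base_action[of q] unfolding perm_action_def by blast

text \<open>The images of the basis form a block for the group action: an element returning one of them to another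
preserves the colours, because the vacant positions have colour 1.\<close>
lemma stabilizer_of_base:
 assumes h: "h : carrier GG" and y: "y : X" "y' : X" and eq: "act_tuple t h (phi y') = phi y"
 shows "h : carrier HH" "act_base d r j h y' = y" proof -
 obtain \<alpha> \<beta> b w b' w' where e: "h = (\<alpha>, \<beta>)" "y = (b, w)" "y' = (b', w')" by (cases h, cases y, cases y')
 have b: "b : Bs" and w: "w : Wset" and b': "b' : Bs" and w': "w' : Wset" using y by (simp_all add: e X_iff)
 have \<beta>: "\<beta> permutes {1..k}" using h e by (simp add: wreath_carrier sym_group_def)
 let ?b = "\<lambda>i\<in>{1..r}. perm_tabloid (\<alpha> (\<beta> (entry j w' i))) (b' i)"
 have bk: "\<beta> p : {1..k}" if "p : {1..k}" for p using permutes_in_image[OF \<beta>] that by blast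
 have bB: "?b : Bs" by (rule act_Bs[OF wreath_perm[OF h[unfolded e(1)] bk[OF entry_k[OF w']]] b'])
 have "Phi (\<beta> o entry j w') ?b = Phi (entry j w) b" using eq unfolding e phi_def fst_conv snd_conv Phi_act[OF h[unfolded e(1)] b'] .
 note inj = Phi_inj[OF bB b this]
 have ent: "\<beta> (entry j w' i) = entry j w i" if "i : {1..r}" for i using inj(1)[OF that] by simp
 have outside: "color p = 1" if "p : {1..k}" "p ~: entry j v ` {1..r}" "v : Wset" for p v proof (rule ccontr)
  assume n: "color p ~= 1"
  have "p : cls (color p)" using that(1) by (simp only: cls_iff simp_thms)
  with entry_surj[OF `v : Wset` n] obtain i where "i : {1..r}" "entry j v i = p" by blast
  then show False using that(2) by blast
 qed
 have "color (\<beta> p) = color p" if p: "p : {1..k}" for p proof (cases "p : entry j w' ` {1..r}")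
  case True
  then obtain i where i: "i : {1..r}" "p = entry j w' i" by blast
  show ?thesis unfolding i(2) ent[OF i(1)] color_entry[OF w i(1)] color_entry[OF w' i(1)] ..
 next
  case False
  have "\<beta> p ~: entry j w ` {1..r}" proof
   assume "\<beta> p : entry j w ` {1..r}"
   then obtain i where i: "i : {1..r}" "\<beta> p = entry j w i" by blast
   then have "\<beta> p = \<beta> (entry j w' i)" using ent[OF i(1)] by simp
   then have "p = entry j w' i" using permutes_inj[OF \<beta>] by (simp only: inj_eq)
   then show False using False i(1) by blast
  qed
  then show ?thesis unfolding outside[OF p False w'] by (rule outside[OF bk[OF p] _ w])
 qed
 then have S: "\<beta> : Sj" using Sj_color[OF \<beta>] by blast
 then show "h : carrier HH" using h unfolding e wreath_carrier by blast
 have "wact \<beta> w' = w" by (rule Wset_eqI[OF wact_in[OF S w'] w]) (simp only: entry_wact[OF w'] ent)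
 then show "act_base d r j h y' = y" unfolding e act_base_eq inj(2) by simp
qed

lemma reach:
 assumes p: "p : Inj"
 shows "EX g:carrier GG. EX w:Wset. ALL b:Bs. act_tuple t g (phi (b, w)) = Phi p b" proof -
 have "inj_on p {1..r}" "p ` {1..r} <= {1..k}" using p unfolding Inj_def by blast+
 from injection_extends[OF this rk] obtain \<beta> where \<beta>: "\<beta> permutes {1..k}" "!!i. i : {1..r} ==> \<beta> i = p i" by blast
 have i: "inj_on (%i. i) {1..r}" by simp
 have c: "i : cls (j i)" if "i : {1..r}" for i using fib_cls fib_self[OF that] by blast
 obtain w where w: "w : Wset" "!!i. i : {1..r} ==> entry j w i = i" by (rule Wset_ex[OF i c]) blast+
 let ?\<alpha> = "\<lambda>i\<in>{1..k}. id :: nat => nat"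
 have g: "(?\<alpha>, \<beta>) : carrier GG" using \<beta>(1) by (simp add: wreath_carrier sym_group_def permutes_id restrict_PiE_iff)
 have "act_tuple t (?\<alpha>, \<beta>) (phi (b, w)) = Phi p b" if b: "b : Bs" for b proof -
  have "(\<lambda>i\<in>{1..r}. perm_tabloid (?\<alpha> (\<beta> (entry j w i))) (b i)) = b" proof (rule extensionalityI[of _ "{1..r}"])
   show "b : extensional {1..r}" using b by (simp add: Bs_def PiE_iff)
   fix i assume i: "i : {1..r}"
   have "\<beta> (entry j w i) : {1..k}" using permutes_in_image[OF \<beta>(1)] entry_k[OF w(1) i] by blast
   then show "(\<lambda>i\<in>{1..r}. perm_tabloid (?\<alpha> (\<beta> (entry j w i))) (b i)) i = b i"
   unfolding restrict_apply'[OF i] by (simp only: restrict_apply' perm_tabloid_id)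
  qed simp
  then show ?thesis
   unfolding phi_def fst_conv snd_conv Phi_act[OF g b] by (simp only:) (rule Phi_cong, simp only: comp_apply w(2) \<beta>(2))
 qed
 then show ?thesis using g w(1) by blast
qed

lemma reach_point:
 assumes x: "x : XP"
 shows "EX g y. g : carrier GG & y : X & x = act_tuple t g (phi y)" proof -
 obtain g w where gw: "g : carrier GG" "w : Wset" "ALL b:Bs. act_tuple t g (phi (b, w)) = Phi (PP x) b" using reach[OF PP_in[OF x]] by blast
 have "x = act_tuple t g (phi (BB x, w))" using gw(3) BB[OF x] by metis
 moreover have "(BB x, w) : X" using gw(2) BB(1)[OF x] by (simp add: X_iff)
 ultimately show ?thesis using gw(1) by blast
qed

lemma winv_GG: "h : carrier GG ==> ginv h = winv k h" by (rule winv_eq[OF perm_group_sym])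

lemma winv_HH: "h : carrier HH ==> winv k h : carrier HH" by (rule winv_closed[OF Sj_perm_group])

lemma winv_winv: "h : carrier HH ==> winv k (winv k h) = h"
 using group.inv_inv[OF HH_group, of h] winv_eq[OF Sj_perm_group] winv_HH by metis

lemma bact_winv: "h : carrier HH ==> y : X ==> bact (winv k h) f y = f (act_base d r j h y)" by (simp add: bact_def winv_winv)

lemma Theta_shift:
 assumes g: "g : carrier GG" and h: "h : carrier HH"
 shows "Theta f (g \<cdot> h) = bact (winv k h) (Theta f g)" proof
 fix y
 have hG: "h : carrier GG" using h HH_sub by blast
 have gh: "g \<cdot> h : carrier GG" by (rule monoid.m_closed[OF group.is_monoid[OF GG_group] g hG])
 show "Theta f (g \<cdot> h) y = bact (winv k h) (Theta f g) y" proof (cases "y : X")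
  case True
  have "act_tuple t (g \<cdot> h) (phi y) = act_tuple t g (phi (act_base d r j h y))"
   unfolding act_mult[OF g hG phi_in[OF True]] phi_act[OF h True] ..
  then show ?thesis using True g gh act_X[OF h True] by (simp add: bact_winv[OF h True] Theta_def)
 next
  case False
  then show ?thesis by (simp add: Theta_def bact_def)
 qed
qed

lemma perm_ext_XP:
 assumes x: "x : carrier GG" and f: "f : free XP"
 shows "perm_ext (act_tuple t) x f = (%z. if z : XP then f (act_tuple t (ginv x) z) else 0)" proof -
 interpret group GG by (rule GG_group)
 have "f : free ({1..t} \<rightarrow>\<^sub>E {1..d} \<times> {1..k})" using f by (auto simp: free_def XP_def Tup_def)
 note e = perm_ext_action[OF act_tuple_action x this]
 have "f (act_tuple t (ginv x) z) = 0" if z: "z : {1..t} \<rightarrow>\<^sub>E {1..d} \<times> {1..k}" "z ~: XP" for z proof (rule ccontr)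
  assume "f (act_tuple t (ginv x) z) ~= 0"
  then have i: "act_tuple t (ginv x) z : XP" using f unfolding free_def by blast
  have "act_tuple t (x \<cdot> ginv x) z = act_tuple t x (act_tuple t (ginv x) z)"
   "act_tuple t \<one>\<^bsub>GG\<^esub> z = z" using act_tuple_action[of d k t] x inv_closed[OF x] z(1) unfolding perm_action_def by blast+
  then have "z = act_tuple t x (act_tuple t (ginv x) z)" using x by simp
  then show False using z(2) XP_act[OF x i] by simp
 qed
 then show ?thesis unfolding e by (auto simp: fun_eq_iff XP_def Tup_def)
qed

lemma Theta_act:
 assumes x: "x : carrier GG" and f: "f : free XP" and g: "g : carrier GG"
 shows "Theta (perm_ext (act_tuple t) x f) g = Theta f (ginv x \<cdot> g)" proof -
 interpret group GG by (rule GG_group)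
 have ix: "ginv x : carrier GG" by (rule inv_closed[OF x])
 have ixg: "ginv x \<cdot> g : carrier GG" by (rule m_closed[OF ix g])
 show ?thesis proof
  fix y
  show "Theta (perm_ext (act_tuple t) x f) g y = Theta f (ginv x \<cdot> g) y" proof (cases "y : X")
   case True
   then show ?thesis using g ixg XP_act[OF g phi_in[OF True]] by (simp add: Theta_def perm_ext_XP[OF x f] act_mult[OF ix g phi_in[OF True]])
  next
   case False
   then show ?thesis by (simp add: Theta_def)
  qed
 qed
qed

lemma Theta_zero:
 assumes f: "f : free XP" and z: "!!g. g : carrier GG ==> Theta f g = 0"
 shows "f = 0" proof
 fix x
 show "f x = 0 x" proof (cases "x : XP")
  case True
  obtain g y where gy: "g : carrier GG" "y : X" "x = act_tuple t g (phi y)" using reach_point[OF True] by blast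
  have "Theta f g y = f x" using gy by (simp add: Theta_def)
  then show ?thesis using z[OF gy(1)] by simp
 next
  case False
  then show ?thesis using f by (simp add: free_def)
 qed
qed

lemma Theta_ex:
 assumes F: "!!g. g : carrier GG ==> F g : free X"
  and eq: "!!g h. g : carrier GG ==> h : carrier HH ==> F (g \<cdot> h) = bact (winv k h) (F g)"
 shows "EX f:free XP. ALL g:carrier GG. Theta f g = F g" proof -
 interpret group GG by (rule GG_group)
 have "ALL x:XP. EX c. fst c : carrier GG & snd c : X & x = act_tuple t (fst c) (phi (snd c))"
  using reach_point by (metis fst_conv snd_conv)
 then obtain c where c: "ALL x:XP. fst (c x) : carrier GG & snd (c x) : X & x = act_tuple t (fst (c x)) (phi (snd (c x)))"
  by (rule bchoice[THEN exE])
 let ?f = "%x. if x : XP then F (fst (c x)) (snd (c x)) else 0"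
 have "Theta ?f g = F g" if g: "g : carrier GG" for g proof
  fix y
  show "Theta ?f g y = F g y" proof (cases "y : X")
   case True
   define x where "x = act_tuple t g (phi y)"
   have x: "x : XP" unfolding x_def by (rule XP_act[OF g phi_in[OF True]])
   define g' y' where "g' = fst (c x)" and "y' = snd (c x)"
   have g': "g' : carrier GG" and y': "y' : X" and xe: "x = act_tuple t g' (phi y')" using c x unfolding g'_def y'_def by blast+
   have ig: "ginv g : carrier GG" by (rule inv_closed[OF g])
   let ?h = "ginv g \<cdot> g'"
   have hG: "?h : carrier GG" by (rule m_closed[OF ig g'])
   have "act_tuple t ?h (phi y') = phi y"
   unfolding act_mult[OF ig g' phi_in[OF y']] xe[symmetric] unfolding x_def by (rule act_inv(1)[OF g phi_in[OF True]])
   note s = stabilizer_of_base[OF hG True y' this]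
   have "g \<cdot> ?h = g'" using g g' ig by (simp add: m_assoc[symmetric])
   then have "F g' y' = bact (winv k ?h) (F g) y'" using eq[OF g s(1)] by simp
   also have "... = F g y" unfolding bact_winv[OF s(1) y'] s(2) ..
   finally show ?thesis using True g x unfolding Theta_def x_def[symmetric] g'_def y'_def by simp
  next
   case False
   then have "F g y = 0" using F[OF g] unfolding free_def by blast
   then show ?thesis using False by (simp add: Theta_def)
  qed
 qed
 moreover have "?f : free XP" by (simp add: free_def)
 ultimately show ?thesis by blast
qed

definition "pull Z = {f : free XP. ALL g:carrier GG. Theta f g : Z}"

lemma pull_submodule:
 assumes "cs.subspace Z"
 shows "submodule GG (tuple_rep d k t) (pull Z)" unfolding submodule_def tuple_rep_def rep.simps proof (intro conjI ballI)
 interpret group GG by (rule GG_group)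
 show "pull Z <= free ({1..t} \<rightarrow>\<^sub>E {1..d} \<times> {1..k})" by (auto simp: pull_def free_def XP_def Tup_def)
 show "cs.subspace (pull Z)" unfolding pull_def by (rule subspace_pullback[OF subspace_free clin_Theta assms])
 fix x f assume x: "x : carrier GG" and f: "f : pull Z"
 have f': "f : free XP" "!!g. g : carrier GG ==> Theta f g : Z" using f unfolding pull_def by blast+
 have "perm_ext (act_tuple t) x f : free XP" unfolding perm_ext_XP[OF x f'(1)] by (simp add: free_def)
 then show "perm_ext (act_tuple t) x f : pull Z"
  unfolding pull_def using Theta_act[OF x f'(1)] f'(2)[OF m_closed[OF inv_closed[OF x]]] by simp
qed

lemma pull_decomposes:
 assumes D: "decomposes C Z Z0" and Z0: "Z0 <= free X"
  and st: "!!c h m. c : C ==> h : carrier HH ==> m : Z c ==> bact h m : Z c"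
 shows "decomposes C (%c. pull (Z c)) (pull Z0)" unfolding pull_def
proof (rule decomposes_pullback[OF D subspace_free clin_Theta Theta_zero])
 interpret group GG by (rule GG_group)
 fix f c and v :: "wr => _ => base => complex"
 assume v: "!!g c. g : carrier GG ==> c : C ==> v g c : Z c" "!!g. g : carrier GG ==> Theta f g = (SUM c:C. v g c)"
  and c: "c : C"
 show "EX u:free XP. ALL g:carrier GG. Theta u g = v g c" proof (rule Theta_ex)
  show "v g c : free X" if "g : carrier GG" for g using v(1)[OF that c] decomposes_subset[OF D c] Z0 by blast
  fix g h assume g: "g : carrier GG" and h: "h : carrier HH"
  have gh: "g \<cdot> h : carrier GG" using g h HH_sub by blast
  show "v (g \<cdot> h) c = bact (winv k h) (v g c)" proof (rule decomposes_unique[OF D v(1)[OF gh] st[OF _ winv_HH[OF h] v(1)[OF g]] _ c])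
   show "(SUM c:C. v (g \<cdot> h) c) = (SUM c:C. bact (winv k h) (v g c))"
   unfolding v(2)[OF gh, symmetric] Theta_shift[OF g h] v(2)[OF g] by (rule clin_sum[OF clin_bact])
  qed
 qed
qed

end

context placed_tensors
begin

abbreviation "tens \<equiv> slots d r j \<sigma>"

lemma tens_subspace: "cs.subspace tens" unfolding slots_def tensor_space_def by (rule subspace_cspan)

lemma tens_free: "tens <= free (Bset q)" unfolding slots_def Bset_def by (rule tensor_space_free) (simp, rule image_free)

lemma tens_induct:
 assumes "f : tens" "clin L" "cs.subspace V"
  and "!!v. (!!i. i : {1..r} ==> v i : specht_image (\<nu> i) Nd (\<sigma> i)) ==> L (pure_tensor {1..r} v) : V"
 shows "L f : V" using assms(1) unfolding slots_def tensor_space_def proof (rule span_induct_lin[OF _ _ assms(2,3)])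
 fix s assume "s : {pure_tensor {1..r} v | v. ALL i:{1..r}. v i : specht_image (\<nu> i) Nd (\<sigma> i)}"
 then obtain v where "s = pure_tensor {1..r} v" "ALL i:{1..r}. v i : specht_image (\<nu> i) Nd (\<sigma> i)" by blast
 then show "L s : V" using assms(4)[of v] by blast
qed

definition "place_at w v = (%(b, w'). if w' = w then v b else (0 :: complex))"

lemma clin_place_at: "clin (place_at w)" by (rule clinI) (auto simp: place_at_def fun_eq_iff cscale_def)

lemma place_at_pure:
 assumes w: "w : Wset" and v: "!!i. i : {1..r} ==> v i : specht_image (\<nu> i) Nd (\<sigma> i)"
 shows "place_at w (pure_tensor {1..r} v) : MA {} (free Wset)" proof -
 have "ALL i:{1..r}. EX s. s : specht (\<nu> i) Nd & v i = tmap (\<nu> i) Nd (\<sigma> i) s" proof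
  fix i assume i: "i : {1..r}"
  show "EX s. s : specht (\<nu> i) Nd & v i = tmap (\<nu> i) Nd (\<sigma> i) s"
   using v[OF i] unfolding specht_image_eq[OF Nd(1) nu_part[OF i]] by blast
 qed
 then obtain s where s: "ALL i:{1..r}. s i : specht (\<nu> i) Nd & v i = tmap (\<nu> i) Nd (\<sigma> i) (s i)" by (rule bchoice[THEN exE])
 note inj = position_inj[OF w] and im = position_image[OF w]
 define u where "u p = s (inv_into {1..r} (position j w) p)" for p
 have up: "u (position j w i) = s i" if "i : {1..r}" for i unfolding u_def by (simp only: inv_into_f_f[OF inj that])
 have us: "us u" unfolding us_def proof
  fix p assume "p : {1..r}"
  then have "p : position j w ` {1..r}" using im by simp
  then obtain i where i: "i : {1..r}" "p = position j w i" by (rule imageE)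
  show "u p : specht (\<nu> p) Nd" unfolding i(2) up[OF i(1)] position_in(2)[OF w i(1)] using s i(1) by blast
 qed
 have e: "pure_tensor {1..r} (slotv u w) = pure_tensor {1..r} v" proof (rule pure_tensor_cong)
  fix i assume i: "i : {1..r}"
  show "slotv u w i = v i" unfolding slotv_def up[OF i] using s i by simp
 qed
 have "place_at w (pure_tensor {1..r} v) = placed u (basis_vec w)" proof
  fix y :: base
  obtain b w' where y: "y = (b, w')" by (cases y)
  show "place_at w (pure_tensor {1..r} v) y = placed u (basis_vec w) y" proof (cases "w' = w")
   case True
   show ?thesis unfolding y True place_at_def placed_def basis_vec_def prod.case e by simp
  next
   case False
   then show ?thesis by (simp add: y place_at_def placed_def basis_vec_def)
  qed
 qed
 moreover have "basis_vec w : free Wset" by (rule basis_vec_free[OF w])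
 ultimately show ?thesis unfolding MA_def gens_def by (intro cspan_base) (use us in auto)
qed

lemma MA_full: "MA {} (free Wset) = {h : free X. ALL w:Wset. (%b. h (b, w)) : tens}" proof (intro equalityI subsetI)
 fix h assume h: "h : MA {} (free Wset)"
 have "(%b. h (b, w)) : tens" if w: "w : Wset" for w proof (rule MA_induct[OF h _ tens_subspace, where L = "%h b. h (b, w)"])
  show "clin (%h b. h (b, w) :: complex)" by (rule clinI) (auto simp: cscale_def)
  fix u x assume u: "us u"
  have "(%b. placed u x (b, w)) = cscale (x w) (pure_tensor {1..r} (slotv u w))" by (simp add: placed_def cscale_def)
  also have "... : tens" by (intro cs.subspace_scale[OF tens_subspace]) (unfold slots_def, intro pure_tensor_in slotv_in u w)
  finally show "(%b. placed u x (b, w)) : tens" .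
 qed
 then have "ALL w:Wset. (%b. h (b, w)) : tens" ..
 then show "h : {h : free X. ALL w:Wset. (%b. h (b, w)) : tens}" using h MA_free[OF order_refl] by blast
next
 fix h assume h: "h : {h : free X. ALL w:Wset. (%b. h (b, w)) : tens}"
 have "h = (SUM w:Wset. place_at w (%b. h (b, w)))" proof
  fix y :: base
  obtain b w where y: "y = (b, w)" by (cases y)
  have "(SUM w':Wset. place_at w' (%b. h (b, w')) y) = (if w : Wset then h (b, w) else 0)"
   unfolding y place_at_def prod.case by (simp add: finite_Wset sum.delta)
  moreover have "h (b, w) = 0" if "w ~: Wset" using h that unfolding free_def X_def by blast
  ultimately show "h y = (SUM w:Wset. place_at w (%b. h (b, w))) y" by (simp add: sum_apply y)
 qed
 moreover have "place_at w (%b. h (b, w)) : MA {} (free Wset)" if w: "w : Wset" for w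
 proof (rule tens_induct[OF _ clin_place_at subspace_MA])
  show "(%b. h (b, w)) : tens" using h w by blast
 qed (rule place_at_pure[OF w])
 then have "(SUM w:Wset. place_at w (%b. h (b, w))) : MA {} (free Wset)" by (rule cs.subspace_sum[OF subspace_MA])
 ultimately show "h : MA {} (free Wset)" by simp
qed

lemma tens_act:
 assumes a: "!!i. i : {1..r} ==> a i permutes Nd" and v: "v : tens"
 shows "(%b. if b : Bset q then v (\<lambda>i\<in>{1..r}. perm_tabloid (a i) (b i)) else 0) : tens"
proof (rule tens_induct[OF v _ tens_subspace, where L = "%v b. if b : Bset q then v (\<lambda>i\<in>{1..r}. perm_tabloid (a i) (b i)) else 0"])
 show "clin (%v b. if b : Bset q then v (\<lambda>i\<in>{1..r}. perm_tabloid (a i) (b i)) else (0 :: complex))"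
  by (rule clinI) (auto simp: fun_eq_iff cscale_def)
 fix v assume v: "!!i. i : {1..r} ==> v i : specht_image (\<nu> i) Nd (\<sigma> i)"
 have inT: "pure_tensor {1..r} (%i. tact (inv' (a i)) (v i)) : tens"
  unfolding slots_def by (intro pure_tensor_in tact_specht_image[OF Nd(1) nu_part] permutes_inv a v)
 have "(%b. if b : Bset q then pure_tensor {1..r} v (\<lambda>i\<in>{1..r}. perm_tabloid (a i) (b i)) else 0) =
   pure_tensor {1..r} (%i. tact (inv' (a i)) (v i))" proof
  fix b
  show "(if b : Bset q then pure_tensor {1..r} v (\<lambda>i\<in>{1..r}. perm_tabloid (a i) (b i)) else 0) =
   pure_tensor {1..r} (%i. tact (inv' (a i)) (v i)) b" proof (cases "b : Bset q")
   case True
   have "v i (perm_tabloid (a i) (b i)) = tact (inv' (a i)) (v i) (b i)" if "i : {1..r}" for i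
   unfolding tact_def inv_inv_eq[OF permutes_bij[OF a[OF that]]] ..
   then have "(PROD i:{1..r}. v i ((\<lambda>i\<in>{1..r}. perm_tabloid (a i) (b i)) i)) = (PROD i:{1..r}. tact (inv' (a i)) (v i) (b i))"
   by (intro prod.cong refl) simp
   moreover have "b : extensional {1..r}" using True by (simp add: Bset_def PiE_iff)
   ultimately show ?thesis using True by (simp add: pure_tensor_def)
  next
   case False
   have "pure_tensor {1..r} (%i. tact (inv' (a i)) (v i)) : free (Bset q)" using inT tens_free by blast
   then show ?thesis using False unfolding free_def by simp
  qed
 qed
 then show "(%b. if b : Bset q then pure_tensor {1..r} v (\<lambda>i\<in>{1..r}. perm_tabloid (a i) (b i)) else 0) : tens" using inT by simp
qed

end

context pattern_placed
begin

text \<open>Two descriptions of the functions whose restrictions to all injective placements of the parts are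
tensors of the prescribed type; only the second one knows the subgroup.\<close>
lemma KS_eq_pull: "KS tens = pull (MA {} (free Wset))" proof (intro equalityI subsetI)
 fix f assume f: "f : KS tens"
 have fX: "f : free XP" and fp: "!!p. p : Inj ==> pslice f p : tens" using f unfolding KS_def by blast+
 have "Theta f g : MA {} (free Wset)" if g: "g : carrier GG" for g unfolding MA_full mem_Collect_eq proof (intro conjI ballI Theta_free)
  fix w assume w: "w : Wset"
  obtain \<alpha> \<beta> where e: "g = (\<alpha>, \<beta>)" by (cases g)
  note g' = g[unfolded e]
  have \<beta>: "\<beta> permutes {1..k}" using g' by (simp add: wreath_carrier sym_group_def)
  let ?a = "%i. \<alpha> (\<beta> (entry j w i))"
  have a: "?a i permutes Nd" if "i : {1..r}" for i proof -
   have "\<beta> (entry j w i) : {1..k}" using permutes_in_image[OF \<beta>] entry_k[OF w that] by blast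
   then show ?thesis by (rule wreath_perm[OF g'])
  qed
  have "(%b. Theta f g (b, w)) = (%b. if b : Bset q then pslice f (\<beta> o entry j w) (\<lambda>i\<in>{1..r}. perm_tabloid (?a i) (b i)) else 0)"
  proof
   fix b
   show "Theta f g (b, w) = (if b : Bset q then pslice f (\<beta> o entry j w) (\<lambda>i\<in>{1..r}. perm_tabloid (?a i) (b i)) else 0)"
   proof (cases "b : Bs")
   case True
   have bw: "(b, w) : X" using True w by (simp add: X_iff)
   have B: "(\<lambda>i\<in>{1..r}. perm_tabloid (?a i) (b i)) : Bs" by (rule act_Bs[OF a True])
   have "Theta f g (b, w) = f (act_tuple t g (phi (b, w)))" using g bw by (simp add: Theta_def)
   also have "... = f (Phi (\<beta> o entry j w) (\<lambda>i\<in>{1..r}. perm_tabloid (?a i) (b i)))"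
   unfolding e phi_def fst_conv snd_conv Phi_act[OF g' True] ..
   finally show ?thesis unfolding Bset_Bs if_P[OF True] pslice_def if_P[OF B] .
   next
   case False
   then show ?thesis by (simp add: Theta_def X_iff Bset_Bs)
   qed
  qed
  also have "... : tens" by (rule tens_act[OF a fp[OF act_Inj[OF \<beta> entry_Inj[OF w]]]])
  finally show "(%b. Theta f g (b, w)) : tens" .
 qed
 then show "f : pull (MA {} (free Wset))" using fX unfolding pull_def by blast
next
 fix f assume f: "f : pull (MA {} (free Wset))"
 have fX: "f : free XP" and fT: "!!g. g : carrier GG ==> Theta f g : MA {} (free Wset)" using f unfolding pull_def by blast+
 have "pslice f p : tens" if p: "p : Inj" for p proof -
  obtain g w where gw: "g : carrier GG" "w : Wset" "ALL b:Bs. act_tuple t g (phi (b, w)) = Phi p b" using reach[OF p] by blast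
  have "(%b. Theta f g (b, w)) : tens" using fT[OF gw(1)] gw(2) unfolding MA_full by blast
  moreover have "pslice f p = (%b. Theta f g (b, w))" proof
   fix b
   show "pslice f p b = Theta f g (b, w)" proof (cases "b : Bs")
   case True
   have "act_tuple t g (phi (b, w)) = Phi p b" using gw(3) True by blast
   then show ?thesis using True gw(1,2) by (simp add: pslice_def Theta_def X_iff)
   next
   case False
   then show ?thesis by (simp add: pslice_def Theta_def X_iff)
   qed
  qed
  ultimately show ?thesis by simp
 qed
 then show "f : KS tens" using fX unfolding KS_def by blast
qed

end

locale pattern_irreducible = irreducible_setup d k r j q \<sigma> \<Lambda> \<tau> + pattern_placed d k r j q \<sigma> t pi bi
 for d k r :: nat and j q :: "nat => nat" and \<sigma> :: "nat => cell => nat" and \<Lambda> :: "nat => nat list"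
  and \<tau> :: "nat => cell => nat" and t :: nat and pi bi :: "nat => nat"
begin

lemma pull_iso: "isomorphic_reps GG (tuple_rep d k t(|vecs := pull (MA {} T2)|)) (W d k r j \<sigma> \<Lambda> \<tau>)"
proof (rule isomorphic_repsI[where f = Theta])
 interpret group GG by (rule GG_group)
 let ?V = "tuple_rep d k t(|vecs := pull (MA {} T2)|)"
 have rep: "representation GG (tuple_rep d k t)" unfolding tuple_rep_def by (rule perm_representation[OF act_tuple_action])
 show "representation GG ?V" by (rule submodule_representation[OF rep pull_submodule[OF subspace_MA]])
 show "representation GG (W d k r j \<sigma> \<Lambda> \<tau>)" unfolding W_def by (rule ind.ind_representation)
 have V: "vecs ?V = pull (MA {} T2)" "scal ?V = cscale" "act ?V = perm_ext (act_tuple t)" by (simp_all add: tuple_rep_def)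
 have out: "Theta f g = 0" if "g ~: carrier GG" for f g using that by (simp add: Theta_def fun_eq_iff)
 have inW: "Theta f : vecs (W d k r j \<sigma> \<Lambda> \<tau>)" if f: "f : pull (MA {} T2)" for f unfolding W_def ind.ind_iff M_vecs
 proof (intro conjI ballI allI impI)
  show T: "Theta f g : MA {} T2" if "g : carrier GG" for g using f that unfolding pull_def by blast
  show "Theta f g = 0" if "g ~: carrier GG" for g by (rule out[OF that])
  fix g h assume g: "g : carrier GG" and h: "h : carrier HH"
  have "h : carrier GG" using h HH_sub by blast
  then show "Theta f (g \<cdot> h) = act M (ginv h) (Theta f g)"
   unfolding Theta_shift[OF g h] winv_GG[OF `h : carrier GG`] by (intro M_act[OF winv_HH[OF h] T[OF g], symmetric])
 qed
 show "linear_between ?V (W d k r j \<sigma> \<Lambda> \<tau>) Theta" unfolding linear_between_def V proof (intro conjI ballI allI)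
  show "Theta f : vecs (W d k r j \<sigma> \<Lambda> \<tau>)" if "f : pull (MA {} T2)" for f by (rule inW[OF that])
  show "Theta (f + f') = Theta f + Theta f'" for f f' by (rule HOL.ext) (simp only: clin_add[OF clin_Theta] plus_fun_apply)
  show "Theta (cscale c f) = scal (W d k r j \<sigma> \<Lambda> \<tau>) c (Theta f)" for c f
   unfolding W_def ind.ind_scal pscale_def by (rule HOL.ext) (rule clin_scale[OF clin_Theta])
 qed
 show "bij_betw Theta (vecs ?V) (vecs (W d k r j \<sigma> \<Lambda> \<tau>))" unfolding V bij_betw_def proof (intro conjI equalityI subsetI)
  show "inj_on Theta (pull (MA {} T2))" proof (rule inj_onI)
   fix f f' assume f: "f : pull (MA {} T2)" "f' : pull (MA {} T2)" and eq: "Theta f = Theta f'"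
   have "f - f' = 0" proof (rule Theta_zero)
   show "f - f' : free XP" using f by (intro cs.subspace_diff[OF subspace_free]) (simp_all add: pull_def)
   fix g
   have "Theta (f - f') g = Theta f g - Theta f' g" by (auto simp: Theta_def fun_eq_iff)
   then show "Theta (f - f') g = 0" by (simp only: eq diff_self)
   qed
   then show "f = f'" by simp
  qed
  show "F : vecs (W d k r j \<sigma> \<Lambda> \<tau>)" if "F : Theta ` pull (MA {} T2)" for F using that inW by blast
  fix F assume "F : vecs (W d k r j \<sigma> \<Lambda> \<tau>)"
  then have F: "F : vecs ind.Ind" unfolding W_def .
  have FM: "F g : MA {} T2" if "g : carrier GG" for g using ind.ind_in[OF F that] unfolding M_vecs .
  have "EX f:free XP. ALL g:carrier GG. Theta f g = F g" proof (rule Theta_ex)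
   show "F g : free X" if "g : carrier GG" for g using FM[OF that] MA_free[OF T2_free] by blast
   fix g h assume g: "g : carrier GG" and h: "h : carrier HH"
   have hG: "h : carrier GG" using h HH_sub by blast
   show "F (g \<cdot> h) = bact (winv k h) (F g)"
   unfolding ind.ind_equiv[OF F g h] winv_GG[OF hG] by (rule M_act[OF winv_HH[OF h] FM[OF g]])
  qed
  then obtain f where f: "f : free XP" "ALL g:carrier GG. Theta f g = F g" by blast
  have "f : pull (MA {} T2)" unfolding pull_def using f FM by simp
  moreover have "Theta f = F" proof
   fix g
   show "Theta f g = F g" proof (cases "g : carrier GG")
   case True
   then show ?thesis using f(2) by blast
   next
   case False
   then show ?thesis using out[OF False] ind.ind_out[OF F False] by simp
   qed
  qed
  ultimately show "F : Theta ` pull (MA {} T2)" by blast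
 qed
 fix x f assume x: "x : carrier GG" and "f : vecs ?V"
 then have f: "f : free XP" unfolding V(1) unfolding pull_def by blast
 show "Theta (act ?V x f) = act (W d k r j \<sigma> \<Lambda> \<tau>) x (Theta f)" unfolding V W_def ind.ind_act proof
  fix g
  show "Theta (perm_ext (act_tuple t) x f) g = (if g : carrier GG then Theta f (ginv x \<cdot> g) else 0)"
   using Theta_act[OF x f] out by simp
 qed
qed

end


section \<open>Reindexing the decompositions\<close>

lemma tensor_space_cong: "(!!i. i : I ==> V i = V' i) ==> tensor_space I V = tensor_space I V'"
 unfolding tensor_space_def by (simp cong: ball_cong)

lemma PiE_Sigma_bij:
 "bij_betw (%(f, g). \<lambda>a\<in>A. (f a, g a)) (Sigma (PiE A B) (%f. PiE A (%a. C a (f a)))) (PiE A (%a. Sigma (B a) (C a)))"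
  (is "bij_betw ?h ?S ?P") proof -
 have h: "?h (f, g) a = (f a, g a)" if "a : A" for f g a using that by simp
 show ?thesis unfolding bij_betw_def proof (intro conjI equalityI subsetI)
  show "inj_on ?h ?S" proof (rule inj_onI)
   fix x y assume x: "x : ?S" and y: "y : ?S" and e: "?h x = ?h y"
   obtain f g where x': "x = (f, g)" "f : PiE A B" "g : PiE A (%a. C a (f a))" using x by blast
   obtain f' g' where y': "y = (f', g')" "f' : PiE A B" "g' : PiE A (%a. C a (f' a))" using y by blast
   have fg: "f a = f' a" "g a = g' a" if "a : A" for a using fun_cong[OF e[unfolded x'(1) y'(1)], of a] unfolding h[OF that] by simp_all
   have ff: "f = f'" by (rule PiE_ext[OF x'(2) y'(2) fg(1)])
   have "g = g'" by (rule PiE_ext[OF x'(3) y'(3)[folded ff] fg(2)])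
   then show "x = y" using ff x'(1) y'(1) by simp
  qed
  show "y : ?P" if y: "y : ?h ` ?S" for y proof -
   obtain x where x: "y = ?h x" "x : ?S" using y by (rule imageE)
   obtain f g where y: "x = (f, g)" "f : PiE A B" "g : PiE A (%a. C a (f a))" using x(2) by blast
   show ?thesis unfolding x(1) y(1) prod.case restrict_PiE_iff using PiE_mem[OF y(2)] PiE_mem[OF y(3)] by blast
  qed
  fix y assume y: "y : ?P"
  have m: "fst (y a) : B a" "snd (y a) : C a (fst (y a))" if "a : A" for a using PiE_mem[OF y that] by auto
  show "y : ?h ` ?S" proof (rule image_eqI)
   show "y = ?h (\<lambda>a\<in>A. fst (y a), \<lambda>a\<in>A. snd (y a))"
   by (rule extensionalityI[of _ A]) (use y in \<open>simp_all add: PiE_def\<close>)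
   show "(\<lambda>a\<in>A. fst (y a), \<lambda>a\<in>A. snd (y a)) : ?S" using m by (simp add: restrict_PiE_iff)
  qed
 qed
qed

lemma bij_betw_Sigma_base:
 assumes "bij_betw h A B"
 shows "bij_betw (%(a, y). (h a, y)) (Sigma A (%a. C (h a))) (Sigma B C)" unfolding bij_betw_def proof
 show "inj_on (%(a, y). (h a, y)) (Sigma A (%a. C (h a)))"
  by (rule inj_onI) (use bij_betw_imp_inj_on[OF assms] in \<open>auto dest: inj_onD\<close>)
 show "(%(a, y). (h a, y)) ` Sigma A (%a. C (h a)) = Sigma B C" proof (intro equalityI subsetI)
  fix x assume "x : Sigma B C"
  then obtain b y where x: "x = (b, y)" "b : B" "y : C b" by blast
  then obtain a where "a : A" "b = h a" using bij_betw_imp_surj_on[OF assms] by blast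
  then show "x : (%(a, y). (h a, y)) ` Sigma A (%a. C (h a))" using x by force
 qed (use bij_betwE[OF assms] in auto)
qed

lemma tensor_decomposes_pairs:
 assumes I: "finite I" and D: "!!i. i : I ==> decomposes (Sigma (B i) (C i)) (%c. V i (fst c) (snd c)) (free (X i))"
  and X: "!!i. i : I ==> finite (X i)"
 shows "decomposes (Sigma (PiE I B) (%f. PiE I (%i. C i (f i)))) (%c. tensor_space I (%i. V i (fst c i) (snd c i))) (free (PiE I X))"
 by (rule decomposes_reindex[OF PiE_Sigma_bij _ tensor_decomposes[OF I D X]])
   (auto simp only: split_paired_all prod.case fst_conv snd_conv restrict_apply' intro!: tensor_space_cong)

context placement
begin

text \<open>The first partition has the right size automatically because all sizes add up to k.\<close>
lemma multipartition_iff: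
 "\<Lambda> : multipartitions (ell d) k & j : j_tuples d r \<Lambda> \<longleftrightarrow> \<Lambda> : PiE {1..ell d} (%a. partitions (card (cls a)))"
proof -
 let ?L = "{1..ell d}"
 have c: "cls a = {p : {1..k}. color p = a}" for a unfolding set_eq_iff cls_iff by simp
 have "color ` {1..k} <= ?L" using color_in by blast
 from sum.group[OF finite_atLeastAtMost finite_atLeastAtMost this, of "%_. 1 :: nat"]
 have tot: "(SUM a:?L. card (cls a)) = k" unfolding c by simp
 have L: "?L = insert 1 {2..ell d}" using ell_pos[OF d] by auto
 have sL: "(SUM a:?L. s a) = s 1 + (SUM a:{2..ell d}. s a)" for s :: "nat => nat" unfolding L by simp
 have bL: "(ALL a:?L. Q a) \<longleftrightarrow> Q 1 & (ALL a:{2..ell d}. Q a)" for Q unfolding L by (simp only: ball_simps)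
 have key: "(SUM a:?L. s a) = k & (ALL a:{2..ell d}. s a = card (cls a)) \<longleftrightarrow> (ALL a:?L. s a = card (cls a))" for s
 proof (cases "ALL a:{2..ell d}. s a = card (cls a)")
  case True
  then have "(SUM a:{2..ell d}. s a) = (SUM a:{2..ell d}. card (cls a))" by (intro sum.cong refl) (rule bspec)
  then have "(SUM a:?L. s a) = k \<longleftrightarrow> s 1 = card (cls 1)" using tot unfolding sL by linarith
  then show ?thesis unfolding bL using True by blast
 next
  case False
  then show ?thesis unfolding bL by blast
 qed
 have cf: "card {i : {1..r}. j i = a} = card (cls a)" if "a : {2..ell d}" for a using that cls_fib[of a] unfolding fib_def by simp
 have jt: "j : j_tuples d r \<Lambda> \<longleftrightarrow> (ALL a:{2..ell d}. sum_list (\<Lambda> a) = card (cls a))"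
  unfolding j_tuples_def mem_Collect_eq eqTrueI[OF j] simp_thms by (intro ball_cong refl) (subst cf, assumption, rule eq_commute)
 have mp: "lam : (\<Union>n. partitions n) & sum_list lam = m \<longleftrightarrow> lam : partitions m" for lam m
  by (auto simp: partitions_def)
 show ?thesis unfolding jt multipartitions_def mem_Collect_eq conj_assoc key PiE_iff mp[symmetric] by blast
qed

lemma Wset_decomposes:
 "decomposes (Sigma (PiE {1..ell d} (%a. partitions (card (cls a)))) (%\<Lambda>. T_k d k r j \<Lambda>))
   (%c. Tens (fst c) (snd c)) (free Wset)" unfolding T_k_def Wset_def Tens_def by (rule tensor_decomposes_pairs[OF finite_atLeastAtMost])
   (rule specht_images_decompose[OF finite_cls row_then_ones_gamma sum_gamma, unfolded case_prod_beta],
   rule finite_tabloids[OF finite_cls])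

end

context pattern
begin

lemma Bs_decomposes:
 "decomposes (Sigma ({1..r} \<rightarrow>\<^sub>E {1..ell d}) (%j. T_d d r j q)) (%c. slots d r (fst c) (snd c)) (free Bs)"
 unfolding T_d_def Bs_def slots_def
proof (rule tensor_decomposes_pairs[OF finite_atLeastAtMost, where C = "%i a. semistandard (nu d a) (mu d (q i))"
   and V = "%i a. specht_image (nu d a) {1..d}"])
 fix i assume i: "i : {1..r}"
 show "finite (tabloids (mu d (q i)) {1..d})" by (rule finite_tabloids) simp
 let ?S = "%lam. semistandard lam (mu d (q i))"
 have cd: "card {1..d} = d" by simp
 have D: "decomposes (Sigma (partitions (card {1..d})) ?S) (%(lam, \<tau>). specht_image lam {1..d} \<tau>)
   (free (tabloids (mu d (q i)) {1..d}))"
  by (rule specht_images_decompose[OF finite_atLeastAtMost row_then_ones_mu]) (simp add: sum_mu[OF qd[OF i]])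
 have b: "bij_betw (%(a, \<tau>). (nu d a, \<tau>)) (Sigma {1..ell d} (%a. ?S (nu d a))) (Sigma (partitions d) ?S)"
  by (rule bij_betw_Sigma_base[OF nu_bij])
 show "decomposes (Sigma {1..ell d} (%a. ?S (nu d a))) (%c. specht_image (nu d (fst c)) {1..d} (snd c))
   (free (tabloids (mu d (q i)) {1..d}))"
  by (rule decomposes_reindex[OF b _ D[unfolded cd]]) (simp only: split_paired_all prod.case fst_conv snd_conv)
qed

end

definition leaf ::
  "nat => nat => nat => nat => (nat => nat) => (nat => nat) => (nat => nat) => (nat => nat list) => (nat => nat) =>
   (nat => cell => nat) => (nat => cell => nat) => ((nat => nat \<times> nat) => complex) set" where
 "leaf d k r t q part_of block_of \<Lambda> j \<tau> \<sigma> =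
   pattern_placed.pull d k r j q t part_of block_of (placed_tensors.MA d r j \<sigma> {} (placement.Tens d k r j \<Lambda> \<tau>))"

locale pattern_le = pattern d k r t q pi bi for d k r t :: nat and q pi bi :: "nat => nat" +
 assumes rk': "r <= k"
begin

lemma pattern_placedI:
 assumes j: "j : {1..r} \<rightarrow>\<^sub>E {1..ell d}" and \<sigma>: "\<sigma> : T_d d r j q"
 shows "pattern_placed d k r j q \<sigma> t pi bi" proof -
 have "placement d k r j" by unfold_locales (use rk' j d1 in auto)
 moreover have "placed_tensors_axioms d r j q \<sigma>" by unfold_locales (use \<sigma> in \<open>auto simp: T_d_def\<close>)
 ultimately show ?thesis unfolding pattern_placed_def placed_tensors_def using pattern_axioms by blast
qed

lemma pattern_irreducibleI:
 assumes Lam: "\<Lambda> : multipartitions (ell d) k" and jt: "j : j_tuples d r \<Lambda>"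
  and ta: "\<tau> : T_k d k r j \<Lambda>" and si: "\<sigma> : T_d d r j q"
 shows "pattern_irreducible d k r j q \<sigma> \<Lambda> \<tau> t pi bi" proof -
 have j': "j : {1..r} \<rightarrow>\<^sub>E {1..ell d}" using jt by (simp add: j_tuples_def)
 interpret pattern_placed d k r j q \<sigma> t pi bi by (rule pattern_placedI[OF j' si])
 have "irreducible_setup_axioms d k r j \<Lambda> \<tau>" proof (rule irreducible_setup_axioms.intro)
  have "\<Lambda> : PiE {1..ell d} (%a. partitions (card (cls a)))" by (rule multipartition_iff[THEN iffD1]) (rule conjI[OF Lam jt])
  then show "\<Lambda> a : partitions (card (cls a))" if "a : {1..ell d}" for a using that by (rule PiE_mem)
  show "\<tau> a : semistandard (\<Lambda> a) (gamma k r j a)" if "a : {1..ell d}" for a using ta that unfolding T_k_def by (rule PiE_mem)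
 qed
 then show ?thesis unfolding pattern_irreducible_def irreducible_setup_def by (intro conjI placed_tensors_axioms pattern_placed_axioms)
qed

lemma leaf_decomposes:
 "decomposes (SIGMA \<Lambda>:multipartitions (ell d) k. SIGMA j:j_tuples d r \<Lambda>. SIGMA \<tau>:T_k d k r j \<Lambda>. T_d d r j q)
   (%(\<Lambda>, j, \<tau>, \<sigma>). leaf d k r t q pi bi \<Lambda> j \<tau> \<sigma>) (free XP)" proof -
 let ?J = "Sigma ({1..r} \<rightarrow>\<^sub>E {1..ell d}) (%j. T_d d r j q)"
 let ?P = "%j. PiE {1..ell d} (%a. partitions (card (placement.cls k r j a)))"
 let ?B = "%c. Sigma (?P (fst c)) (%\<Lambda>. T_k d k r (fst c) \<Lambda>)"
 let ?L = "%c l. leaf d k r t q pi bi (fst l) (fst c) (snd l) (snd c)"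
 have E: "decomposes (?B c) (?L c) (KS (slots d r (fst c) (snd c)))" if "c : ?J" for c proof -
  from that obtain j \<sigma> where c: "c = (j, \<sigma>)" "j : {1..r} \<rightarrow>\<^sub>E {1..ell d}" "\<sigma> : T_d d r j q" by blast
  interpret pattern_placed d k r j q \<sigma> t pi bi by (rule pattern_placedI[OF c(2,3)])
  have "decomposes (?B c) (%l. pull (MA {} (Tens (fst l) (snd l)))) (pull (MA {} (free Wset)))" unfolding c(1) fst_conv
  proof (rule pull_decomposes[OF MA_decomposes[OF Wset_decomposes] MA_free[OF order_refl]])
   fix l h m assume l: "l : Sigma (?P j) (T_k d k r j)" and hm: "h : carrier HH" "m : MA {} (Tens (fst l) (snd l))"
   obtain \<Lambda> \<tau> where l': "l = (\<Lambda>, \<tau>)" "\<Lambda> : ?P j" "\<tau> : T_k d k r j \<Lambda>" using l by blast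
   have m: "\<Lambda> : multipartitions (ell d) k" "j : j_tuples d r \<Lambda>" using l'(2) multipartition_iff by blast+
   interpret I: pattern_irreducible d k r j q \<sigma> \<Lambda> \<tau> t pi bi by (rule pattern_irreducibleI[OF m l'(3) c(3)])
   show "bact h m : MA {} (Tens (fst l) (snd l))" using I.bact_MA[OF hm(1)] hm(2) unfolding l'(1) fst_conv snd_conv .
  qed
  then show ?thesis unfolding leaf_def KS_eq_pull[symmetric] by (simp only: c(1) fst_conv snd_conv)
 qed
 note D = decomposes_Sigma[OF KS_decomposes[OF Bs_decomposes] E]
 let ?C = "SIGMA \<Lambda>:multipartitions (ell d) k. SIGMA j:j_tuples d r \<Lambda>. SIGMA \<tau>:T_k d k r j \<Lambda>. T_d d r j q"
 have iff: "\<Lambda> : multipartitions (ell d) k & j : j_tuples d r \<Lambda> \<longleftrightarrow> j : {1..r} \<rightarrow>\<^sub>E {1..ell d} & \<Lambda> : ?P j" for \<Lambda> j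
 proof (cases "j : {1..r} \<rightarrow>\<^sub>E {1..ell d}")
  case True
  then interpret placement d k r j by unfold_locales (use rk' d1 in auto)
  show ?thesis using multipartition_iff True by blast
 next
  case False
  then show ?thesis by (simp add: j_tuples_def)
 qed
 have C: "(\<Lambda>, j, \<tau>, \<sigma>) : ?C \<longleftrightarrow> ((j, \<sigma>), (\<Lambda>, \<tau>)) : Sigma ?J ?B" for \<Lambda> j \<tau> \<sigma>
  unfolding mem_Sigma_iff fst_conv using iff by blast
 let ?h = "%(\<Lambda>, j, \<tau>, \<sigma>). ((j, \<sigma>), (\<Lambda>, \<tau>))" and ?h' = "%((j, \<sigma>), (\<Lambda>, \<tau>)). (\<Lambda>, j, \<tau>, \<sigma>)"
 show ?thesis proof (rule decomposes_reindex[OF _ _ D])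
  show "bij_betw ?h ?C (Sigma ?J ?B)" proof (rule bij_betw_byWitness[where f' = ?h'])
   show "ALL c:?C. ?h' (?h c) = c" by (rule ballI) (simp only: split_paired_all prod.case)
   show "ALL c:Sigma ?J ?B. ?h (?h' c) = c" by (rule ballI) (simp only: split_paired_all prod.case)
   show "?h ` ?C <= Sigma ?J ?B" by (rule image_subsetI) (simp only: split_paired_all prod.case C)
   show "?h' ` Sigma ?J ?B <= ?C" by (rule image_subsetI) (simp only: split_paired_all prod.case C)
  qed
  show "(case c of (\<Lambda>, j, \<tau>, \<sigma>) => leaf d k r t q pi bi \<Lambda> j \<tau> \<sigma>) = (case ?h c of (c, l) => ?L c l)" for c
  proof -
   obtain \<Lambda> j \<tau> \<sigma> where c: "c = (\<Lambda>, j, \<tau>, \<sigma>)" by (cases c)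
   show ?thesis unfolding c prod.case fst_conv snd_conv ..
  qed
 qed
qed

lemma leaf_iso:
 assumes "\<Lambda> : multipartitions (ell d) k" "j : j_tuples d r \<Lambda>" "\<tau> : T_k d k r j \<Lambda>" "\<sigma> : T_d d r j q"
 shows "isomorphic_reps (wreath_sym d k) (tuple_rep d k t(|vecs := leaf d k r t q pi bi \<Lambda> j \<tau> \<sigma>|)) (W d k r j \<sigma> \<Lambda> \<tau>)"
  and "irreducible_rep (wreath_sym d k) (W d k r j \<sigma> \<Lambda> \<tau>)" proof -
 interpret pattern_irreducible d k r j q \<sigma> \<Lambda> \<tau> t pi bi by (rule pattern_irreducibleI[OF assms])
 show "isomorphic_reps (wreath_sym d k) (tuple_rep d k t(|vecs := leaf d k r t q pi bi \<Lambda> j \<tau> \<sigma>|)) (W d k r j \<sigma> \<Lambda> \<tau>)"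
  unfolding leaf_def by (rule pull_iso)
 show "irreducible_rep (wreath_sym d k) (W d k r j \<sigma> \<Lambda> \<tau>)" by (rule W_irreducible)
qed

end


section \<open>The orbits on tuples\<close>

definition idx :: "(nat => 'a set) => nat => 'a => nat" where
 "idx f n s = (THE m. m : {1..n} & s : f m)"

definition "levels f A = (%s. {s' : A. f s' = f s}) ` A"

context
 fixes A :: "'a set" and R and f and n :: nat
 assumes P: "partition_on A R" and f: "bij_betw f {1..n} R"
begin

lemma idx_eq:
 assumes m: "m : {1..n}" "s : f m"
 shows "idx f n s = m" unfolding idx_def proof (rule the_equality)
 show "m : {1..n} & s : f m" using m by blast
 fix m' assume m': "m' : {1..n} & s : f m'"
 then have "f m' : R" "f m : R" "f m' \<inter> f m ~= {}" using bij_betwE[OF f] m by blast+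
 then have "f m' = f m" using disjointD[OF partition_onD2[OF P]] by blast
 then show "m' = m" using m' m(1) by (intro inj_onD[OF bij_betw_imp_inj_on[OF f]]) blast+
qed

lemma idx_in:
 assumes "s : A"
 shows "idx f n s : {1..n}" "s : f (idx f n s)" proof -
 have "s : (UN m:{1..n}. f m)" using assms partition_onD1[OF P] bij_betw_imp_surj_on[OF f] by simp
 then obtain m where m: "m : {1..n}" "s : f m" by blast
 show "idx f n s : {1..n}" "s : f (idx f n s)" unfolding idx_eq[OF m] by (rule m)+
qed

lemma idx_image: "idx f n ` A = {1..n}" proof (intro equalityI subsetI)
 fix m assume m: "m : {1..n}"
 then have fm: "f m : R" using bij_betwE[OF f] by blast
 then have "f m ~= {}" using partition_onD3[OF P] by metis
 then obtain s where s: "s : f m" by blast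
 then have "s : A" using fm partition_onD1[OF P] by blast
 then show "m : idx f n ` A" using idx_eq[OF m s] by blast
qed (use idx_in in blast)

lemma levels_idx: "levels (idx f n) A = R" proof -
 have sub: "f m <= A" if "m : {1..n}" for m using that bij_betwE[OF f] partition_onD1[OF P] by blast
 have "{s' : A. idx f n s' = idx f n s} = f (idx f n s)" if "s : A" for s proof (intro equalityI subsetI)
  show "s' : f (idx f n s)" if "s' : {s' : A. idx f n s' = idx f n s}" for s' using that idx_in(2)[of s'] by simp
  show "s' : {s' : A. idx f n s' = idx f n s}" if "s' : f (idx f n s)" for s'
   using that sub[OF idx_in(1)[OF `s : A`]] idx_eq[OF idx_in(1)[OF `s : A`]] by blast
 qed
 then have "levels (idx f n) A = f ` idx f n ` A" unfolding levels_def image_image by (rule image_cong[OF refl])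
 then show ?thesis unfolding idx_image bij_betw_imp_surj_on[OF f] .
qed

end

lemma levels_partition: "partition_on A (levels f A)" by (rule partition_onI) (auto simp: levels_def disjnt_def)

lemma levels_eq_iff: "levels f A = levels g A \<longleftrightarrow> (ALL s:A. ALL s':A. f s = f s' \<longleftrightarrow> g s = g s')" proof
 assume e: "levels f A = levels g A"
 show "ALL s:A. ALL s':A. f s = f s' \<longleftrightarrow> g s = g s'" proof (intro ballI)
  fix s s' assume s: "s : A" "s' : A"
  have "{x : A. f x = f s} : levels g A" unfolding e[symmetric] unfolding levels_def using s(1) by (rule imageI)
  then obtain s0 where "{x : A. f x = f s} = {x : A. g x = g s0}" unfolding levels_def by (rule imageE)
  then have "f x = f s \<longleftrightarrow> g x = g s0" if "x : A" for x using that by blast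
  from this[OF s(1)] this[OF s(2)] show "f s = f s' \<longleftrightarrow> g s = g s'" by metis
 qed
next
 assume e: "ALL s:A. ALL s':A. f s = f s' \<longleftrightarrow> g s = g s'"
 show "levels f A = levels g A" unfolding levels_def by (intro image_cong Collect_cong conj_cong refl) (rule e[THEN bspec, THEN bspec])
qed

lemma card_levels:
 assumes "finite A"
 shows "card (levels f A) <= card (f ` A)" proof -
 have e: "levels f A = (%v. {s' : A. f s' = v}) ` f ` A" unfolding levels_def image_image ..
 show ?thesis unfolding e by (rule card_image_le[OF finite_imageI[OF assms]])
qed

definition "part_index parts P = idx (parts P) (card P)"
definition "enum Q = (SOME f. bij_betw f {1..card Q} Q)"
definition "block_index parts P Q s =
 idx (enum (Q (part_index parts P s))) (card (Q (part_index parts P s))) s"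

lemma enum:
 assumes "finite Q"
 shows "bij_betw (enum Q) {1..card Q} Q" using someI_ex[OF ex_bij_betw_nat_finite_1[OF assms]] unfolding enum_def .

context
 fixes d k t :: nat and parts :: "nat set set => nat => nat set"
 assumes d2: "d >= 2"
  and parts: "!!P. partition_on {1..t} P ==> bij_betw (parts P) {1..card P} P"
begin

abbreviation "OP \<equiv> orbit_pairs parts d k t"
abbreviation "pat P Q \<equiv> pattern.XP d k t (part_index parts P) (block_index parts P Q)"

context
 fixes P Q assumes PQ: "(P, Q) : OP"
begin

lemma P: "partition_on {1..t} P" "card P <= k" using PQ by (simp_all add: orbit_pairs_def)

lemma Q: "i : {1..card P} ==> partition_on (parts P i) (Q i)" "i : {1..card P} ==> card (Q i) <= d"
 using PQ by (auto simp: orbit_pairs_def PiE_iff)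

lemma parts_sub: "i : {1..card P} ==> parts P i <= {1..t}" using bij_betwE[OF parts[OF P(1)]] partition_onD1[OF P(1)] by blast

lemma Q_enum: "i : {1..card P} ==> bij_betw (enum (Q i)) {1..card (Q i)} (Q i)"
 by (rule enum, rule finite_elements[OF finite_subset[OF parts_sub finite_atLeastAtMost] Q(1)])

lemma part_index_in: "s : {1..t} ==> part_index parts P s : {1..card P} & s : parts P (part_index parts P s)"
 unfolding part_index_def using idx_in[OF P(1) parts[OF P(1)]] by blast

lemma part_index_eq: "i : {1..card P} ==> s : parts P i ==> part_index parts P s = i"
 unfolding part_index_def by (rule idx_eq[OF P(1) parts[OF P(1)]])

lemma part_index_fibre: "i : {1..card P} ==> {s : {1..t}. part_index parts P s = i} = parts P i"
 using part_index_in part_index_eq parts_sub by blast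

lemma block_index_eq: "i : {1..card P} ==> s : parts P i ==> block_index parts P Q s = idx (enum (Q i)) (card (Q i)) s"
 unfolding block_index_def by (simp only: part_index_eq)

lemma pattern_le: "pattern_le d k (card P) t (%i. card (Q i)) (part_index parts P) (block_index parts P Q)"
proof (intro pattern_le.intro pattern.intro pattern_le_axioms.intro)
 show "1 <= d" using d2 by simp
 show "card P <= k" by (rule P(2))
 show "card (Q i) <= d" if "i : {1..card P}" for i by (rule Q(2)[OF that])
 show "part_index parts P ` {1..t} = {1..card P}" unfolding part_index_def by (rule idx_image[OF P(1) parts[OF P(1)]])
 show "block_index parts P Q ` {s : {1..t}. part_index parts P s = i} = {1..card (Q i)}" if i: "i : {1..card P}" for i proof -
  have "block_index parts P Q ` parts P i = idx (enum (Q i)) (card (Q i)) ` parts P i" by (rule image_cong[OF refl block_index_eq[OF i]])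
  then show ?thesis unfolding part_index_fibre[OF i] idx_image[OF Q(1)[OF i] Q_enum[OF i]] .
 qed
qed

lemma pat_sub: "x : pat P Q ==> x : {1..t} \<rightarrow>\<^sub>E {1..d} \<times> {1..k}" proof -
 interpret pattern_le d k "card P" t "%i. card (Q i)" "part_index parts P" "block_index parts P Q" by (rule pattern_le)
 show "x : pat P Q ==> x : {1..t} \<rightarrow>\<^sub>E {1..d} \<times> {1..k}" by (simp add: XP_def Tup_def)
qed

text \<open>Hence the pattern of x is unique and always exists: P and Q are the level sets of its second coordinate
and of x itself.\<close>
lemma pat_iff:
 assumes x: "x : {1..t} \<rightarrow>\<^sub>E {1..d} \<times> {1..k}"
 shows "x : pat P Q \<longleftrightarrow> levels (%s. snd (x s)) {1..t} = P & (ALL i:{1..card P}. levels x (parts P i) = Q i)" proof -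
 let ?pi = "part_index parts P" and ?bi = "block_index parts P Q"
 interpret pattern_le d k "card P" t "%i. card (Q i)" ?pi ?bi by (rule pattern_le)
 have lP: "levels (%s. snd (x s)) {1..t} = P \<longleftrightarrow> (ALL s:{1..t}. ALL s':{1..t}. snd (x s) = snd (x s') \<longleftrightarrow> ?pi s = ?pi s')"
  by (rule levels_eq_iff[where g = ?pi and A = "{1..t}", unfolded levels_idx[OF P(1) parts[OF P(1)], folded part_index_def]])
 have lQ: "levels x (parts P i) = Q i \<longleftrightarrow> (ALL s:parts P i. ALL s':parts P i. x s = x s' \<longleftrightarrow> ?bi s = ?bi s')"
  if i: "i : {1..card P}" for i proof -
  note e = levels_eq_iff[where g = "idx (enum (Q i)) (card (Q i))" and A = "parts P i", unfolded levels_idx[OF Q(1)[OF i] Q_enum[OF i]]]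
  show ?thesis unfolding e by (intro ball_cong refl) (simp only: block_index_eq[OF i])
 qed
 have step: "(ALL s:{1..t}. ALL s':{1..t}. x s = x s' \<longleftrightarrow> ?pi s = ?pi s' & ?bi s = ?bi s') \<longleftrightarrow>
   (ALL i:{1..card P}. levels x (parts P i) = Q i)" (is "?L \<longleftrightarrow> ?R")
  if B: "ALL s:{1..t}. ALL s':{1..t}. snd (x s) = snd (x s') \<longleftrightarrow> ?pi s = ?pi s'" proof
  assume L: ?L
  show ?R proof
   fix i assume i: "i : {1..card P}"
   show "levels x (parts P i) = Q i" unfolding lQ[OF i] proof (intro ballI)
   fix s s' assume s: "s : parts P i" "s' : parts P i"
   then have "s : {1..t}" "s' : {1..t}" using parts_sub[OF i] by blast+
   from L[rule_format, OF this] show "x s = x s' \<longleftrightarrow> ?bi s = ?bi s'"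
   unfolding part_index_eq[OF i s(1)] part_index_eq[OF i s(2)] by simp
   qed
  qed
 next
  assume R: ?R
  show ?L proof (intro ballI)
   fix s s' assume s: "s : {1..t}" "s' : {1..t}"
   note i = part_index_in[OF s(1)] and i' = part_index_in[OF s(2)]
   show "x s = x s' \<longleftrightarrow> ?pi s = ?pi s' & ?bi s = ?bi s'" proof (cases "?pi s = ?pi s'")
   case True
   then show ?thesis using R[rule_format, OF conjunct1[OF i], unfolded lQ[OF conjunct1[OF i]]] i i' by simp
   next
   case False
   then have "snd (x s) ~= snd (x s')" using B s by blast
   then show ?thesis using False by auto
   qed
  qed
 qed
 show ?thesis unfolding XP_def Tup_def mem_Collect_eq eqTrueI[OF x] simp_thms ball_conj_distrib lP by (rule conj_cong[OF refl step])
qed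

end

lemma finite_OP: "finite OP" proof -
 have "OP <= (SIGMA P : {P. partition_on {1..t} P}. \<Pi>\<^sub>E i\<in>{1..card P}. {Q. partition_on (parts P i) Q})"
  unfolding orbit_pairs_def by (auto simp: PiE_iff)
 moreover have "finite (SIGMA P : {P. partition_on {1..t} P}. \<Pi>\<^sub>E i\<in>{1..card P}. {Q. partition_on (parts P i) Q})"
 proof (intro finite_SigmaI finite_PiE finitely_many_partition_on finite_atLeastAtMost)
  fix P i assume "P : {P. partition_on {1..t} P}" "i : {1..card P}"
  then have "parts P i <= {1..t}" using bij_betwE[OF parts] partition_onD1 by blast
  then show "finite (parts P i)" by (rule finite_subset) simp
 qed
 ultimately show ?thesis by (rule finite_subset)
qed

lemma pat_disjoint:
 assumes PQ: "(P, Q) : OP" and PQ': "(P', Q') : OP" and x: "x : pat P Q" "x : pat P' Q'"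
  and xT: "x : {1..t} \<rightarrow>\<^sub>E {1..d} \<times> {1..k}"
 shows "P = P' & Q = Q'" proof -
 note l = pat_iff[OF PQ xT, THEN iffD1, OF x(1)] and l' = pat_iff[OF PQ' xT, THEN iffD1, OF x(2)]
 have e: "P = P'" by (rule trans[OF sym[OF conjunct1[OF l]] conjunct1[OF l']])
 have "Q = Q'" proof (rule PiE_ext)
  show "Q : (\<Pi>\<^sub>E i\<in>{1..card P}. {Q. partition_on (parts P i) Q & card Q <= d})"
   "Q' : (\<Pi>\<^sub>E i\<in>{1..card P}. {Q. partition_on (parts P i) Q & card Q <= d})" using PQ PQ' e by (simp_all add: orbit_pairs_def)
  show "Q i = Q' i" if "i : {1..card P}" for i
   using bspec[OF conjunct2[OF l] that] bspec[OF conjunct2[OF l'] that[unfolded e]] unfolding e by (rule trans[OF sym])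
 qed
 then show ?thesis using e by simp
qed

lemma pat_cover:
 assumes x: "x : {1..t} \<rightarrow>\<^sub>E {1..d} \<times> {1..k}"
 shows "EX P Q. (P, Q) : OP & x : pat P Q" proof -
 have xs: "fst (x s) : {1..d}" "snd (x s) : {1..k}" if "s : {1..t}" for s using PiE_mem[OF x that] by (simp_all add: mem_Times_iff)
 define P where "P = levels (%s. snd (x s)) {1..t}"
 define Q where "Q = (\<lambda>i\<in>{1..card P}. levels x (parts P i))"
 have Pp: "partition_on {1..t} P" unfolding P_def by (rule levels_partition)
 have "card ((%s. snd (x s)) ` {1..t}) <= card {1..k}" by (rule card_mono) (use xs(2) in auto)
 then have Pk: "card P <= k" using card_levels[OF finite_atLeastAtMost, of "%s. snd (x s)" 1 t] unfolding P_def by simp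
 note bp = parts[OF Pp]
 have mem: "EX s0. B = {s' : {1..t}. snd (x s') = snd (x s0)}" if "B : P" for B using that unfolding P_def levels_def by blast
 have Qd: "card (levels x (parts P i)) <= d" if i: "i : {1..card P}" for i proof -
  have sub: "parts P i <= {1..t}" using bij_betwE[OF bp] partition_onD1[OF Pp] i by blast
  obtain s0 where s0: "parts P i = {s' : {1..t}. snd (x s') = snd (x s0)}" using mem bij_betwE[OF bp] i by blast
  have "snd y = snd (x s0)" if "y : x ` parts P i" for y using that unfolding s0 by auto
  then have "inj_on fst (x ` parts P i)" by (intro inj_onI prod_eqI) simp_all
  then have "card (x ` parts P i) = card (fst ` x ` parts P i)" by (simp add: card_image)
  also have "... <= card {1..d}" by (rule card_mono) (use xs(1) sub in auto)
  finally show ?thesis using card_levels[OF finite_subset[OF sub finite_atLeastAtMost], of x] by simp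
 qed
 have PQ: "(P, Q) : OP" unfolding orbit_pairs_def Q_def
  by (intro SigmaI CollectI conjI Pp Pk restrict_PiE_iff[THEN iffD2] ballI levels_partition Qd)
 moreover have "x : pat P Q" unfolding pat_iff[OF PQ x] by (rule conjI[OF P_def[symmetric]]) (simp add: Q_def del: atLeastAtMost_iff)
 ultimately show ?thesis by blast
qed

lemma tuples_decompose: "decomposes OP (%(P, Q). free (pat P Q)) (free ({1..t} \<rightarrow>\<^sub>E {1..d} \<times> {1..k}))"
proof (rule decomposes_reindex[OF bij_betw_id])
 show "decomposes OP (%c. free (pat (fst c) (snd c))) (free ({1..t} \<rightarrow>\<^sub>E {1..d} \<times> {1..k}))"
 proof (rule decomposes_support[OF finite_OP])
  show "{1..t} \<rightarrow>\<^sub>E {1..d} \<times> {1..k} = (UN c:OP. pat (fst c) (snd c))" proof (intro equalityI subsetI)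
   fix x assume "x : {1..t} \<rightarrow>\<^sub>E {1..d} \<times> {1..k}"
   from pat_cover[OF this] obtain P Q where "(P, Q) : OP" "x : pat P Q" by blast
   then show "x : (UN c:OP. pat (fst c) (snd c))" by (intro UN_I[of "(P, Q)"]) simp_all
  next
   fix x assume "x : (UN c:OP. pat (fst c) (snd c))"
   then obtain c where c: "c : OP" "x : pat (fst c) (snd c)" by blast
   have "(fst c, snd c) : OP" using c(1) by simp
   then show "x : {1..t} \<rightarrow>\<^sub>E {1..d} \<times> {1..k}" using c(2) pat_sub by blast
  qed
  fix c c' x assume "c : OP" "c' : OP" "x : pat (fst c) (snd c)" "x : pat (fst c') (snd c')"
  then show "c = c'" using pat_disjoint[of "fst c" "snd c" "fst c'" "snd c'" x] pat_sub[of "fst c" "snd c" x] by (simp add: prod_eq_iff)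
 qed
qed (simp add: case_prod_beta)

end

lemma W_vector_space: "vector_space (scal (W d k r j \<sigma> \<Lambda> \<tau>))" proof -
 have "scal (W d k r j \<sigma> \<Lambda> \<tau>) = pscale" by (simp add: W_def induced_def base_rep_def pscale_def fun_eq_iff)
 then show ?thesis using ps.vector_space_axioms by simp
qed

theorem mainTheorem1:
  fixes d k t :: nat and parts :: "nat set set \<Rightarrow> nat \<Rightarrow> nat set"
  assumes "d \<ge> 2" and "k \<ge> 1" and "t \<ge> 1"
    and "\<And>P. partition_on {1..t} P \<Longrightarrow> bij_betw (parts P) {1..card P} P"
  shows
    "isomorphic_reps (wreath_sym d k) (tuple_rep d k t)
       (direct_sum (orbit_pairs parts d k t) (\<lambda>(P, Q).
          direct_sum (multipartitions (ell d) k) (\<lambda>\<Lambda>.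
            direct_sum (j_tuples d (card P) \<Lambda>) (\<lambda>j.
              direct_sum (T_k d k (card P) j \<Lambda>) (\<lambda>\<tau>.
                direct_sum (T_d d (card P) j (\<lambda>i. card (Q i))) (\<lambda>\<sigma>.
                  W d k (card P) j \<sigma> \<Lambda> \<tau>))))))
     \<and> (\<forall>(P, Q) \<in> orbit_pairs parts d k t.
        \<forall>\<Lambda> \<in> multipartitions (ell d) k.
        \<forall>j \<in> j_tuples d (card P) \<Lambda>.
        \<forall>\<tau> \<in> T_k d k (card P) j \<Lambda>.
        \<forall>\<sigma> \<in> T_d d (card P) j (\<lambda>i. card (Q i)).
          irreducible_rep (wreath_sym d k) (W d k (card P) j \<sigma> \<Lambda> \<tau>))"
proof
 note hyps = assms(1,4)
 let ?G = "wreath_sym d k" and ?V = "tuple_rep d k t" and ?OP = "orbit_pairs parts d k t" and ?MP = "multipartitions (ell d) k"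
 let ?Td = "%PQ j. T_d d (card (fst PQ)) j (%i. card (snd PQ i))"
 let ?Tk = "%PQ \<Lambda> j. T_k d k (card (fst PQ)) j \<Lambda>"
 let ?J = "%PQ \<Lambda>. j_tuples d (card (fst PQ)) \<Lambda>"
 let ?C3 = "%PQ \<Lambda> j. Sigma (?Tk PQ \<Lambda> j) (%\<tau>. ?Td PQ j)"
 let ?C2 = "%PQ \<Lambda>. Sigma (?J PQ \<Lambda>) (?C3 PQ \<Lambda>)"
 let ?C1 = "%PQ. Sigma ?MP (?C2 PQ)"
 let ?C = "Sigma ?OP ?C1"
 let ?leaf = "%PQ \<Lambda> j \<tau> \<sigma>. leaf d k (card (fst PQ)) t (%i. card (snd PQ i))
  (part_index parts (fst PQ)) (block_index parts (fst PQ) (snd PQ)) \<Lambda> j \<tau> \<sigma>"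
 let ?W = "%PQ \<Lambda> j \<tau> \<sigma>. W d k (card (fst PQ)) j \<sigma> \<Lambda> \<tau>"
 have G: "group ?G" by (rule wreath_group[OF perm_group_sym])
 have V: "representation ?G ?V" unfolding tuple_rep_def by (rule perm_representation[OF act_tuple_action])
 have pat: "pattern_le d k (card (fst PQ)) t (%i. card (snd PQ i)) (part_index parts (fst PQ)) (block_index parts (fst PQ) (snd PQ))"
  if "PQ : ?OP" for PQ by (rule pattern_le[OF hyps]) (simp_all add: that)
 note leaf = pattern_le.leaf_iso[OF pat]
 have Wrep: "representation ?G (?W PQ \<Lambda> j \<tau> \<sigma>)"
  if "PQ : ?OP" "\<Lambda> : ?MP" "j : ?J PQ \<Lambda>" "\<tau> : ?Tk PQ \<Lambda> j" "\<sigma> : ?Td PQ j" for PQ \<Lambda> j \<tau> \<sigma>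
  using leaf(2)[OF that] unfolding irreducible_rep_def by blast
 have D: "decomposes ?C (%(PQ, \<Lambda>, j, \<tau>, \<sigma>). ?leaf PQ \<Lambda> j \<tau> \<sigma>) (vecs ?V)" proof -
  have L: "decomposes (?C1 PQ) (%(\<Lambda>, j, \<tau>, \<sigma>). ?leaf PQ \<Lambda> j \<tau> \<sigma>)
   (case PQ of (P, Q) => free (pattern.XP d k t (part_index parts P) (block_index parts P Q)))" if "PQ : ?OP" for PQ
   unfolding case_prod_beta[of _ PQ] by (rule pattern_le.leaf_decomposes[OF pat[OF that]])
  show ?thesis unfolding tuple_rep_def rep.simps by (rule decomposes_Sigma[OF tuples_decompose[OF hyps] L])
 qed
 have flat: "isomorphic_reps ?G ?V (direct_sum ?C (%(PQ, \<Lambda>, j, \<tau>, \<sigma>). ?W PQ \<Lambda> j \<tau> \<sigma>))"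
 proof (rule isomorphic_to_direct_sum[OF V _ D])
  show "scal ?V = cscale" by (simp add: tuple_rep_def)
  show "vector_space (scal ((%(PQ, \<Lambda>, j, \<tau>, \<sigma>). ?W PQ \<Lambda> j \<tau> \<sigma>) c))" for c
   unfolding case_prod_beta by (rule W_vector_space)
  fix c assume "c : ?C"
  then obtain PQ \<Lambda> j \<tau> \<sigma> where c: "c = (PQ, \<Lambda>, j, \<tau>, \<sigma>)" "PQ : ?OP" "\<Lambda> : ?MP" "j : ?J PQ \<Lambda>"
   "\<tau> : ?Tk PQ \<Lambda> j" "\<sigma> : ?Td PQ j" by (elim SigmaE) blast
  show "isomorphic_reps ?G (?V(|vecs := (%(PQ, \<Lambda>, j, \<tau>, \<sigma>). ?leaf PQ \<Lambda> j \<tau> \<sigma>) c|))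
   ((%(PQ, \<Lambda>, j, \<tau>, \<sigma>). ?W PQ \<Lambda> j \<tau> \<sigma>) c)" unfolding c(1) prod.case by (rule leaf(1)[OF c(2-6)])
 qed
 have "isomorphic_reps ?G (direct_sum ?C (%(PQ, \<Lambda>, j, \<tau>, \<sigma>). ?W PQ \<Lambda> j \<tau> \<sigma>))
   (direct_sum ?OP (%PQ. direct_sum ?MP (%\<Lambda>. direct_sum (?J PQ \<Lambda>) (%j.
   direct_sum (?Tk PQ \<Lambda> j) (%\<tau>. direct_sum (?Td PQ j) (?W PQ \<Lambda> j \<tau>))))))"
  by (rule direct_sum_flatten[where M = ?W and B = "%_. ?MP" and C = ?J and D = ?Tk and E = "%PQ \<Lambda> j \<tau>. ?Td PQ j",
   OF G W_vector_space Wrep])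
 from isomorphic_reps_trans[OF flat this]
 show "isomorphic_reps ?G ?V
   (direct_sum ?OP (%(P, Q).
   direct_sum ?MP (%\<Lambda>.
   direct_sum (j_tuples d (card P) \<Lambda>) (%j.
   direct_sum (T_k d k (card P) j \<Lambda>) (%\<tau>.
   direct_sum (T_d d (card P) j (%i. card (Q i))) (%\<sigma>.
   W d k (card P) j \<sigma> \<Lambda> \<tau>))))))" unfolding case_prod_unfold .
  show "\<forall>(P, Q) \<in> ?OP. \<forall>\<Lambda> \<in> ?MP. \<forall>j \<in> j_tuples d (card P) \<Lambda>. \<forall>\<tau> \<in> T_k d k (card P) j \<Lambda>.
      \<forall>\<sigma> \<in> T_d d (card P) j (\<lambda>i. card (Q i)). irreducible_rep ?G (W d k (card P) j \<sigma> \<Lambda> \<tau>)"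
  unfolding case_prod_beta using leaf(2) by blast
qed

end
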